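(* Let $M$ be an even integral lattice of signature $(2,n)$ and $\Gamma\subset O^+(M)$ a subgroup of finite index. The lowering and raising operators act on the spaces of almost-holomorphic modular forms as derivations $$\mathsf L_k:\mathsf{AHMod}_{k,s}(\Gamma)\to\mathsf{AHMod}_{k-1,s+1}(\Gamma),\qquad \mathsf R_k:\mathsf{AHMod}_{k,s}(\Gamma)\to\mathsf{AHMod}_{k+1,s+1}(\Gamma),$$ and for $F\in\mathsf{AHMod}_{k,s}(\Gamma)$ they satisfy $$[\mathsf L,\mathsf R]F=\frac k2F\otimes g+\frac12\sum_{r=1}^s\Big(\sigma_{r,s+1}(F\otimes g)-\sigma_{r,s+2}(F\otimes g)\Big).$$
   Context: $\mathcal D$ is a connected component of $\{[Z]\in\mathbb P(M_{\mathbb C}):\langle Z,Z\rangle=0,\langle Z,\overline Z\rangle>0\}$; $O^+(M)\subset O(M)$ is the subgroup preserving $\mathcal D$; $\mathcal L,\mathcal E$ are the Hodge bundles with fibres $\mathcal L|_{[Z]}=\mathbb CZ$, $\mathcal E|_{[Z]}=Z^\perp/\mathbb CZ$ (rank $n$). Let $\mathrm{Aff}(\mathcal D)=\{Z\in M_{\mathbb C}\setminus0:[Z]\in\mathcal D\}$, $|Z|^2=\frac12\langle Z,\overline Z\rangle$. Fix a basis $e_a$ of $M$ with coordinates $Z_a$ and $g_{ab}=\langle e_a,e_b\rangle$. Via the canonical isomorphism $\mathcal E\cong\Omega_{\mathcal D}\otimes\mathcal L^\vee$ and pullback to $\mathrm{Aff}(\mathcal D)$, smooth sections of $\mathcal E^{\otimes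 s}\otimes\mathcal L^k$ are identified with multidifferentials $F=\sum_IF_I\,dZ_{i_1}\otimes\cdots\otimes dZ_{i_s}$ on $\mathrm{Aff}(\mathcal D)$ with $F_I(\lambda Z)=\lambda^{-k}F_I(Z)$ for $\lambda\in\mathbb C^*$ and vanishing contraction of every slot with $\sum_iZ_i\partial/\partial Z_i$, modulo multidifferentials having $d\langle Z,Z\rangle$ as a tensor factor. Put $\nu=\partial\log|Z|^2$. Let $\varphi:\overline{\mathcal E}\to\mathcal E$ be the map $d\overline Z_k\mapsto dZ_k-Z_k\nu$ and $\psi=\overline\varphi:\mathcal E\to\overline{\mathcal E}$ its conjugate $dZ_k\mapsto d\overline Z_k-\overline Z_k\overline\nu$ (mutually inverse). On sections of $\mathcal E^{\otimes s}\otimes\mathcal L^k$: $$\mathsf L_kF=|Z|^2(\mathrm{id}\otimes\varphi)(\overline\partial F),\qquad \mathsf R_kF=|Z|^{-2k}(\varphi^{\otimes s}\otimes\mathrm{id})\,\partial\big(|Z|^{2k}\psi^{\otimes s}F\big),$$ the derivative giving the new last tensor factor (sections of $\mathcal E^{\otimes(s+1)}\otimes\mathcal L^{k\mp1}$). "Derivation" is with respect to the tensor product, with tensor factors reordered so that the new factor is last. Further, $g=\sum_{a,b}g_{ab}\,dZ_a\otimes dZ_b$ (section of $\mathcal E^{\otimes2}$), $\sigma_{ij}$ interchanges the $i$-th and $j$-th tensor factor, and $[\mathsf L,\mathsf R]F:=\mathsf L\mathsf RF-\sigma_{s+1,s+2}\mathsf R\mathsf LF$. $\mathsf{AHMod}_{k,s}(\Gamma)$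 is the space of $\Gamma$-invariant smooth sections $F$ of $\mathcal E^{\otimes s}\otimes\mathcal L^k$ over $\mathcal D$ with $\mathsf L^{d+1}F=0$ for some $d\ge0$. If $n\le2$ one additionally requires a cusp condition: for every primitive isotropic $e'\in M$, choose isotropic $f'\in M_{\mathbb Q}$ with $\langle e',f'\rangle=1$, and pull back along $z\mapsto-\frac12\langle z,z\rangle e'+z+f'$ from the tube domain (component of $\{z\in\{e',f'\}^\perp\otimes\mathbb C:\langle\mathrm{Im}z,\mathrm{Im}z\rangle>0\}$); then the coefficients of $\mathsf L^dF$ are polynomials in $\nu_j=\partial_{z_j}\log\langle\mathrm{Im}z,\mathrm{Im}z\rangle$ with holomorphic coefficients, and for every $d\ge 0$ the constant term of this polynomial must have a Fourier expansion $\sum_\alpha c_\alpha e^{2\pi i\alpha(z)}$ with $c_\alpha\neq0$ only for $\alpha$ in the closure of the corresponding component of the positive cone. *)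

theory Defs
  imports "HOL-Analysis.Analysis" "HOL-Algebra.Coset"
begin

section \<open>The lattice\<close>

text \<open>
  After the choice of a basis, the lattice is \<open>M = \<int>\<^sup>m\<close> with Gram matrix \<open>g\<close>, and \<open>M\<^sub>\<rat>\<close>, \<open>M\<^sub>\<real>\<close>,
  \<open>M\<^sub>\<complex>\<close> are the coordinate spaces over the respective fields.
\<close>

definition vmap :: "('a \<Rightarrow> 'b) \<Rightarrow> 'a^'m \<Rightarrow> 'b^'m" where
  "vmap f x = (\<chi> i. f (x $ i))"

definition bil :: "int^'m^'m \<Rightarrow> 'a::comm_ring_1^'m \<Rightarrow> 'a^'m \<Rightarrow> 'a" where
  "bil g x y = (\<Sum>a\<in>UNIV. \<Sum>b\<in>UNIV. of_int (g $ a $ b) * x $ a * y $ b)"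

definition even_lattice :: "int^'m^'m \<Rightarrow> bool" where
  "even_lattice g \<longleftrightarrow> (\<forall>a b. g $ a $ b = g $ b $ a) \<and> (\<forall>x::int^'m. even (bil g x x))"

text \<open>A real orthogonal basis; as none of its vectors is isotropic, this forces
  \<open>CARD('m) = p + q\<close> and non-degeneracy.\<close>

definition has_signature :: "int^'m^'m \<Rightarrow> nat \<Rightarrow> nat \<Rightarrow> bool" where
  "has_signature g p q \<longleftrightarrow>
     (\<exists>b :: 'm \<Rightarrow> real^'m.
        (\<forall>i j. i \<noteq> j \<longrightarrow> bil g (b i) (b j) = 0) \<and>
        (\<forall>i. bil g (b i) (b i) \<noteq> 0) \<and>
        card {i. bil g (b i) (b i) > 0} = p \<and>
        card {i. bil g (b i) (b i) < 0} = q)"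

text \<open>\<open>|Z|\<^sup>2 = \<langle>Z, Z\<^sup>-\<rangle> / 2\<close>; the pairing is real, and \<open>Re\<close> only changes the type.\<close>

definition nsq :: "int^'m^'m \<Rightarrow> complex^'m \<Rightarrow> real" where
  "nsq g Z = Re (bil g Z (vmap cnj Z)) / 2"


section \<open>The domain and the groups\<close>

definition cline :: "complex^'m \<Rightarrow> (complex^'m) set" where
  "cline Z = {c *s Z | c. c \<noteq> 0}"

text \<open>Projective space with the quotient topology; a point \<open>[Z]\<close> is the punctured line through
  \<open>Z\<close>.\<close>

definition proj_space :: "(complex^'m) set topology" where
  "proj_space = topology (\<lambda>U. U \<subseteq> cline ` (- {0}) \<and> open {Z. Z \<noteq> 0 \<and> cline Z \<in> U})"

lemma openin_proj_space:
  "openin proj_space U \<longleftrightarrow>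
     U \<subseteq> cline ` (- {0}) \<and> open {Z :: complex^'m. Z \<noteq> 0 \<and> cline Z \<in> U}"
proof -
  have "istopology (\<lambda>U. U \<subseteq> cline ` (- {0}) \<and> open {Z :: complex^'m. Z \<noteq> 0 \<and> cline Z \<in> U})"
    unfolding istopology_def
  proof (intro conjI allI impI)
    fix S T :: "(complex^'m) set set"
    assume S: "S \<subseteq> cline ` (- {0}) \<and> open {Z. Z \<noteq> 0 \<and> cline Z \<in> S}"
      and T: "T \<subseteq> cline ` (- {0}) \<and> open {Z. Z \<noteq> 0 \<and> cline Z \<in> T}"
    show "S \<inter> T \<subseteq> cline ` (- {0})" using S by blast
    have "{Z. Z \<noteq> 0 \<and> cline Z \<in> S \<inter> T} =
          {Z. Z \<noteq> 0 \<and> cline Z \<in> S} \<inter> {Z. Z \<noteq> 0 \<and> cline Z \<in> T}" by blast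
    then show "open {Z. Z \<noteq> 0 \<and> cline Z \<in> S \<inter> T}" using S T by auto
  next
    fix K :: "(complex^'m) set set set"
    assume K: "\<forall>S\<in>K. S \<subseteq> cline ` (- {0}) \<and> open {Z. Z \<noteq> 0 \<and> cline Z \<in> S}"
    show "\<Union>K \<subseteq> cline ` (- {0})" using K by blast
    have "{Z. Z \<noteq> 0 \<and> cline Z \<in> \<Union>K} = (\<Union>S\<in>K. {Z. Z \<noteq> 0 \<and> cline Z \<in> S})" by blast
    then show "open {Z. Z \<noteq> 0 \<and> cline Z \<in> \<Union>K}" using K by auto
  qed
  then show ?thesis by (simp add: proj_space_def topology_inverse')
qed

definition period_set :: "int^'m^'m \<Rightarrow> (complex^'m) set set" where
  "period_set g = cline ` {Z. Z \<noteq> 0 \<and> bil g Z Z = 0 \<and> Re (bil g Z (vmap cnj Z)) > 0}"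

definition is_domain :: "int^'m^'m \<Rightarrow> (complex^'m) set set \<Rightarrow> bool" where
  "is_domain g D \<longleftrightarrow> D \<in> connected_components_of (subtopology proj_space (period_set g))"

definition Aff :: "(complex^'m) set set \<Rightarrow> (complex^'m) set" where
  "Aff D = {Z. Z \<noteq> 0 \<and> cline Z \<in> D}"

definition cmat :: "int^'m^'m \<Rightarrow> complex^'m^'m" where
  "cmat A = map_matrix of_int A"

definition Oplus :: "int^'m^'m \<Rightarrow> (complex^'m) set set \<Rightarrow> (int^'m^'m) monoid" where
  "Oplus g D =
     \<lparr>carrier = {A. invertible A \<and> (\<forall>x y. bil g (A *v x) (A *v y) = bil g x y) \<and>
                    (\<lambda>l. (\<lambda>Z. cmat A *v Z) ` l) ` D = D},
      monoid.mult = (**), one = mat 1\<rparr>"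


section \<open>Derivatives and smoothness\<close>

fun Ck_on :: "nat \<Rightarrow> 'a::real_normed_vector set \<Rightarrow> ('a \<Rightarrow> 'b::real_normed_vector) \<Rightarrow> bool" where
  "Ck_on 0 U f \<longleftrightarrow> continuous_on U f"
| "Ck_on (Suc k) U f \<longleftrightarrow>
     (\<forall>x\<in>U. f differentiable (at x)) \<and> (\<forall>v. Ck_on k U (\<lambda>x. frechet_derivative f (at x) v))"

definition smooth_on :: "'a::real_normed_vector set \<Rightarrow> ('a \<Rightarrow> 'b::real_normed_vector) \<Rightarrow> bool" where
  "smooth_on U f \<longleftrightarrow> (\<forall>k. Ck_on k U f)"

text \<open>The Wirtinger derivatives in the direction of \<open>v\<close>; for \<open>v = e\<^sub>k\<close> these are
  \<open>\<partial>/\<partial>Z\<^sub>k\<close> and \<open>\<partial>/\<partial>Z\<^sup>-\<^sub>k\<close>.\<close>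

definition dee :: "(complex^'m \<Rightarrow> complex) \<Rightarrow> complex^'m \<Rightarrow> complex^'m \<Rightarrow> complex" where
  "dee f v Z = (frechet_derivative f (at Z) v - \<i> * frechet_derivative f (at Z) (\<i> *s v)) / 2"

definition deebar :: "(complex^'m \<Rightarrow> complex) \<Rightarrow> complex^'m \<Rightarrow> complex^'m \<Rightarrow> complex" where
  "deebar f v Z = (frechet_derivative f (at Z) v + \<i> * frechet_derivative f (at Z) (\<i> *s v)) / 2"


section \<open>Multidifferentials and sections\<close>

text \<open>
  \<open>F = \<Sum>\<^sub>I F\<^sub>I dZ\<^bsub>i1\<^esub> \<otimes> \<dots> \<otimes> dZ\<^bsub>is\<^esub>\<close> is given by its coefficients \<open>F Z I\<close>, where \<open>I\<close> is a list of
  length \<open>s\<close>; values at lists of any other length are irrelevant. A smooth function on the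
  submanifold \<open>Aff D\<close> of \<open>M\<^sub>\<complex>\<close> is represented by a smooth extension to an open neighbourhood,
  so that the derivatives below are ambient ones; sections are compared on \<open>Aff D\<close> only.
\<close>

type_synonym 'm mdiff = "complex^'m \<Rightarrow> 'm list \<Rightarrow> complex"

text \<open>Equality modulo multidifferentials with a tensor factor
  \<open>d\<langle>Z, Z\<rangle> = \<Sum>\<^sub>a 2 \<langle>e\<^sub>a, Z\<rangle> dZ\<^sub>a\<close>, on the cone \<open>A\<close>.\<close>

definition sec_eq ::
  "int^'m^'m \<Rightarrow> (complex^'m) set \<Rightarrow> nat \<Rightarrow> 'm mdiff \<Rightarrow> 'm mdiff \<Rightarrow> bool" where
  "sec_eq g A s F G \<longleftrightarrow>
     (\<forall>Z\<in>A. \<exists>H :: nat \<Rightarrow> 'm list \<Rightarrow> complex. \<forall>I. length I = s \<longrightarrow>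
        F Z I - G Z I =
          (\<Sum>r<s. 2 * bil g (axis (I ! r) 1) Z * H r (take r I @ drop (Suc r) I)))"

definition euler_contr :: "nat \<Rightarrow> 'm::finite mdiff \<Rightarrow> 'm mdiff" where
  "euler_contr r F = (\<lambda>Z I. \<Sum>a\<in>UNIV. Z $ a * F Z (take r I @ a # drop r I))"

text \<open>Smooth sections of \<open>\<E>\<^sup>s \<otimes> \<L>\<^sup>k\<close>. Homogeneity and vanishing of the contractions are
  conditions on the class in the quotient, not on the representative: for instance the contraction
  of the section \<open>g\<close> of \<open>\<E>\<^sup>2\<close> in either slot is \<open>d\<langle>Z, Z\<rangle> / 2\<close>, and the ambient derivatives of an
  extension are determined on \<open>Aff D\<close> only up to multiples of \<open>d\<langle>Z, Z\<rangle>\<close>.\<close>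

definition is_section ::
  "int^'m^'m \<Rightarrow> (complex^'m) set \<Rightarrow> int \<Rightarrow> nat \<Rightarrow> 'm mdiff \<Rightarrow> bool" where
  "is_section g A k s F \<longleftrightarrow>
     (\<exists>U. open U \<and> A \<subseteq> U \<and> (\<forall>I. length I = s \<longrightarrow> smooth_on U (\<lambda>Z. F Z I))) \<and>
     (\<forall>c. c \<noteq> 0 \<longrightarrow> sec_eq g A s (\<lambda>Z. F (c *s Z)) (\<lambda>Z I. c powi (- k) * F Z I)) \<and>
     (\<forall>r<s. sec_eq g A (s - 1) (euler_contr r F) (\<lambda>_ _. 0))"

text \<open>Substitution of \<open>\<Sum>\<^sub>j P i j w\<^sub>j\<close> for the \<open>i\<close>-th basis covector in every slot of a tensor.\<close>

definition subst_slots ::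
  "('i::finite \<Rightarrow> 'j \<Rightarrow> complex) \<Rightarrow> ('i list \<Rightarrow> complex) \<Rightarrow> 'j list \<Rightarrow> complex" where
  "subst_slots P T J = (\<Sum>I | length I = length J. T I * (\<Prod>r<length J. P (I ! r) (J ! r)))"

definition pull_mat :: "int^'m^'m \<Rightarrow> 'm::finite mdiff \<Rightarrow> 'm mdiff" where
  "pull_mat A F = (\<lambda>Z. subst_slots (\<lambda>i j. of_int (A $ i $ j)) (F (cmat A *v Z)))"

definition tensor :: "nat \<Rightarrow> 'm mdiff \<Rightarrow> 'm mdiff \<Rightarrow> 'm mdiff" where
  "tensor s F G = (\<lambda>Z I. F Z (take s I) * G Z (drop s I))"

definition gmetric :: "int^'m^'m \<Rightarrow> 'm mdiff" where
  "gmetric g = (\<lambda>Z I. of_int (g $ (I ! 0) $ (I ! 1)))"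

text \<open>\<open>\<sigma>\<^sub>i\<^sub>j\<close>; tensor factors are counted from 1.\<close>

definition swap_slots :: "nat \<Rightarrow> nat \<Rightarrow> 'm mdiff \<Rightarrow> 'm mdiff" where
  "swap_slots i j F = (\<lambda>Z I. F Z (I[i - 1 := I ! (j - 1), j - 1 := I ! (i - 1)]))"

text \<open>Moves tensor factor \<open>s + 1\<close> behind all others.\<close>

definition move_last :: "nat \<Rightarrow> 'm mdiff \<Rightarrow> 'm mdiff" where
  "move_last s F = (\<lambda>Z I. F Z (take s I @ last I # butlast (drop s I)))"


section \<open>Lowering and raising operators\<close>

definition nu :: "int^'m^'m \<Rightarrow> complex^'m \<Rightarrow> 'm \<Rightarrow> complex" where
  "nu g Z j = dee (\<lambda>W. of_real (ln (nsq g W))) (axis j 1) Z"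

text \<open>\<open>phi g Z k j\<close> is the coefficient of \<open>dZ\<^sub>j\<close> in \<open>\<phi>(dZ\<^sup>-\<^sub>k)\<close>, and \<open>psi g Z k j\<close> that of
  \<open>dZ\<^sup>-\<^sub>j\<close> in \<open>\<psi>(dZ\<^sub>k)\<close>.\<close>

definition phi :: "int^'m^'m \<Rightarrow> complex^'m \<Rightarrow> 'm \<Rightarrow> 'm \<Rightarrow> complex" where
  "phi g Z k j = (if k = j then 1 else 0) - Z $ k * nu g Z j"

definition psi :: "int^'m^'m \<Rightarrow> complex^'m \<Rightarrow> 'm \<Rightarrow> 'm \<Rightarrow> complex" where
  "psi g Z k j = cnj (phi g Z k j)"

definition lower :: "int^'m^'m \<Rightarrow> 'm mdiff \<Rightarrow> 'm mdiff" where
  "lower g F = (\<lambda>Z J. of_real (nsq g Z) *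
     (\<Sum>l\<in>UNIV. deebar (\<lambda>W. F W (butlast J)) (axis l 1) Z * phi g Z l (last J)))"

definition raise :: "int^'m^'m \<Rightarrow> int \<Rightarrow> 'm mdiff \<Rightarrow> 'm mdiff" where
  "raise g k F = (\<lambda>Z J. of_real (nsq g Z powi (- k)) *
     subst_slots (phi g Z)
       (\<lambda>I. dee (\<lambda>W. of_real (nsq g W powi k) * subst_slots (psi g W) (F W) I)
              (axis (last J) 1) Z)
       (butlast J))"


section \<open>Almost-holomorphic modular forms\<close>

definition tube_map :: "int^'m^'m \<Rightarrow> int^'m \<Rightarrow> rat^'m \<Rightarrow> complex^'m \<Rightarrow> complex^'m" where
  "tube_map g e f z = (- bil g z z / 2) *s vmap of_int e + z + vmap of_rat f"

definition cusp_pair :: "int^'m^'m \<Rightarrow> int^'m \<Rightarrow> rat^'m \<Rightarrow> bool" where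
  "cusp_pair g e f \<longleftrightarrow>
     e \<noteq> 0 \<and> (\<forall>c x. e = c *s x \<longrightarrow> \<bar>c\<bar> = 1) \<and> bil g e e = 0 \<and>
     bil g f f = 0 \<and> bil g (vmap of_int e) f = 1"

text \<open>The component of the tube which is mapped to \<open>\<D>\<close>.\<close>

definition is_tube_domain ::
  "int^'m^'m \<Rightarrow> (complex^'m) set \<Rightarrow> int^'m \<Rightarrow> rat^'m \<Rightarrow> (complex^'m) set \<Rightarrow> bool" where
  "is_tube_domain g A e f \<Omega> \<longleftrightarrow>
     \<Omega> \<in> components {z. bil g (vmap of_int e) z = 0 \<and> bil g (vmap of_rat f) z = 0 \<and>
                         bil g (vmap Im z) (vmap Im z) > 0} \<and>
     tube_map g e f ` \<Omega> \<subseteq> A"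

text \<open>Linear coordinates on \<open>{e, f}\<^sup>\<bottom>\<close> are given by a basis \<open>b\<^sub>0, \<dots>, b\<^bsub>n-1\<^esub>\<close> of
  its real points.\<close>

definition is_coord_basis ::
  "int^'m^'m \<Rightarrow> int^'m \<Rightarrow> rat^'m \<Rightarrow> nat \<Rightarrow> (nat \<Rightarrow> real^'m) \<Rightarrow> bool" where
  "is_coord_basis g e f n b \<longleftrightarrow>
     inj_on b {..<n} \<and> independent (b ` {..<n}) \<and>
     span (b ` {..<n}) = {y. bil g (vmap of_int e) y = 0 \<and> bil g (vmap of_rat f) y = 0}"

text \<open>Coefficient of \<open>dz\<^bsub>j1\<^esub> \<otimes> \<dots> \<otimes> dz\<^bsub>js\<^esub>\<close> in the pullback along the (holomorphic) map
  \<open>tube_map g e f\<close>.\<close>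

definition pull_tube ::
  "int^'m^'m \<Rightarrow> int^'m \<Rightarrow> rat^'m \<Rightarrow> (nat \<Rightarrow> real^'m) \<Rightarrow> 'm::finite mdiff \<Rightarrow>
     complex^'m \<Rightarrow> nat list \<Rightarrow> complex" where
  "pull_tube g e f b F = (\<lambda>z. subst_slots
     (\<lambda>i j. frechet_derivative (tube_map g e f) (at z) (vmap of_real (b j)) $ i)
     (F (tube_map g e f z)))"

definition nu_tube :: "int^'m^'m \<Rightarrow> (nat \<Rightarrow> real^'m) \<Rightarrow> complex^'m \<Rightarrow> nat \<Rightarrow> complex" where
  "nu_tube g b z j =
     dee (\<lambda>w. of_real (ln (bil g (vmap Im w) (vmap Im w)))) (vmap of_real (b j)) z"

text \<open>For a function on a relatively open subset of a complex linear subspace, on which the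
  derivative within the set is determined.\<close>

definition holo_on :: "(complex^'m) set \<Rightarrow> (complex^'m \<Rightarrow> complex) \<Rightarrow> bool" where
  "holo_on S h \<longleftrightarrow>
     (\<forall>z\<in>S. \<exists>h'. (h has_derivative h') (at z within S) \<and> (\<forall>c v. h' (c *s v) = c * h' v))"

text \<open>Frequencies \<open>\<alpha>\<close> are identified with real vectors through the bilinear form. By convergence
  only countably many of them occur.\<close>

definition regular_fourier ::
  "int^'m^'m \<Rightarrow> (complex^'m) set \<Rightarrow> (complex^'m \<Rightarrow> complex) \<Rightarrow> bool" where
  "regular_fourier g \<Omega> h \<longleftrightarrow>
     (\<exists>c :: real^'m \<Rightarrow> complex.
        (\<forall>\<alpha>. c \<alpha> \<noteq> 0 \<longrightarrow> \<alpha> \<in> closure (vmap Im ` \<Omega>)) \<and>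
        (\<forall>z\<in>\<Omega>. ((\<lambda>\<alpha>. c \<alpha> * exp (2 * of_real pi * \<i> * bil g (vmap of_real \<alpha>) z))
                   has_sum h z) UNIV))"

text \<open>The polynomials in \<open>\<nu>\<^sub>0, \<dots>, \<nu>\<^bsub>n-1\<^esub>\<close> are sums over a finite set \<open>N\<close> of multi-indices;
  \<open>h J (\<lambda>_. 0)\<close> is the constant term.\<close>

definition cusp_condition ::
  "int^'m^'m \<Rightarrow> nat \<Rightarrow> (complex^'m) set \<Rightarrow> nat \<Rightarrow> 'm::finite mdiff \<Rightarrow> bool" where
  "cusp_condition g n A s F \<longleftrightarrow>
     (\<forall>e f \<Omega> b d J.
        cusp_pair g e f \<and> is_tube_domain g A e f \<Omega> \<and> is_coord_basis g e f n b \<and>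
        length J = s + d \<and> set J \<subseteq> {..<n} \<longrightarrow>
        (\<exists>N (h :: (nat \<Rightarrow> nat) \<Rightarrow> complex^'m \<Rightarrow> complex).
           finite N \<and> (\<lambda>_. 0) \<in> N \<and> (\<forall>p\<in>N. \<forall>j\<ge>n. p j = 0) \<and>
           (\<forall>p\<in>N. holo_on \<Omega> (h p)) \<and>
           (\<forall>z\<in>\<Omega>. pull_tube g e f b ((lower g ^^ d) F) z J =
              (\<Sum>p\<in>N. h p z * (\<Prod>j<n. nu_tube g b z j ^ p j))) \<and>
           regular_fourier g \<Omega> (h (\<lambda>_. 0))))"

definition AHMod ::
  "int^'m^'m \<Rightarrow> nat \<Rightarrow> (complex^'m) set set \<Rightarrow> (int^'m^'m) set \<Rightarrow> int \<Rightarrow> nat \<Rightarrow> 'm::finite mdiff set"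
  where
  "AHMod g n D \<Gamma> k s =
     {F. is_section g (Aff D) k s F \<and>
         (\<forall>A\<in>\<Gamma>. sec_eq g (Aff D) s (pull_mat A F) F) \<and>
         (\<exists>d. sec_eq g (Aff D) (s + d + 1) ((lower g ^^ (d + 1)) F) (\<lambda>_ _. 0)) \<and>
         (n \<le> 2 \<longrightarrow> cusp_condition g n (Aff D) s F)}"

end

theory Submission
  imports Defs "HOL-Complex_Analysis.Cauchy_Integral_Formula"
begin

text \<open>
  A section is tested by evaluating it on vectors orthogonal to \<open>Z\<close>, that is, tangent to the cone.
  On vectors, \<open>\<phi>\<close> and \<open>\<psi>\<close> act as the projections along \<open>Z\<close> and \<open>Z\<^sup>-\<close>, so that \<open>L\<close> is the
  antiholomorphic derivative in the direction of the conjugate of the projected new vector, and \<open>R\<close> is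
  the holomorphic derivative of the tensor evaluated on moving projected vectors. A function which
  vanishes on the cone has vanishing derivatives along it; this makes both operators independent of the
  representative. The Leibniz rules are then immediate, and in the commutator the mixed second
  derivatives cancel, only the derivatives of the projections and of \<open>|Z|\<^sup>2\<close> remaining.

  By the commutator formula, \<open>L\<^sup>d R F\<close> is, up to permutations of the slots, a sum of \<open>R L\<^sup>d F\<close> and of
  tensors \<open>L\<^bsup>d-1\<^esup> F \<otimes> g\<close>. Hence nilpotency and the cusp condition need only be transferred from \<open>F\<close> to
  \<open>R F\<close>. In tube coordinates \<open>R\<close> is \<open>\<partial>\<^sub>j + k \<nu>\<^sub>j\<close> plus slotwise terms linear in \<open>\<nu>\<close>, and
  \<open>\<partial>\<^sub>j \<nu>\<^sub>i\<close> is quadratic in \<open>\<nu>\<close>; so polynomials in \<open>\<nu>\<close> are preserved and their constant terms are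
  merely differentiated, which is possible term by term in an unconditionally convergent Fourier series.
\<close>

text \<open>The derivatives in the operators are ambient, while sections are known only on the cone
  and only modulo d<Z, Z>; so everything has to be read off from derivatives along the cone. A
  tangent vector at \<open>Z\<close> is not tangent at nearby points, but the frame
  \<open>pip W v\<close> is, and its antiholomorphic derivative vanishes at \<open>Z\<close>: for
  lowering it may be inserted at no cost, for raising \<open>psi\<close> provides it. The vanishing
  contraction with \<open>Z\<close> is again a condition along the cone, and differentiating it is
  what removes the terms with \<open>Z\<close> in a slot. Since both sides of the commutator formula
  are killed by \<open>Z\<close> in every slot, it suffices to prove it on vectors orthogonal to
  \<open>Z\<close> and to \<open>cj Z\<close>, where all projections are the identity at the base
  point and only their derivatives count. At the cusps the coefficients are merely complex
  differentiable, with no continuity assumed of the derivative; that their derivatives are again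
  holomorphic is reduced to one variable by a quadratic error estimate.\<close>

abbreviation cj :: "complex^'m \<Rightarrow> complex^'m" where
  "cj \<equiv> vmap cnj"

lemma cj_nth [simp]: "cj v $ i = cnj (v $ i)"
  by (simp add: vmap_def)

lemma cj_cj [simp]: "cj (cj v) = v"
  by (simp add: vec_eq_iff)

lemma cj_add: "cj (v + w) = cj v + cj w"
  by (simp add: vec_eq_iff)

lemma cj_diff: "cj (v - w) = cj v - cj w"
  by (simp add: vec_eq_iff)

lemma cj_scale: "cj (c *s v) = cnj c *s cj v"
  by (simp add: vec_eq_iff)

lemma cj_zero [simp]: "cj 0 = 0"
  by (simp add: vec_eq_iff)

section \<open>Bilinearity and expansion in coordinates\<close>

lemma bil_add_left: "bil g (x + y) z = bil g x z + bil g y z"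
  by (simp add: bil_def algebra_simps sum.distrib)

lemma bil_add_right: "bil g z (x + y) = bil g z x + bil g z y"
  by (simp add: bil_def algebra_simps sum.distrib)

lemma bil_scale_left: "bil g (c *s x) z = c * bil g x z"
  by (simp add: bil_def sum_distrib_left algebra_simps)

lemma bil_scale_right: "bil g z (c *s x) = c * bil g z x"
  by (simp add: bil_def sum_distrib_left algebra_simps)

lemma bil_diff_left: "bil g (x - y) z = bil g x z - bil g y z"
  by (simp add: bil_def algebra_simps sum_subtractf)

lemma bil_diff_right: "bil g z (x - y) = bil g z x - bil g z y"
  by (simp add: bil_def algebra_simps sum_subtractf)

lemma bil_zero_left [simp]: "bil g 0 z = 0"
  by (simp add: bil_def)

lemma bil_zero_right [simp]: "bil g z 0 = 0"
  by (simp add: bil_def)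

lemma bil_minus_left [simp]: "bil g (- x) z = - bil g x z"
  by (simp add: bil_def sum_negf)

lemma bil_minus_right [simp]: "bil g z (- x) = - bil g z x"
  by (simp add: bil_def sum_negf)

lemmas bil_lin = bil_add_left bil_add_right bil_scale_left bil_scale_right bil_diff_left
  bil_diff_right

lemma bil_sum_left: "bil g (\<Sum>i\<in>S. f i) z = (\<Sum>i\<in>S. bil g (f i) z)"
  by (induction S rule: infinite_finite_induct) (auto simp: bil_add_left)

lemma bil_sum_right: "bil g z (\<Sum>i\<in>S. f i) = (\<Sum>i\<in>S. bil g z (f i))"
  by (induction S rule: infinite_finite_induct) (auto simp: bil_add_right)

lemma bil_cnj: "cnj (bil g x y) = bil g (cj x) (cj y)"
  by (simp add: bil_def)

lemma vec_axis_expand: "v = (\<Sum>i\<in>UNIV. v $ i *s axis i (1::'a::comm_ring_1))"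
  by (simp add: vec_eq_iff axis_def if_distrib[of "\<lambda>x. _ * x"] sum_component cong: if_cong)

lemma bil_axis_left: "(\<Sum>i\<in>UNIV. v $ i * bil g (axis i 1) z) = bil g v z"
proof -
  have "bil g v z = bil g (\<Sum>i\<in>UNIV. v $ i *s axis i 1) z"
    using vec_axis_expand[of v] by simp
  then show ?thesis by (simp only: bil_sum_left bil_scale_left)
qed

lemma bil_axis_axis: "bil g (axis i 1) (axis j 1) = of_int (g $ i $ j)"
proof -
  have "bil g (axis i 1) (axis j (1::'a)) =
    (\<Sum>a\<in>UNIV. \<Sum>b\<in>UNIV. if a = i then (if b = j then of_int (g $ a $ b) else 0) else 0)"
    unfolding bil_def by (intro sum.cong refl) (auto simp: axis_def)
  also have "\<dots> = (\<Sum>a\<in>UNIV. if a = i then of_int (g $ a $ j) else 0)"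
    by (intro sum.cong refl) auto
  finally show ?thesis by simp
qed

section \<open>Evaluation of tensors\<close>

text \<open>The multilinear form with coefficients \<open>T\<close>. The recursion suits inductions
  in which the coefficients vary; the closed sum over index lists, \<open>ev_as_sum\<close>, is
  needed only for permutations of slots.\<close>

fun ev :: "('m::finite list \<Rightarrow> complex) \<Rightarrow> (complex^'m) list \<Rightarrow> complex" where
  "ev T [] = T []"
| "ev T (v # vs) = (\<Sum>i\<in>UNIV. v $ i * ev (\<lambda>I. T (i # I)) vs)"

lemma ev_cong: "(\<And>I. length I = length vs \<Longrightarrow> T I = S I) \<Longrightarrow> ev T vs = ev S vs"
proof (induction vs arbitrary: T S)
  case (Cons v vs)
  show ?case
    unfolding ev.simps
    by (intro sum.cong refl arg_cong2[where f = "(*)"] Cons.IH) (simp add: Cons.prems)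
qed simp

lemma ev_add: "ev (\<lambda>I. T I + S I) vs = ev T vs + ev S vs"
  by (induction vs arbitrary: T S) (simp_all add: algebra_simps sum.distrib)

lemma ev_scale: "ev (\<lambda>I. c * T I) vs = c * ev T vs"
  by (induction vs arbitrary: T) (simp_all add: algebra_simps sum_distrib_left)

lemma ev_zero [simp]: "ev (\<lambda>I. 0) vs = 0"
  by (induction vs) simp_all

lemma ev_diff: "ev (\<lambda>I. T I - S I) vs = ev T vs - ev S vs"
  using ev_add[of T "\<lambda>I. - 1 * S I" vs] ev_scale[of "- 1" S vs] by simp

lemma ev_sum: "ev (\<lambda>I. \<Sum>x\<in>X. T x I) vs = (\<Sum>x\<in>X. ev (T x) vs)"
  by (induction X rule: infinite_finite_induct) (simp_all add: ev_add)

lemma ev_append: "ev T (vs @ ws) = ev (\<lambda>I. ev (\<lambda>J. T (I @ J)) ws) vs"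
  by (induction vs arbitrary: T) simp_all

lemma ev_tensor: "ev (\<lambda>I. T (take (length vs) I) * S (drop (length vs) I)) (vs @ ws) = ev T vs * ev S ws"
proof (induction vs arbitrary: T)
  case (Cons v vs)
  have "ev (\<lambda>I. T (i # take (length vs) I) * S (drop (length vs) I)) (vs @ ws) =
      ev (\<lambda>I. T (i # I)) vs * ev S ws" for i
    by (rule Cons.IH[of "\<lambda>I. T (i # I)"])
  then show ?case by (simp add: sum_distrib_right mult.assoc)
qed (simp add: ev_scale)

text \<open>Isolates one slot by inserting its index at position \<open>length xs\<close>; linearity
  in a single argument follows from this expansion.\<close>

lemma ev_slot: "ev T (xs @ v # ys) = (\<Sum>i\<in>UNIV. v $ i * ev (\<lambda>I. T (take (length xs) I @ i # drop (length xs) I)) (xs @ ys))"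
proof (induction xs arbitrary: T)
  case (Cons x xs)
  show ?case
    by (simp add: Cons.IH sum_distrib_left mult.left_commute)
      (rule sum.swap)
qed simp

lemma ev_slot_add: "ev T (xs @ (u + v) # ys) = ev T (xs @ u # ys) + ev T (xs @ v # ys)"
  by (simp add: ev_slot algebra_simps sum.distrib)

lemma ev_slot_diff: "ev T (xs @ (u - v) # ys) = ev T (xs @ u # ys) - ev T (xs @ v # ys)"
  by (simp add: ev_slot algebra_simps sum_subtractf)

lemma ev_slot_scale: "ev T (xs @ (c *s v) # ys) = c * ev T (xs @ v # ys)"
  by (simp add: ev_slot algebra_simps sum_distrib_left)

lemma ev_slot_zero [simp]: "ev T (xs @ 0 # ys) = 0"
  by (simp add: ev_slot)

lemma ev_slot_sum: "ev T (xs @ (\<Sum>i\<in>S. f i) # ys) = (\<Sum>i\<in>S. ev T (xs @ f i # ys))"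
  by (induction S rule: infinite_finite_induct) (simp_all add: ev_slot_add)

lemma ev_upd_diff: "r < length vs \<Longrightarrow> ev T (vs[r := u - v]) = ev T (vs[r := u]) - ev T (vs[r := v])"
  by (simp add: upd_conv_take_nth_drop ev_slot_diff)

lemma ev_upd_scale: "r < length vs \<Longrightarrow> ev T (vs[r := c *s v]) = c * ev T (vs[r := v])"
  by (simp add: upd_conv_take_nth_drop ev_slot_scale)

lemma ev_upd_zero: "r < length vs \<Longrightarrow> ev T (vs[r := 0]) = 0"
  by (simp add: upd_conv_take_nth_drop)

lemma ev_upd_sum: "r < length vs \<Longrightarrow> ev T (vs[r := (\<Sum>i\<in>S. f i)]) = (\<Sum>i\<in>S. ev T (vs[r := f i]))"
  by (simp add: upd_conv_take_nth_drop ev_slot_sum)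

lemma ev_axis: "ev T (map (\<lambda>i. axis i 1) I) = T I"
proof (induction I arbitrary: T)
  case (Cons i I)
  have "ev T (map (\<lambda>i. axis i 1) (i # I)) = (\<Sum>j\<in>UNIV. axis i 1 $ j * T (j # I))"
    by (simp add: Cons.IH)
  also have "\<dots> = (\<Sum>j\<in>UNIV. if j = i then T (j # I) else 0)"
    by (intro sum.cong) (auto simp: axis_def)
  finally show ?case by simp
qed simp

text \<open>A frame substituted into the coefficients becomes a linear map on the arguments, the one
  that sends the basis vectors to \<open>f j\<close>. It serves for \<open>phi\<close>,
  \<open>psi\<close>, integral matrices and the differential of the tube map.\<close>

lemma ev_ev: "ev (\<lambda>J. ev T (map f J)) vs = ev T (map (\<lambda>v. \<Sum>j\<in>UNIV. v $ j *s f j) vs)"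
proof (induction vs arbitrary: T)
  case (Cons v vs)
  have "ev (\<lambda>J. ev T (map f J)) (v # vs) =
    (\<Sum>j\<in>UNIV. v $ j * (\<Sum>i\<in>UNIV. f j $ i * ev (\<lambda>J. ev (\<lambda>I. T (i # I)) (map f J)) vs))"
    by (simp add: ev_sum ev_scale)
  also have "\<dots> = (\<Sum>i\<in>UNIV. (\<Sum>j\<in>UNIV. v $ j * f j $ i) * ev (\<lambda>J. ev (\<lambda>I. T (i # I)) (map f J)) vs)"
    by (simp add: sum_distrib_left sum_distrib_right mult.assoc) (rule sum.swap)
  finally show ?case by (simp add: Cons.IH)
qed simp

lemma lists_of_length_Suc:
  "{I :: 'i list. length I = Suc n} = (\<lambda>(i, I). i # I) ` (UNIV \<times> {I. length I = n})"
  by (auto simp: image_iff length_Suc_conv)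

lemma subst_slots_Nil: "subst_slots P T [] = T []"
  by (simp add: subst_slots_def)

lemma subst_slots_Cons:
  "subst_slots P T (j # J) = (\<Sum>i\<in>UNIV. P i j * subst_slots P (\<lambda>I. T (i # I)) J)"
proof -
  have inj: "inj_on (\<lambda>(i, I). i # I) (UNIV \<times> {I :: 'a list. length I = length J})"
    by (auto simp: inj_on_def)
  have "subst_slots P T (j # J) =
    (\<Sum>(i, I)\<in>UNIV \<times> {I. length I = length J}.
       T (i # I) * (\<Prod>r<Suc (length J). P ((i # I) ! r) ((j # J) ! r)))"
    unfolding subst_slots_def length_Cons lists_of_length_Suc
    by (subst sum.reindex[OF inj]) (simp add: case_prod_unfold)
  also have "\<dots> = (\<Sum>i\<in>UNIV. \<Sum>I | length I = length J.
       P i j * (T (i # I) * (\<Prod>r<length J. P (I ! r) (J ! r))))"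
    by (subst sum.cartesian_product[symmetric])
      (simp only: prod.lessThan_Suc_shift nth_Cons_0 nth_Cons_Suc mult.assoc mult.left_commute)
  finally show ?thesis by (simp add: subst_slots_def sum_distrib_left)
qed

lemma subst_slots_ev: "subst_slots P T J = ev T (map (\<lambda>j. \<chi> i. P i j) J)"
  by (induction J arbitrary: T) (simp_all add: subst_slots_Nil subst_slots_Cons)

lemma ev_subst_slots:
  "ev (subst_slots P T) vs = ev T (map (\<lambda>v. \<chi> i. \<Sum>j\<in>UNIV. P i j * v $ j) vs)"
proof -
  have "ev (subst_slots P T) vs = ev (\<lambda>J. ev T (map (\<lambda>j. \<chi> i. P i j) J)) vs"
    by (simp add: subst_slots_ev[abs_def])
  also have "\<dots> = ev T (map (\<lambda>v. \<Sum>j\<in>UNIV. v $ j *s (\<chi> i. P i j)) vs)"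
    by (rule ev_ev)
  also have "(\<lambda>v. \<Sum>j\<in>UNIV. v $ j *s (\<chi> i. P i j)) = (\<lambda>v. \<chi> i. \<Sum>j\<in>UNIV. P i j * v $ j)"
    by (simp add: vec_eq_iff fun_eq_iff mult.commute)
  finally show ?thesis .
qed

text \<open>The easy half of the description of the quotient: a tensor factor proportional to d<Z,
  Z> is a linear form that vanishes on vectors orthogonal to \<open>Z\<close>.\<close>

lemma ev_linear_factor:
  assumes "r < length vs" "bil g (vs ! r) Z = 0"
  shows "ev (\<lambda>I. bil g (axis (I ! r) 1) Z * H (take r I @ drop (Suc r) I)) vs = 0"
proof -
  have vs: "vs = take r vs @ vs ! r # drop (Suc r) vs"
    using assms(1) by (rule id_take_nth_drop)
  have len: "length (take r vs) = r" using assms(1) by simp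
  let ?T = "\<lambda>I. bil g (axis (I ! r) 1) Z * H (take r I @ drop (Suc r) I)"
  have "ev ?T vs = ev ?T (take r vs @ vs ! r # drop (Suc r) vs)"
    using vs by simp
  also have "\<dots> = (\<Sum>i\<in>UNIV. (vs ! r) $ i *
       ev (\<lambda>I. ?T (take r I @ i # drop r I)) (take r vs @ drop (Suc r) vs))"
    by (simp only: ev_slot len)
  also have "\<dots> = (\<Sum>i\<in>UNIV. (vs ! r) $ i *
       (bil g (axis i 1) Z * ev H (take r vs @ drop (Suc r) vs)))"
  proof (intro sum.cong refl arg_cong2[where f = "(*)"])
    fix i
    have "ev (\<lambda>I. ?T (take r I @ i # drop r I)) (take r vs @ drop (Suc r) vs) =
      ev (\<lambda>I. bil g (axis i 1) Z * H I) (take r vs @ drop (Suc r) vs)"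
      using assms(1) by (intro ev_cong) (simp add: nth_append min_def)
    then show "ev (\<lambda>I. ?T (take r I @ i # drop r I)) (take r vs @ drop (Suc r) vs) =
      bil g (axis i 1) Z * ev H (take r vs @ drop (Suc r) vs)"
      by (simp add: ev_scale)
  qed
  also have "\<dots> = bil g (vs ! r) Z * ev H (take r vs @ drop (Suc r) vs)"
    by (simp add: bil_axis_left[of "vs ! r" g Z, symmetric] sum_distrib_right mult.assoc)
  finally show ?thesis using assms(2) by simp
qed

text \<open>The arguments are replaced by their projections one after the other from the left. The
  error in slot \<open>r\<close> therefore has projected vectors before the slot, \<open>w\<close>
  in it and the original vectors behind it.\<close>

lemma ev_telescope:
  assumes p: "\<And>v. p v = v - l v *s w"
  shows "ev T vs = ev T (map p vs) +
    (\<Sum>r<length vs. l (vs ! r) * ev T (map p (take r vs) @ w # drop (Suc r) vs))"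
proof (induction vs arbitrary: T)
  case (Cons v vs)
  have v: "v = p v + l v *s w" by (simp add: p)
  have head: "ev T (v # vs) = ev T (p v # vs) + l v * ev T (w # vs)"
    using ev_slot_add[of T "[]" "p v" "l v *s w" vs] ev_slot_scale[of T "[]" "l v" w vs] v
    by simp
  have "ev T (p v # vs) = (\<Sum>i\<in>UNIV. p v $ i * ev (\<lambda>I. T (i # I)) vs)"
    by simp
  also have "\<dots> = (\<Sum>i\<in>UNIV. p v $ i * ev (\<lambda>I. T (i # I)) (map p vs)) +
     (\<Sum>i\<in>UNIV. p v $ i * (\<Sum>r<length vs. l (vs ! r) *
        ev (\<lambda>I. T (i # I)) (map p (take r vs) @ w # drop (Suc r) vs)))"
    by (subst Cons.IH) (simp add: algebra_simps sum.distrib)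
  also have "(\<Sum>i\<in>UNIV. p v $ i * (\<Sum>r<length vs. l (vs ! r) *
        ev (\<lambda>I. T (i # I)) (map p (take r vs) @ w # drop (Suc r) vs))) =
     (\<Sum>r<length vs. l (vs ! r) * ev T (p v # map p (take r vs) @ w # drop (Suc r) vs))"
    by (simp add: sum_distrib_left mult.left_commute) (rule sum.swap)
  finally show ?case
    by (simp only: head length_Cons sum.lessThan_Suc_shift) simp
qed simp

lemma sec_eq_evD:
  assumes "sec_eq g A s F G" "Z \<in> A" "length vs = s" "\<forall>v\<in>set vs. bil g v Z = 0"
  shows "ev (F Z) vs = ev (G Z) vs"
proof -
  obtain H where H: "\<And>I. length I = s \<Longrightarrow> F Z I - G Z I =
      (\<Sum>r<s. 2 * bil g (axis (I ! r) 1) Z * H r (take r I @ drop (Suc r) I))"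
    using assms(1)[unfolded sec_eq_def, rule_format, OF assms(2)] by blast
  have "ev (F Z) vs - ev (G Z) vs = ev (\<lambda>I. F Z I - G Z I) vs"
    by (simp add: ev_diff)
  also have "\<dots> = ev (\<lambda>I. \<Sum>r<s. 2 * (bil g (axis (I ! r) 1) Z * H r (take r I @ drop (Suc r) I))) vs"
    using assms(3) by (intro ev_cong) (simp add: H mult.assoc)
  also have "\<dots> = (\<Sum>r<s. 2 * ev (\<lambda>I. bil g (axis (I ! r) 1) Z * H r (take r I @ drop (Suc r) I)) vs)"
    by (simp only: ev_sum ev_scale)
  also have "\<dots> = 0"
    using assms(3,4) by (intro sum.neutral ballI) (simp add: ev_linear_factor)
  finally show ?thesis by simp
qed

text \<open>The vector \<open>cj Z\<close> is transversal to the orthogonal complement of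
  \<open>Z\<close>. Telescoping the basis vectors along \<open>cj Z\<close> writes the difference as
  a sum of terms, each with the factor \<open>bil g (axis i 1) Z\<close> of one slot, which is the
  shape that the quotient demands.\<close>

lemma sec_eq_evI:
  assumes nz: "\<And>Z. Z \<in> A \<Longrightarrow> bil g (cj Z) Z \<noteq> 0"
    and eq: "\<And>Z vs. Z \<in> A \<Longrightarrow> length vs = s \<Longrightarrow> \<forall>v\<in>set vs. bil g v Z = 0 \<Longrightarrow> ev (F Z) vs = ev (G Z) vs"
  shows "sec_eq g A s F G"
  unfolding sec_eq_def
proof
  fix Z assume Z: "Z \<in> A"
  define T where "T = (\<lambda>I. F Z I - G Z I)"
  define l where "l = (\<lambda>v. bil g v Z / bil g (cj Z) Z)"
  define p where "p = (\<lambda>v. v - l v *s cj Z)"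
  have pZ: "bil g (p v) Z = 0" for v
    using nz[OF Z] by (simp add: p_def l_def bil_lin)
  \<comment> \<open>Slots before \<open>r\<close> are projected, those behind are not. The
    denominator combines the normalisation in \<open>l\<close> with the 2 in the differential of <Z,
    Z>.\<close>
  define H where "H = (\<lambda>r I. ev T (map p (take r (map (\<lambda>i. axis i 1) I)) @ cj Z #
     drop r (map (\<lambda>i. axis i 1) I)) / (2 * bil g (cj Z) Z))"
  have "F Z I - G Z I = (\<Sum>r<s. 2 * bil g (axis (I ! r) 1) Z * H r (take r I @ drop (Suc r) I))"
    if I: "length I = s" for I
  proof -
    let ?vs = "map (\<lambda>i. axis i 1) I :: (complex^'a) list"
    have "F Z I - G Z I = ev T ?vs" by (simp add: ev_axis T_def)
    also have "\<dots> = ev T (map p ?vs) +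
      (\<Sum>r<length ?vs. l (?vs ! r) * ev T (map p (take r ?vs) @ cj Z # drop (Suc r) ?vs))"
      by (rule ev_telescope) (simp add: p_def)
    also have "ev T (map p ?vs) = 0"
      using eq[OF Z, of "map p ?vs"] I by (simp add: T_def ev_diff pZ)
    also have "(\<Sum>r<length ?vs. l (?vs ! r) * ev T (map p (take r ?vs) @ cj Z # drop (Suc r) ?vs)) =
      (\<Sum>r<s. 2 * bil g (axis (I ! r) 1) Z * H r (take r I @ drop (Suc r) I))"
    proof (intro sum.cong)
      fix r assume "r \<in> {..<s}"
      then show "l (?vs ! r) * ev T (map p (take r ?vs) @ cj Z # drop (Suc r) ?vs) =
        2 * bil g (axis (I ! r) 1) Z * H r (take r I @ drop (Suc r) I)"
        using I by (simp add: H_def l_def min_def take_map drop_map)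
    qed (simp add: I)
    finally show ?thesis by simp
  qed
  then show "\<exists>H. \<forall>I. length I = s \<longrightarrow> F Z I - G Z I =
     (\<Sum>r<s. 2 * bil g (axis (I ! r) 1) Z * H r (take r I @ drop (Suc r) I))"
    by blast
qed

section \<open>Wirtinger calculus\<close>

lemma has_derivative_cong_ev:
  assumes "eventually (\<lambda>W. f W = g W) (nhds Z)"
  shows "(f has_derivative D) (at Z) \<longleftrightarrow> (g has_derivative D) (at Z)"
proof -
  have eq: "f Z = g Z" using assms by (rule eventually_nhds_x_imp_x)
  show ?thesis
  proof
    assume "(f has_derivative D) (at Z)"
    then show "(g has_derivative D) (at Z)"
      by (rule has_derivative_transform_eventually[of f D Z UNIV g, OF _ _ eq])
        (use assms in \<open>auto simp: eventually_at_filter elim: eventually_mono\<close>)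
  next
    assume "(g has_derivative D) (at Z)"
    then show "(f has_derivative D) (at Z)"
      by (rule has_derivative_transform_eventually[of g D Z UNIV f, OF _ _ eq[symmetric]])
        (use assms in \<open>auto simp: eventually_at_filter elim: eventually_mono\<close>)
  qed
qed

lemma frechet_derivative_cong_ev:
  "eventually (\<lambda>W. f W = g W) (nhds Z) \<Longrightarrow> frechet_derivative f (at Z) = frechet_derivative g (at Z)"
  by (simp add: frechet_derivative_def has_derivative_cong_ev)

lemma differentiable_cong_ev:
  "eventually (\<lambda>W. f W = g W) (nhds Z) \<Longrightarrow> f differentiable (at Z) \<longleftrightarrow> g differentiable (at Z)"
  by (simp add: differentiable_def has_derivative_cong_ev)

lemma dee_has_derivative:
  "(f has_derivative f') (at Z) \<Longrightarrow> dee f v Z = (f' v - \<i> * f' (\<i> *s v)) / 2"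
  using frechet_derivative_at[of f f' Z] by (simp add: dee_def)

lemma deebar_has_derivative:
  "(f has_derivative f') (at Z) \<Longrightarrow> deebar f v Z = (f' v + \<i> * f' (\<i> *s v)) / 2"
  using frechet_derivative_at[of f f' Z] by (simp add: deebar_def)

text \<open>The rules common to \<open>dee\<close> and \<open>deebar\<close> in a fixed direction,
  so that the calculus is developed once for both. Axiom \<open>cong\<close> allows functions that
  agree only near \<open>Z\<close>, as the formulas for \<open>nu\<close> and the projections hold
  only where the norm is positive.\<close>

locale derivation_at =
  fixes Z :: "complex^'m" and \<delta> :: "(complex^'m \<Rightarrow> complex) \<Rightarrow> complex"
  assumes add: "\<And>f g. f differentiable (at Z) \<Longrightarrow> g differentiable (at Z) \<Longrightarrow>
      \<delta> (\<lambda>W. f W + g W) = \<delta> f + \<delta> g"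
    and mult: "\<And>f g. f differentiable (at Z) \<Longrightarrow> g differentiable (at Z) \<Longrightarrow>
      \<delta> (\<lambda>W. f W * g W) = f Z * \<delta> g + \<delta> f * g Z"
    and const [simp]: "\<And>c. \<delta> (\<lambda>W. c) = 0"
    and cong: "\<And>f g. eventually (\<lambda>W. f W = g W) (nhds Z) \<Longrightarrow> \<delta> f = \<delta> g"

lemma derivation_at_dee: "derivation_at Z (\<lambda>f. dee f v Z)"
proof
  fix f g :: "complex^'a \<Rightarrow> complex"
  assume "f differentiable (at Z)" "g differentiable (at Z)"
  then obtain f' g' where d: "(f has_derivative f') (at Z)" "(g has_derivative g') (at Z)"
    by (auto simp: differentiable_def)
  show "dee (\<lambda>W. f W + g W) v Z = dee f v Z + dee g v Z"
    using d by (simp add: dee_has_derivative[OF has_derivative_add[OF d]] dee_has_derivative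
        add_divide_distrib diff_divide_distrib algebra_simps)
  show "dee (\<lambda>W. f W * g W) v Z = f Z * dee g v Z + dee f v Z * g Z"
    using d by (simp add: dee_has_derivative[OF has_derivative_mult[OF d]] dee_has_derivative
        add_divide_distrib diff_divide_distrib algebra_simps)
next
  show "dee (\<lambda>W. c) v Z = 0" for c by (simp add: dee_def)
next
  fix f g :: "complex^'a \<Rightarrow> complex"
  assume "eventually (\<lambda>W. f W = g W) (nhds Z)"
  then show "dee f v Z = dee g v Z" by (simp add: dee_def frechet_derivative_cong_ev)
qed

lemma derivation_at_deebar: "derivation_at Z (\<lambda>f. deebar f v Z)"
proof
  fix f g :: "complex^'a \<Rightarrow> complex"
  assume "f differentiable (at Z)" "g differentiable (at Z)"
  then obtain f' g' where d: "(f has_derivative f') (at Z)" "(g has_derivative g') (at Z)"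
    by (auto simp: differentiable_def)
  show "deebar (\<lambda>W. f W + g W) v Z = deebar f v Z + deebar g v Z"
    using d by (simp add: deebar_has_derivative[OF has_derivative_add[OF d]] deebar_has_derivative
        add_divide_distrib diff_divide_distrib algebra_simps)
  show "deebar (\<lambda>W. f W * g W) v Z = f Z * deebar g v Z + deebar f v Z * g Z"
    using d by (simp add: deebar_has_derivative[OF has_derivative_mult[OF d]] deebar_has_derivative
        add_divide_distrib diff_divide_distrib algebra_simps)
next
  show "deebar (\<lambda>W. c) v Z = 0" for c by (simp add: deebar_def)
next
  fix f g :: "complex^'a \<Rightarrow> complex"
  assume "eventually (\<lambda>W. f W = g W) (nhds Z)"
  then show "deebar f v Z = deebar g v Z" by (simp add: deebar_def frechet_derivative_cong_ev)
qed

definition vdiff :: "complex^'m \<Rightarrow> (complex^'m \<Rightarrow> complex^'m) \<Rightarrow> bool" where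
  "vdiff Z x \<longleftrightarrow> (\<forall>i. (\<lambda>W. x W $ i) differentiable (at Z))"

lemma diff_nth [simp, intro]: "(\<lambda>W::complex^'m. W $ i) differentiable (at Z)"
  by (intro bounded_linear_imp_differentiable bounded_linear_vec_nth)

lemma diff_cnj_nth [simp, intro]: "(\<lambda>W::complex^'m. cnj (W $ i)) differentiable (at Z)"
  by (intro bounded_linear_imp_differentiable bounded_linear_compose[OF bounded_linear_cnj]
      bounded_linear_vec_nth)

lemma vdiff_id [simp]: "vdiff Z (\<lambda>W. W)"
  by (simp add: vdiff_def)

lemma vdiff_cj [simp]: "vdiff Z cj"
  by (simp add: vdiff_def)

lemma vdiff_const [simp]: "vdiff Z (\<lambda>W. c)"
  by (simp add: vdiff_def)

lemma vdiff_scale: "a differentiable (at Z) \<Longrightarrow> vdiff Z x \<Longrightarrow> vdiff Z (\<lambda>W. a W *s x W)"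
  by (auto simp: vdiff_def intro: differentiable_mult)

lemma vdiff_diff: "vdiff Z x \<Longrightarrow> vdiff Z y \<Longrightarrow> vdiff Z (\<lambda>W. x W - y W)"
  by (auto simp: vdiff_def)

lemma diff_sum:
  fixes f :: "'i \<Rightarrow> 'a::real_normed_vector \<Rightarrow> 'b::real_normed_vector"
  shows "(\<And>i. i \<in> S \<Longrightarrow> f i differentiable (at Z)) \<Longrightarrow> (\<lambda>W. \<Sum>i\<in>S. f i W) differentiable (at Z)"
  by (induction S rule: infinite_finite_induct) auto

lemma diff_bil:
  assumes "vdiff Z x" "vdiff Z y"
  shows "(\<lambda>W. bil g (x W) (y W)) differentiable (at Z)"
  using assms unfolding bil_def vdiff_def
  by (intro diff_sum differentiable_mult) auto

lemma diff_ev: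
  assumes "\<And>I. length I = length xs \<Longrightarrow> (\<lambda>W. F W I) differentiable (at Z)"
    and "\<And>x. x \<in> set xs \<Longrightarrow> vdiff Z x"
  shows "(\<lambda>W. ev (F W) (map (\<lambda>x. x W) xs)) differentiable (at Z)"
  using assms
proof (induction xs arbitrary: F)
  case (Cons x xs)
  have "(\<lambda>W. ev (\<lambda>I. F W (i # I)) (map (\<lambda>x. x W) xs)) differentiable (at Z)" for i
    using Cons.prems by (intro Cons.IH) auto
  then show ?case
    using Cons.prems(2)[of x] by (auto simp: vdiff_def intro!: diff_sum differentiable_mult)
qed simp

lemma diff_powi:
  fixes f :: "'a::real_normed_vector \<Rightarrow> complex"
  assumes "f differentiable (at Z)" "f Z \<noteq> 0"
  shows "(\<lambda>W. f W powi k) differentiable (at Z)"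
  using assms by (cases "k \<ge> 0") (simp_all add: power_int_def differentiable_power differentiable_inverse)

context derivation_at
begin

definition \<delta>v :: "(complex^'m \<Rightarrow> complex^'m) \<Rightarrow> complex^'m" where
  "\<delta>v x = (\<chi> i. \<delta> (\<lambda>W. x W $ i))"

lemma cmult: "f differentiable (at Z) \<Longrightarrow> \<delta> (\<lambda>W. c * f W) = c * \<delta> f"
  using mult[of "\<lambda>W. c" f] by simp

lemma sum: "(\<And>i. i \<in> S \<Longrightarrow> f i differentiable (at Z)) \<Longrightarrow> \<delta> (\<lambda>W. \<Sum>i\<in>S. f i W) = (\<Sum>i\<in>S. \<delta> (f i))"
  by (induction S rule: infinite_finite_induct) (auto simp: add diff_sum)

lemma minus: "f differentiable (at Z) \<Longrightarrow> \<delta> (\<lambda>W. - f W) = - \<delta> f"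
  using cmult[of f "-1"] by simp

lemma diff: "f differentiable (at Z) \<Longrightarrow> g differentiable (at Z) \<Longrightarrow> \<delta> (\<lambda>W. f W - g W) = \<delta> f - \<delta> g"
  using add[of f "\<lambda>W. - g W"] by (simp add: minus)

text \<open>By the product rule for \<open>f\<close> times its inverse, which is constant near
  \<open>Z\<close>.\<close>

lemma inverse:
  assumes f: "f differentiable (at Z)" "f Z \<noteq> 0"
  shows "\<delta> (\<lambda>W. inverse (f W)) = - \<delta> f / (f Z)\<^sup>2"
proof -
  have "isCont f Z" using f(1) by (simp add: differentiable_imp_continuous_within)
  then have "eventually (\<lambda>W. f W \<noteq> 0) (nhds Z)"
    using f(2) tendsto_imp_eventually_ne[of f "f Z" "at Z" 0]
    by (simp add: eventually_nhds_conv_at isCont_def)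
  then have "eventually (\<lambda>W. f W * inverse (f W) = 1) (nhds Z)"
    by (rule eventually_mono) simp
  then have "\<delta> (\<lambda>W. f W * inverse (f W)) = 0"
    using cong[of "\<lambda>W. f W * inverse (f W)" "\<lambda>W. 1"] by simp
  then have "f Z * \<delta> (\<lambda>W. inverse (f W)) + \<delta> f * inverse (f Z) = 0"
    using mult[OF f(1) differentiable_inverse[OF f]] by simp
  then have "f Z * (f Z * \<delta> (\<lambda>W. inverse (f W)) + \<delta> f * inverse (f Z)) = 0" by simp
  then have "(f Z)\<^sup>2 * \<delta> (\<lambda>W. inverse (f W)) = - \<delta> f"
    using f(2) right_inverse[OF f(2)]
    by (simp add: distrib_left power2_eq_square eq_neg_iff_add_eq_0 mult.assoc mult.left_commute[of "f Z" "\<delta> f"])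
  then have "\<delta> (\<lambda>W. inverse (f W)) = (- \<delta> f) / (f Z)\<^sup>2"
    using f(2) by (simp only: nonzero_eq_divide_eq mult.commute power_not_zero not_False_eq_True)
  then show ?thesis by simp
qed

lemma divide:
  assumes "f differentiable (at Z)" "g differentiable (at Z)" "g Z \<noteq> 0"
  shows "\<delta> (\<lambda>W. f W / g W) = \<delta> f / g Z - f Z * \<delta> g / (g Z)\<^sup>2"
  using mult[OF assms(1) differentiable_inverse[OF assms(2,3)]] inverse[OF assms(2,3)] assms(3)
  by (simp add: divide_inverse)

text \<open>Multiplication by \<open>f Z\<close> avoids the exponent \<open>n - 1\<close>, and with
  it a case distinction at 0.\<close>

lemma power:
  assumes "f differentiable (at Z)"
  shows "f Z * \<delta> (\<lambda>W. f W ^ n) = of_nat n * f Z ^ n * \<delta> f"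
proof (induction n)
  case (Suc n)
  have "f Z * \<delta> (\<lambda>W. f W ^ Suc n) = f Z * (f Z * \<delta> (\<lambda>W. f W ^ n) + \<delta> f * f Z ^ n)"
    using mult[OF assms differentiable_power[OF assms, of n]] by simp
  also have "\<dots> = f Z * (of_nat n * f Z ^ n * \<delta> f + \<delta> f * f Z ^ n)"
    by (simp only: Suc)
  finally show ?case by (simp add: algebra_simps)
qed simp

lemma powi:
  assumes f: "f differentiable (at Z)" "f Z \<noteq> 0"
  shows "\<delta> (\<lambda>W. f W powi k) = of_int k * f Z powi k * \<delta> f / f Z"
proof (cases "k \<ge> 0")
  case True
  then have "\<delta> (\<lambda>W. f W powi k) = \<delta> (\<lambda>W. f W ^ nat k)" by (simp add: power_int_def)
  also have "\<dots> = of_int k * f Z powi k * \<delta> f / f Z"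
    using power[OF f(1), of "nat k"] True f(2)
    by (simp add: power_int_def of_nat_nat nonzero_eq_divide_eq mult.commute)
  finally show ?thesis .
next
  case False
  define n where "n = nat (- k)"
  have k: "of_int k = - (of_nat n :: complex)" using False by (simp add: n_def of_nat_nat)
  have "\<delta> (\<lambda>W. f W powi k) = \<delta> (\<lambda>W. inverse (f W ^ n))"
    using False by (simp add: power_int_def n_def power_inverse)
  also have "\<dots> = - \<delta> (\<lambda>W. f W ^ n) / (f Z ^ n)\<^sup>2"
    using f by (intro inverse differentiable_power) auto
  also have "\<delta> (\<lambda>W. f W ^ n) = of_nat n * f Z ^ n * \<delta> f / f Z"
    using power[OF f(1), of n] f(2) by (simp add: field_simps)
  also have "- \<dots> / (f Z ^ n)\<^sup>2 = of_int k * inverse (f Z ^ n) * \<delta> f / f Z"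
    using f(2) by (simp add: k field_simps power2_eq_square)
  also have "inverse (f Z ^ n) = f Z powi k"
    using False by (simp add: power_int_def n_def power_inverse)
  finally show ?thesis .
qed

lemma \<delta>v_const [simp]: "\<delta>v (\<lambda>W. c) = 0"
  by (simp add: \<delta>v_def vec_eq_iff)

lemma \<delta>v_diff: "vdiff Z x \<Longrightarrow> vdiff Z y \<Longrightarrow> \<delta>v (\<lambda>W. x W - y W) = \<delta>v x - \<delta>v y"
  by (simp add: \<delta>v_def vec_eq_iff vdiff_def diff)

lemma \<delta>v_scale: "a differentiable (at Z) \<Longrightarrow> vdiff Z x \<Longrightarrow>
    \<delta>v (\<lambda>W. a W *s x W) = a Z *s \<delta>v x + \<delta> a *s x Z"
  by (simp add: \<delta>v_def vec_eq_iff vdiff_def mult)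

lemma bil:
  assumes "vdiff Z x" "vdiff Z y"
  shows "\<delta> (\<lambda>W. bil g (x W) (y W)) = bil g (x Z) (\<delta>v y) + bil g (\<delta>v x) (y Z)"
proof -
  have d: "(\<lambda>W. x W $ a) differentiable (at Z)" "(\<lambda>W. y W $ a) differentiable (at Z)" for a
    using assms by (auto simp: vdiff_def)
  show ?thesis
    using d unfolding bil_def
    by (simp add: sum diff_sum mult differentiable_mult \<delta>v_def sum.distrib[symmetric] algebra_simps)
qed

text \<open>The calculus of moving frames: \<open>ev\<close> is linear in the coefficients and in
  every argument, so each of them contributes one term.\<close>

lemma ev_map:
  assumes "\<And>I. length I = length xs \<Longrightarrow> (\<lambda>W. F W I) differentiable (at Z)"
    and "\<And>x. x \<in> set xs \<Longrightarrow> vdiff Z x"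
  shows "\<delta> (\<lambda>W. ev (F W) (map (\<lambda>x. x W) xs)) =
    ev (\<lambda>I. \<delta> (\<lambda>W. F W I)) (map (\<lambda>x. x Z) xs) +
    (\<Sum>r<length xs. ev (F Z) ((map (\<lambda>x. x Z) xs)[r := \<delta>v (xs ! r)]))"
  using assms
proof (induction xs arbitrary: F)
  case (Cons x xs)
  let ?e = "\<lambda>i W. ev (\<lambda>I. F W (i # I)) (map (\<lambda>x. x W) xs)"
  have x: "(\<lambda>W. x W $ i) differentiable (at Z)" for i
    using Cons.prems(2)[of x] by (simp add: vdiff_def)
  have e: "?e i differentiable (at Z)" for i
    using Cons.prems by (intro diff_ev) auto
  have "\<delta> (\<lambda>W. ev (F W) (map (\<lambda>x. x W) (x # xs))) =
      (\<Sum>i\<in>UNIV. x Z $ i * \<delta> (?e i) + \<delta>v x $ i * ?e i Z)"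
    using x e by (simp add: sum mult differentiable_mult \<delta>v_def)
  also have "\<dots> = (\<Sum>i\<in>UNIV. x Z $ i * (ev (\<lambda>I. \<delta> (\<lambda>W. F W (i # I))) (map (\<lambda>x. x Z) xs) +
     (\<Sum>r<length xs. ev (\<lambda>I. F Z (i # I)) ((map (\<lambda>x. x Z) xs)[r := \<delta>v (xs ! r)])))) +
     (\<Sum>i\<in>UNIV. \<delta>v x $ i * ?e i Z)"
    unfolding sum.distrib
    by (intro arg_cong2[where f = "(+)"] sum.cong refl arg_cong2[where f = "(*)"] Cons.IH)
      (use Cons.prems in auto)
  also have "\<dots> = (\<Sum>i\<in>UNIV. x Z $ i * ev (\<lambda>I. \<delta> (\<lambda>W. F W (i # I))) (map (\<lambda>x. x Z) xs)) +
     (\<Sum>r<length xs. \<Sum>i\<in>UNIV. x Z $ i *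
       ev (\<lambda>I. F Z (i # I)) ((map (\<lambda>x. x Z) xs)[r := \<delta>v (xs ! r)])) +
     (\<Sum>i\<in>UNIV. \<delta>v x $ i * ?e i Z)"
    by (simp add: distrib_left sum.distrib sum_distrib_left) (rule sum.swap)
  finally show ?case
    by (simp only: length_Cons sum.lessThan_Suc_shift) simp
qed simp

lemma ev_const:
  assumes "\<And>I. length I = length vs \<Longrightarrow> (\<lambda>W. F W I) differentiable (at Z)"
  shows "\<delta> (\<lambda>W. ev (F W) (vs :: (complex^'m) list)) = ev (\<lambda>I. \<delta> (\<lambda>W. F W I)) vs"
proof -
  have m: "map ((\<lambda>x. x W) \<circ> (\<lambda>v W. v)) vs = vs" for W :: "complex^'m"
    by (induction vs) auto
  let ?xs = "map (\<lambda>v W. v) vs :: (complex^'m \<Rightarrow> complex^'m) list"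
  have "\<delta> (\<lambda>W. ev (F W) (map (\<lambda>x. x W) ?xs)) =
    ev (\<lambda>I. \<delta> (\<lambda>W. F W I)) (map (\<lambda>x. x Z) ?xs) +
    (\<Sum>r<length ?xs. ev (F Z) ((map (\<lambda>x. x Z) ?xs)[r := \<delta>v (?xs ! r)]))"
    by (rule ev_map) (use assms in auto)
  then show ?thesis by (simp add: m ev_upd_zero)
qed

end

text \<open>Complex linearity of the inner derivative keeps the holomorphic and the antiholomorphic
  part apart; otherwise each would contribute to both.\<close>

lemma dee_chain:
  assumes B: "(B has_derivative B') (at Z)" and lin: "\<And>v. B' (\<i> *s v) = \<i> *s B' v"
    and f: "f differentiable (at (B Z))"
  shows "dee (\<lambda>W. f (B W)) v Z = dee f (B' v) (B Z)"
    and "deebar (\<lambda>W. f (B W)) v Z = deebar f (B' v) (B Z)"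
proof -
  obtain f' where f': "(f has_derivative f') (at (B Z))" using f by (auto simp: differentiable_def)
  have c: "((\<lambda>W. f (B W)) has_derivative (\<lambda>v. f' (B' v))) (at Z)"
    using B f' by (rule has_derivative_compose)
  show "dee (\<lambda>W. f (B W)) v Z = dee f (B' v) (B Z)"
    "deebar (\<lambda>W. f (B W)) v Z = deebar f (B' v) (B Z)"
    by (simp_all add: dee_has_derivative[OF c] dee_has_derivative[OF f'] deebar_has_derivative[OF c]
        deebar_has_derivative[OF f'] lin)
qed

lemma dee_dir:
  assumes f: "f differentiable (at Z)"
  shows "dee f (u + v) Z = dee f u Z + dee f v Z" "dee f (c *s v) Z = c * dee f v Z"
    "deebar f (u + v) Z = deebar f u Z + deebar f v Z" "deebar f (c *s v) Z = cnj c * deebar f v Z"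
proof -
  obtain f' where f': "(f has_derivative f') (at Z)" using f by (auto simp: differentiable_def)
  have lin: "linear f'" using f' by (rule has_derivative_linear)
  note [simp] = dee_has_derivative[OF f'] deebar_has_derivative[OF f'] linear_add[OF lin]
  \<comment> \<open>The differential is only real linear, so \<open>c *s v\<close> is decomposed in
    the real span of \<open>v\<close> and \<i> times \<open>v\<close>.\<close>
  have sc: "f' (c *s v) = Re c * f' v + Im c * f' (\<i> *s v)" for c :: complex and v
  proof -
    have "c *s v = Re c *\<^sub>R v + Im c *\<^sub>R (\<i> *s v)"
      by (simp add: vec_eq_iff complex_eq_iff)
    then have "f' (c *s v) = Re c *\<^sub>R f' v + Im c *\<^sub>R f' (\<i> *s v)"
      by (simp only: linear_add[OF lin] linear_scale[OF lin])
    then show ?thesis by (simp add: scaleR_conv_of_real)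
  qed
  have ii: "f' ((\<i> * c) *s v) = Re c * f' (\<i> *s v) - Im c * f' v"
    using sc[of "\<i> * c" v] by simp
  show "dee f (u + v) Z = dee f u Z + dee f v Z" "deebar f (u + v) Z = deebar f u Z + deebar f v Z"
    by (simp_all add: vector_add_ldistrib algebra_simps add_divide_distrib diff_divide_distrib)
  have c: "c = of_real (Re c) + \<i> * of_real (Im c)" by (rule complex_eq)
  have cc: "cnj c = of_real (Re c) - \<i> * of_real (Im c)" by (simp add: complex_eq_iff)
  show "dee f (c *s v) Z = c * dee f v Z"
    by (subst (2) c) (simp add: ii sc[of c v] algebra_simps add_divide_distrib diff_divide_distrib)
  show "deebar f (c *s v) Z = cnj c * deebar f v Z"
    by (subst cc) (simp add: ii sc[of c v] algebra_simps add_divide_distrib diff_divide_distrib)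
qed

lemma dee_dir_sum:
  assumes f: "f differentiable (at Z)" and "finite S"
  shows "dee f (\<Sum>i\<in>S. u i) Z = (\<Sum>i\<in>S. dee f (u i) Z)" "deebar f (\<Sum>i\<in>S. u i) Z = (\<Sum>i\<in>S. deebar f (u i) Z)"
proof -
  have z: "dee f 0 Z = 0" "deebar f 0 Z = 0"
    using dee_dir(2)[OF f, of 0 0] dee_dir(4)[OF f, of 0 0] by simp_all
  show "dee f (\<Sum>i\<in>S. u i) Z = (\<Sum>i\<in>S. dee f (u i) Z)" "deebar f (\<Sum>i\<in>S. u i) Z = (\<Sum>i\<in>S. deebar f (u i) Z)"
    using \<open>finite S\<close> by (induction S) (auto simp: z dee_dir[OF f])
qed

text \<open>Since \<open>deebar\<close> is conjugate linear in its direction, the coefficients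
  \<open>v $ l\<close> belong to the direction \<open>cj v\<close>. This is the source of all the
  conjugates in the formulas for \<open>lower\<close>.\<close>

lemma dee_expand:
  assumes f: "f differentiable (at Z)"
  shows "(\<Sum>l\<in>UNIV. v $ l * dee f (axis l 1) Z) = dee f v Z"
    and "(\<Sum>l\<in>UNIV. v $ l * deebar f (axis l 1) Z) = deebar f (cj v) Z"
proof -
  have "dee f (\<Sum>i\<in>UNIV. v $ i *s axis i 1) Z = (\<Sum>l\<in>UNIV. v $ l * dee f (axis l 1) Z)"
    by (simp add: dee_dir_sum[OF f] dee_dir[OF f])
  then show "(\<Sum>l\<in>UNIV. v $ l * dee f (axis l 1) Z) = dee f v Z"
    using vec_axis_expand[of v] by simp
  have "deebar f (\<Sum>i\<in>UNIV. cj v $ i *s axis i 1) Z = (\<Sum>l\<in>UNIV. v $ l * deebar f (axis l 1) Z)"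
    by (simp add: dee_dir_sum[OF f] dee_dir[OF f])
  then show "(\<Sum>l\<in>UNIV. v $ l * deebar f (axis l 1) Z) = deebar f (cj v) Z"
    using vec_axis_expand[of "cj v"] by simp
qed

lemma dee_coord [simp]: "dee (\<lambda>W. W $ i) v Z = v $ i" "deebar (\<lambda>W. W $ i) v Z = 0"
  "dee (\<lambda>W. cnj (W $ i)) v Z = 0" "deebar (\<lambda>W. cnj (W $ i)) v Z = cnj (v $ i)"
proof -
  have 1: "((\<lambda>W::complex^'a. W $ i) has_derivative (\<lambda>W. W $ i)) (at Z)"
    by (intro bounded_linear_imp_has_derivative bounded_linear_vec_nth)
  have 2: "((\<lambda>W::complex^'a. cnj (W $ i)) has_derivative (\<lambda>W. cnj (W $ i))) (at Z)"
    by (intro bounded_linear_imp_has_derivative bounded_linear_compose[OF bounded_linear_cnj]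
      bounded_linear_vec_nth)
  show "dee (\<lambda>W. W $ i) v Z = v $ i" "deebar (\<lambda>W. W $ i) v Z = 0"
    "dee (\<lambda>W. cnj (W $ i)) v Z = 0" "deebar (\<lambda>W. cnj (W $ i)) v Z = cnj (v $ i)"
    by (simp_all add: dee_has_derivative[OF 1] deebar_has_derivative[OF 1] dee_has_derivative[OF 2]
        deebar_has_derivative[OF 2])
qed

interpretation dee: derivation_at Z "\<lambda>f. dee f v Z" for Z v
  by (rule derivation_at_dee)

interpretation deebar: derivation_at Z "\<lambda>f. deebar f v Z" for Z v
  by (rule derivation_at_deebar)

lemma dee_\<delta>v_id [simp]: "dee.\<delta>v v Z (\<lambda>W. W) = v" "dee.\<delta>v v Z cj = 0"
  "deebar.\<delta>v v Z (\<lambda>W. W) = 0" "deebar.\<delta>v v Z cj = cj v"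
  by (simp_all add: dee.\<delta>v_def deebar.\<delta>v_def vec_eq_iff)

section \<open>Smooth functions\<close>

text \<open>Derivatives at points of an open set see only the values there. This is needed in every
  induction on \<open>k\<close> below, as the differentiation rules hold only at points of
  \<open>U\<close>.\<close>

lemma Ck_on_cong:
  assumes "open U" "\<And>x. x \<in> U \<Longrightarrow> f x = g x"
  shows "Ck_on k U f \<longleftrightarrow> Ck_on k U g"
  using assms(2)
proof (induction k arbitrary: f g)
  case 0
  then show ?case using continuous_on_cong[of U U f g] by simp
next
  case (Suc k)
  have ev: "eventually (\<lambda>y. f y = g y) (nhds x)" if "x \<in> U" for x
    using assms(1) Suc.prems that by (auto simp: eventually_nhds)
  have fr: "frechet_derivative f (at x) = frechet_derivative g (at x)" if "x \<in> U" for x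
    using ev[OF that] by (rule frechet_derivative_cong_ev)
  have diff: "f differentiable (at x) \<longleftrightarrow> g differentiable (at x)" if "x \<in> U" for x
    using ev[OF that] by (rule differentiable_cong_ev)
  have "Ck_on k U (\<lambda>x. frechet_derivative f (at x) v) \<longleftrightarrow> Ck_on k U (\<lambda>x. frechet_derivative g (at x) v)" for v
    by (rule Suc.IH) (simp add: fr)
  with diff show ?case by simp
qed

lemma Ck_on_subset: "Ck_on k U f \<Longrightarrow> V \<subseteq> U \<Longrightarrow> Ck_on k V f"
  by (induction k arbitrary: f) (auto intro: continuous_on_subset)

lemma Ck_on_Suc_imp: "Ck_on (Suc k) U f \<Longrightarrow> Ck_on k U f"
proof (induction k arbitrary: f)
  case 0
  then show ?case
    by (simp add: continuous_at_imp_continuous_on differentiable_imp_continuous_within)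
next
  case (Suc k)
  have "Ck_on (Suc k) U (\<lambda>x. frechet_derivative f (at x) v)" for v
    using Suc.prems by (subst (asm) Ck_on.simps(2)) blast
  then have "Ck_on k U (\<lambda>x. frechet_derivative f (at x) v)" for v
    by (rule Suc.IH)
  moreover have "\<forall>x\<in>U. f differentiable (at x)"
    using Suc.prems by (subst (asm) Ck_on.simps(2)) blast
  ultimately show ?case by simp
qed

lemma Ck_on_const: "Ck_on k U (\<lambda>x. c)"
  by (induction k arbitrary: c) auto

lemma Ck_on_add:
  assumes "open U"
  shows "Ck_on k U f \<Longrightarrow> Ck_on k U g \<Longrightarrow> Ck_on k U (\<lambda>x. f x + g x)"
proof (induction k arbitrary: f g)
  case (Suc k)
  have "Ck_on k U (\<lambda>x. frechet_derivative (\<lambda>x. f x + g x) (at x) v)" for v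
  proof (subst Ck_on_cong[OF assms])
    fix x assume "x \<in> U"
    then have *: "(f has_derivative frechet_derivative f (at x)) (at x)"
      "(g has_derivative frechet_derivative g (at x)) (at x)"
      using Suc.prems by (auto simp: frechet_derivative_works)
    then show "frechet_derivative (\<lambda>x. f x + g x) (at x) v =
      frechet_derivative f (at x) v + frechet_derivative g (at x) v"
      by (simp only: frechet_derivative_at[OF has_derivative_add[OF *], symmetric])
  qed (use Suc in auto)
  then show ?case using Suc.prems by auto
qed (auto intro: continuous_intros)

lemma Ck_on_mult:
  fixes f g :: "'a::real_normed_vector \<Rightarrow> 'b::real_normed_algebra"
  assumes "open U"
  shows "Ck_on k U f \<Longrightarrow> Ck_on k U g \<Longrightarrow> Ck_on k U (\<lambda>x. f x * g x)"
proof (induction k arbitrary: f g)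
  case (Suc k)
  have lower: "Ck_on k U f" "Ck_on k U g" using Suc.prems Ck_on_Suc_imp by blast+
  have "Ck_on k U (\<lambda>x. frechet_derivative (\<lambda>x. f x * g x) (at x) v)" for v
  proof (subst Ck_on_cong[OF assms])
    fix x assume "x \<in> U"
    then have *: "(f has_derivative frechet_derivative f (at x)) (at x)"
      "(g has_derivative frechet_derivative g (at x)) (at x)"
      using Suc.prems by (auto simp: frechet_derivative_works)
    then show "frechet_derivative (\<lambda>x. f x * g x) (at x) v =
      f x * frechet_derivative g (at x) v + frechet_derivative f (at x) v * g x"
      by (simp only: frechet_derivative_at[OF has_derivative_mult[OF *], symmetric])
  next
    show "Ck_on k U (\<lambda>x. f x * frechet_derivative g (at x) v + frechet_derivative f (at x) v * g x)"
      using Suc.prems lower by (intro Ck_on_add assms Suc.IH) auto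
  qed
  then show ?case using Suc.prems by auto
qed (auto intro: continuous_intros)

text \<open>The derivative is expressed through the inverse itself and not through a quotient, so
  the induction hypothesis and the product rule apply to it.\<close>

lemma Ck_on_inverse:
  fixes f :: "'a::real_normed_vector \<Rightarrow> 'b::real_normed_field"
  assumes "open U" and nz: "\<And>x. x \<in> U \<Longrightarrow> f x \<noteq> 0"
  shows "Ck_on k U f \<Longrightarrow> Ck_on k U (\<lambda>x. inverse (f x))"
proof (induction k)
  case (Suc k)
  have lower: "Ck_on k U f" using Suc.prems Ck_on_Suc_imp by blast
  have "Ck_on k U (\<lambda>x. frechet_derivative (\<lambda>x. inverse (f x)) (at x) v)" for v
  proof (subst Ck_on_cong[OF assms(1)])
    fix x assume "x \<in> U"
    then have *: "(f has_derivative frechet_derivative f (at x)) (at x)"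
      using Suc.prems by (auto simp: frechet_derivative_works)
    show "frechet_derivative (\<lambda>x. inverse (f x)) (at x) v =
      (- 1) * (inverse (f x) * frechet_derivative f (at x) v * inverse (f x))"
      by (simp add: frechet_derivative_at[OF Deriv.has_derivative_inverse[OF nz[OF \<open>x \<in> U\<close>] *], symmetric])
  next
    show "Ck_on k U (\<lambda>x. (- 1) * (inverse (f x) * frechet_derivative f (at x) v * inverse (f x)))"
      using Suc lower by (intro Ck_on_mult assms Suc.IH Ck_on_const) auto
  qed
  then show ?case using Suc.prems nz by (auto intro: differentiable_inverse)
qed (auto intro!: continuous_intros nz)

lemma smooth_on_cong:
  "open U \<Longrightarrow> (\<And>x. x \<in> U \<Longrightarrow> f x = g x) \<Longrightarrow> smooth_on U f \<longleftrightarrow> smooth_on U g"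
  by (simp add: smooth_on_def Ck_on_cong[of U f g])

lemma smooth_on_subset: "smooth_on U f \<Longrightarrow> V \<subseteq> U \<Longrightarrow> smooth_on V f"
  by (auto simp: smooth_on_def intro: Ck_on_subset)

lemma smooth_on_const [simp]: "smooth_on U (\<lambda>x. c)"
  by (simp add: smooth_on_def Ck_on_const)

lemma smooth_on_add: "open U \<Longrightarrow> smooth_on U f \<Longrightarrow> smooth_on U g \<Longrightarrow> smooth_on U (\<lambda>x. f x + g x)"
  by (simp add: smooth_on_def Ck_on_add)

lemma smooth_on_mult:
  fixes f g :: "'a::real_normed_vector \<Rightarrow> 'b::real_normed_algebra"
  shows "open U \<Longrightarrow> smooth_on U f \<Longrightarrow> smooth_on U g \<Longrightarrow> smooth_on U (\<lambda>x. f x * g x)"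
  by (simp add: smooth_on_def Ck_on_mult)

lemma smooth_on_diff:
  fixes f g :: "'a::real_normed_vector \<Rightarrow> 'b::real_normed_algebra_1"
  assumes "open U" "smooth_on U f" "smooth_on U g"
  shows "smooth_on U (\<lambda>x. f x - g x)"
  using smooth_on_add[OF assms(1,2) smooth_on_mult[OF assms(1) smooth_on_const[of U "- 1"] assms(3)]]
  by simp

lemma smooth_on_inverse:
  fixes f :: "'a::real_normed_vector \<Rightarrow> 'b::real_normed_field"
  shows "open U \<Longrightarrow> (\<And>x. x \<in> U \<Longrightarrow> f x \<noteq> 0) \<Longrightarrow> smooth_on U f \<Longrightarrow> smooth_on U (\<lambda>x. inverse (f x))"
  by (simp add: smooth_on_def Ck_on_inverse)

lemma smooth_on_divide:
  fixes f :: "'a::real_normed_vector \<Rightarrow> 'b::real_normed_field"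
  shows "open U \<Longrightarrow> (\<And>x. x \<in> U \<Longrightarrow> g x \<noteq> 0) \<Longrightarrow> smooth_on U f \<Longrightarrow> smooth_on U g \<Longrightarrow>
    smooth_on U (\<lambda>x. f x / g x)"
  by (simp add: divide_inverse smooth_on_mult smooth_on_inverse)

lemma smooth_on_sum: "open U \<Longrightarrow> (\<And>i. i \<in> S \<Longrightarrow> smooth_on U (f i)) \<Longrightarrow> smooth_on U (\<lambda>x. \<Sum>i\<in>S. f i x)"
  by (induction S rule: infinite_finite_induct) (auto simp: smooth_on_add)

lemma smooth_on_power:
  fixes f :: "'a::real_normed_vector \<Rightarrow> 'b::real_normed_algebra_1"
  shows "open U \<Longrightarrow> smooth_on U f \<Longrightarrow> smooth_on U (\<lambda>x. f x ^ n)"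
  by (induction n) (auto simp: smooth_on_mult)

lemma smooth_on_powi:
  fixes f :: "'a::real_normed_vector \<Rightarrow> 'b::real_normed_field"
  assumes "open U" "\<And>x. x \<in> U \<Longrightarrow> f x \<noteq> 0" "smooth_on U f"
  shows "smooth_on U (\<lambda>x. f x powi k)"
  using assms by (cases "k \<ge> 0") (simp_all add: power_int_def smooth_on_power smooth_on_inverse)

lemma smooth_on_deriv: "smooth_on U f \<Longrightarrow> smooth_on U (\<lambda>x. frechet_derivative f (at x) v)"
  unfolding smooth_on_def using Ck_on.simps(2) by blast

lemma smooth_on_differentiable: "smooth_on U f \<Longrightarrow> x \<in> U \<Longrightarrow> f differentiable (at x)"
  unfolding smooth_on_def using Ck_on.simps(2) by blast

lemma smooth_on_continuous: "smooth_on U f \<Longrightarrow> continuous_on U f"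
  unfolding smooth_on_def using Ck_on.simps(1) by blast

lemma smooth_on_dee: "open U \<Longrightarrow> smooth_on U f \<Longrightarrow> smooth_on U (\<lambda>Z. dee f v Z)"
  unfolding dee_def by (intro smooth_on_divide smooth_on_diff smooth_on_mult smooth_on_deriv) auto

lemma smooth_on_deebar: "open U \<Longrightarrow> smooth_on U f \<Longrightarrow> smooth_on U (\<lambda>Z. deebar f v Z)"
  unfolding deebar_def by (intro smooth_on_divide smooth_on_add smooth_on_mult smooth_on_deriv) auto

lemma smooth_on_linear:
  assumes "bounded_linear f"
  shows "smooth_on U f"
proof -
  have "Ck_on k U f" for k
  proof (cases k)
    case 0
    then show ?thesis using assms by (simp add: linear_continuous_on)
  next
    case (Suc j)
    have "frechet_derivative f (at x) = f" for x
      using frechet_derivative_at[OF bounded_linear_imp_has_derivative[OF assms]] by simp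
    then show ?thesis
      using Suc assms by (simp add: bounded_linear_imp_differentiable Ck_on_const)
  qed
  then show ?thesis by (simp add: smooth_on_def)
qed

lemma smooth_on_coord [simp]: "smooth_on U (\<lambda>W::complex^'m. W $ i)"
  by (intro smooth_on_linear bounded_linear_vec_nth)

lemma smooth_on_cnj_coord [simp]: "smooth_on U (\<lambda>W::complex^'m. cnj (W $ i))"
  by (intro smooth_on_linear bounded_linear_compose[OF bounded_linear_cnj] bounded_linear_vec_nth)

lemma smooth_on_bil:
  "open U \<Longrightarrow> (\<And>i. smooth_on U (\<lambda>W. x W $ i)) \<Longrightarrow> (\<And>i. smooth_on U (\<lambda>W. y W $ i)) \<Longrightarrow>
   smooth_on U (\<lambda>W. bil g (x W :: complex^'m) (y W))"
  unfolding bil_def by (intro smooth_on_sum smooth_on_mult) auto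

lemma smooth_on_ev:
  assumes "open U" "\<And>I. length I = length xs \<Longrightarrow> smooth_on U (\<lambda>W. F W I)"
    and "\<And>x i. x \<in> set xs \<Longrightarrow> smooth_on U (\<lambda>W. x W $ i)"
  shows "smooth_on U (\<lambda>W. ev (F W) (map (\<lambda>x. x W) xs))"
  using assms(2,3)
proof (induction xs arbitrary: F)
  case (Cons x xs)
  have "smooth_on U (\<lambda>W. ev (\<lambda>I. F W (i # I)) (map (\<lambda>x. x W) xs))" for i
    using Cons.prems by (intro Cons.IH) auto
  then show ?case
    using Cons.prems(2)[of x] by (auto intro!: smooth_on_sum smooth_on_mult assms(1))
qed simp

section \<open>Symmetry of second derivatives\<close>

lemma has_real_derivative_line:
  fixes f :: "'a::real_normed_vector \<Rightarrow> real"
  assumes "f differentiable (at (p + s *\<^sub>R v))"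
  shows "((\<lambda>s. f (p + s *\<^sub>R v)) has_real_derivative frechet_derivative f (at (p + s *\<^sub>R v)) v) (at s)"
proof -
  let ?f' = "frechet_derivative f (at (p + s *\<^sub>R v))"
  have f: "(f has_derivative ?f') (at (p + s *\<^sub>R v))"
    using assms by (simp add: frechet_derivative_works)
  have "((\<lambda>s. p + s *\<^sub>R v) has_derivative (\<lambda>h. h *\<^sub>R v)) (at s)"
    by (auto intro!: derivative_eq_intros)
  from has_derivative_compose[OF this f]
  have "((\<lambda>s. f (p + s *\<^sub>R v)) has_derivative (\<lambda>h. ?f' (h *\<^sub>R v))) (at s)" .
  moreover have "?f' (h *\<^sub>R v) = ?f' v * h" for h
    using linear_scale[OF has_derivative_linear[OF f]] by simp
  ultimately show ?thesis by (simp add: has_field_derivative_def)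
qed

text \<open>The mean value theorem is used twice: along \<open>v\<close> for the increment in
  direction \<open>w\<close>, then along \<open>w\<close> for the derivative in direction
  \<open>v\<close>.\<close>

lemma second_difference:
  fixes f :: "'a::real_normed_vector \<Rightarrow> real"
  assumes h: "h > 0"
    and U: "\<And>s t. 0 \<le> s \<Longrightarrow> s \<le> h \<Longrightarrow> 0 \<le> t \<Longrightarrow> t \<le> h \<Longrightarrow> Z + s *\<^sub>R v + t *\<^sub>R w \<in> U"
    and f: "smooth_on U f"
  obtains s t where "0 < s" "s < h" "0 < t" "t < h"
    "f (Z + h *\<^sub>R v + h *\<^sub>R w) - f (Z + h *\<^sub>R v) - f (Z + h *\<^sub>R w) + f Z =
     h * h * frechet_derivative (\<lambda>W. frechet_derivative f (at W) v) (at (Z + s *\<^sub>R v + t *\<^sub>R w)) w"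
proof -
  let ?D = "\<lambda>W. frechet_derivative f (at W) v"
  define \<phi> where "\<phi> = (\<lambda>s. f ((Z + h *\<^sub>R w) + s *\<^sub>R v) - f (Z + s *\<^sub>R v))"
  have in1: "Z + h *\<^sub>R w + s *\<^sub>R v \<in> U" "Z + s *\<^sub>R v \<in> U" if "0 \<le> s" "s \<le> h" for s
    using U[of s h] U[of s 0] that h by (simp_all add: algebra_simps)
  have "DERIV \<phi> s :> ?D ((Z + h *\<^sub>R w) + s *\<^sub>R v) - ?D (Z + s *\<^sub>R v)" if "0 \<le> s" "s \<le> h" for s
    unfolding \<phi>_def using in1[OF that]
    by (intro DERIV_diff has_real_derivative_line smooth_on_differentiable[OF f])
  from MVT2[OF h this] obtain s where s: "0 < s" "s < h" and
    \<phi>: "\<phi> h - \<phi> 0 = (h - 0) * (?D ((Z + h *\<^sub>R w) + s *\<^sub>R v) - ?D (Z + s *\<^sub>R v))" by blast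
  have "DERIV (\<lambda>t. ?D ((Z + s *\<^sub>R v) + t *\<^sub>R w)) t :>
      frechet_derivative ?D (at ((Z + s *\<^sub>R v) + t *\<^sub>R w)) w" if "0 \<le> t" "t \<le> h" for t
    using U[of s t] s that
    by (intro has_real_derivative_line smooth_on_differentiable[OF smooth_on_deriv[OF f]]) auto
  from MVT2[OF h this] obtain t where t: "0 < t" "t < h" and
    \<psi>: "?D ((Z + s *\<^sub>R v) + h *\<^sub>R w) - ?D ((Z + s *\<^sub>R v) + 0 *\<^sub>R w) =
      (h - 0) * frechet_derivative ?D (at ((Z + s *\<^sub>R v) + t *\<^sub>R w)) w" by blast
  have "f (Z + h *\<^sub>R v + h *\<^sub>R w) - f (Z + h *\<^sub>R v) - f (Z + h *\<^sub>R w) + f Z = \<phi> h - \<phi> 0"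
    by (simp add: \<phi>_def algebra_simps)
  also have "\<dots> = h * h * frechet_derivative ?D (at (Z + s *\<^sub>R v + t *\<^sub>R w)) w"
    using \<phi> \<psi> by (simp add: algebra_simps)
  finally show thesis using that s t by blast
qed

text \<open>The second difference is symmetric in \<open>v\<close> and \<open>w\<close>. Hence the
  two mixed derivatives take a common value at points arbitrarily close to \<open>Z\<close>, not
  necessarily the same point, and continuity of both finishes.\<close>

lemma frechet_derivative_swap_real:
  fixes f :: "'a::real_normed_vector \<Rightarrow> real"
  assumes "open U" "smooth_on U f" "Z \<in> U"
  shows "frechet_derivative (\<lambda>W. frechet_derivative f (at W) v) (at Z) w =
    frechet_derivative (\<lambda>W. frechet_derivative f (at W) w) (at Z) v"
proof -
  define A where "A = (\<lambda>W. frechet_derivative (\<lambda>W. frechet_derivative f (at W) v) (at W) w)"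
  define B where "B = (\<lambda>W. frechet_derivative (\<lambda>W. frechet_derivative f (at W) w) (at W) v)"
  have cont: "isCont A Z" "isCont B Z"
    unfolding A_def B_def using assms
    by (auto intro!: continuous_on_interior[of U] smooth_on_continuous smooth_on_deriv
        simp: interior_open)
  have "\<bar>A Z - B Z\<bar> \<le> e" if e: "e > 0" for e
  proof -
    have "e / 2 > 0" using e by simp
    then obtain d1 where d1: "d1 > 0" "\<And>W. dist W Z < d1 \<Longrightarrow> dist (A W) (A Z) < e / 2"
      using cont(1) unfolding continuous_at_eps_delta by blast
    obtain d2 where d2: "d2 > 0" "\<And>W. dist W Z < d2 \<Longrightarrow> dist (B W) (B Z) < e / 2"
      using cont(2) \<open>e / 2 > 0\<close> unfolding continuous_at_eps_delta by blast
    note d = d1(1) d2(1) d1(2) d2(2)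
    obtain d3 where d3: "d3 > 0" "ball Z d3 \<subseteq> U" using assms(1,3) openE by blast
    define d where "d = min d1 (min d2 d3)"
    have "d > 0" using d d3 by (simp add: d_def)
    \<comment> \<open>Displacements with both parameters at most \<open>h\<close> then have length
      at most \<open>d / 2\<close>; the summand 1 covers the case that \<open>v\<close> and
      \<open>w\<close> are zero.\<close>
    define h where "h = d / (2 * (norm v + norm w + 1))"
    have h: "h > 0" using \<open>d > 0\<close> by (simp add: h_def add_nonneg_pos)
    have near: "dist (Z + s *\<^sub>R v + t *\<^sub>R w) Z < d" if "0 \<le> s" "s \<le> h" "0 \<le> t" "t \<le> h" for s t
    proof -
      have "dist (Z + s *\<^sub>R v + t *\<^sub>R w) Z = norm (s *\<^sub>R v + t *\<^sub>R w)"
        by (simp add: dist_norm algebra_simps)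
      also have "\<dots> \<le> s * norm v + t * norm w"
        using that norm_triangle_ineq[of "s *\<^sub>R v" "t *\<^sub>R w"] by simp
      also have "\<dots> \<le> h * norm v + h * norm w"
        using that by (intro add_mono mult_right_mono) auto
      also have "\<dots> \<le> h * (norm v + norm w + 1)" using h by (simp add: algebra_simps)
      also have "\<dots> = d / 2"
        unfolding h_def using add_nonneg_pos[OF add_nonneg_nonneg[OF norm_ge_zero[of v] norm_ge_zero[of w]] zero_less_one]
        by (simp only: times_divide_eq_left divide_eq_eq eq_divide_eq) simp
      also have "\<dots> < d" using \<open>d > 0\<close> by simp
      finally show ?thesis .
    qed
    have inU: "Z + s *\<^sub>R v + t *\<^sub>R w \<in> U" if "0 \<le> s" "s \<le> h" "0 \<le> t" "t \<le> h" for s t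
      using near[OF that] d3(2) by (auto simp: d_def dist_commute subset_iff)
    obtain s t where st: "0 < s" "s < h" "0 < t" "t < h"
      "f (Z + h *\<^sub>R v + h *\<^sub>R w) - f (Z + h *\<^sub>R v) - f (Z + h *\<^sub>R w) + f Z =
       h * h * A (Z + s *\<^sub>R v + t *\<^sub>R w)"
      using second_difference[of h Z v w U f thesis, OF h inU assms(2)] unfolding A_def by simp
    have inU': "Z + s *\<^sub>R w + t *\<^sub>R v \<in> U" if "0 \<le> s" "s \<le> h" "0 \<le> t" "t \<le> h" for s t
      using inU[of t s] that by (simp add: algebra_simps)
    obtain s' t' where st': "0 < s'" "s' < h" "0 < t'" "t' < h"
      "f (Z + h *\<^sub>R w + h *\<^sub>R v) - f (Z + h *\<^sub>R w) - f (Z + h *\<^sub>R v) + f Z =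
       h * h * B (Z + s' *\<^sub>R w + t' *\<^sub>R v)"
      using second_difference[of h Z w v U f thesis, OF h inU' assms(2)] unfolding B_def by simp
    have "h * h * A (Z + s *\<^sub>R v + t *\<^sub>R w) = h * h * B (Z + s' *\<^sub>R w + t' *\<^sub>R v)"
      unfolding st(5)[symmetric] st'(5)[symmetric] by (simp add: algebra_simps)
    then have eq: "A (Z + s *\<^sub>R v + t *\<^sub>R w) = B (Z + t' *\<^sub>R v + s' *\<^sub>R w)"
      using h by (simp add: algebra_simps)
    have "dist (A (Z + s *\<^sub>R v + t *\<^sub>R w)) (A Z) < e / 2"
      using near[of s t] st by (intro d(3)) (auto simp: d_def)
    moreover have "dist (B (Z + t' *\<^sub>R v + s' *\<^sub>R w)) (B Z) < e / 2"
      using near[of t' s'] st' by (intro d(4)) (auto simp: d_def)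
    ultimately show ?thesis unfolding eq dist_real_def by linarith
  qed
  then have "\<bar>A Z - B Z\<bar> \<le> 0" by (rule field_le_epsilon) simp
  then show ?thesis by (simp add: A_def B_def)
qed

lemma frechet_derivative_linear_compose:
  assumes "bounded_linear L" "f differentiable (at x)"
  shows "frechet_derivative (\<lambda>x. L (f x)) (at x) = (\<lambda>v. L (frechet_derivative f (at x) v))"
proof -
  have "(f has_derivative frechet_derivative f (at x)) (at x)"
    using assms(2) by (simp add: frechet_derivative_works)
  from bounded_linear.has_derivative[OF assms(1) this] show ?thesis
    by (rule frechet_derivative_at[symmetric])
qed

lemma smooth_on_linear_compose:
  assumes "open U" "bounded_linear L" "smooth_on U f"
  shows "smooth_on U (\<lambda>x. L (f x))"
proof -
  have "Ck_on k U f \<Longrightarrow> Ck_on k U (\<lambda>x. L (f x))" for k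
  proof (induction k arbitrary: f)
    case 0
    then show ?case
      using continuous_on_compose2[OF linear_continuous_on[OF assms(2), of UNIV]] by auto
  next
    case (Suc k)
    have "Ck_on k U (\<lambda>x. frechet_derivative (\<lambda>x. L (f x)) (at x) v)" for v
    proof -
      have "Ck_on k U (\<lambda>x. L (frechet_derivative f (at x) v))"
        using Suc.prems by (intro Suc.IH) simp
      moreover have "frechet_derivative (\<lambda>x. L (f x)) (at x) v = L (frechet_derivative f (at x) v)"
        if "x \<in> U" for x
        using Suc.prems that by (simp add: frechet_derivative_linear_compose[OF assms(2)])
      ultimately show ?thesis
        using Ck_on_cong[OF assms(1), of "\<lambda>x. frechet_derivative (\<lambda>x. L (f x)) (at x) v"
            "\<lambda>x. L (frechet_derivative f (at x) v)" k] by simp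
    qed
    moreover have "(\<lambda>x. L (f x)) differentiable (at x)" if "x \<in> U" for x
    proof -
      have "(f has_derivative frechet_derivative f (at x)) (at x)"
        using Suc.prems that by (simp add: frechet_derivative_works[symmetric])
      then show ?thesis
        using bounded_linear.has_derivative[OF assms(2)] by (auto simp: differentiable_def)
    qed
    ultimately show ?case by simp
  qed
  then show ?thesis using assms(3) by (simp add: smooth_on_def)
qed

text \<open>Real and imaginary part are treated separately, because the mean value theorem is a real
  one.\<close>

lemma frechet_derivative_swap:
  fixes f :: "'a::real_normed_vector \<Rightarrow> complex"
  assumes U: "open U" and f: "smooth_on U f" and Z: "Z \<in> U"
  shows "frechet_derivative (\<lambda>W. frechet_derivative f (at W) v) (at Z) w =
    frechet_derivative (\<lambda>W. frechet_derivative f (at W) w) (at Z) v"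
proof -
  have *: "L (frechet_derivative (\<lambda>W. frechet_derivative f (at W) v) (at Z) w) =
    frechet_derivative (\<lambda>W. frechet_derivative (\<lambda>x. L (f x)) (at W) v) (at Z) w"
    if L: "bounded_linear L" for L :: "complex \<Rightarrow> real" and v w
  proof -
    have "frechet_derivative (\<lambda>W. L (frechet_derivative f (at W) v)) (at Z) =
       frechet_derivative (\<lambda>W. frechet_derivative (\<lambda>x. L (f x)) (at W) v) (at Z)"
      using U Z smooth_on_differentiable[OF f]
      by (intro frechet_derivative_cong_ev)
        (auto simp: eventually_nhds frechet_derivative_linear_compose[OF L])
    from this[symmetric] show ?thesis
      using smooth_on_differentiable[OF smooth_on_deriv[OF f] Z]
      by (simp only: frechet_derivative_linear_compose[OF L])
  qed
  have **: "L (frechet_derivative (\<lambda>W. frechet_derivative f (at W) v) (at Z) w) =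
     L (frechet_derivative (\<lambda>W. frechet_derivative f (at W) w) (at Z) v)"
    if L: "bounded_linear L" for L :: "complex \<Rightarrow> real"
    unfolding *[OF L] by (rule frechet_derivative_swap_real[OF U smooth_on_linear_compose[OF U L f] Z])
  show ?thesis
    using **[OF bounded_linear_Re] **[OF bounded_linear_Im] by (rule complex_eqI)
qed

text \<open>This is where the mixed second derivatives of the commutator cancel.\<close>

lemma dee_deebar_commute:
  assumes U: "open U" and f: "smooth_on U f" and Z: "Z \<in> U"
  shows "deebar (\<lambda>W. dee f v W) w Z = dee (\<lambda>W. deebar f w W) v Z"
proof -
  let ?D = "\<lambda>v W. frechet_derivative f (at W) v"
  have d [simp]: "?D v differentiable (at Z)" for v
    by (rule smooth_on_differentiable[OF smooth_on_deriv[OF f] Z])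
  have sw: "frechet_derivative (?D v) (at Z) w = frechet_derivative (?D w) (at Z) v" for v w
    by (rule frechet_derivative_swap[OF U f Z])
  have h: "(?D v has_derivative frechet_derivative (?D v) (at Z)) (at Z)" for v
    by (simp add: frechet_derivative_works[symmetric])
  have 1: "((\<lambda>W. dee f v W) has_derivative (\<lambda>w. (frechet_derivative (?D v) (at Z) w -
      \<i> * frechet_derivative (?D (\<i> *s v)) (at Z) w) / 2)) (at Z)"
    unfolding dee_def using h by (auto intro!: derivative_eq_intros)
  have 2: "((\<lambda>W. deebar f w W) has_derivative (\<lambda>v. (frechet_derivative (?D w) (at Z) v +
      \<i> * frechet_derivative (?D (\<i> *s w)) (at Z) v) / 2)) (at Z)"
    unfolding deebar_def using h by (auto intro!: derivative_eq_intros)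
  show ?thesis
    unfolding deebar_has_derivative[OF 1] dee_has_derivative[OF 2] sw[of w] sw[of "\<i> *s w"]
    by (simp add: algebra_simps add_divide_distrib diff_divide_distrib)
qed

lemma (in derivation_at) ev_mapf:
  assumes "\<And>I. length I = length L \<Longrightarrow> (\<lambda>W. F W I) differentiable (at Z)"
    and "\<And>a. a \<in> set L \<Longrightarrow> vdiff Z (f a)"
  shows "\<delta> (\<lambda>W. ev (F W) (map (\<lambda>a. f a W) L)) =
    ev (\<lambda>I. \<delta> (\<lambda>W. F W I)) (map (\<lambda>a. f a Z) L) +
    (\<Sum>r<length L. ev (F Z) ((map (\<lambda>a. f a Z) L)[r := \<delta>v (f (L ! r))]))"
proof -
  have "\<And>x. x \<in> set (map f L) \<Longrightarrow> vdiff Z x" using assms(2) by auto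
  from ev_map[of "map f L" F, OF _ this] assms(1) show ?thesis by (simp add: o_def)
qed

lemma diff_evf:
  assumes "\<And>I. length I = length L \<Longrightarrow> (\<lambda>W. F W I) differentiable (at Z)"
    and "\<And>a. a \<in> set L \<Longrightarrow> vdiff Z (f a)"
  shows "(\<lambda>W. ev (F W) (map (\<lambda>a. f a W) L)) differentiable (at Z)"
proof -
  have "\<And>x. x \<in> set (map f L) \<Longrightarrow> vdiff Z x" using assms(2) by auto
  from diff_ev[of "map f L" F Z, OF _ this] assms(1) show ?thesis by (simp add: o_def)
qed

lemma smooth_on_evf:
  assumes "open U" "\<And>I. length I = length L \<Longrightarrow> smooth_on U (\<lambda>W. F W I)"
    and "\<And>a i. a \<in> set L \<Longrightarrow> smooth_on U (\<lambda>W. f a W $ i)"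
  shows "smooth_on U (\<lambda>W. ev (F W) (map (\<lambda>a. f a W) L))"
proof -
  have "\<And>x i. x \<in> set (map f L) \<Longrightarrow> smooth_on U (\<lambda>W. x W $ i)" using assms(3) by auto
  from smooth_on_ev[OF assms(1), of "map f L" F, OF _ this] assms(2) show ?thesis by (simp add: o_def)
qed

lemma diff_ev_const:
  fixes Z :: "complex^'m"
  assumes "\<And>I. length I = length vs \<Longrightarrow> (\<lambda>W. F W I) differentiable (at Z)"
  shows "(\<lambda>W. ev (F W) (vs :: (complex^'m) list)) differentiable (at Z)"
  using diff_evf[of vs F Z "\<lambda>v W. v"] assms by simp

lemma ev_snoc: "ev T (vs @ [v]) = ev (\<lambda>I. \<Sum>i\<in>UNIV. v $ i * T (I @ [i])) vs"
  by (simp add: ev_append)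

lemma smooth_on_transfer:
  "smooth_on U f \<Longrightarrow> open U \<Longrightarrow> (\<And>x. x \<in> U \<Longrightarrow> h x = f x) \<Longrightarrow> smooth_on U h"
  using smooth_on_cong[of U h f] by simp

lemma dee_plus_deebar: "frechet_derivative f (at Z) v = dee f v Z + deebar f v Z"
  by (simp add: dee_def deebar_def field_simps)

section \<open>The operators on tensors\<close>

locale sym_form =
  fixes g :: "int^'m^'m"
  assumes sym: "\<And>a b. g $ a $ b = g $ b $ a"
begin

lemma bil_sym: "bil g x y = bil g y x"
  unfolding bil_def by (subst sum.swap) (simp add: sym algebra_simps)

text \<open>Twice the squared norm, as a complex number. In this form it is a polynomial in the
  coordinates and their conjugates, whose Wirtinger derivatives can be read off.\<close>

definition N :: "complex^'m \<Rightarrow> complex" where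
  "N Z = bil g Z (cj Z)"

lemma cnj_N: "cnj (N Z) = N Z"
  by (simp add: N_def bil_cnj bil_sym[of "cj Z"])

lemma N_nsq: "N Z = 2 * of_real (nsq g Z)"
  using cnj_N[of Z] by (simp add: nsq_def N_def complex_eq_iff)

lemma nsq_N: "of_real (nsq g Z) = N Z / 2"
  by (simp add: N_nsq)

lemma N_nz: "nsq g Z > 0 \<Longrightarrow> N Z \<noteq> 0"
  by (simp add: N_nsq)

lemma diff_N [simp]: "N differentiable (at Z)"
  using diff_bil[OF vdiff_id vdiff_cj] by (simp add: N_def[abs_def])

lemma dee_N: "dee N v Z = bil g v (cj Z)"
  using dee.bil[OF vdiff_id vdiff_cj] by (simp add: N_def[abs_def])

lemma deebar_N: "deebar N v Z = bil g Z (cj v)"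
  using deebar.bil[OF vdiff_id vdiff_cj] by (simp add: N_def[abs_def])

lemma smooth_N: "open U \<Longrightarrow> smooth_on U N"
  unfolding N_def[abs_def] by (intro smooth_on_bil) auto

lemma open_pos: "open {Z. nsq g Z > 0}"
proof -
  have "continuous_on UNIV (\<lambda>Z. Re (N Z))"
    by (intro continuous_on_Re smooth_on_continuous smooth_N) simp
  then have "open {Z. Re (N Z) > 0}"
    by (intro open_Collect_less) auto
  then show ?thesis by (simp add: N_nsq)
qed

text \<open>The differential of the squared norm is the real part of the complex linear form
  \<open>bil g v (cj Z)\<close>, and \<open>dee\<close> returns one half of that form. The half
  cancels against \<open>nsq\<close>, which is one half of \<open>N\<close>.\<close>

lemma nu_eq:
  assumes "nsq g Z > 0"
  shows "nu g Z j = bil g (axis j 1) (cj Z) / N Z"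
proof -
  have "(N has_derivative frechet_derivative N (at Z)) (at Z)"
    using diff_N by (simp add: frechet_derivative_works)
  also have "frechet_derivative N (at Z) = (\<lambda>v. bil g v (cj Z) + bil g Z (cj v))"
    by (simp add: fun_eq_iff dee_plus_deebar dee_N deebar_N)
  finally have "((\<lambda>W. Re (N W) / 2) has_derivative (\<lambda>v. Re (bil g v (cj Z) + bil g Z (cj v)) / 2)) (at Z)"
    by (auto intro!: derivative_eq_intros)
  moreover have "Re (bil g v (cj Z) + bil g Z (cj v)) / 2 = Re (bil g v (cj Z))" for v
  proof -
    have "bil g Z (cj v) = cnj (bil g v (cj Z))" by (simp add: bil_cnj bil_sym)
    then show ?thesis by simp
  qed
  moreover have "Re (N W) / 2 = nsq g W" for W by (simp add: N_nsq)
  ultimately have "(nsq g has_derivative (\<lambda>v. Re (bil g v (cj Z)))) (at Z)"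
    by simp
  then have "((\<lambda>W. complex_of_real (ln (nsq g W))) has_derivative
      (\<lambda>v. of_real (Re (bil g v (cj Z)) / nsq g Z))) (at Z)"
    using assms by (auto intro!: derivative_eq_intros simp: divide_inverse)
  from dee_has_derivative[OF this] show ?thesis
    using assms by (simp add: nu_def bil_lin N_nsq complex_eq_iff)
qed

text \<open>The transposes of \<open>\<phi>\<close> and \<open>\<psi>\<close>, up to conjugation: \<open>\<phi>(dZ\<^sup>-\<^sub>k)\<close> takes the value
  \<open>(pih Z v)\<^sub>k\<close> at \<open>v\<close>.\<close>

definition pih :: "complex^'m \<Rightarrow> complex^'m \<Rightarrow> complex^'m" where
  "pih Z v = v - (bil g v (cj Z) / N Z) *s Z"

definition pip :: "complex^'m \<Rightarrow> complex^'m \<Rightarrow> complex^'m" where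
  "pip Z v = v - (bil g v Z / N Z) *s cj Z"

lemma pih_orth: "nsq g Z > 0 \<Longrightarrow> bil g (pih Z v) (cj Z) = 0"
  using N_nz[of Z] by (simp add: pih_def bil_lin) (simp add: N_def)

lemma pip_orth: "nsq g Z > 0 \<Longrightarrow> bil g (pip Z v) Z = 0"
  using N_nz[of Z] by (simp add: pip_def bil_lin bil_sym[of "cj Z"]) (simp add: N_def)

lemma pih_self: "nsq g Z > 0 \<Longrightarrow> pih Z Z = 0"
  using N_nz[of Z] by (simp add: pih_def N_def vec_eq_iff)

lemma pip_fix: "bil g v Z = 0 \<Longrightarrow> pip Z v = v"
  by (simp add: pip_def)

lemma phi_sum: "nsq g Z > 0 \<Longrightarrow> (\<Sum>j\<in>UNIV. phi g Z k j * v $ j) = pih Z v $ k"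
proof -
  assume Z: "nsq g Z > 0"
  have "phi g Z k j * v $ j = (if k = j then v $ j else 0) - Z $ k / N Z * (v $ j * bil g (axis j 1) (cj Z))" for j
    by (simp add: phi_def nu_eq[OF Z] algebra_simps)
  then have "(\<Sum>j\<in>UNIV. phi g Z k j * v $ j) =
     (\<Sum>j\<in>UNIV. if k = j then v $ j else 0) - Z $ k / N Z * (\<Sum>j\<in>UNIV. v $ j * bil g (axis j 1) (cj Z))"
    by (simp only: sum_subtractf sum_distrib_left)
  then show ?thesis by (simp add: bil_axis_left pih_def)
qed

lemma psi_sum: "nsq g Z > 0 \<Longrightarrow> (\<Sum>j\<in>UNIV. psi g Z k j * v $ j) = pip Z v $ k"
proof -
  assume Z: "nsq g Z > 0"
  have "(\<Sum>j\<in>UNIV. psi g Z k j * v $ j) = cnj (\<Sum>j\<in>UNIV. phi g Z k j * cj v $ j)"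
    by (simp add: psi_def)
  also have "\<dots> = cnj (pih Z (cj v) $ k)" by (simp only: phi_sum[OF Z])
  also have "\<dots> = pip Z v $ k" by (simp add: pih_def pip_def bil_cnj cnj_N)
  finally show ?thesis .
qed

lemma phi_psi_vec:
  assumes "nsq g Z > 0"
  shows "(\<lambda>v. \<chi> i. \<Sum>j\<in>UNIV. phi g Z i j * v $ j) = pih Z"
    "(\<lambda>v. \<chi> i. \<Sum>j\<in>UNIV. psi g Z i j * v $ j) = pip Z"
  by (simp_all add: fun_eq_iff phi_sum[OF assms] psi_sum[OF assms])

text \<open>Summing \<open>phi\<close> against the new vector yields its projection along
  \<open>Z\<close>, and \<open>dee_expand\<close> conjugates it. The old arguments are constant
  vectors here.\<close>

lemma ev_lower:
  assumes Z: "nsq g Z > 0" and F: "\<And>I. length I = length vs \<Longrightarrow> (\<lambda>W. F W I) differentiable (at Z)"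
  shows "ev (lower g F Z) (vs @ [v]) = N Z / 2 * deebar (\<lambda>W. ev (F W) vs) (cj (pih Z v)) Z"
proof -
  have "ev (lower g F Z) (vs @ [v]) = ev (\<lambda>I. N Z / 2 * deebar (\<lambda>W. F W I) (cj (pih Z v)) Z) vs"
    unfolding ev_snoc
  proof (rule ev_cong)
    fix I :: "'m list" assume I: "length I = length vs"
    have "(\<Sum>i\<in>UNIV. v $ i * lower g F Z (I @ [i])) =
      N Z / 2 * (\<Sum>i\<in>UNIV. \<Sum>l\<in>UNIV. deebar (\<lambda>W. F W I) (axis l 1) Z * (phi g Z l i * v $ i))"
      by (simp add: lower_def nsq_N sum_distrib_left algebra_simps)
    also have "\<dots> = N Z / 2 * (\<Sum>l\<in>UNIV. deebar (\<lambda>W. F W I) (axis l 1) Z * pih Z v $ l)"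
      by (subst sum.swap) (simp only: sum_distrib_left[symmetric] phi_sum[OF Z])
    also have "\<dots> = N Z / 2 * (\<Sum>l\<in>UNIV. pih Z v $ l * deebar (\<lambda>W. F W I) (axis l 1) Z)"
      by (simp only: mult.commute)
    finally show "(\<Sum>i\<in>UNIV. v $ i * lower g F Z (I @ [i])) =
        N Z / 2 * deebar (\<lambda>W. F W I) (cj (pih Z v)) Z"
      by (simp add: dee_expand(2)[OF F[OF I]])
  qed
  also have "\<dots> = N Z / 2 * deebar (\<lambda>W. ev (F W) vs) (cj (pih Z v)) Z"
    unfolding ev_scale by (subst deebar.ev_const[OF F]) auto
  finally show ?thesis .
qed

lemma eventually_pos: "nsq g Z > 0 \<Longrightarrow> eventually (\<lambda>W. nsq g W > 0) (nhds Z)"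
  using open_pos by (auto simp: eventually_nhds)

lemma vdiff_pip: "nsq g Z > 0 \<Longrightarrow> vdiff Z (\<lambda>W. pip W v)"
  unfolding pip_def
  by (intro vdiff_diff vdiff_scale differentiable_divide diff_bil vdiff_const vdiff_id vdiff_cj diff_N N_nz)

lemma diff_Npowi: "nsq g Z > 0 \<Longrightarrow> (\<lambda>W. (N W / 2) powi k) differentiable (at Z)"
  by (intro diff_powi differentiable_divide diff_N) (auto simp: N_nz)

text \<open>\<open>psi\<close> acts before the differentiation and thus at the moving point
  \<open>W\<close>, whereas \<open>phi\<close> acts afterwards at the fixed point \<open>Z\<close>.
  This is why the arguments under the derivative are \<open>pip W (pih Z x)\<close>.\<close>

lemma ev_raise:
  assumes Z: "nsq g Z > 0" and F: "\<And>I. length I = length vs \<Longrightarrow> (\<lambda>W. F W I) differentiable (at Z)"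
  shows "ev (raise g k F Z) (vs @ [v]) = (N Z / 2) powi (- k) *
    dee (\<lambda>W. (N W / 2) powi k * ev (F W) (map (\<lambda>x. pip W (pih Z x)) vs)) v Z"
proof -
  define u where "u = (\<lambda>W I. (N W / 2) powi k * ev (F W) (map (\<lambda>j. pip W (axis j 1)) I))"
  have du: "(\<lambda>W. u W I) differentiable (at Z)" if "length I = length vs" for I
    unfolding u_def by (intro differentiable_mult diff_Npowi Z diff_evf vdiff_pip F) (simp add: that)
  have ax: "(\<chi> i. psi g W i j) = pip W (axis j 1)" if "nsq g W > 0" for W j
  proof -
    have "(\<Sum>l\<in>UNIV. psi g W i l * axis j 1 $ l) = psi g W i j" for i
      by (simp add: axis_def if_distrib[of "\<lambda>x. _ * x"] cong: if_cong)
    then show ?thesis using psi_sum[OF that, of _ "axis j 1"] by (simp add: vec_eq_iff)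
  qed
  have u: "dee (\<lambda>W. of_real (nsq g W powi k) * subst_slots (psi g W) (F W) I) w Z = dee (\<lambda>W. u W I) w Z" for I w
  proof (rule dee.cong, rule eventually_mono[OF eventually_pos[OF Z]])
    fix W assume "0 < nsq g W"
    then show "of_real (nsq g W powi k) * subst_slots (psi g W) (F W) I = u W I"
      by (simp add: u_def subst_slots_ev ax nsq_N of_real_power_int[symmetric] del: of_real_power_int)
        (simp add: nsq_N)
  qed
  have "ev (raise g k F Z) (vs @ [v]) =
    ev (\<lambda>I. (N Z / 2) powi (- k) * subst_slots (phi g Z) (\<lambda>I. dee (\<lambda>W. u W I) v Z) I) vs"
    unfolding ev_snoc
  proof (rule ev_cong)
    fix I :: "'m list" assume I: "length I = length vs"
    have "raise g k F Z (I @ [i]) =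
        (N Z / 2) powi (- k) * subst_slots (phi g Z) (\<lambda>I. dee (\<lambda>W. u W I) (axis i 1) Z) I" for i
      unfolding raise_def u last_snoc butlast_snoc by (simp add: nsq_N)
    then have "(\<Sum>i\<in>UNIV. v $ i * raise g k F Z (I @ [i])) = (N Z / 2) powi (- k) *
      (\<Sum>i\<in>UNIV. v $ i * subst_slots (phi g Z) (\<lambda>I. dee (\<lambda>W. u W I) (axis i 1) Z) I)"
      by (simp add: sum_distrib_left mult.left_commute)
    also have "(\<Sum>i\<in>UNIV. v $ i * subst_slots (phi g Z) (\<lambda>I. dee (\<lambda>W. u W I) (axis i 1) Z) I) =
       subst_slots (phi g Z) (\<lambda>I. \<Sum>i\<in>UNIV. v $ i * dee (\<lambda>W. u W I) (axis i 1) Z) I"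
      by (simp add: subst_slots_ev ev_sum ev_scale)
    also have "\<dots> = subst_slots (phi g Z) (\<lambda>I. dee (\<lambda>W. u W I) v Z) I"
      unfolding subst_slots_ev by (intro ev_cong) (simp add: dee_expand(1)[OF du] I)
    finally show "(\<Sum>i\<in>UNIV. v $ i * raise g k F Z (I @ [i])) =
      (N Z / 2) powi (- k) * subst_slots (phi g Z) (\<lambda>I. dee (\<lambda>W. u W I) v Z) I" .
  qed
  also have "\<dots> = (N Z / 2) powi (- k) * ev (\<lambda>I. dee (\<lambda>W. u W I) v Z) (map (pih Z) vs)"
    by (simp only: ev_scale ev_subst_slots phi_psi_vec[OF Z])
  also have "ev (\<lambda>I. dee (\<lambda>W. u W I) v Z) (map (pih Z) vs) = dee (\<lambda>W. ev (u W) (map (pih Z) vs)) v Z"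
    by (rule dee.ev_const[symmetric]) (simp add: du)
  also have "\<dots> = dee (\<lambda>W. (N W / 2) powi k * ev (F W) (map (\<lambda>x. pip W (pih Z x)) vs)) v Z"
  proof (rule dee.cong, rule eventually_mono[OF eventually_pos[OF Z]])
    fix W assume W: "0 < nsq g W"
    have "ev (u W) (map (pih Z) vs) = (N W / 2) powi k * ev (subst_slots (psi g W) (F W)) (map (pih Z) vs)"
      unfolding u_def by (simp add: ev_scale subst_slots_ev[abs_def] ax[OF W])
    then show "ev (u W) (map (pih Z) vs) = (N W / 2) powi k * ev (F W) (map (\<lambda>x. pip W (pih Z x)) vs)"
      by (simp add: ev_subst_slots phi_psi_vec[OF W] o_def)
  qed
  finally show ?thesis .
qed

lemma smooth_on_lower:
  assumes U: "open U" "U \<subseteq> {Z. nsq g Z > 0}" and F: "\<And>I. length I = s \<Longrightarrow> smooth_on U (\<lambda>Z. F Z I)"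
    and J: "length J = s + 1"
  shows "smooth_on U (\<lambda>Z. lower g F Z J)"
proof -
  have "smooth_on U (\<lambda>Z. N Z / 2 * (\<Sum>l\<in>UNIV. deebar (\<lambda>W. F W (butlast J)) (axis l 1) Z *
     ((if l = last J then 1 else 0) - Z $ l * (bil g (axis (last J) 1) (cj Z) / N Z))))"
    using U(2) J by (intro smooth_on_mult smooth_on_sum smooth_on_divide smooth_on_diff smooth_on_deebar
      smooth_on_bil F U(1) smooth_N smooth_on_const) (auto simp: N_nz subset_iff)
  then show ?thesis
  proof (rule smooth_on_transfer[OF _ U(1)])
    fix Z assume "Z \<in> U"
    then have Z: "nsq g Z > 0" using U(2) by auto
    show "lower g F Z J = N Z / 2 * (\<Sum>l\<in>UNIV. deebar (\<lambda>W. F W (butlast J)) (axis l 1) Z *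
     ((if l = last J then 1 else 0) - Z $ l * (bil g (axis (last J) 1) (cj Z) / N Z)))"
      unfolding lower_def nsq_N phi_def nu_eq[OF Z] ..
  qed
qed

lemma smooth_on_raise:
  assumes U: "open U" "U \<subseteq> {Z. nsq g Z > 0}" and F: "\<And>I. length I = s \<Longrightarrow> smooth_on U (\<lambda>Z. F Z I)"
    and J: "length J = s + 1"
  shows "smooth_on U (\<lambda>Z. raise g k F Z J)"
proof -
  have sm_nsq: "smooth_on U (\<lambda>Z. complex_of_real (nsq g Z powi k))" for k
    using U(2) by (simp add: nsq_N) (intro smooth_on_powi smooth_on_divide smooth_N U(1) smooth_on_const,
      auto simp: N_nz subset_iff)
  have sm_nu: "smooth_on U (\<lambda>Z. nu g Z j)" for j
  proof (rule smooth_on_transfer[OF _ U(1)])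
    show "smooth_on U (\<lambda>Z. bil g (axis j 1) (cj Z) / N Z)"
      using U by (intro smooth_on_divide smooth_on_bil smooth_N) (auto simp: N_nz subset_iff)
    show "nu g Z j = bil g (axis j 1) (cj Z) / N Z" if "Z \<in> U" for Z
      using U that by (intro nu_eq) auto
  qed
  have sm_phi: "smooth_on U (\<lambda>Z. phi g Z i j)" for i j
    unfolding phi_def by (intro smooth_on_diff smooth_on_mult U(1) sm_nu smooth_on_const smooth_on_coord)
  have sm_psi: "smooth_on U (\<lambda>Z. psi g Z i j)" for i j
    unfolding psi_def by (rule smooth_on_linear_compose[OF U(1) bounded_linear_cnj sm_phi])
  show ?thesis
    unfolding raise_def subst_slots_ev
    by (intro smooth_on_mult sm_nsq U(1) smooth_on_evf smooth_on_dee F) (use sm_phi sm_psi J in auto)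
qed

lemma vdiff_pih: "nsq g Z > 0 \<Longrightarrow> vdiff Z x \<Longrightarrow> vdiff Z (\<lambda>W. pih W (x W))"
  unfolding pih_def
  by (intro vdiff_diff vdiff_scale differentiable_divide diff_bil vdiff_id vdiff_cj diff_N N_nz)

lemma vdiff_pip': "nsq g Z > 0 \<Longrightarrow> vdiff Z x \<Longrightarrow> vdiff Z (\<lambda>W. pip W (x W))"
  unfolding pip_def
  by (intro vdiff_diff vdiff_scale differentiable_divide diff_bil vdiff_id vdiff_cj diff_N N_nz)

text \<open>The coefficient of \<open>cj W\<close> in \<open>pip W v\<close> has the numerator
  \<open>bil g v W\<close>, which is holomorphic in \<open>W\<close> and vanishes at
  \<open>Z\<close>; so neither the coefficient nor its antiholomorphic derivative survives
  there.\<close>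

lemma deebar_pip:
  assumes Z: "nsq g Z > 0" and v: "bil g v Z = 0"
  shows "deebar.\<delta>v w Z (\<lambda>W. pip W v) = 0"
proof -
  have d: "(\<lambda>W. bil g v W / N W) differentiable (at Z)"
    by (intro differentiable_divide diff_bil vdiff_const vdiff_id diff_N N_nz Z)
  have "deebar (\<lambda>W. bil g v W / N W) w Z = 0"
    using deebar.divide[OF diff_bil[OF vdiff_const vdiff_id] diff_N N_nz[OF Z]] v
    by (simp add: deebar.bil)
  then show ?thesis
    unfolding pip_def using v d
    by (subst deebar.\<delta>v_diff) (auto simp: deebar.\<delta>v_scale vdiff_scale)
qed

lemma deebar_frame:
  assumes F: "\<And>I. length I = length xs \<Longrightarrow> (\<lambda>W. F W I) differentiable (at Z)"
    and xs: "\<And>x. x \<in> set xs \<Longrightarrow> vdiff Z x \<and> deebar.\<delta>v w Z x = 0"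
  shows "deebar (\<lambda>W. ev (F W) (map (\<lambda>x. x W) xs)) w Z = deebar (\<lambda>W. ev (F W) (map (\<lambda>x. x Z) xs)) w Z"
proof -
  have "deebar (\<lambda>W. ev (F W) (map (\<lambda>x. x W) xs)) w Z =
    ev (\<lambda>I. deebar (\<lambda>W. F W I) w Z) (map (\<lambda>x. x Z) xs) +
    (\<Sum>r<length xs. ev (F Z) ((map (\<lambda>x. x Z) xs)[r := deebar.\<delta>v w Z (xs ! r)]))"
    using F xs by (intro deebar.ev_map) auto
  also have "\<dots> = ev (\<lambda>I. deebar (\<lambda>W. F W I) w Z) (map (\<lambda>x. x Z) xs)"
    using xs by (simp add: ev_upd_zero)
  also have "\<dots> = deebar (\<lambda>W. ev (F W) (map (\<lambda>x. x Z) xs)) w Z"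
    using F by (subst deebar.ev_const) auto
  finally show ?thesis .
qed

text \<open>Lowering may be computed with the frame \<open>pip W v\<close>, which is tangent at
  every point. Only with such a frame is the differentiated function determined on the cone by the
  class of \<open>F\<close>.\<close>

lemma deebar_moving_frame:
  assumes Z: "nsq g Z > 0" and vs: "\<forall>v\<in>set vs. bil g v Z = 0"
    and F: "\<And>I. length I = length vs \<Longrightarrow> (\<lambda>W. F W I) differentiable (at Z)"
  shows "deebar (\<lambda>W. ev (F W) (map (pip W) vs)) w Z = deebar (\<lambda>W. ev (F W) vs) w Z"
proof -
  have "deebar (\<lambda>W. ev (F W) (map (\<lambda>x. x W) (map (\<lambda>v W. pip W v) vs))) w Z =
    deebar (\<lambda>W. ev (F W) (map (\<lambda>x. x Z) (map (\<lambda>v W. pip W v) vs))) w Z"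
    using vs F by (intro deebar_frame) (auto simp: vdiff_pip Z deebar_pip)
  moreover have "map (pip Z) vs = vs"
    using vs by (intro map_idI) (simp add: pip_fix)
  ultimately show ?thesis by (simp add: o_def)
qed

end

section \<open>Derivatives along curves and along lines through the origin\<close>

lemma bounded_linear_smult_left: "bounded_linear (\<lambda>a::complex. a *s (w::complex^'m))"
  unfolding linear_conv_bounded_linear[symmetric]
  by (intro linearI) (simp_all add: vec_eq_iff algebra_simps)

lemma has_vector_derivative_complex_of_real: "((\<lambda>t. complex_of_real t) has_vector_derivative 1) (at t within S)"
  unfolding has_vector_derivative_def scaleR_conv_of_real by (auto intro!: derivative_eq_intros)

lemma curve_derivative_zero:
  fixes u :: "'a::real_normed_vector \<Rightarrow> 'b::real_normed_vector"
  assumes \<gamma>: "(\<gamma> has_vector_derivative v) (at (0::real))" and u: "u differentiable (at (\<gamma> 0))"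
    and z: "eventually (\<lambda>t. u (\<gamma> t) = 0) (nhds 0)"
  shows "frechet_derivative u (at (\<gamma> 0)) v = 0"
proof -
  let ?D = "frechet_derivative u (at (\<gamma> 0))"
  have "(u has_derivative ?D) (at (\<gamma> 0))" using u by (simp add: frechet_derivative_works)
  from has_derivative_compose[OF \<gamma>[unfolded has_vector_derivative_def] this]
  have "((\<lambda>t. u (\<gamma> t)) has_derivative (\<lambda>h. ?D (h *\<^sub>R v))) (at 0)" .
  then have "((\<lambda>t. 0) has_derivative (\<lambda>h. ?D (h *\<^sub>R v))) (at (0::real))"
    using has_derivative_cong_ev[of "\<lambda>t. u (\<gamma> t)" "\<lambda>t. 0" 0] z by simp
  from has_derivative_unique[OF this has_derivative_const] have "?D (1 *\<^sub>R v) = 0" by metis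
  then show ?thesis by simp
qed

text \<open>For every complex \<open>a\<close> the curve \<open>(1 + t * a) *s Z\<close> stays in
  the punctured line for small \<open>t\<close>. The cases \<open>a = 1\<close> and
  \<open>a = \<i>\<close> give both Wirtinger derivatives.\<close>

lemma line_derivative_zero:
  fixes Z :: "complex^'m"
  assumes u: "u differentiable (at Z)" and z: "\<And>c. c \<noteq> 0 \<Longrightarrow> u (c *s Z) = 0"
  shows "dee u Z Z = 0" "deebar u Z Z = 0"
proof -
  have D: "frechet_derivative u (at Z) (a *s Z) = 0" for a
  proof -
    from bounded_linear.has_vector_derivative[OF bounded_linear_smult_left has_vector_derivative_complex_of_real, of "a *s Z" 0 UNIV]
    have "((\<lambda>t. Z + of_real t *s (a *s Z)) has_vector_derivative (a *s Z)) (at (0::real))"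
      using has_vector_derivative_add[OF has_vector_derivative_const[of Z]] by force
    moreover have "eventually (\<lambda>t. u (Z + complex_of_real t *s (a *s Z)) = 0) (nhds 0)"
    proof -
      have "((\<lambda>t. 1 + complex_of_real t * a) \<longlongrightarrow> 1 + complex_of_real 0 * a) (nhds 0)"
        by (intro tendsto_intros filterlim_ident)
      then have "eventually (\<lambda>t. 1 + complex_of_real t * a \<noteq> 0) (nhds 0)"
        by (rule tendsto_imp_eventually_ne) simp
      then show ?thesis
      proof (rule eventually_mono)
        fix t assume "1 + complex_of_real t * a \<noteq> 0"
        from z[OF this] show "u (Z + complex_of_real t *s (a *s Z)) = 0"
          by (simp add: vector_sadd_rdistrib)
      qed
    qed
    ultimately show ?thesis
      using curve_derivative_zero[of "\<lambda>t. Z + complex_of_real t *s (a *s Z)" "a *s Z" u] u by simp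
  qed
  show "dee u Z Z = 0" "deebar u Z Z = 0"
    using D[of 1] D[of \<i>] by (simp_all add: dee_def deebar_def)
qed

lemma ev_euler_contr:
  assumes "r \<le> length vs"
  shows "ev (euler_contr r F Z) vs = ev (F Z) (take r vs @ Z # drop r vs)"
  using assms by (simp add: ev_slot euler_contr_def ev_sum ev_scale)

lemma ev_pull_mat: "ev (pull_mat M F Z) vs = ev (F (cmat M *v Z)) (map (\<lambda>v. cmat M *v v) vs)"
proof -
  have "(\<lambda>v::complex^'a. \<chi> i. \<Sum>j\<in>UNIV. of_int (M $ i $ j) * v $ j) = (*v) (cmat M)"
    by (simp add: fun_eq_iff vec_eq_iff matrix_vector_mult_def cmat_def map_matrix_def)
  then show ?thesis by (simp add: pull_mat_def ev_subst_slots)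
qed

lemma ev_tensor_mdiff:
  "length vs = s \<Longrightarrow> ev (tensor s F G Z) (vs @ ws) = ev (F Z) vs * ev (G Z) ws"
  unfolding tensor_def using ev_tensor[of "F Z" vs "G Z" ws] by simp

lemma ev_move_last:
  assumes "length vs = s"
  shows "ev (move_last s F Z) (vs @ ws @ [v]) = ev (F Z) (vs @ v # ws)"
proof -
  have "ev (move_last s F Z) (vs @ ws @ [v]) =
    ev (\<lambda>I. ev (\<lambda>J. \<Sum>i\<in>UNIV. v $ i * F Z (I @ i # J)) ws) vs"
    unfolding ev_append[of _ vs] ev_snoc
    by (intro ev_cong) (simp add: move_last_def assms butlast_append)
  then show ?thesis by (simp add: ev_append ev_sum ev_scale)
qed

section \<open>Sections over the cone\<close>

text \<open>By \<open>path\<close>, curves in the quadric starting in \<open>A\<close> stay in \<open>A\<close>; this is all that is needed of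
  the connected component.\<close>

locale quad_cone = sym_form g for g :: "int^'m^'m" +
  fixes A :: "(complex^'m) set"
  assumes quad: "\<And>Z. Z \<in> A \<Longrightarrow> bil g Z Z = 0"
    and pos: "\<And>Z. Z \<in> A \<Longrightarrow> nsq g Z > 0"
    and scale: "\<And>Z c. Z \<in> A \<Longrightarrow> c \<noteq> 0 \<Longrightarrow> c *s Z \<in> A"
    and path: "\<And>\<gamma> :: real \<Rightarrow> complex^'m. continuous_on {0..1} \<gamma> \<Longrightarrow> \<gamma> 0 \<in> A \<Longrightarrow>
      (\<And>t. t \<in> {0..1} \<Longrightarrow> bil g (\<gamma> t) (\<gamma> t) = 0 \<and> nsq g (\<gamma> t) > 0) \<Longrightarrow> \<gamma> 1 \<in> A"
begin

lemma tangent_frechet: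
  assumes Z: "Z \<in> A" and v: "bil g v Z = 0" and u: "u differentiable (at Z)"
    and u0: "\<And>W. W \<in> A \<Longrightarrow> u W = (0::complex)"
  shows "frechet_derivative u (at Z) v = 0"
proof -
  define d where "d = (\<lambda>z. N Z + z * bil g v (cj Z))"
  \<comment> \<open>The correction along \<open>cj Z\<close> puts the straight line through
    \<open>Z\<close> in direction \<open>v\<close> back on the quadric. Since \<open>v\<close> is
    tangent and \<open>cj Z\<close> is isotropic, the equation for the correction is linear, with
    coefficient twice \<open>d\<close>. The solution is of second order in \<open>t\<close>, so the
    initial velocity remains \<open>v\<close>.\<close>
  define c where "c = (\<lambda>z. z\<^sup>2 * bil g v v / (2 * d z))"
  define \<gamma> where "\<gamma> = (\<lambda>t. Z + complex_of_real t *s v - c (of_real t) *s cj Z)"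
  have d0: "d 0 \<noteq> 0" using N_nz[OF pos[OF Z]] by (simp add: d_def)
  have \<gamma>0: "\<gamma> 0 = Z" by (simp add: \<gamma>_def c_def)
  have zz: "bil g (cj Z) (cj Z) = 0"
    using quad[OF Z] by (simp add: bil_cnj[symmetric])
  have quad\<gamma>: "bil g (\<gamma> t) (\<gamma> t) = 0" if "d (of_real t) \<noteq> 0" for t
  proof -
    have "bil g (\<gamma> t) (\<gamma> t) = (of_real t)\<^sup>2 * bil g v v - 2 * c (of_real t) * d (of_real t)"
      using v quad[OF Z] zz unfolding \<gamma>_def d_def N_def
      by (simp add: bil_lin bil_sym[of "cj Z" Z] bil_sym[of "cj Z" v] bil_sym[of Z v] power2_eq_square algebra_simps)
    also have "\<dots> = 0" using that by (simp add: c_def)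
    finally show ?thesis .
  qed
  have cont: "continuous (at t within S) \<gamma>" if "d (of_real t) \<noteq> 0" for t S
  proof -
    have "continuous (at t within S) (\<lambda>x::real. d (of_real x))"
      unfolding d_def by (intro continuous_intros)
    then show ?thesis
      unfolding \<gamma>_def c_def
      by (intro continuous_intros bounded_linear.continuous[OF bounded_linear_smult_left])
        (use that in auto)
  qed
  have "isCont (\<lambda>t::real. d (of_real t)) 0"
    unfolding d_def by (intro continuous_intros)
  then have "((\<lambda>t::real. d (of_real t)) \<longlongrightarrow> d (of_real 0)) (nhds 0)"
    by (simp add: isCont_def tendsto_nhds_iff)
  then have ev1: "eventually (\<lambda>t::real. d (of_real t) \<noteq> 0) (nhds 0)"
    by (rule tendsto_imp_eventually_ne) (simp add: d0)
  have "(\<gamma> \<longlongrightarrow> \<gamma> 0) (nhds 0)"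
    using cont[of 0 UNIV] d0 by (simp add: isCont_def tendsto_nhds_iff)
  then have ev2: "eventually (\<lambda>t. nsq g (\<gamma> t) > 0) (nhds 0)"
    using open_pos pos[OF Z] topological_tendstoD[of \<gamma> "\<gamma> 0" "nhds 0" "{Z. nsq g Z > 0}"]
    by (simp add: \<gamma>0)
  obtain e where e: "e > 0" "\<And>t. \<bar>t\<bar> < e \<Longrightarrow> d (of_real t) \<noteq> 0 \<and> nsq g (\<gamma> t) > 0"
    using eventually_conj[OF ev1 ev2] unfolding eventually_nhds_metric by (auto simp: dist_norm)
  have inA: "\<gamma> t \<in> A" if t: "\<bar>t\<bar> < e" for t
  proof -
    have st: "\<bar>s * t\<bar> < e" if "s \<in> {0..1}" for s
    proof -
      have "\<bar>s * t\<bar> \<le> 1 * \<bar>t\<bar>" unfolding abs_mult using that by (intro mult_right_mono) auto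
      with t show ?thesis by simp
    qed
    \<comment> \<open>\<open>path\<close> speaks of curves on the unit interval, so the piece of the
      curve between 0 and \<open>t\<close> is reparametrised; \<open>t\<close> may be
      negative.\<close>
    have "(\<lambda>s. \<gamma> (s * t)) 1 \<in> A"
    proof (rule path)
      show "continuous_on {0..1} (\<lambda>s. \<gamma> (s * t))"
      proof (rule continuous_on_compose2[of "{-e<..<e}" \<gamma>])
        show "continuous_on {- e<..<e} \<gamma>"
          using e by (auto simp: continuous_on_eq_continuous_within intro!: cont)
        show "continuous_on {0..1} (\<lambda>s. s * t)" by (intro continuous_intros)
        show "(\<lambda>s. s * t) ` {0..1} \<subseteq> {- e<..<e}"
          using st by (fastforce simp: abs_less_iff)
      qed
      show "\<gamma> (0 * t) \<in> A" using Z \<gamma>0 by simp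
    next
      fix s :: real assume "s \<in> {0..1}"
      with e(2)[OF st] quad\<gamma>
      show "bil g (\<gamma> (s * t)) (\<gamma> (s * t)) = 0 \<and> 0 < nsq g (\<gamma> (s * t))" by blast
    qed
    then show ?thesis by simp
  qed
  have "(c has_field_derivative 0) (at 0)"
    unfolding c_def d_def using d0 by (auto intro!: derivative_eq_intros simp: d_def)
  then have c': "((\<lambda>t. c (of_real t)) has_vector_derivative 0) (at (0::real))"
    using has_vector_derivative_real_field[of c 0 0 UNIV] by simp
  have r': "((\<lambda>t. complex_of_real t) has_vector_derivative 1) (at (0::real))"
    by (rule has_vector_derivative_complex_of_real)
  have "(\<gamma> has_vector_derivative 0 + 1 *s v - 0 *s cj Z) (at 0)"
    unfolding \<gamma>_def
    by (intro has_vector_derivative_add has_vector_derivative_diff has_vector_derivative_const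
      bounded_linear.has_vector_derivative[OF bounded_linear_smult_left] c' r')
  then have "(\<gamma> has_vector_derivative v) (at 0)" by simp
  moreover have "eventually (\<lambda>t. u (\<gamma> t) = 0) (nhds 0)"
    unfolding eventually_nhds_metric using e(1) inA u0 by (auto simp: dist_norm)
  ultimately have "frechet_derivative u (at (\<gamma> 0)) v = 0"
    using u by (intro curve_derivative_zero) (auto simp: \<gamma>0)
  then show ?thesis by (simp add: \<gamma>0)
qed

lemma tangent_zero:
  assumes "Z \<in> A" "bil g v Z = 0" "u differentiable (at Z)" "\<And>W. W \<in> A \<Longrightarrow> u W = 0"
  shows "dee u v Z = 0" "deebar u v Z = 0"
  using tangent_frechet[OF assms] tangent_frechet[OF assms(1) _ assms(3,4), of "\<i> *s v"] assms(2)
  by (simp_all add: dee_def deebar_def bil_lin)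

lemma tangent_eq:
  assumes Z: "Z \<in> A" "bil g v Z = 0" and d: "u differentiable (at Z)" "w differentiable (at Z)"
    and eq: "\<And>W. W \<in> A \<Longrightarrow> u W = w W"
  shows "dee u v Z = dee w v Z" "deebar u v Z = deebar w v Z"
  using tangent_zero[OF Z, of "\<lambda>W. u W - w W"] d eq
  by (simp_all add: dee.diff deebar.diff)

lemma orth_pih: "Z \<in> A \<Longrightarrow> bil g (cj (pih Z v)) Z = 0"
  using pih_orth[OF pos, of Z v] bil_cnj[of g "pih Z v" "cj Z"] by simp

definition difrep :: "nat \<Rightarrow> 'm mdiff \<Rightarrow> bool" where
  "difrep s F \<longleftrightarrow> (\<forall>Z\<in>A. \<forall>I. length I = s \<longrightarrow> (\<lambda>W. F W I) differentiable (at Z))"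

text \<open>The open set is taken inside the locus of positive norm, on which \<open>phi\<close>,
  \<open>psi\<close> and \<open>nu\<close> are smooth; by \<open>smrep_iff\<close> this is no
  restriction.\<close>

definition smrep :: "nat \<Rightarrow> 'm mdiff \<Rightarrow> bool" where
  "smrep s F \<longleftrightarrow> (\<exists>U. open U \<and> A \<subseteq> U \<and> U \<subseteq> {Z. nsq g Z > 0} \<and>
     (\<forall>I. length I = s \<longrightarrow> smooth_on U (\<lambda>Z. F Z I)))"

lemma smrep_iff: "smrep s F \<longleftrightarrow> (\<exists>U. open U \<and> A \<subseteq> U \<and> (\<forall>I. length I = s \<longrightarrow> smooth_on U (\<lambda>Z. F Z I)))"
proof
  assume "\<exists>U. open U \<and> A \<subseteq> U \<and> (\<forall>I. length I = s \<longrightarrow> smooth_on U (\<lambda>Z. F Z I))"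
  then obtain U where "open U" "A \<subseteq> U" "\<And>I. length I = s \<Longrightarrow> smooth_on U (\<lambda>Z. F Z I)" by blast
  then show "smrep s F"
    unfolding smrep_def using open_pos pos
    by (intro exI[of _ "U \<inter> {Z. nsq g Z > 0}"]) (auto intro: smooth_on_subset)
qed (auto simp: smrep_def)

lemma smrep_difrep: "smrep s F \<Longrightarrow> difrep s F"
  unfolding smrep_def difrep_def using smooth_on_differentiable by blast

lemma smrep_transfer:
  assumes "smrep s F"
    and "\<And>U J. open U \<Longrightarrow> U \<subseteq> {Z. nsq g Z > 0} \<Longrightarrow> (\<And>I. length I = s \<Longrightarrow> smooth_on U (\<lambda>Z. F Z I)) \<Longrightarrow>
      length J = t \<Longrightarrow> smooth_on U (\<lambda>Z. G Z J)"
  shows "smrep t G"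
  using assms(1) unfolding smrep_def
  by (elim exE conjE, intro exI conjI) (assumption+, use assms(2) in blast)

lemma smrep_lower: "smrep s F \<Longrightarrow> smrep (s + 1) (lower g F)"
  by (erule smrep_transfer) (rule smooth_on_lower, auto)

lemma smrep_raise: "smrep s F \<Longrightarrow> smrep (s + 1) (raise g k F)"
  by (erule smrep_transfer) (rule smooth_on_raise, auto)

lemma smrep_add:
  assumes "smrep s F" "smrep s G"
  shows "smrep s (\<lambda>Z I. a * F Z I + b * G Z I)"
proof -
  obtain U V where "open U" "A \<subseteq> U" "\<And>I. length I = s \<Longrightarrow> smooth_on U (\<lambda>Z. F Z I)"
    "open V" "A \<subseteq> V" "\<And>I. length I = s \<Longrightarrow> smooth_on V (\<lambda>Z. G Z I)"
    using assms unfolding smrep_def by blast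
  then show ?thesis unfolding smrep_iff
    by (intro exI[of _ "U \<inter> V"] conjI allI impI smooth_on_add smooth_on_mult smooth_on_const)
      (auto intro: smooth_on_subset[OF _ Int_lower1] smooth_on_subset[OF _ Int_lower2])
qed

lemma sec_eq_iff:
  "sec_eq g A s F G \<longleftrightarrow> (\<forall>Z\<in>A. \<forall>vs. length vs = s \<longrightarrow> (\<forall>v\<in>set vs. bil g v Z = 0) \<longrightarrow>
     ev (F Z) vs = ev (G Z) vs)"
proof
  assume "\<forall>Z\<in>A. \<forall>vs. length vs = s \<longrightarrow> (\<forall>v\<in>set vs. bil g v Z = 0) \<longrightarrow> ev (F Z) vs = ev (G Z) vs"
  then show "sec_eq g A s F G"
    using N_nz[OF pos] by (intro sec_eq_evI) (simp_all add: N_def bil_sym[of "cj Z" Z for Z])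
qed (use sec_eq_evD in blast)

lemma sec_eq_refl [simp]: "sec_eq g A s F F"
  by (simp add: sec_eq_iff)

lemma sec_eq_sym: "sec_eq g A s F G \<Longrightarrow> sec_eq g A s G F"
  by (simp add: sec_eq_iff)

lemma sec_eq_trans: "sec_eq g A s F G \<Longrightarrow> sec_eq g A s G H \<Longrightarrow> sec_eq g A s F H"
  by (simp add: sec_eq_iff)

lemma sec_eq_pointwise:
  "(\<And>Z I. Z \<in> A \<Longrightarrow> length I = s \<Longrightarrow> F Z I = G Z I) \<Longrightarrow> sec_eq g A s F G"
  unfolding sec_eq_iff by (auto intro!: ev_cong)

lemma sec_eq_snocI:
  assumes "\<And>Z vs v. Z \<in> A \<Longrightarrow> length vs = s \<Longrightarrow> \<forall>v\<in>set vs. bil g v Z = 0 \<Longrightarrow> bil g v Z = 0 \<Longrightarrow>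
      ev (F Z) (vs @ [v]) = ev (G Z) (vs @ [v])"
  shows "sec_eq g A (s + 1) F G"
  unfolding sec_eq_iff
proof (intro ballI allI impI)
  fix Z vs assume *: "Z \<in> A" "length vs = s + 1" "\<forall>v\<in>set vs. bil g v Z = 0"
  have "vs \<noteq> []" using *(2) by auto
  then have vs: "vs = butlast vs @ [last vs]" by simp
  have "\<forall>v\<in>set (butlast vs). bil g v Z = 0" "bil g (last vs) Z = 0"
    using *(3) \<open>vs \<noteq> []\<close> by (auto dest: in_set_butlastD)
  then show "ev (F Z) vs = ev (G Z) vs"
    using assms[OF *(1), of "butlast vs" "last vs"] *(2) vs by simp
qed

lemma diff_ev_pip:
  "difrep s F \<Longrightarrow> Z \<in> A \<Longrightarrow> length vs = s \<Longrightarrow> (\<lambda>W. ev (F W) (map (\<lambda>x. pip W (h x)) vs)) differentiable (at Z)"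
  by (rule diff_evf) (auto simp: difrep_def intro: vdiff_pip pos)

lemma sec_eq_pip:
  "sec_eq g A s F G \<Longrightarrow> W \<in> A \<Longrightarrow> length vs = s \<Longrightarrow>
    ev (F W) (map (\<lambda>x. pip W (h x)) vs) = ev (G W) (map (\<lambda>x. pip W (h x)) vs)"
  by (rule sec_eq_evD) (auto intro: pip_orth pos)

lemma ev_lower_A:
  "difrep s F \<Longrightarrow> Z \<in> A \<Longrightarrow> length vs = s \<Longrightarrow>
    ev (lower g F Z) (vs @ [v]) = N Z / 2 * deebar (\<lambda>W. ev (F W) vs) (cj (pih Z v)) Z"
  by (rule ev_lower) (auto simp: difrep_def pos)

lemma ev_raise_A:
  "difrep s F \<Longrightarrow> Z \<in> A \<Longrightarrow> length vs = s \<Longrightarrow>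
    ev (raise g k F Z) (vs @ [v]) = (N Z / 2) powi (- k) *
      dee (\<lambda>W. (N W / 2) powi k * ev (F W) (map (\<lambda>x. pip W (pih Z x)) vs)) v Z"
  by (rule ev_raise) (auto simp: difrep_def pos)

text \<open>On the moving tangent frame the two representatives agree along the whole cone, and the
  direction \<open>cj (pih Z v)\<close> of differentiation is tangent to the cone by
  \<open>orth_pih\<close>.\<close>

lemma lower_sec_eq:
  assumes F: "difrep s F" and G: "difrep s G" and eq: "sec_eq g A s F G"
  shows "sec_eq g A (s + 1) (lower g F) (lower g G)"
proof (rule sec_eq_snocI)
  fix Z v and vs :: "(complex^'m) list" assume *: "Z \<in> A" "length vs = s" "\<forall>v\<in>set vs. bil g v Z = 0"
  have mf: "deebar (\<lambda>W. ev (F W) (map (pip W) vs)) w Z = deebar (\<lambda>W. ev (F W) vs) w Z"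
    if "difrep s F" for F w
    using that * by (intro deebar_moving_frame pos) (auto simp: difrep_def)
  have "deebar (\<lambda>W. ev (F W) (map (pip W) vs)) (cj (pih Z v)) Z =
    deebar (\<lambda>W. ev (G W) (map (pip W) vs)) (cj (pih Z v)) Z"
    using diff_ev_pip[OF F *(1,2), of "\<lambda>x. x"] diff_ev_pip[OF G *(1,2), of "\<lambda>x. x"]
      sec_eq_pip[OF eq _ *(2), of _ "\<lambda>x. x"]
    by (intro tangent_eq orth_pih *) simp_all
  then show "ev (lower g F Z) (vs @ [v]) = ev (lower g G Z) (vs @ [v])"
    by (simp add: ev_lower_A[OF F *(1,2)] ev_lower_A[OF G *(1,2)] mf[OF F] mf[OF G])
qed

text \<open>Here the tangent frame \<open>pip W\<close> is part of the operator, and the direction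
  of differentiation is the tested vector \<open>v\<close> itself.\<close>

lemma raise_sec_eq:
  assumes F: "difrep s F" and G: "difrep s G" and eq: "sec_eq g A s F G"
  shows "sec_eq g A (s + 1) (raise g k F) (raise g k G)"
proof (rule sec_eq_snocI)
  fix Z v and vs :: "(complex^'m) list" assume *: "Z \<in> A" "length vs = s" and v: "bil g v Z = 0"
  have "dee (\<lambda>W. (N W / 2) powi k * ev (F W) (map (\<lambda>x. pip W (pih Z x)) vs)) v Z =
    dee (\<lambda>W. (N W / 2) powi k * ev (G W) (map (\<lambda>x. pip W (pih Z x)) vs)) v Z"
    by (intro tangent_eq(1) * v differentiable_mult diff_Npowi pos diff_ev_pip[OF F] diff_ev_pip[OF G])
      (simp add: sec_eq_pip[OF eq _ *(2)])
  then show "ev (raise g k F Z) (vs @ [v]) = ev (raise g k G Z) (vs @ [v])"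
    by (simp add: ev_raise_A[OF F *] ev_raise_A[OF G *])
qed

lemma difrep_ev: "difrep s F \<Longrightarrow> Z \<in> A \<Longrightarrow> length vs = s \<Longrightarrow> (\<lambda>W. ev (F W) vs) differentiable (at Z)"
  by (rule diff_ev_const) (auto simp: difrep_def)

lemma difrep_comb:
  "difrep s F \<Longrightarrow> difrep s G \<Longrightarrow> difrep s (\<lambda>Z I. a * F Z I + b * G Z I)"
  by (auto simp: difrep_def)

lemma lower_comb:
  assumes F: "difrep s F" and G: "difrep s G"
  shows "sec_eq g A (s + 1) (lower g (\<lambda>Z I. a * F Z I + b * G Z I))
    (\<lambda>Z I. a * lower g F Z I + b * lower g G Z I)"
proof (rule sec_eq_snocI)
  fix Z v and vs :: "(complex^'m) list" assume *: "Z \<in> A" "length vs = s"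
  show "ev (lower g (\<lambda>Z I. a * F Z I + b * G Z I) Z) (vs @ [v]) =
    ev (\<lambda>I. a * lower g F Z I + b * lower g G Z I) (vs @ [v])"
    using difrep_ev[OF F *] difrep_ev[OF G *]
    by (simp add: ev_lower_A[OF difrep_comb[OF F G] *] ev_add ev_scale ev_lower_A[OF F *]
      ev_lower_A[OF G *] deebar.add deebar.cmult differentiable_mult algebra_simps)
qed

lemma raise_comb:
  assumes F: "difrep s F" and G: "difrep s G"
  shows "sec_eq g A (s + 1) (raise g k (\<lambda>Z I. a * F Z I + b * G Z I))
    (\<lambda>Z I. a * raise g k F Z I + b * raise g k G Z I)"
proof (rule sec_eq_snocI)
  fix Z v and vs :: "(complex^'m) list" assume *: "Z \<in> A" "length vs = s"
  let ?u = "\<lambda>F W. (N W / 2) powi k * ev (F W) (map (\<lambda>x. pip W (pih Z x)) vs)"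
  have d: "?u F differentiable (at Z)" "?u G differentiable (at Z)"
    by (intro * differentiable_mult diff_Npowi pos diff_ev_pip[OF F] diff_ev_pip[OF G])+
  have "?u (\<lambda>Z I. a * F Z I + b * G Z I) = (\<lambda>W. a * ?u F W + b * ?u G W)"
    by (simp add: fun_eq_iff ev_add ev_scale algebra_simps)
  then show "ev (raise g k (\<lambda>Z I. a * F Z I + b * G Z I) Z) (vs @ [v]) =
    ev (\<lambda>I. a * raise g k F Z I + b * raise g k G Z I) (vs @ [v])"
    using d
    by (simp add: ev_raise_A[OF difrep_comb[OF F G] *] ev_add ev_scale ev_raise_A[OF F *]
      ev_raise_A[OF G *] dee.add dee.cmult differentiable_mult distrib_left mult.left_commute)
qed

lemma difrep_tensor:
  "difrep s F \<Longrightarrow> difrep t G \<Longrightarrow> difrep (s + t) (tensor s F G)"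
  by (auto simp: difrep_def tensor_def intro!: differentiable_mult)

lemma split_list_length: "length vs = s + t \<Longrightarrow> \<exists>us ws. vs = us @ ws \<and> length us = s \<and> length ws = t"
  by (rule exI[of _ "take s vs"], rule exI[of _ "drop s vs"]) simp

lemma lower_tensor:
  assumes F: "difrep s F" and G: "difrep t G"
  shows "sec_eq g A (s + t + 1) (lower g (tensor s F G))
    (\<lambda>Z I. move_last s (tensor (s + 1) (lower g F) G) Z I + tensor s F (lower g G) Z I)"
proof (rule sec_eq_snocI)
  fix Z v and vs' :: "(complex^'m) list" assume Z: "Z \<in> A" and vs': "length vs' = s + t"
  obtain vs ws where vs: "vs' = vs @ ws" "length vs = s" "length ws = t"
    using split_list_length[OF vs'] by blast
  have F1: "ev (tensor (s + 1) (lower g F) G Z) ((vs @ [v]) @ ws) = ev (lower g F Z) (vs @ [v]) * ev (G Z) ws"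
    using vs by (intro ev_tensor_mdiff) simp
  have G1: "ev (tensor s F (lower g G) Z) (vs @ (ws @ [v])) = ev (F Z) vs * ev (lower g G Z) (ws @ [v])"
    using vs by (intro ev_tensor_mdiff) simp
  have "ev (lower g (tensor s F G) Z) (vs' @ [v]) =
      N Z / 2 * deebar (\<lambda>W. ev (F W) vs * ev (G W) ws) (cj (pih Z v)) Z"
    using vs by (subst ev_lower_A[OF difrep_tensor[OF F G] Z vs']) (simp add: ev_tensor_mdiff)
  also have "\<dots> = ev (lower g F Z) (vs @ [v]) * ev (G Z) ws + ev (F Z) vs * ev (lower g G Z) (ws @ [v])"
    using difrep_ev[OF F Z vs(2)] difrep_ev[OF G Z vs(3)]
    by (simp add: deebar.mult ev_lower_A[OF F Z vs(2)] ev_lower_A[OF G Z vs(3)] algebra_simps)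
  also have "\<dots> = ev (\<lambda>I. move_last s (tensor (s + 1) (lower g F) G) Z I + tensor s F (lower g G) Z I) (vs' @ [v])"
    using F1 G1 vs by (simp add: ev_add ev_move_last)
  finally show "ev (lower g (tensor s F G) Z) (vs' @ [v]) =
    ev (\<lambda>I. move_last s (tensor (s + 1) (lower g F) G) Z I + tensor s F (lower g G) Z I) (vs' @ [v])" .
qed

lemma powi_add_N: "nsq g W > 0 \<Longrightarrow> (N W / 2) powi (k + l) = (N W / 2) powi k * (N W / 2) powi l"
  using N_nz[of W] by (simp add: power_int_add)

lemma powi_cancel_N: "nsq g W > 0 \<Longrightarrow> (N W / 2) powi (- k) * (N W / 2) powi k = 1"
  using powi_add_N[of W "- k" k] by simp

lemma split_slot:
  "ev (F Z) vs = ev (F Z) (map (pih Z) vs) +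
    (\<Sum>r<length vs. (bil g (vs ! r) (cj Z) / N Z) * ev (F Z) (map (pih Z) (take r vs) @ Z # drop (Suc r) vs))"
  by (rule ev_telescope) (simp add: pih_def)

text \<open>The contraction conditions of \<open>is_section\<close> as conditions on the class: the
  remaining arguments are taken tangent.\<close>

definition euler :: "nat \<Rightarrow> 'm mdiff \<Rightarrow> bool" where
  "euler s F \<longleftrightarrow> (\<forall>Z\<in>A. \<forall>xs ys. length xs + length ys + 1 = s \<longrightarrow>
     (\<forall>v\<in>set (xs @ ys). bil g v Z = 0) \<longrightarrow> ev (F Z) (xs @ Z # ys) = 0)"

lemma orth_pih_tangent: "Z \<in> A \<Longrightarrow> bil g v Z = 0 \<Longrightarrow> bil g (pih Z v) Z = 0"
  by (simp add: pih_def bil_lin quad)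

text \<open>The projection \<open>pih\<close> changes arguments only by multiples of
  \<open>Z\<close>, which the contraction conditions ignore. It gives the value at the base point of
  the function that \<open>raise\<close> differentiates.\<close>

lemma euler_pih:
  assumes F: "euler s F" and Z: "Z \<in> A" and vs: "length vs = s" "\<forall>v\<in>set vs. bil g v Z = 0"
  shows "ev (F Z) (map (\<lambda>x. pip Z (pih Z x)) vs) = ev (F Z) vs"
proof -
  have "ev (F Z) (map (pih Z) (take r vs) @ Z # drop (Suc r) vs) = 0" if "r < length vs" for r
    using that vs Z
    by (intro F[unfolded euler_def, rule_format, OF Z])
      (auto intro!: orth_pih_tangent dest: in_set_takeD in_set_dropD)
  then have "ev (F Z) vs = ev (F Z) (map (pih Z) vs)"
    by (subst split_slot) simp
  moreover have "map (\<lambda>x. pip Z (pih Z x)) vs = map (pih Z) vs"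
    using vs by (intro map_cong refl pip_fix orth_pih_tangent[OF Z]) simp
  ultimately show ?thesis by (simp only:)
qed

text \<open>The powers of the norm multiply, so the differentiated function is a product. Its
  undifferentiated factor is evaluated on projected vectors; that this factor is \<open>F\<close> or
  \<open>G\<close> itself is \<open>euler_pih\<close>, hence the contraction assumptions.\<close>

lemma raise_tensor:
  assumes F: "difrep s F" "euler s F" and G: "difrep t G" "euler t G"
  shows "sec_eq g A (s + t + 1) (raise g (k + l) (tensor s F G))
    (\<lambda>Z I. move_last s (tensor (s + 1) (raise g k F) G) Z I + tensor s F (raise g l G) Z I)"
proof (rule sec_eq_snocI)
  fix Z v and vs' :: "(complex^'m) list"
  assume Z: "Z \<in> A" and vs': "length vs' = s + t" and orth: "\<forall>v\<in>set vs'. bil g v Z = 0"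
  obtain vs ws where vs: "vs' = vs @ ws" "length vs = s" "length ws = t"
    using split_list_length[OF vs'] by blast
  let ?a = "\<lambda>W. (N W / 2) powi k"
  let ?b = "\<lambda>W. (N W / 2) powi l"
  let ?f = "\<lambda>W. ?a W * ev (F W) (map (\<lambda>x. pip W (pih Z x)) vs)"
  let ?h = "\<lambda>W. ?b W * ev (G W) (map (\<lambda>x. pip W (pih Z x)) ws)"
  have d: "?f differentiable (at Z)" "?h differentiable (at Z)"
    by (intro Z vs differentiable_mult diff_Npowi pos diff_ev_pip[OF F(1)] diff_ev_pip[OF G(1)])+
  have F1: "ev (tensor (s + 1) (raise g k F) G Z) ((vs @ [v]) @ ws) = ev (raise g k F Z) (vs @ [v]) * ev (G Z) ws"
    using vs by (intro ev_tensor_mdiff) simp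
  have G1: "ev (tensor s F (raise g l G) Z) (vs @ (ws @ [v])) = ev (F Z) vs * ev (raise g l G Z) (ws @ [v])"
    using vs by (intro ev_tensor_mdiff) simp
  have val: "?f Z = ?a Z * ev (F Z) vs" "?h Z = ?b Z * ev (G Z) ws"
    using orth vs by (simp_all add: euler_pih[OF F(2) Z] euler_pih[OF G(2) Z])
  have pc: "(N Z / 2) powi (- k) * ?a Z = 1" "(N Z / 2) powi (- l) * ?b Z = 1"
    by (rule powi_cancel_N[OF pos[OF Z]])+
  have "ev (raise g (k + l) (tensor s F G) Z) (vs' @ [v]) =
      (N Z / 2) powi (- (k + l)) * dee (\<lambda>W. (N W / 2) powi (k + l) *
        (ev (F W) (map (\<lambda>x. pip W (pih Z x)) vs) * ev (G W) (map (\<lambda>x. pip W (pih Z x)) ws))) v Z"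
    using vs by (subst ev_raise_A[OF difrep_tensor[OF F(1) G(1)] Z vs']) (simp add: ev_tensor_mdiff)
  also have "dee (\<lambda>W. (N W / 2) powi (k + l) *
      (ev (F W) (map (\<lambda>x. pip W (pih Z x)) vs) * ev (G W) (map (\<lambda>x. pip W (pih Z x)) ws))) v Z =
      dee (\<lambda>W. ?f W * ?h W) v Z"
    by (rule dee.cong, rule eventually_mono[OF eventually_pos[OF pos[OF Z]]])
      (simp add: powi_add_N)
  also have "\<dots> = ?f Z * dee ?h v Z + dee ?f v Z * ?h Z"
    by (rule dee.mult[OF d])
  also have "(N Z / 2) powi (- (k + l)) = (N Z / 2) powi (- k) * (N Z / 2) powi (- l)"
    using powi_add_N[OF pos[OF Z], of "- k" "- l"] by simp
  also have "(N Z / 2) powi (- k) * (N Z / 2) powi (- l) * (?f Z * dee ?h v Z + dee ?f v Z * ?h Z) =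
      ((N Z / 2) powi (- k) * ?a Z) * (ev (F Z) vs * ((N Z / 2) powi (- l) * dee ?h v Z)) +
      ((N Z / 2) powi (- l) * ?b Z) * (((N Z / 2) powi (- k) * dee ?f v Z) * ev (G Z) ws)"
    unfolding val by (simp only: distrib_left mult_ac)
  also have "\<dots> = ev (F Z) vs * ((N Z / 2) powi (- l) * dee ?h v Z) +
      ((N Z / 2) powi (- k) * dee ?f v Z) * ev (G Z) ws"
    unfolding pc by simp
  also have "\<dots> = ev (\<lambda>I. move_last s (tensor (s + 1) (raise g k F) G) Z I + tensor s F (raise g l G) Z I) (vs' @ [v])"
    using F1 G1 vs by (simp add: ev_add ev_move_last ev_raise_A[OF F(1) Z] ev_raise_A[OF G(1) Z])
  finally show "ev (raise g (k + l) (tensor s F G) Z) (vs' @ [v]) =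
    ev (\<lambda>I. move_last s (tensor (s + 1) (raise g k F) G) Z I + tensor s F (raise g l G) Z I) (vs' @ [v])" .
qed

end

section \<open>Linear substitutions\<close>

lemma bounded_linear_complexI:
  fixes B :: "complex^'m \<Rightarrow> complex^'n"
  assumes "\<And>x y. B (x + y) = B x + B y" "\<And>c x. B (c *s x) = c *s B x"
  shows "bounded_linear B"
proof -
  have sc: "r *\<^sub>R x = complex_of_real r *s x" for r and x :: "complex^'k"
    by (simp add: vec_eq_iff complex_eq_iff)
  show ?thesis
    unfolding linear_conv_bounded_linear[symmetric] using assms by (intro linearI) (simp_all add: sc)
qed

lemma dee_linear_chain:
  fixes B :: "complex^'m \<Rightarrow> complex^'m"
  assumes B: "\<And>x y. B (x + y) = B x + B y" "\<And>c x. B (c *s x) = c *s B x"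
    and f: "f differentiable (at (B Z))"
  shows "dee (\<lambda>W. f (B W)) v Z = dee f (B v) (B Z)"
    and "deebar (\<lambda>W. f (B W)) v Z = deebar f (B v) (B Z)"
    and "(\<lambda>W. f (B W)) differentiable (at Z)"
proof -
  have *: "(B has_derivative B) (at Z)"
    using B by (intro bounded_linear_imp_has_derivative bounded_linear_complexI)
  show "dee (\<lambda>W. f (B W)) v Z = dee f (B v) (B Z)" "deebar (\<lambda>W. f (B W)) v Z = deebar f (B v) (B Z)"
    by (rule dee_chain[OF * B(2) f])+
  show "(\<lambda>W. f (B W)) differentiable (at Z)"
    using f has_derivative_compose[OF *] unfolding differentiable_def by blast
qed

text \<open>On basis vectors the claim is an identity of integers; bilinear expansion extends it to
  complex vectors.\<close>

lemma bil_cmat: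
  assumes "\<forall>x y. bil g (M *v x) (M *v y) = bil g x y"
  shows "bil g (cmat M *v x) (cmat M *v y) = bil g x (y :: complex^'m)"
proof -
  have ax: "cmat M *v axis i 1 = vmap of_int (M *v axis i (1::int))" for i
    by (simp add: vec_eq_iff vmap_def matrix_vector_mult_def cmat_def map_matrix_def axis_def
        if_distrib[of "\<lambda>x. _ * x"] cong: if_cong)
  have of_int: "bil g (vmap of_int x) (vmap of_int y) = (of_int (bil g x y) :: complex)" for x y :: "int^'m"
    by (simp add: bil_def vmap_def)
  have e: "bil g (cmat M *v axis i 1) (cmat M *v axis j 1) = bil g (axis i 1) (axis j (1::complex))" for i j
    using assms by (simp add: ax of_int bil_axis_axis)
  have exp: "cmat M *v x = (\<Sum>i\<in>UNIV. x $ i *s (cmat M *v axis i 1))" for x :: "complex^'m"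
  proof -
    have "cmat M *v (\<Sum>i\<in>UNIV. x $ i *s axis i 1) = (\<Sum>i\<in>UNIV. x $ i *s (cmat M *v axis i 1))"
      by (simp only: vec.sum matrix_vector_mult_scaleR vec.scale)
    then show ?thesis by (simp only: vec_axis_expand[symmetric])
  qed
  have b1: "bil g x y = (\<Sum>j\<in>UNIV. y $ j * (\<Sum>i\<in>UNIV. x $ i * bil g (axis i 1) (axis j 1)))"
  proof -
    have "bil g x y = bil g (\<Sum>i\<in>UNIV. x $ i *s axis i 1) (\<Sum>i\<in>UNIV. y $ i *s axis i 1)"
      by (rule arg_cong2[where f = "bil g", OF vec_axis_expand vec_axis_expand])
    then show ?thesis by (simp add: bil_sum_left bil_sum_right bil_scale_left bil_scale_right)
  qed
  have b2: "bil g (cmat M *v x) (cmat M *v y) =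
     (\<Sum>j\<in>UNIV. y $ j * (\<Sum>i\<in>UNIV. x $ i * bil g (cmat M *v axis i 1) (cmat M *v axis j 1)))"
  proof -
    have "bil g (cmat M *v x) (cmat M *v y) = bil g (\<Sum>i\<in>UNIV. x $ i *s (cmat M *v axis i 1))
      (\<Sum>i\<in>UNIV. y $ i *s (cmat M *v axis i 1))"
      by (rule arg_cong2[where f = "bil g", OF exp exp])
    then show ?thesis by (simp add: bil_sum_left bil_sum_right bil_scale_left bil_scale_right)
  qed
  show ?thesis by (simp only: b1 b2 e)
qed

lemma cj_cmat: "cj (cmat M *v x) = cmat M *v cj x"
  by (simp add: vec_eq_iff matrix_vector_mult_def cmat_def map_matrix_def)

section \<open>Homogeneity and contractions under the operators\<close>

context quad_cone
begin

definition homog :: "int \<Rightarrow> nat \<Rightarrow> 'm mdiff \<Rightarrow> bool" where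
  "homog k s F \<longleftrightarrow> (\<forall>c. c \<noteq> 0 \<longrightarrow> sec_eq g A s (\<lambda>Z. F (c *s Z)) (\<lambda>Z I. c powi (- k) * F Z I))"

lemma is_section_iff: "is_section g A k s F \<longleftrightarrow> smrep s F \<and> homog k s F \<and> euler s F"
proof -
  have "(\<forall>r<s. sec_eq g A (s - 1) (euler_contr r F) (\<lambda>_ _. 0)) \<longleftrightarrow> euler s F"
  proof
    assume *: "\<forall>r<s. sec_eq g A (s - 1) (euler_contr r F) (\<lambda>_ _. 0)"
    show "euler s F"
      unfolding euler_def
    proof (intro ballI allI impI)
      fix Z and xs ys :: "(complex^'m) list"
      assume Z: "Z \<in> A" and len: "length xs + length ys + 1 = s" and o: "\<forall>v\<in>set (xs @ ys). bil g v Z = 0"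
      have "ev (euler_contr (length xs) F Z) (xs @ ys) = ev (\<lambda>_. 0) (xs @ ys)"
        by (rule sec_eq_evD[OF *[rule_format]]) (use Z len o in auto)
      then show "ev (F Z) (xs @ Z # ys) = 0" by (simp add: ev_euler_contr)
    qed
  next
    assume F: "euler s F"
    show "\<forall>r<s. sec_eq g A (s - 1) (euler_contr r F) (\<lambda>_ _. 0)"
      unfolding sec_eq_iff
    proof (intro allI impI ballI)
      fix r Z and vs :: "(complex^'m) list"
      assume r: "r < s" and Z: "Z \<in> A" and len: "length vs = s - 1" and o: "\<forall>v\<in>set vs. bil g v Z = 0"
      have "ev (F Z) (take r vs @ Z # drop r vs) = 0"
        by (rule F[unfolded euler_def, rule_format, OF Z]) (use r len o in auto)
      then show "ev (euler_contr r F Z) vs = ev (\<lambda>_. 0) vs"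
        using r len by (simp add: ev_euler_contr)
    qed
  qed
  then show ?thesis by (auto simp: is_section_def smrep_iff homog_def)
qed

lemma homog_ev:
  "homog k s F \<Longrightarrow> c \<noteq> 0 \<Longrightarrow> Z \<in> A \<Longrightarrow> length vs = s \<Longrightarrow> \<forall>v\<in>set vs. bil g v Z = 0 \<Longrightarrow>
    ev (F (c *s Z)) vs = c powi (- k) * ev (F Z) vs"
  unfolding homog_def sec_eq_iff by (simp add: ev_scale)

lemma N_scale: "N (c *s Z) = c * cnj c * N Z"
  by (simp add: N_def cj_scale bil_lin)

lemma pih_scale: "c \<noteq> 0 \<Longrightarrow> pih (c *s Z) v = pih Z v"
  by (simp add: pih_def cj_scale bil_lin N_scale vec_eq_iff)

lemma pip_scale: "c \<noteq> 0 \<Longrightarrow> pip (c *s Z) v = pip Z v"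
  by (simp add: pip_def cj_scale bil_lin N_scale vec_eq_iff)

lemma scale_chain:
  fixes f :: "complex^'m \<Rightarrow> complex"
  assumes "f differentiable (at (c *s Z))"
  shows "dee (\<lambda>W. f (c *s W)) v Z = c * dee f v (c *s Z)"
    and "deebar (\<lambda>W. f (c *s W)) v Z = cnj c * deebar f v (c *s Z)"
    and "(\<lambda>W. f (c *s W)) differentiable (at Z)"
  using dee_linear_chain[where B = "\<lambda>W. c *s W", OF _ _ assms] dee_dir[OF assms]
  by (simp_all add: vector_add_ldistrib mult.commute)

lemma difrep_scale: "difrep s F \<Longrightarrow> c \<noteq> 0 \<Longrightarrow> difrep s (\<lambda>Z. F (c *s Z))"
  unfolding difrep_def using scale scale_chain(3) by blast

text \<open>The norm contributes \<open>c * cnj c\<close>, the chain rule for \<open>deebar\<close>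
  takes back \<open>cnj c\<close>, and the projections depend only on the line. The remaining factor
  \<open>c\<close> lowers the weight by one.\<close>

lemma lower_scale:
  assumes F: "difrep s F" and c: "c \<noteq> 0"
  shows "sec_eq g A (s + 1) (\<lambda>Z. lower g F (c *s Z)) (\<lambda>Z I. c * lower g (\<lambda>Z. F (c *s Z)) Z I)"
proof (rule sec_eq_snocI)
  fix Z v and vs :: "(complex^'m) list" assume *: "Z \<in> A" "length vs = s"
  have cZ: "c *s Z \<in> A" using scale * c by blast
  show "ev (lower g F (c *s Z)) (vs @ [v]) = ev (\<lambda>I. c * lower g (\<lambda>Z. F (c *s Z)) Z I) (vs @ [v])"
    using scale_chain(2)[OF difrep_ev[OF F cZ *(2)]]
    by (simp add: ev_scale ev_lower_A[OF F cZ *(2)] ev_lower_A[OF difrep_scale[OF F c] *] N_scale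
        pih_scale[OF c])
qed

text \<open>The two powers of the norm scale inversely to each other, so only the factor
  \<open>c\<close> from the chain rule for \<open>dee\<close> remains.\<close>

lemma raise_scale:
  assumes F: "difrep s F" and c: "c \<noteq> 0"
  shows "sec_eq g A (s + 1) (\<lambda>Z. raise g k F (c *s Z)) (\<lambda>Z I. inverse c * raise g k (\<lambda>Z. F (c *s Z)) Z I)"
proof (rule sec_eq_snocI)
  fix Z v and vs :: "(complex^'m) list" assume *: "Z \<in> A" "length vs = s"
  have cZ: "c *s Z \<in> A" using scale * c by blast
  define u where "u = (\<lambda>W. (N W / 2) powi k * ev (F W) (map (\<lambda>x. pip W (pih Z x)) vs))"
  have du: "u differentiable (at (c *s Z))"
    unfolding u_def by (intro differentiable_mult diff_Npowi pos cZ diff_ev_pip[OF F] *)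
  have "(N W / 2) powi k * ev (F (c *s W)) (map (\<lambda>x. pip W (pih Z x)) vs) =
      inverse ((c * cnj c) powi k) * u (c *s W)" for W
    using c by (simp add: u_def N_scale pip_scale power_int_mult_distrib power_int_divide_distrib field_simps)
  then have "dee (\<lambda>W. (N W / 2) powi k * ev (F (c *s W)) (map (\<lambda>x. pip W (pih Z x)) vs)) v Z =
      inverse ((c * cnj c) powi k) * (c * dee u v (c *s Z))"
    using scale_chain[OF du] by (simp add: dee.cmult)
  then have "ev (raise g k (\<lambda>Z. F (c *s Z)) Z) (vs @ [v]) =
      (N Z / 2) powi (- k) * inverse ((c * cnj c) powi k) * (c * dee u v (c *s Z))"
    by (simp add: ev_raise_A[OF difrep_scale[OF F c] *])
  moreover have "ev (raise g k F (c *s Z)) (vs @ [v]) = (N (c *s Z) / 2) powi (- k) * dee u v (c *s Z)"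
    by (simp add: ev_raise_A[OF F cZ *(2)] pih_scale[OF c] u_def)
  moreover have "(N (c *s Z) / 2) powi (- k) = (N Z / 2) powi (- k) * inverse ((c * cnj c) powi k)"
    using c by (simp add: N_scale power_int_mult_distrib power_int_divide_distrib power_int_minus field_simps)
  ultimately show "ev (raise g k F (c *s Z)) (vs @ [v]) =
      ev (\<lambda>I. inverse c * raise g k (\<lambda>Z. F (c *s Z)) Z I) (vs @ [v])"
    using c by (simp add: ev_scale)
qed

lemma sec_eq_cmult: "sec_eq g A s F G \<Longrightarrow> sec_eq g A s (\<lambda>Z I. c * F Z I) (\<lambda>Z I. c * G Z I)"
  by (simp add: sec_eq_iff ev_scale)

lemma lower_cmult: "difrep s F \<Longrightarrow> sec_eq g A (s + 1) (lower g (\<lambda>Z I. c * F Z I)) (\<lambda>Z I. c * lower g F Z I)"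
  using lower_comb[of s F F c 0] by simp

lemma raise_cmult: "difrep s F \<Longrightarrow> sec_eq g A (s + 1) (raise g k (\<lambda>Z I. c * F Z I)) (\<lambda>Z I. c * raise g k F Z I)"
  using raise_comb[of s F F k c 0] by simp

lemma difrep_cmult: "difrep s F \<Longrightarrow> difrep s (\<lambda>Z I. c * F Z I)"
  using difrep_comb[of s F F c 0] by simp

lemma lower_homog:
  assumes F: "difrep s F" and h: "homog k s F"
  shows "homog (k - 1) (s + 1) (lower g F)"
  unfolding homog_def
proof (intro allI impI)
  fix c :: complex assume c: "c \<noteq> 0"
  have "sec_eq g A (s + 1) (lower g (\<lambda>Z. F (c *s Z))) (lower g (\<lambda>Z I. c powi (- k) * F Z I))"
    using h c by (intro lower_sec_eq difrep_scale difrep_cmult F) (auto simp: homog_def)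
  from sec_eq_trans[OF this lower_cmult[OF F]]
  have "sec_eq g A (s + 1) (\<lambda>Z I. c * lower g (\<lambda>Z. F (c *s Z)) Z I)
     (\<lambda>Z I. c * (c powi (- k) * lower g F Z I))"
    by (rule sec_eq_cmult)
  moreover have "c * (c powi (- k) * x) = c powi (- (k - 1)) * x" for x
    using c power_int_add[of c 1 "- k"] by (simp add: add.commute)
  ultimately show "sec_eq g A (s + 1) (\<lambda>Z. lower g F (c *s Z)) (\<lambda>Z I. c powi (- (k - 1)) * lower g F Z I)"
    using sec_eq_trans[OF lower_scale[OF F c]] by simp
qed

lemma raise_homog:
  assumes F: "difrep s F" and h: "homog k s F"
  shows "homog (k + 1) (s + 1) (raise g k F)"
  unfolding homog_def
proof (intro allI impI)
  fix c :: complex assume c: "c \<noteq> 0"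
  have "sec_eq g A (s + 1) (raise g k (\<lambda>Z. F (c *s Z))) (raise g k (\<lambda>Z I. c powi (- k) * F Z I))"
    using h c by (intro raise_sec_eq difrep_scale difrep_cmult F) (auto simp: homog_def)
  from sec_eq_trans[OF this raise_cmult[OF F]]
  have "sec_eq g A (s + 1) (\<lambda>Z I. inverse c * raise g k (\<lambda>Z. F (c *s Z)) Z I)
     (\<lambda>Z I. inverse c * (c powi (- k) * raise g k F Z I))"
    by (rule sec_eq_cmult)
  moreover have "inverse c * (c powi (- k) * x) = c powi (- (k + 1)) * x" for x
    using c power_int_add[of c "- k" "- 1"] by (simp add: power_int_minus)
  ultimately show "sec_eq g A (s + 1) (\<lambda>Z. raise g k F (c *s Z)) (\<lambda>Z I. c powi (- (k + 1)) * raise g k F Z I)"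
    using sec_eq_trans[OF raise_scale[OF F c]] by simp
qed

text \<open>In the last slot \<open>pih Z Z\<close> is zero. In any other slot the fixed
  \<open>Z\<close> is replaced by the moving point, a holomorphic field, and the remaining vectors
  by their \<open>pip W\<close>. None of these has an antiholomorphic derivative at
  \<open>Z\<close>, and the new function vanishes along the cone.\<close>

lemma lower_euler:
  assumes F: "difrep s F" and e: "euler s F"
  shows "euler (s + 1) (lower g F)"
  unfolding euler_def
proof (intro ballI allI impI)
  fix Z and xs ys :: "(complex^'m) list"
  assume Z: "Z \<in> A" and len: "length xs + length ys + 1 = s + 1" and o: "\<forall>v\<in>set (xs @ ys). bil g v Z = 0"
  show "ev (lower g F Z) (xs @ Z # ys) = 0"
  proof (cases ys rule: rev_cases)
    case Nil
    with len have xs: "length xs = s" by simp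
    have "deebar (\<lambda>W. ev (F W) xs) 0 Z = 0"
      using dee_dir(4)[OF difrep_ev[OF F Z xs], of 0 0] by simp
    then show ?thesis
      using Nil by (simp add: ev_lower_A[OF F Z xs] pih_self[OF pos[OF Z]])
  next
    case (snoc ys' v)
    let ?L = "map (\<lambda>v W. pip W v) xs @ (\<lambda>W. W) # map (\<lambda>v W. pip W v) ys'"
    have len': "length ?L = s" "length (xs @ Z # ys') = s" using len snoc by auto
    have fixeq: "map (\<lambda>x. x Z) ?L = xs @ Z # ys'"
      using o snoc by (auto intro!: map_idI pip_fix)
    have vd: "vdiff Z x" if "x \<in> set ?L" for x
      using that by (auto intro: vdiff_pip pos Z)
    have dL: "(\<lambda>W. ev (F W) (map (\<lambda>x. x W) ?L)) differentiable (at Z)"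
      by (rule diff_ev) (use F Z len' vd in \<open>auto simp: difrep_def\<close>)
    have "deebar (\<lambda>W. ev (F W) (xs @ Z # ys')) w Z = deebar (\<lambda>W. ev (F W) (map (\<lambda>x. x W) ?L)) w Z" for w
      unfolding fixeq[symmetric]
      by (rule deebar_frame[symmetric])
        (use F Z len' vd o snoc in \<open>auto simp: difrep_def deebar_pip[OF pos[OF Z]]\<close>)
    moreover have "ev (F W) (map (\<lambda>x. x W) ?L) = 0" if W: "W \<in> A" for W
    proof -
      have "ev (F W) (map (pip W) xs @ W # map (pip W) ys') = 0"
        by (rule e[unfolded euler_def, rule_format, OF W]) (use len snoc W in \<open>auto simp: pip_orth pos\<close>)
      then show ?thesis by (simp add: o_def)
    qed
    ultimately have "deebar (\<lambda>W. ev (F W) (xs @ Z # ys')) (cj (pih Z v)) Z = 0"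
      using tangent_zero(2)[OF Z orth_pih[OF Z] dL] by simp
    then show ?thesis
      using ev_lower_A[OF F Z len'(2), of v] snoc by simp
  qed
qed

text \<open>In an old slot \<open>pih Z Z\<close> is zero. In the new slot the weight enters: the
  power of the norm turns homogeneity of weight \<open>k\<close> into an antiholomorphic dependence
  on the scaling parameter, which \<open>dee\<close> annihilates.\<close>

lemma raise_euler:
  assumes F: "difrep s F" and h: "homog k s F"
  shows "euler (s + 1) (raise g k F)"
  unfolding euler_def
proof (intro ballI allI impI)
  fix Z and xs ys :: "(complex^'m) list"
  assume Z: "Z \<in> A" and len: "length xs + length ys + 1 = s + 1" and o: "\<forall>v\<in>set (xs @ ys). bil g v Z = 0"
  show "ev (raise g k F Z) (xs @ Z # ys) = 0"
  proof (cases ys rule: rev_cases)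
    case Nil
    with len have xs: "length xs = s" by simp
    define u where "u = (\<lambda>W. (N W / 2) powi k * ev (F W) (map (\<lambda>x. pip W (pih Z x)) xs))"
    \<comment> \<open>An antiholomorphic function on the whole space that takes the value
      \<open>cnj c\<close> at \<open>c *s Z\<close>; its \<open>k\<close>-th power reproduces
      \<open>u\<close> on the line, up to the constant \<open>u Z\<close>.\<close>
    define l where "l = (\<lambda>W. bil g Z (cj W) / N Z)"
    have nz: "N Z \<noteq> 0" using N_nz pos Z by blast
    have lZ: "l Z = 1" using nz by (simp add: l_def N_def)
    have du: "u differentiable (at Z)"
      unfolding u_def by (intro differentiable_mult diff_Npowi pos Z diff_ev_pip[OF F] xs)
    have dl: "l differentiable (at Z)"
      unfolding l_def by (intro differentiable_divide diff_bil vdiff_const vdiff_cj nz differentiable_const)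
    have dpl: "(\<lambda>W. l W powi k) differentiable (at Z)"
      using diff_powi[OF dl] lZ by simp
    have scal: "u (c *s Z) - u Z * l (c *s Z) powi k = 0" if c: "c \<noteq> 0" for c
    proof -
      have "ev (F (c *s Z)) (map (\<lambda>x. pip Z (pih Z x)) xs) =
          c powi (- k) * ev (F Z) (map (\<lambda>x. pip Z (pih Z x)) xs)"
        by (rule homog_ev[OF h c Z]) (use xs Z in \<open>auto simp: pip_orth pos\<close>)
      then have "u (c *s Z) = (c * cnj c) powi k * c powi (- k) * u Z"
        using c by (simp add: u_def N_scale pip_scale power_int_mult_distrib power_int_divide_distrib)
      also have "(c * cnj c) powi k * c powi (- k) = cnj c powi k"
        using c by (simp add: power_int_mult_distrib power_int_minus)
      also have "cnj c = l (c *s Z)" using nz by (simp add: l_def cj_scale bil_lin N_def)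
      finally show ?thesis by simp
    qed
    have "dee (\<lambda>W. u W - u Z * l W powi k) Z Z = 0"
      by (rule line_derivative_zero(1)) (use du dpl scal in auto)
    moreover have "dee l Z Z = 0"
      unfolding l_def using nz
      by (subst dee.divide) (auto simp: diff_bil dee.bil)
    then have "dee (\<lambda>W. l W powi k) Z Z = 0"
      using dee.powi[OF dl] lZ by simp
    ultimately have "dee u Z Z = 0"
      using du dpl by (simp add: dee.diff dee.cmult)
    then show ?thesis
      using Nil by (simp add: ev_raise_A[OF F Z xs] u_def)
  next
    case (snoc ys' v)
    have len': "length (xs @ Z # ys') = s" using len snoc by auto
    have "pip W (pih Z Z) = 0" for W
      by (simp add: pih_self[OF pos[OF Z]] pip_def)
    then have "ev (raise g k F Z) ((xs @ Z # ys') @ [v]) = 0"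
      by (simp add: ev_raise_A[OF F Z len'] del: append_assoc)
    then show ?thesis using snoc by simp
  qed
qed

lemma is_section_lower: "is_section g A k s F \<Longrightarrow> is_section g A (k - 1) (s + 1) (lower g F)"
  unfolding is_section_iff using smrep_lower lower_homog lower_euler smrep_difrep by blast

lemma is_section_raise: "is_section g A k s F \<Longrightarrow> is_section g A (k + 1) (s + 1) (raise g k F)"
  unfolding is_section_iff using smrep_raise raise_homog raise_euler smrep_difrep by blast

section \<open>Equivariance under isometries of the lattice\<close>

context
  fixes M :: "int^'m^'m"
  assumes M: "\<forall>x y. bil g (M *v x) (M *v y) = bil g x y"
    and MA: "\<And>Z. Z \<in> A \<Longrightarrow> cmat M *v Z \<in> A"
begin

lemma N_cmat: "N (cmat M *v Z) = N Z"
  by (simp add: N_def cj_cmat bil_cmat[OF M])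

lemma pih_cmat: "pih (cmat M *v Z) (cmat M *v v) = cmat M *v pih Z v"
  by (simp add: pih_def cj_cmat bil_cmat[OF M] N_cmat vec.diff vec.scale)

lemma pip_cmat: "pip (cmat M *v Z) (cmat M *v v) = cmat M *v pip Z v"
  by (simp add: pip_def cj_cmat bil_cmat[OF M] N_cmat vec.diff vec.scale)

lemma cmat_chain:
  fixes f :: "complex^'m \<Rightarrow> complex"
  assumes "f differentiable (at (cmat M *v Z))"
  shows "dee (\<lambda>W. f (cmat M *v W)) v Z = dee f (cmat M *v v) (cmat M *v Z)"
    and "deebar (\<lambda>W. f (cmat M *v W)) v Z = deebar f (cmat M *v v) (cmat M *v Z)"
    and "(\<lambda>W. f (cmat M *v W)) differentiable (at Z)"
  using dee_linear_chain[where B = "(*v) (cmat M)", OF vec.add vec.scale assms] by simp_all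

lemma difrep_pull_mat: "difrep s F \<Longrightarrow> difrep s (pull_mat M F)"
proof -
  assume F: "difrep s F"
  have "(\<lambda>W. ev (F (cmat M *v W)) (map (\<lambda>j. \<chi> i. of_int (M $ i $ j)) I)) differentiable (at Z)"
    if "Z \<in> A" "length I = s" for Z I
    by (rule cmat_chain(3), rule difrep_ev[OF F]) (use that MA in auto)
  then show ?thesis by (simp add: difrep_def pull_mat_def subst_slots_ev)
qed

lemma lower_pull_mat:
  assumes F: "difrep s F"
  shows "sec_eq g A (s + 1) (lower g (pull_mat M F)) (pull_mat M (lower g F))"
proof (rule sec_eq_snocI)
  fix Z v and vs :: "(complex^'m) list" assume *: "Z \<in> A" "length vs = s"
  have len: "length (map (\<lambda>v. cmat M *v v) vs) = s" using * by simp
  show "ev (lower g (pull_mat M F) Z) (vs @ [v]) = ev (pull_mat M (lower g F) Z) (vs @ [v])"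
    using cmat_chain(2)[OF difrep_ev[OF F MA[OF *(1)] len]]
    by (simp add: ev_lower_A[OF difrep_pull_mat[OF F] *] ev_pull_mat ev_lower_A[OF F MA[OF *(1)] len]
        N_cmat pih_cmat cj_cmat)
qed

lemma raise_pull_mat:
  assumes F: "difrep s F"
  shows "sec_eq g A (s + 1) (raise g k (pull_mat M F)) (pull_mat M (raise g k F))"
proof (rule sec_eq_snocI)
  fix Z v and vs :: "(complex^'m) list" assume *: "Z \<in> A" "length vs = s"
  have len: "length (map (\<lambda>v. cmat M *v v) vs) = s" using * by simp
  define u where "u = (\<lambda>W. (N W / 2) powi k *
    ev (F W) (map (\<lambda>x. pip W (pih (cmat M *v Z) x)) (map (\<lambda>v. cmat M *v v) vs)))"
  have du: "u differentiable (at (cmat M *v Z))"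
    unfolding u_def by (intro differentiable_mult diff_Npowi pos MA * diff_ev_pip[OF F] len)
  have eq: "(\<lambda>W. (N W / 2) powi k * ev (pull_mat M F W) (map (\<lambda>x. pip W (pih Z x)) vs)) =
      (\<lambda>W. u (cmat M *v W))"
    by (simp add: fun_eq_iff u_def N_cmat ev_pull_mat o_def pih_cmat pip_cmat)
  have "ev (raise g k (pull_mat M F) Z) (vs @ [v]) = (N Z / 2) powi (- k) * dee (\<lambda>W. u (cmat M *v W)) v Z"
    by (simp only: ev_raise_A[OF difrep_pull_mat[OF F] *] eq)
  also have "\<dots> = (N (cmat M *v Z) / 2) powi (- k) * dee u (cmat M *v v) (cmat M *v Z)"
    by (simp only: cmat_chain(1)[OF du] N_cmat)
  also have "\<dots> = ev (raise g k F (cmat M *v Z)) (map (\<lambda>v. cmat M *v v) vs @ [cmat M *v v])"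
    by (simp only: ev_raise_A[OF F MA[OF *(1)] len] u_def)
  finally show "ev (raise g k (pull_mat M F) Z) (vs @ [v]) = ev (pull_mat M (raise g k F) Z) (vs @ [v])"
    by (simp add: ev_pull_mat)
qed

lemma invariant_lower:
  assumes F: "difrep s F" and inv: "sec_eq g A s (pull_mat M F) F"
  shows "sec_eq g A (s + 1) (pull_mat M (lower g F)) (lower g F)"
  using sec_eq_trans[OF sec_eq_sym[OF lower_pull_mat[OF F]] lower_sec_eq[OF difrep_pull_mat[OF F] F inv]] .

lemma invariant_raise:
  assumes F: "difrep s F" and inv: "sec_eq g A s (pull_mat M F) F"
  shows "sec_eq g A (s + 1) (pull_mat M (raise g k F)) (raise g k F)"
  using sec_eq_trans[OF sec_eq_sym[OF raise_pull_mat[OF F]] raise_sec_eq[OF difrep_pull_mat[OF F] F inv]] .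

end

end

section \<open>Permutations of slots and the right side of the commutator formula\<close>

lemma ev_as_sum: "ev T vs = (\<Sum>I | length I = length vs. T I * (\<Prod>r<length vs. vs ! r $ (I ! r)))"
proof -
  have "map (\<lambda>v. \<chi> i. v $ i) vs = vs" by simp
  then show ?thesis
    using subst_slots_ev[of "\<lambda>i v. v $ i" T vs] by (simp add: subst_slots_def)
qed

text \<open>Positions are counted from 0 here, while \<open>swap_slots\<close> counts tensor factors
  from 1.\<close>

definition lswap :: "nat \<Rightarrow> nat \<Rightarrow> 'a list \<Rightarrow> 'a list" where
  "lswap i j xs = xs[i := xs ! j, j := xs ! i]"

lemma length_lswap [simp]: "length (lswap i j xs) = length xs"
  by (simp add: lswap_def)

lemma nth_lswap:
  "i < length xs \<Longrightarrow> j < length xs \<Longrightarrow> r < length xs \<Longrightarrow> lswap i j xs ! r = xs ! (Transposition.transpose i j r)"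
  by (auto simp: lswap_def nth_list_update Transposition.transpose_def)

lemma lswap_lswap: "i < length xs \<Longrightarrow> j < length xs \<Longrightarrow> lswap i j (lswap i j xs) = xs"
  by (rule nth_equalityI) (auto simp: nth_lswap Transposition.transpose_def)

lemma set_lswap [simp]: "i < length xs \<Longrightarrow> j < length xs \<Longrightarrow> set (lswap i j xs) = set xs"
  by (simp add: lswap_def set_swap)

text \<open>The involution reindexes the sum over index lists, and the transposition reindexes the
  product over positions.\<close>

lemma ev_lswap:
  assumes "i < length vs" "j < length vs"
  shows "ev (\<lambda>I. T (lswap i j I)) vs = ev T (lswap i j vs)"
proof -
  let ?S = "{I :: 'a list. length I = length vs}"
  have bij: "bij_betw (lswap i j) ?S ?S"
    by (rule bij_betw_byWitness[where f' = "lswap i j"]) (use assms in \<open>auto simp: lswap_lswap\<close>)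
  have t: "Transposition.transpose i j r < length vs" if "r < length vs" for r
    using that assms by (auto simp: Transposition.transpose_def)
  have "(\<Prod>r<length vs. vs ! r $ (I ! r)) =
      (\<Prod>r<length vs. lswap i j vs ! r $ (lswap i j I ! r))" if "I \<in> ?S" for I
  proof -
    have "(\<Prod>r<length vs. lswap i j vs ! r $ (lswap i j I ! r)) =
      (\<Prod>r<length vs. vs ! (Transposition.transpose i j r) $ (I ! (Transposition.transpose i j r)))"
      using assms that by (intro prod.cong) (auto simp: nth_lswap)
    also have "\<dots> = (\<Prod>r<length vs. vs ! r $ (I ! r))"
      by (rule prod.reindex_bij_betw[where h = "Transposition.transpose i j"])
        (rule bij_betw_byWitness[where f' = "Transposition.transpose i j"], use t in auto)
    finally show ?thesis by simp
  qed
  then have "ev (\<lambda>I. T (lswap i j I)) vs =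
    (\<Sum>I\<in>?S. T (lswap i j I) * (\<Prod>r<length vs. lswap i j vs ! r $ (lswap i j I ! r)))"
    by (simp add: ev_as_sum)
  also have "\<dots> = (\<Sum>I\<in>?S. T I * (\<Prod>r<length vs. lswap i j vs ! r $ (I ! r)))"
    by (rule sum.reindex_bij_betw[OF bij])
  finally show ?thesis by (simp add: ev_as_sum)
qed

lemma swap_slots_lswap: "swap_slots i j F = (\<lambda>Z I. F Z (lswap (i - 1) (j - 1) I))"
  by (simp add: swap_slots_def lswap_def)

lemma ev_swap_slots:
  "1 \<le> i \<Longrightarrow> i \<le> length vs \<Longrightarrow> 1 \<le> j \<Longrightarrow> j \<le> length vs \<Longrightarrow>
    ev (swap_slots i j F Z) vs = ev (F Z) (lswap (i - 1) (j - 1) vs)"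
  by (simp add: swap_slots_lswap ev_lswap)

text \<open>On index lists of length \<open>s + 2\<close> this is the tensor product with the
  metric, see \<open>ins_g_tensor\<close>. On longer lists the metric stays in factors
  \<open>s + 1\<close> and \<open>s + 2\<close>, and \<open>G\<close> keeps its further slots behind
  them; this is the form required for iterated lowerings of \<open>F\<close>.\<close>

definition ins_g :: "int^'m^'m \<Rightarrow> nat \<Rightarrow> 'm mdiff \<Rightarrow> 'm mdiff" where
  "ins_g g s G = (\<lambda>Z I. of_int (g $ (I ! s) $ (I ! (s + 1))) * G Z (take s I @ drop (s + 2) I))"

text \<open>The right side of the commutator formula, for tensors that may have more than
  \<open>s\<close> slots; the interchanges concern only the first \<open>s\<close>.\<close>

definition comm_rhs :: "int^'m^'m \<Rightarrow> int \<Rightarrow> nat \<Rightarrow> 'm mdiff \<Rightarrow> 'm mdiff" where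
  "comm_rhs g k s G = (\<lambda>Z I. of_int k / 2 * ins_g g s G Z I +
     1 / 2 * (\<Sum>r = 1..s. swap_slots r (s + 1) (ins_g g s G) Z I - swap_slots r (s + 2) (ins_g g s G) Z I))"

lemma ev_bil: "ev (\<lambda>J. of_int (g $ (J ! 0) $ (J ! 1))) [a, b] = bil g a b"
  by (simp add: bil_def sum_distrib_left algebra_simps)

lemma ev_ins_g:
  assumes "s + 2 \<le> length L"
  shows "ev (ins_g g s G Z) L = bil g (L ! s) (L ! (s + 1)) * ev (G Z) (take s L @ drop (s + 2) L)"
proof -
  define vs a b ws where "vs = take s L" and "a = L ! s" and "b = L ! (s + 1)" and "ws = drop (s + 2) L"
  have L: "L = vs @ [a, b] @ ws"
    using assms unfolding vs_def a_def b_def ws_def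
    by (metis Cons_nth_drop_Suc Suc_eq_plus1 add_2_eq_Suc' append_Cons append_Nil append_take_drop_id
        le_Suc_eq less_le_trans lessI less_SucI add_Suc_right)
  have len: "length vs = s" using assms by (simp add: vs_def)
  have "ev (ins_g g s G Z) L = ev (\<lambda>I. ev (\<lambda>J. ev (\<lambda>K. of_int (g $ (J ! 0) $ (J ! 1)) * G Z (I @ K)) ws) [a, b]) vs"
    unfolding L ev_append[of _ vs] ev_append[of _ "[a, b]"]
    by (intro ev_cong) (simp add: ins_g_def len nth_append)
  also have "\<dots> = ev (\<lambda>I. ev (\<lambda>J. of_int (g $ (J ! 0) $ (J ! 1))) [a, b] * ev (\<lambda>K. G Z (I @ K)) ws) vs"
  proof (rule ev_cong)
    fix I
    have "ev (\<lambda>J. ev (\<lambda>K. of_int (g $ (J ! 0) $ (J ! 1)) * G Z (I @ K)) ws) [a, b] =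
       ev (\<lambda>J. ev (\<lambda>K. G Z (I @ K)) ws * of_int (g $ (J ! 0) $ (J ! 1))) [a, b]"
    proof (rule ev_cong)
      fix J :: "'a list"
      show "ev (\<lambda>K. of_int (g $ (J ! 0) $ (J ! 1)) * G Z (I @ K)) ws =
          ev (\<lambda>K. G Z (I @ K)) ws * of_int (g $ (J ! 0) $ (J ! 1))"
        unfolding ev_scale by (rule mult.commute)
    qed
    also have "\<dots> = ev (\<lambda>J. of_int (g $ (J ! 0) $ (J ! 1))) [a, b] * ev (\<lambda>K. G Z (I @ K)) ws"
      unfolding ev_scale by (rule mult.commute)
    finally show "ev (\<lambda>J. ev (\<lambda>K. of_int (g $ (J ! 0) $ (J ! 1)) * G Z (I @ K)) ws) [a, b] = \<dots>" .
  qed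
  also have "\<dots> = bil g a b * ev (G Z) (vs @ ws)"
    unfolding ev_scale ev_bil by (simp add: ev_append)
  finally show ?thesis by (simp add: vs_def a_def b_def ws_def)
qed

section \<open>The commutator of the two operators\<close>

context sym_form
begin

lemma dee_pip:
  assumes W: "nsq g W > 0"
  shows "dee.\<delta>v a W (\<lambda>X. pip X x) = (- (bil g x a / N W - bil g x W * bil g a (cj W) / (N W)\<^sup>2)) *s cj W"
proof -
  have d: "(\<lambda>W. bil g x W / N W) differentiable (at W)"
    by (intro differentiable_divide diff_bil vdiff_const vdiff_id diff_N N_nz W)
  have "dee (\<lambda>W. bil g x W / N W) a W = bil g x a / N W - bil g x W * bil g a (cj W) / (N W)\<^sup>2"
    using dee.divide[OF diff_bil[OF vdiff_const vdiff_id] diff_N N_nz[OF W]]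
    by (simp add: dee.bil dee_N)
  then show ?thesis
    unfolding pip_def using d
    by (subst dee.\<delta>v_diff) (auto simp: dee.\<delta>v_scale vdiff_scale vec_eq_iff)
qed

end

context quad_cone
begin

lemma deebar_pih:
  assumes Z: "Z \<in> A" and v: "bil g v (cj Z) = 0"
  shows "deebar.\<delta>v w Z (\<lambda>W. pih W v) = (- (bil g v (cj w) / N Z)) *s Z"
proof -
  have nz: "N Z \<noteq> 0" using N_nz pos Z by blast
  have d: "(\<lambda>W. bil g v (cj W) / N W) differentiable (at Z)"
    by (intro differentiable_divide diff_bil vdiff_const vdiff_cj diff_N nz)
  have "deebar (\<lambda>W. bil g v (cj W) / N W) w Z = bil g v (cj w) / N Z"
    using deebar.divide[OF diff_bil[OF vdiff_const vdiff_cj] diff_N nz] v by (simp add: deebar.bil)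
  then show ?thesis
    unfolding pih_def using v d
    by (subst deebar.\<delta>v_diff) (auto simp: deebar.\<delta>v_scale vdiff_scale vec_eq_iff)
qed

text \<open>The outer projection adds nothing to first order: \<open>bil g (pih W v) W\<close>
  vanishes at \<open>Z\<close>, and its antiholomorphic derivative is a multiple of <Z, Z>.\<close>

lemma deebar_pip_pih:
  assumes Z: "Z \<in> A" and v: "bil g v Z = 0" "bil g v (cj Z) = 0"
  shows "deebar.\<delta>v w Z (\<lambda>W. pip W (pih W v)) = (- (bil g v (cj w) / N Z)) *s Z"
proof -
  have nz: "N Z \<noteq> 0" and p: "nsq g Z > 0" using N_nz pos Z by blast+
  have vd: "vdiff Z (\<lambda>W. pih W v)" by (rule vdiff_pih[OF p vdiff_const])
  have pv: "pih Z v = v" using v by (simp add: pih_def)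
  have db: "(\<lambda>W. bil g (pih W v) W) differentiable (at Z)"
    by (rule diff_bil[OF vd vdiff_id])
  have d: "(\<lambda>W. bil g (pih W v) W / N W) differentiable (at Z)"
    by (intro differentiable_divide db diff_N nz)
  have "deebar (\<lambda>W. bil g (pih W v) W) w Z = 0"
    using deebar.bil[OF vd vdiff_id] by (simp add: deebar_pih[OF Z v(2)] bil_lin quad[OF Z])
  then have "deebar (\<lambda>W. bil g (pih W v) W / N W) w Z = 0"
    using deebar.divide[OF db diff_N nz] v by (simp add: pv)
  then show ?thesis
    unfolding pip_def using d vd v
    by (subst deebar.\<delta>v_diff) (auto simp: deebar.\<delta>v_scale vdiff_scale deebar_pih[OF Z] pv)
qed

text \<open>At \<open>Z\<close> all projections fix these vectors. Lowering after raising yields the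
  derivative of the weight factor, a mixed second derivative, and derivatives of the frame; raising
  after lowering yields the same mixed derivative and the part of the frame terms in which
  \<open>F\<close> is differentiated. What is left is either the right side or has both
  \<open>Z\<close> and \<open>cj Z\<close> in slots, and the latter terms cancel in pairs.\<close>

lemma commutator_orth:
  assumes sec: "is_section g A k s F" and Z: "Z \<in> A" and len: "length vs = s"
    and vs: "\<forall>v\<in>set vs. bil g v Z = 0 \<and> bil g v (cj Z) = 0"
    and a: "bil g a Z = 0" "bil g a (cj Z) = 0" and b: "bil g b Z = 0" "bil g b (cj Z) = 0"
  shows "ev (lower g (raise g k F) Z) (vs @ [a, b]) - ev (raise g (k - 1) (lower g F) Z) (vs @ [b, a]) =
    of_int k / 2 * bil g a b * ev (F Z) vs + 1 / 2 * (\<Sum>r<s. bil g (vs ! r) b * ev (F Z) (vs[r := a]) -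
       bil g (vs ! r) a * ev (F Z) (vs[r := b]))"
proof -
  have smF: "smrep s F" and hom: "homog k s F" and eul: "euler s F"
    using sec by (simp_all add: is_section_iff)
  have dF: "difrep s F" using smF by (rule smrep_difrep)
  obtain U where U: "open U" "A \<subseteq> U" "U \<subseteq> {Z. nsq g Z > 0}"
    and sm: "\<And>I. length I = s \<Longrightarrow> smooth_on U (\<lambda>Z. F Z I)"
    using smF unfolding smrep_def by blast
  have ZU: "Z \<in> U" using Z U by blast
  have evU: "eventually (\<lambda>W. W \<in> U) (nhds Z)" using U(1) ZU by (auto simp: eventually_nhds)
  have pU: "nsq g W > 0" if "W \<in> U" for W using that U(3) by auto
  have p: "nsq g Z > 0" and nz: "N Z \<noteq> 0" using pU[OF ZU] N_nz by auto
  have cjb: "bil g (cj b) (cj Z) = 0" "bil g Z (cj (cj b)) = 0"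
    using b by (simp_all add: bil_cnj[symmetric] bil_sym)
  have Zv: "bil g v Z = 0" "bil g v (cj Z) = 0" if "v \<in> set vs" for v using vs that by auto
  have Zr: "bil g (vs ! r) Z = 0" "bil g (vs ! r) (cj Z) = 0" if "r < s" for r
    using Zv[of "vs ! r"] that len by auto
  have pihb: "pih Z b = b" "pip Z b = b" using b by (simp_all add: pih_def pip_def)
  \<comment> \<open>\<open>q\<close> is the frame inside \<open>raise\<close> with both projections
    at the same point. \<open>c\<close> is the holomorphic derivative of the outer projection in
    direction \<open>a\<close>, with the inner one frozen.\<close>
  define q where "q = (\<lambda>v W. pip W (pih W v))"
  define \<kappa> where "\<kappa> = (\<lambda>v W. bil g (pih W v) a / N W - bil g (pih W v) W * bil g a (cj W) / (N W)\<^sup>2)"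
  define c where "c = (\<lambda>v W. (- \<kappa> v W) *s cj W)"
  define G where "G = (\<lambda>W I. dee (\<lambda>X. F X I) a W)"
  define H where "H = (\<lambda>W J. deebar (\<lambda>X. F X (butlast J)) (axis (last J) 1) W)"
  define w where "w = cj b"
  have qZ: "q v Z = v" if "v \<in> set vs" for v
    using Zv[OF that] by (simp add: q_def pih_def pip_def)
  have mqZ: "map (\<lambda>v. q v Z) vs = vs" using qZ by (intro map_idI)
  have mpZ: "map (\<lambda>v. pip Z v) vs = vs" using Zv by (intro map_idI) (simp add: pip_fix)
  have vdp: "vdiff Z (\<lambda>W. pih W v)" for v by (rule vdiff_pih[OF p vdiff_const])
  have vdq: "vdiff Z (q v)" for v unfolding q_def by (rule vdiff_pip'[OF p vdp])
  have d\<kappa>: "\<kappa> v differentiable (at Z)" for v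
    unfolding \<kappa>_def using nz
    by (intro differentiable_diff differentiable_divide differentiable_mult diff_bil vdp vdiff_const
        vdiff_id vdiff_cj diff_N differentiable_power) auto
  have vdc: "vdiff Z (c v)" for v
    unfolding c_def by (intro vdiff_scale differentiable_minus d\<kappa> vdiff_cj)
  have \<kappa>Z: "\<kappa> v Z = bil g v a / N Z" if "v \<in> set vs" for v
    using Zv[OF that] a by (simp add: \<kappa>_def pih_def)
  have cZ: "c v Z = (- (bil g v a / N Z)) *s cj Z" if "v \<in> set vs" for v
    using \<kappa>Z[OF that] by (simp add: c_def)
  have \<delta>q: "deebar.\<delta>v w Z (q v) = (- (bil g v b / N Z)) *s Z" if "v \<in> set vs" for v
    using deebar_pip_pih[OF Z Zv[OF that]] by (simp add: q_def w_def)
  have \<delta>c: "deebar.\<delta>v w Z (c v) = (- (bil g v a / N Z)) *s b" if "v \<in> set vs" for v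
  proof -
    have "deebar (\<kappa> v) w Z = 0"
    proof -
      have pv: "pih Z v = v" using Zv[OF that] by (simp add: pih_def)
      have d1: "(\<lambda>W. bil g (pih W v) a) differentiable (at Z)"
        "(\<lambda>W. bil g (pih W v) W) differentiable (at Z)" "(\<lambda>W. bil g a (cj W)) differentiable (at Z)"
        by (intro diff_bil vdp vdiff_const vdiff_id vdiff_cj)+
      have e1: "deebar (\<lambda>W. bil g (pih W v) a) w Z = 0"
        using a by (subst deebar.bil[OF vdp vdiff_const])
          (simp add: deebar_pih[OF Z Zv(2)[OF that]] bil_lin bil_sym[of Z a])
      have e2: "deebar N w Z = 0"
        using cjb by (simp add: deebar_N w_def)
      have e3: "deebar (\<lambda>W. bil g (pih W v) W) w Z = 0"
        by (subst deebar.bil[OF vdp vdiff_id])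
          (simp add: deebar_pih[OF Z Zv(2)[OF that]] bil_lin quad[OF Z])
      have "deebar (\<lambda>W. bil g (pih W v) a / N W) w Z = 0"
        using e1 e2 by (subst deebar.divide[OF d1(1) diff_N nz]) simp
      moreover have "deebar (\<lambda>W. bil g (pih W v) W * bil g a (cj W)) w Z = 0"
        using e3 a pv Zv[OF that] by (subst deebar.mult[OF d1(2,3)]) simp
      then have "deebar (\<lambda>W. bil g (pih W v) W * bil g a (cj W) / (N W)\<^sup>2) w Z = 0"
        using a d1 nz by (subst deebar.divide) (auto intro!: differentiable_mult differentiable_power)
      ultimately show ?thesis
        unfolding \<kappa>_def using d1 nz
        by (subst deebar.diff) (auto intro!: differentiable_divide differentiable_mult differentiable_power)
    qed
    then have "deebar (\<lambda>W. - \<kappa> v W) w Z = 0" using d\<kappa> by (simp add: deebar.minus)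
    then show ?thesis
      unfolding c_def using \<kappa>Z[OF that] by (subst deebar.\<delta>v_scale) (auto simp: d\<kappa> w_def)
  qed
  have dFU: "(\<lambda>X. F X I) differentiable (at W)" if "length I = s" "W \<in> U" for I W
    using smooth_on_differentiable[OF sm that(2)] that by blast
  have dG: "(\<lambda>W. G W I) differentiable (at Z)" if "length I = s" for I
    unfolding G_def using smooth_on_differentiable[OF smooth_on_dee[OF U(1) sm[OF that]] ZU] .
  have dH: "(\<lambda>W. H W J) differentiable (at Z)" if "length J = s + 1" for J
    unfolding H_def using smooth_on_differentiable[OF smooth_on_deebar[OF U(1) sm] ZU] that by simp

  \<comment> \<open>The raised tensor is needed at all nearby points, because it is differentiated
    again. There \<open>pih W\<close> is constant for the inner derivative but moves with
    \<open>W\<close> for the outer one.\<close>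
  have raise_near: "ev (raise g k F W) (vs @ [a]) =
      of_int k * (bil g a (cj W) / N W) * ev (F W) (map (\<lambda>v. q v W) vs) +
      ev (G W) (map (\<lambda>v. q v W) vs) +
      (\<Sum>r<s. ev (F W) ((map (\<lambda>v. q v W) vs)[r := c (vs ! r) W]))" if W: "W \<in> U" for W
  proof -
    have pW: "nsq g W > 0" and nW: "N W \<noteq> 0" using pU[OF W] N_nz by auto
    define u where "u = (\<lambda>X. ev (F X) (map (\<lambda>x. pip X (pih W x)) vs))"
    have du: "u differentiable (at W)"
      unfolding u_def by (rule diff_evf) (auto simp: dFU len W vdiff_pip pW)
    have dN: "(\<lambda>X. N X / 2) differentiable (at W)" by (intro differentiable_divide diff_N) auto
    have "dee (\<lambda>X. N X / 2) a W = bil g a (cj W) / 2"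
      using dee.cmult[OF diff_N, where c = "1/2" and Z = W and v = a] by (simp add: dee_N)
    then have dP: "dee (\<lambda>X. (N X / 2) powi k) a W = of_int k * (N W / 2) powi k * (bil g a (cj W) / N W)"
      using dee.powi[OF dN] nW by simp
    have d_u: "dee u a W = ev (G W) (map (\<lambda>v. q v W) vs) +
        (\<Sum>r<s. ev (F W) ((map (\<lambda>v. q v W) vs)[r := c (vs ! r) W]))"
      unfolding u_def
      by (subst dee.ev_mapf) (auto simp: dFU len W vdiff_pip pW G_def q_def c_def \<kappa>_def dee_pip[OF pW])
    have "ev (raise g k F W) (vs @ [a]) = (N W / 2) powi (- k) * dee (\<lambda>X. (N X / 2) powi k * u X) a W"
      unfolding u_def by (rule ev_raise[OF pW]) (simp add: dFU len W)
    also have "dee (\<lambda>X. (N X / 2) powi k * u X) a W =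
      (N W / 2) powi k * (of_int k * (bil g a (cj W) / N W) * u W + dee u a W)"
      by (subst dee.mult[OF diff_Npowi[OF pW] du]) (simp add: dP algebra_simps)
    also have "(N W / 2) powi (- k) * \<dots> = of_int k * (bil g a (cj W) / N W) * u W + dee u a W"
      by (simp only: mult.assoc[symmetric] powi_cancel_N[OF pW]) simp
    finally have "ev (raise g k F W) (vs @ [a]) = of_int k * (bil g a (cj W) / N W) * u W + dee u a W" .
    moreover have "u W = ev (F W) (map (\<lambda>v. q v W) vs)" by (simp add: u_def q_def)
    ultimately show ?thesis by (simp only: d_u add.assoc)
  qed

  define E1 where "E1 = (\<lambda>W. ev (F W) (map (\<lambda>v. q v W) vs))"
  define E2 where "E2 = (\<lambda>W. ev (G W) (map (\<lambda>v. q v W) vs))"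
  define E3 where "E3 = (\<lambda>r W. ev (F W) ((map (\<lambda>v. q v W) vs)[r := c (vs ! r) W]))"
  have L3: "map (\<lambda>x. x W) ((map q vs)[r := c (vs ! r)]) = (map (\<lambda>v. q v W) vs)[r := c (vs ! r) W]" for r W
    by (simp add: map_update o_def)
  have vd3: "vdiff Z x" if "x \<in> set ((map q vs)[r := c (vs ! r)])" for x r
    using that set_update_subset_insert[of "map q vs" r "c (vs ! r)"] vdq vdc by auto
  have dE1: "E1 differentiable (at Z)" unfolding E1_def
    by (rule diff_evf) (auto simp: dFU len ZU vdq)
  have dE2: "E2 differentiable (at Z)" unfolding E2_def
    by (rule diff_evf) (auto simp: dG len vdq)
  have dE3: "E3 r differentiable (at Z)" for r unfolding E3_def L3[symmetric]
    by (rule diff_ev) (use dFU len ZU vd3 in auto)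
  \<comment> \<open>The factor \<open>bil g a (cj W)\<close> vanishes at \<open>Z\<close>, so only
    its own derivative remains; this produces the term with \<open>k\<close>.\<close>
  have t1: "deebar (\<lambda>W. of_int k * (bil g a (cj W) / N W) * E1 W) w Z = of_int k * (bil g a b / N Z) * ev (F Z) vs"
  proof -
    have d: "(\<lambda>W. bil g a (cj W) / N W) differentiable (at Z)"
      by (intro differentiable_divide diff_bil vdiff_const vdiff_cj diff_N nz)
    have "deebar (\<lambda>W. bil g a (cj W) / N W) w Z = bil g a b / N Z"
      using deebar.divide[OF diff_bil[OF vdiff_const vdiff_cj] diff_N nz] a by (simp add: deebar.bil w_def)
    then show ?thesis
      using a d dE1
      by (simp add: deebar.mult deebar.cmult differentiable_mult E1_def mqZ del: times_divide_eq_right times_divide_eq_left)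
  qed
  \<comment> \<open>By \<open>deebar_pip_pih\<close> the frame moves only in the direction of
    \<open>Z\<close>.\<close>
  have t2: "deebar E2 w Z = ev (\<lambda>I. deebar (\<lambda>W. G W I) w Z) vs -
      (\<Sum>r<s. bil g (vs ! r) b / N Z * ev (G Z) (vs[r := Z]))"
  proof -
    have e: "ev (G Z) (vs[r := deebar.\<delta>v w Z (q (vs ! r))]) = - (bil g (vs ! r) b / N Z) * ev (G Z) (vs[r := Z])"
      if "r < s" for r
    proof -
      have "vs ! r \<in> set vs" using that len by simp
      then show ?thesis using that len by (simp only: \<delta>q ev_upd_scale)
    qed
    have "deebar E2 w Z = ev (\<lambda>I. deebar (\<lambda>W. G W I) w Z) vs +
        (\<Sum>r<s. ev (G Z) (vs[r := deebar.\<delta>v w Z (q (vs ! r))]))"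
      unfolding E2_def by (subst deebar.ev_mapf) (auto simp: dG len vdq mqZ)
    also have "(\<Sum>r<s. ev (G Z) (vs[r := deebar.\<delta>v w Z (q (vs ! r))])) =
        (\<Sum>r<s. - (bil g (vs ! r) b / N Z) * ev (G Z) (vs[r := Z]))"
      by (intro sum.cong refl) (simp only: e lessThan_iff)
    finally show ?thesis by (simp add: sum_negf)
  qed
  \<comment> \<open>The summand \<open>j = r\<close> comes from the derivative of \<open>c\<close>.
    The others come from the frame in a different slot and contain \<open>cj Z\<close> in slot
    \<open>r\<close> and \<open>Z\<close> in slot \<open>j\<close>.\<close>
  have t3: "deebar (E3 r) w Z = ev (\<lambda>I. deebar (\<lambda>W. F W I) w Z) (vs[r := c (vs ! r) Z]) +
      (\<Sum>j<s. if j = r then - (bil g (vs ! r) a / N Z) * ev (F Z) (vs[r := b])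
         else bil g (vs ! r) a / N Z * (bil g (vs ! j) b / N Z) * ev (F Z) (vs[r := cj Z, j := Z]))"
    if r: "r < s" for r
  proof -
    have "deebar (E3 r) w Z = ev (\<lambda>I. deebar (\<lambda>W. F W I) w Z) (vs[r := c (vs ! r) Z]) +
      (\<Sum>j<s. ev (F Z) (vs[r := c (vs ! r) Z, j := deebar.\<delta>v w Z ((map q vs)[r := c (vs ! r)] ! j)]))"
      unfolding E3_def L3[symmetric]
      by (subst deebar.ev_map) (use dFU len ZU vd3 in \<open>auto simp: L3 mqZ\<close>)
    also have "(\<Sum>j<s. ev (F Z) (vs[r := c (vs ! r) Z, j := deebar.\<delta>v w Z ((map q vs)[r := c (vs ! r)] ! j)])) =
      (\<Sum>j<s. if j = r then - (bil g (vs ! r) a / N Z) * ev (F Z) (vs[r := b])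
         else bil g (vs ! r) a / N Z * (bil g (vs ! j) b / N Z) * ev (F Z) (vs[r := cj Z, j := Z]))"
    proof (intro sum.cong refl)
      fix j assume "j \<in> {..<s}"
      then have j: "j < s" by simp
      have m: "vs ! r \<in> set vs" "vs ! j \<in> set vs" using r j len by auto
      show "ev (F Z) (vs[r := c (vs ! r) Z, j := deebar.\<delta>v w Z ((map q vs)[r := c (vs ! r)] ! j)]) =
        (if j = r then - (bil g (vs ! r) a / N Z) * ev (F Z) (vs[r := b])
         else bil g (vs ! r) a / N Z * (bil g (vs ! j) b / N Z) * ev (F Z) (vs[r := cj Z, j := Z]))"
      proof (cases "j = r")
        case True
        have "ev (F Z) (vs[r := (- (bil g (vs ! r) a / N Z)) *s b]) = - (bil g (vs ! r) a / N Z) * ev (F Z) (vs[r := b])"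
          using r len by (intro ev_upd_scale) simp
        then show ?thesis using True r len by (simp add: \<delta>c[OF m(1)])
      next
        case False
        have "ev (F Z) (vs[r := c (vs ! r) Z, j := (- (bil g (vs ! j) b / N Z)) *s Z]) =
          - (bil g (vs ! j) b / N Z) * ev (F Z) (vs[r := (- (bil g (vs ! r) a / N Z)) *s cj Z, j := Z])"
          using j len by (simp only: cZ[OF m(1)]) (intro ev_upd_scale, simp)
        also have "ev (F Z) (vs[r := (- (bil g (vs ! r) a / N Z)) *s cj Z, j := Z]) =
            ev (F Z) (vs[j := Z, r := (- (bil g (vs ! r) a / N Z)) *s cj Z])"
          using False by (simp add: list_update_swap)
        also have "\<dots> = - (bil g (vs ! r) a / N Z) * ev (F Z) (vs[j := Z, r := cj Z])"
          using r len by (intro ev_upd_scale) simp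
        also have "vs[j := Z, r := cj Z] = vs[r := cj Z, j := Z]"
          using False by (simp add: list_update_swap)
        finally show ?thesis using False r j len by (simp add: \<delta>q[OF m(2)])
      qed
    qed
    finally show ?thesis .
  qed
  have LR: "ev (lower g (raise g k F) Z) (vs @ [a, b]) = N Z / 2 *
      (of_int k * (bil g a b / N Z) * ev (F Z) vs + deebar E2 w Z + (\<Sum>r<s. deebar (E3 r) w Z))"
  proof -
    have "ev (lower g (raise g k F) Z) ((vs @ [a]) @ [b]) =
       N Z / 2 * deebar (\<lambda>W. ev (raise g k F W) (vs @ [a])) w Z"
      using ev_lower_A[OF smrep_difrep[OF smrep_raise[OF smF]] Z, of "vs @ [a]" k b] len
      by (simp add: pihb w_def)
    also have "deebar (\<lambda>W. ev (raise g k F W) (vs @ [a])) w Z =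
      deebar (\<lambda>W. of_int k * (bil g a (cj W) / N W) * E1 W + E2 W + (\<Sum>r<s. E3 r W)) w Z"
      by (rule deebar.cong, rule eventually_mono[OF evU]) (simp add: raise_near E1_def E2_def E3_def)
    also have "\<dots> = deebar (\<lambda>W. of_int k * (bil g a (cj W) / N W) * E1 W) w Z + deebar E2 w Z + (\<Sum>r<s. deebar (E3 r) w Z)"
    proof -
      have d1: "(\<lambda>W. of_int k * (bil g a (cj W) / N W) * E1 W) differentiable (at Z)"
        by (intro differentiable_mult differentiable_divide diff_bil vdiff_const vdiff_cj diff_N nz dE1
            differentiable_const)
      have d3: "(\<lambda>W. \<Sum>r<s. E3 r W) differentiable (at Z)" by (intro diff_sum dE3)
      show ?thesis
        by (simp only: deebar.add[OF differentiable_add[OF d1 dE2] d3] deebar.add[OF d1 dE2] deebar.sum[OF dE3])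
    qed
    finally show ?thesis by (simp only: t1 append_assoc append_Cons append_Nil)
  qed

  have evH: "ev (H W) (xs @ [y]) = deebar (\<lambda>X. ev (F X) xs) (cj y) W" if "W \<in> U" "length xs = s" for W xs y
  proof -
    have "ev (H W) (xs @ [y]) = ev (\<lambda>I. deebar (\<lambda>X. F X I) (cj y) W) xs"
      unfolding ev_snoc H_def using that by (intro ev_cong) (simp add: dee_expand(2)[OF dFU])
    also have "\<dots> = deebar (\<lambda>X. ev (F X) xs) (cj y) W"
      by (rule deebar.ev_const[symmetric]) (simp add: dFU that)
    finally show ?thesis .
  qed
  have low_near: "ev (lower g F W) (xs @ [y]) = N W / 2 * ev (H W) (xs @ [pih W y])" if "W \<in> U" "length xs = s" for W xs y
    using that by (simp add: evH ev_lower[OF pU] dFU)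
  \<comment> \<open>The arguments are first moved by \<open>pip W\<close>, from \<open>psi\<close>
    in \<open>raise\<close>; then \<open>lower\<close> projects the last one by
    \<open>pih W\<close>.\<close>
  define h where "h = (\<lambda>W. ev (H W) (map (\<lambda>v. pip W v) vs @ [pih W (pip W b)]))"
  define L where "L = map (\<lambda>v W. pip W v) vs @ [\<lambda>W. pih W (pip W b)]"
  have hL: "h = (\<lambda>W. ev (H W) (map (\<lambda>x. x W) L))" by (simp add: h_def L_def o_def)
  have vdL: "vdiff Z x" if "x \<in> set L" for x
    using that by (auto simp: L_def vdiff_pip[OF p] intro!: vdiff_pih[OF p])
  have dh: "h differentiable (at Z)"
    unfolding hL by (rule diff_ev) (use dH vdL len in \<open>auto simp: L_def\<close>)
  have \<delta>p: "dee.\<delta>v a Z (\<lambda>W. pip W v) = (- (bil g v a / N Z)) *s cj Z" if "bil g v Z = 0" for v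
    using that a by (simp add: dee_pip[OF p])
  have \<delta>pb: "dee.\<delta>v a Z (\<lambda>W. pih W (pip W b)) = (- (bil g b a / N Z)) *s cj Z"
  proof -
    have vd: "vdiff Z (\<lambda>W. pip W b)" by (rule vdiff_pip[OF p])
    have db: "(\<lambda>W. bil g (pip W b) (cj W)) differentiable (at Z)" by (rule diff_bil[OF vd vdiff_cj])
    have d: "(\<lambda>W. bil g (pip W b) (cj W) / N W) differentiable (at Z)"
      by (intro differentiable_divide db diff_N nz)
    have zz: "bil g (cj Z) (cj Z) = 0" using quad[OF Z] by (simp add: bil_cnj[symmetric])
    have "dee (\<lambda>W. bil g (pip W b) (cj W)) a Z = 0"
      by (subst dee.bil[OF vd vdiff_cj]) (simp add: \<delta>p[OF b(1)] bil_lin zz)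
    then have "dee (\<lambda>W. bil g (pip W b) (cj W) / N W) a Z = 0"
      using b by (subst dee.divide[OF db diff_N nz]) (simp add: pihb)
    then show ?thesis
      unfolding pih_def using d vd b
      by (subst dee.\<delta>v_diff) (auto simp: dee.\<delta>v_scale vdiff_scale \<delta>p pihb)
  qed
  \<comment> \<open>By homogeneity \<open>F\<close> is holomorphic along the line through
    \<open>Z\<close>, as comparison with a power of the linear form \<open>l\<close> shows. This
    disposes of the derivative of the last argument in \<open>h\<close>: it points along
    \<open>cj Z\<close>, which conjugation turns into \<open>Z\<close>.\<close>
  have antihol: "deebar (\<lambda>X. ev (F X) vs) Z Z = 0"
  proof -
    define l where "l = (\<lambda>W. bil g W (cj Z) / N Z)"
    have lZ: "l Z = 1" using nz by (simp add: l_def N_def)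
    have dl: "l differentiable (at Z)"
      unfolding l_def by (intro differentiable_divide diff_bil vdiff_const vdiff_id nz differentiable_const)
    have dpl: "(\<lambda>W. l W powi (- k)) differentiable (at Z)"
      using diff_powi[OF dl] lZ by simp
    have dE: "(\<lambda>X. ev (F X) vs) differentiable (at Z)" by (rule difrep_ev[OF dF Z len])
    have "deebar (\<lambda>W. ev (F W) vs - ev (F Z) vs * l W powi (- k)) Z Z = 0"
    proof (rule line_derivative_zero(2))
      show "(\<lambda>W. ev (F W) vs - ev (F Z) vs * l W powi (- k)) differentiable (at Z)"
        using dE dpl by auto
      show "ev (F (t *s Z)) vs - ev (F Z) vs * l (t *s Z) powi (- k) = 0" if "t \<noteq> 0" for t
        using homog_ev[OF hom that Z len] Zv nz by (simp add: l_def bil_lin N_def)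
    qed
    moreover have "deebar l Z Z = 0"
      unfolding l_def using nz by (subst deebar.divide) (auto simp: diff_bil deebar.bil)
    then have "deebar (\<lambda>W. l W powi (- k)) Z Z = 0"
      using deebar.powi[OF dl] lZ by simp
    ultimately show ?thesis
      using dE dpl by (simp add: deebar.diff deebar.cmult)
  qed
  have dh': "dee h a Z = ev (\<lambda>I. deebar (\<lambda>W. G W I) w Z) vs +
      (\<Sum>r<s. ev (\<lambda>I. deebar (\<lambda>W. F W I) w Z) (vs[r := c (vs ! r) Z]))"
  proof -
    have mL: "map (\<lambda>x. x Z) L = vs @ [b]"
      using mpZ by (simp add: L_def o_def pihb)
    have "dee h a Z = ev (\<lambda>J. dee (\<lambda>W. H W J) a Z) (vs @ [b]) +
      (\<Sum>r<Suc s. ev (H Z) ((vs @ [b])[r := dee.\<delta>v a Z (L ! r)]))"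
    proof -
      have lL: "length L = Suc s" by (simp add: L_def len)
      have "dee (\<lambda>W. ev (H W) (map (\<lambda>x. x W) L)) a Z = ev (\<lambda>J. dee (\<lambda>W. H W J) a Z) (map (\<lambda>x. x Z) L) +
        (\<Sum>r<length L. ev (H Z) ((map (\<lambda>x. x Z) L)[r := dee.\<delta>v a Z (L ! r)]))"
        by (rule dee.ev_map) (use dH vdL lL in auto)
      then show ?thesis by (simp only: hL mL lL)
    qed
    also have "(\<Sum>r<Suc s. ev (H Z) ((vs @ [b])[r := dee.\<delta>v a Z (L ! r)])) =
      (\<Sum>r<s. ev (H Z) (vs[r := c (vs ! r) Z] @ [b])) + ev (H Z) (vs @ [(- (bil g b a / N Z)) *s cj Z])"
    proof -
      have "ev (H Z) ((vs @ [b])[r := dee.\<delta>v a Z (L ! r)]) = ev (H Z) (vs[r := c (vs ! r) Z] @ [b])" if "r < s" for r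
        using that len cZ[of "vs ! r"] \<delta>p[OF Zr(1)[OF that]]
        by (simp add: L_def nth_append list_update_append1)
      moreover have "(vs @ [b])[s := dee.\<delta>v a Z (L ! s)] = vs @ [(- (bil g b a / N Z)) *s cj Z]"
        using len \<delta>pb by (simp add: L_def nth_append list_update_append)
      ultimately show ?thesis by simp
    qed
    also have "ev (H Z) (vs @ [(- (bil g b a / N Z)) *s cj Z]) = 0"
      using antihol dee_dir(4)[OF difrep_ev[OF dF Z len]]
      by (simp only: evH[OF ZU len] cj_scale cj_cj) simp
    also have "(\<Sum>r<s. ev (H Z) (vs[r := c (vs ! r) Z] @ [b])) =
      (\<Sum>r<s. ev (\<lambda>I. deebar (\<lambda>W. F W I) w Z) (vs[r := c (vs ! r) Z]))"
      using len by (intro sum.cong refl) (simp add: evH[OF ZU] w_def deebar.ev_const dFU ZU)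
    also have "ev (\<lambda>J. dee (\<lambda>W. H W J) a Z) (vs @ [b]) = ev (\<lambda>I. deebar (\<lambda>W. G W I) w Z) vs"
      unfolding ev_snoc
    proof (rule ev_cong)
      fix I :: "'m list" assume I: "length I = length vs"
      have "(\<Sum>i\<in>UNIV. b $ i * dee (\<lambda>W. H W (I @ [i])) a Z) =
        (\<Sum>i\<in>UNIV. b $ i * deebar (\<lambda>W. G W I) (axis i 1) Z)"
        using I len
        by (intro sum.cong refl) (simp add: H_def G_def dee_deebar_commute[OF U(1) sm ZU])
      also have "\<dots> = deebar (\<lambda>W. G W I) w Z"
        using dee_expand(2)[OF dG[of I]] I len by (simp add: w_def)
      finally show "(\<Sum>i\<in>UNIV. b $ i * dee (\<lambda>W. H W (I @ [i])) a Z) = deebar (\<lambda>W. G W I) w Z" .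
    qed
    finally show ?thesis by simp
  qed
  \<comment> \<open>The factor \<open>N W / 2\<close> from \<open>lower\<close> changes the exponent
    \<open>k - 1\<close> into \<open>k\<close>, and the derivative of this power vanishes because
    \<open>a\<close> is orthogonal to \<open>cj Z\<close>.\<close>
  have RL: "ev (raise g (k - 1) (lower g F) Z) (vs @ [b, a]) = N Z / 2 * dee h a Z"
  proof -
    have lenb: "length (vs @ [b]) = s + 1" using len by simp
    have dP: "dee (\<lambda>X. (N X / 2) powi k) a Z = 0"
    proof -
      have dN: "(\<lambda>X. N X / 2) differentiable (at Z)" by (intro differentiable_divide diff_N) auto
      have "dee (\<lambda>X. N X / 2) a Z = 0"
        using dee.cmult[OF diff_N, where c = "1/2" and Z = Z and v = a] a by (simp add: dee_N)
      then show ?thesis using dee.powi[OF dN] nz by simp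
    qed
    have mp: "map (\<lambda>x. pip W (pih Z x)) vs = map (pip W) vs" for W
      using Zv by (intro map_cong refl) (simp add: pih_def)
    have "ev (raise g (k - 1) (lower g F) Z) ((vs @ [b]) @ [a]) = (N Z / 2) powi (- (k - 1)) *
      dee (\<lambda>W. (N W / 2) powi (k - 1) * ev (lower g F W) (map (\<lambda>x. pip W (pih Z x)) (vs @ [b]))) a Z"
      by (rule ev_raise_A[OF smrep_difrep[OF smrep_lower[OF smF]] Z lenb])
    also have "dee (\<lambda>W. (N W / 2) powi (k - 1) * ev (lower g F W) (map (\<lambda>x. pip W (pih Z x)) (vs @ [b]))) a Z =
       dee (\<lambda>W. (N W / 2) powi k * h W) a Z"
    proof (rule dee.cong, rule eventually_mono[OF evU])
      fix W assume W: "W \<in> U"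
      have "(N W / 2) powi (k - 1) * (N W / 2) = (N W / 2) powi k"
        using powi_add_N[OF pU[OF W], of "k - 1" 1] by simp
      then show "(N W / 2) powi (k - 1) * ev (lower g F W) (map (\<lambda>x. pip W (pih Z x)) (vs @ [b])) =
        (N W / 2) powi k * h W"
        using W len by (simp add: low_near mp pihb h_def)
    qed
    also have "\<dots> = (N Z / 2) powi k * dee h a Z"
      by (simp add: dee.mult[OF diff_Npowi[OF p] dh] dP)
    also have "(N Z / 2) powi (- (k - 1)) * \<dots> = ((N Z / 2) powi (- (k - 1)) * (N Z / 2) powi k) * dee h a Z"
      by simp
    also have "(N Z / 2) powi (- (k - 1)) * (N Z / 2) powi k = N Z / 2"
      using powi_add_N[OF p, of "- (k - 1)" k] by simp
    finally show ?thesis by simp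
  qed

  \<comment> \<open>The contraction in slot \<open>r\<close> vanishes along the cone and is
    differentiated in the tangent direction \<open>a\<close>. The moving point in slot
    \<open>r\<close> contributes \<open>a\<close>, every other slot of the frame a multiple of
    \<open>cj Z\<close>.\<close>
  have step: "ev (G Z) (vs[r := Z]) = - (\<Sum>j<s. if j = r then ev (F Z) (vs[r := a])
      else - (bil g (vs ! j) a / N Z) * ev (F Z) (vs[r := Z, j := cj Z]))" if r: "r < s" for r
  proof -
    define K where "K = (map (\<lambda>v W. pip W v) vs)[r := (\<lambda>W. W)]"
    have mK: "map (\<lambda>x. x W) K = (map (pip W) vs)[r := W]" for W
      by (simp add: K_def map_update o_def)
    have vdK: "vdiff Z x" if "x \<in> set K" for x
      using that set_update_subset_insert[of "map (\<lambda>v W. pip W v) vs" r "\<lambda>W. W"] vdiff_pip[OF p]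
      by (auto simp: K_def)
    have lK: "length K = s" by (simp add: K_def len)
    have dK: "(\<lambda>W. ev (F W) (map (\<lambda>x. x W) K)) differentiable (at Z)"
      by (rule diff_ev) (use dFU lK ZU vdK in auto)
    have zero: "ev (F W) (map (\<lambda>x. x W) K) = 0" if W: "W \<in> A" for W
    proof -
      have "(map (pip W) vs)[r := W] = take r (map (pip W) vs) @ W # drop (Suc r) (map (pip W) vs)"
        using r len by (simp add: upd_conv_take_nth_drop)
      also have "ev (F W) \<dots> = 0"
        by (rule eul[unfolded euler_def, rule_format, OF W])
          (use r len W in \<open>auto dest!: in_set_takeD in_set_dropD simp: pip_orth pos\<close>)
      finally show ?thesis by (simp add: mK)
    qed
    have "dee (\<lambda>W. ev (F W) (map (\<lambda>x. x W) K)) a Z = 0"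
      by (rule tangent_zero(1)[OF Z a(1) dK zero])
    also have "dee (\<lambda>W. ev (F W) (map (\<lambda>x. x W) K)) a Z = ev (G Z) (vs[r := Z]) +
      (\<Sum>j<s. ev (F Z) (vs[r := Z, j := dee.\<delta>v a Z (K ! j)]))"
      using mpZ by (subst dee.ev_map) (use dFU lK ZU vdK in \<open>auto simp: mK G_def\<close>)
    also have "(\<Sum>j<s. ev (F Z) (vs[r := Z, j := dee.\<delta>v a Z (K ! j)])) =
      (\<Sum>j<s. if j = r then ev (F Z) (vs[r := a])
      else - (bil g (vs ! j) a / N Z) * ev (F Z) (vs[r := Z, j := cj Z]))"
    proof (intro sum.cong refl)
      fix j assume "j \<in> {..<s}"
      then have j: "j < s" by simp
      show "ev (F Z) (vs[r := Z, j := dee.\<delta>v a Z (K ! j)]) = (if j = r then ev (F Z) (vs[r := a])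
        else - (bil g (vs ! j) a / N Z) * ev (F Z) (vs[r := Z, j := cj Z]))"
      proof (cases "j = r")
        case True
        then show ?thesis using r len by (simp add: K_def)
      next
        case False
        have "ev (F Z) (vs[r := Z, j := (- (bil g (vs ! j) a / N Z)) *s cj Z]) =
          - (bil g (vs ! j) a / N Z) * ev (F Z) (vs[r := Z, j := cj Z])"
          using j len by (intro ev_upd_scale) simp
        then show ?thesis using False r j len \<delta>p[OF Zr(1)[OF j]] by (simp add: K_def)
      qed
    qed
    finally show ?thesis by (simp add: eq_neg_iff_add_eq_0)
  qed

  \<comment> \<open>\<open>P\<close> and \<open>Q\<close> collect the frame terms of
    \<open>E2\<close> and \<open>E3\<close>. Off the diagonal \<open>P r j\<close> and
    \<open>Q j r\<close> are opposite to each other; the diagonal is the sum in the claim.\<close>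
  define P where "P = (\<lambda>r j. bil g (vs ! r) b / N Z * (if j = r then ev (F Z) (vs[r := a])
      else - (bil g (vs ! j) a / N Z) * ev (F Z) (vs[r := Z, j := cj Z])))"
  define Q where "Q = (\<lambda>r j. if j = r then - (bil g (vs ! r) a / N Z) * ev (F Z) (vs[r := b])
         else bil g (vs ! r) a / N Z * (bil g (vs ! j) b / N Z) * ev (F Z) (vs[r := cj Z, j := Z]))"
  have PQ: "P r j + Q j r = (if j = r then (bil g (vs ! r) b * ev (F Z) (vs[r := a]) -
       bil g (vs ! r) a * ev (F Z) (vs[r := b])) / N Z else 0)" for r j
  proof (cases "j = r")
    case False
    then have "vs[j := cj Z, r := Z] = vs[r := Z, j := cj Z]" by (simp add: list_update_swap)
    then show ?thesis using False by (auto simp: P_def Q_def)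
  qed (simp add: P_def Q_def diff_divide_distrib)
  have "(\<Sum>r<s. \<Sum>j<s. P r j) + (\<Sum>r<s. \<Sum>j<s. Q r j) = (\<Sum>r<s. \<Sum>j<s. P r j + Q j r)"
    by (subst (2) sum.swap) (simp add: sum.distrib)
  also have "\<dots> = (\<Sum>r<s. (bil g (vs ! r) b * ev (F Z) (vs[r := a]) -
       bil g (vs ! r) a * ev (F Z) (vs[r := b])) / N Z)"
    by (simp add: PQ)
  finally have sumPQ: "(\<Sum>r<s. \<Sum>j<s. P r j) + (\<Sum>r<s. \<Sum>j<s. Q r j) =
     (\<Sum>r<s. bil g (vs ! r) b * ev (F Z) (vs[r := a]) - bil g (vs ! r) a * ev (F Z) (vs[r := b])) / N Z"
    by (simp add: sum_divide_distrib)
  have E2': "deebar E2 w Z = ev (\<lambda>I. deebar (\<lambda>W. G W I) w Z) vs + (\<Sum>r<s. \<Sum>j<s. P r j)"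
  proof -
    have "(\<Sum>r<s. bil g (vs ! r) b / N Z * ev (G Z) (vs[r := Z])) = (\<Sum>r<s. - (\<Sum>j<s. P r j))"
      by (intro sum.cong refl) (simp only: step lessThan_iff P_def sum_distrib_left mult_minus_right)
    then show ?thesis by (simp add: t2 sum_negf)
  qed
  have E3': "(\<Sum>r<s. deebar (E3 r) w Z) =
     (\<Sum>r<s. ev (\<lambda>I. deebar (\<lambda>W. F W I) w Z) (vs[r := c (vs ! r) Z])) + (\<Sum>r<s. \<Sum>j<s. Q r j)"
    by (simp add: t3 Q_def sum.distrib)
  have "ev (lower g (raise g k F) Z) (vs @ [a, b]) - ev (raise g (k - 1) (lower g F) Z) (vs @ [b, a]) =
    N Z / 2 * (of_int k * (bil g a b / N Z) * ev (F Z) vs +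
      ((\<Sum>r<s. \<Sum>j<s. P r j) + (\<Sum>r<s. \<Sum>j<s. Q r j)))"
    unfolding LR RL E2' E3' dh' by (simp add: algebra_simps)
  also have "\<dots> = of_int k / 2 * bil g a b * ev (F Z) vs + 1 / 2 * (\<Sum>r<s. bil g (vs ! r) b * ev (F Z) (vs[r := a]) -
       bil g (vs ! r) a * ev (F Z) (vs[r := b]))"
    unfolding sumPQ using nz by (simp add: field_simps)
  finally show ?thesis .
qed

end

section \<open>Lowering the right side, and reduction to orthogonal vectors\<close>

lemma take_drop_snoc:
  assumes "s + 3 \<le> length J"
  shows "last (take s J @ drop (s + 2) J) = last J"
    and "butlast (take s J @ drop (s + 2) J) = take s (butlast J) @ drop (s + 2) (butlast J)"
proof -
  have "J \<noteq> []" using assms by auto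
  then obtain K x where J: "J = K @ [x]" by (metis append_butlast_last_id)
  then have "s + 2 \<le> length K" using assms by simp
  then show "last (take s J @ drop (s + 2) J) = last J"
    "butlast (take s J @ drop (s + 2) J) = take s (butlast J) @ drop (s + 2) (butlast J)"
    by (simp_all add: J butlast_append)
qed

lemma lswap_snoc: "i < length K \<Longrightarrow> j < length K \<Longrightarrow> lswap i j (K @ [x]) = lswap i j K @ [x]"
  by (simp add: lswap_def nth_append list_update_append1)

text \<open>The new slot comes last, so interchanges of old slots do not touch it.\<close>

lemma lower_swap_slots:
  assumes "1 \<le> i" "i \<le> t" "1 \<le> j" "j \<le> t" "length J = t + 1"
  shows "lower g (swap_slots i j G) Z J = swap_slots i j (lower g G) Z J"
proof -
  have "J \<noteq> []" using assms by auto
  then obtain K x where J: "J = K @ [x]" by (metis append_butlast_last_id)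
  have "lswap (i - 1) (j - 1) J = lswap (i - 1) (j - 1) K @ [x]"
    unfolding J using assms by (intro lswap_snoc) (auto simp: J)
  then show ?thesis by (simp add: lower_def swap_slots_lswap J)
qed

lemma ev_comm_rhs:
  assumes "s + 2 \<le> length L"
  shows "ev (comm_rhs g k s G Z) L = of_int k / 2 * ev (ins_g g s G Z) L +
    1 / 2 * (\<Sum>r = 1..s. ev (ins_g g s G Z) (lswap (r - 1) s L) - ev (ins_g g s G Z) (lswap (r - 1) (s + 1) L))"
proof -
  have "ev (comm_rhs g k s G Z) L = of_int k / 2 * ev (ins_g g s G Z) L +
    1 / 2 * (\<Sum>r = 1..s. ev (swap_slots r (s + 1) (ins_g g s G) Z) L - ev (swap_slots r (s + 2) (ins_g g s G) Z) L)"
    by (simp only: comm_rhs_def ev_add ev_scale ev_sum ev_diff)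
  also have "(\<Sum>r = 1..s. ev (swap_slots r (s + 1) (ins_g g s G) Z) L - ev (swap_slots r (s + 2) (ins_g g s G) Z) L) =
     (\<Sum>r = 1..s. ev (ins_g g s G Z) (lswap (r - 1) s L) - ev (ins_g g s G Z) (lswap (r - 1) (s + 1) L))"
    using assms by (intro sum.cong refl) (simp add: ev_swap_slots)
  finally show ?thesis .
qed

context quad_cone
begin

lemma ins_g_sec_eq:
  assumes "sec_eq g A (s + d) G G'" "Z \<in> A" "length L = s + 2 + d" "\<forall>v\<in>set L. bil g v Z = 0"
  shows "ev (ins_g g s G Z) L = ev (ins_g g s G' Z) L"
proof -
  have "ev (G Z) (take s L @ drop (s + 2) L) = ev (G' Z) (take s L @ drop (s + 2) L)"
    using assms by (intro sec_eq_evD[OF assms(1)]) (auto dest: in_set_takeD in_set_dropD)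
  then show ?thesis using assms(3) by (simp add: ev_ins_g)
qed

lemma comm_rhs_sec_eq:
  assumes G: "sec_eq g A (s + d) G G'"
  shows "sec_eq g A (s + 2 + d) (comm_rhs g k s G) (comm_rhs g k s G')"
  unfolding sec_eq_iff
proof (intro ballI allI impI)
  fix Z and L :: "(complex^'m) list"
  assume Z: "Z \<in> A" and L: "length L = s + 2 + d" "\<forall>v\<in>set L. bil g v Z = 0"
  have "ev (ins_g g s G Z) (lswap i j L) = ev (ins_g g s G' Z) (lswap i j L)"
    if "i < s + 2" "j < s + 2" for i j
    using that L by (intro ins_g_sec_eq[OF G Z]) auto
  then have "(\<Sum>r = 1..s. ev (ins_g g s G Z) (lswap (r - 1) s L) - ev (ins_g g s G Z) (lswap (r - 1) (s + 1) L)) =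
    (\<Sum>r = 1..s. ev (ins_g g s G' Z) (lswap (r - 1) s L) - ev (ins_g g s G' Z) (lswap (r - 1) (s + 1) L))"
    by (intro sum.cong refl arg_cong2[where f = "(-)"]) auto
  then show "ev (comm_rhs g k s G Z) L = ev (comm_rhs g k s G' Z) L"
    using L ins_g_sec_eq[OF G Z L] by (simp only: ev_comm_rhs)
qed

lemma swap_sec_eq:
  assumes "sec_eq g A t F G" "1 \<le> i" "i \<le> t" "1 \<le> j" "j \<le> t"
  shows "sec_eq g A t (swap_slots i j F) (swap_slots i j G)"
  using assms unfolding sec_eq_iff by (auto simp: ev_swap_slots)

lemma smrep_swap: "smrep t F \<Longrightarrow> smrep t (swap_slots i j F)"
  by (erule smrep_transfer) (auto simp: swap_slots_lswap)

lemma smrep_comm_rhs: "smrep (s + d) G \<Longrightarrow> smrep (s + 2 + d) (comm_rhs g k s G)"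
proof (erule smrep_transfer)
  fix U and J :: "'m list"
  assume U: "open U" and sm: "\<And>I. length I = s + d \<Longrightarrow> smooth_on U (\<lambda>Z. G Z I)" and J: "length J = s + 2 + d"
  have "smooth_on U (\<lambda>Z. ins_g g s G Z K)" if "length K = s + 2 + d" for K
    unfolding ins_g_def by (intro smooth_on_mult U smooth_on_const sm) (simp add: that)
  then show "smooth_on U (\<lambda>Z. comm_rhs g k s G Z J)"
    unfolding comm_rhs_def swap_slots_lswap
    by (intro smooth_on_add smooth_on_mult smooth_on_sum smooth_on_diff smooth_on_const U) (auto simp: J)
qed

lemma difrep_ins_g: "difrep (s + d) G \<Longrightarrow> difrep (s + 2 + d) (ins_g g s G)"
  by (auto simp: difrep_def ins_g_def intro!: differentiable_mult)

text \<open>The metric has constant coefficients and sits in front of the new slot, so the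
  derivative passes through to \<open>G\<close>.\<close>

lemma lower_ins_g:
  assumes G: "difrep (s + d) G" and Z: "Z \<in> A" and J: "length J = s + 2 + d + 1"
  shows "lower g (ins_g g s G) Z J = ins_g g s (lower g G) Z J"
proof -
  have "deebar (\<lambda>W. ins_g g s G W (butlast J)) v Z =
    of_int (g $ (J ! s) $ (J ! (s + 1))) * deebar (\<lambda>W. G W (take s (butlast J) @ drop (s + 2) (butlast J))) v Z" for v
    unfolding ins_g_def
    by (subst deebar.cmult) (use G Z J in \<open>auto simp: difrep_def nth_butlast\<close>)
  then show ?thesis
    using take_drop_snoc[of s J] J by (simp add: lower_def ins_g_def sum_distrib_left mult_ac)
qed

lemma lower_comm_rhs:
  assumes G: "difrep (s + d) G" and Z: "Z \<in> A" and J: "length J = s + 2 + d + 1"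
  shows "lower g (comm_rhs g k s G) Z J = comm_rhs g k s (lower g G) Z J"
proof -
  let ?I = "butlast J"
  have lI: "length ?I = s + 2 + d" using J by simp
  have dI: "(\<lambda>W. ins_g g s G W I) differentiable (at Z)" if "length I = s + 2 + d" for I
    using difrep_ins_g[OF G] Z that by (auto simp: difrep_def)
  have dS: "(\<lambda>W. swap_slots i j (ins_g g s G) W ?I) differentiable (at Z)" for i j
    unfolding swap_slots_lswap by (rule dI) (simp only: length_lswap lI)
  have d: "deebar (\<lambda>W. comm_rhs g k s G W ?I) v Z = of_int k / 2 * deebar (\<lambda>W. ins_g g s G W ?I) v Z +
    1 / 2 * (\<Sum>r = 1..s. deebar (\<lambda>W. swap_slots r (s + 1) (ins_g g s G) W ?I) v Z -
      deebar (\<lambda>W. swap_slots r (s + 2) (ins_g g s G) W ?I) v Z)" for v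
  proof -
    have d1: "(\<lambda>W. \<Sum>r = 1..s. swap_slots r (s + 1) (ins_g g s G) W ?I - swap_slots r (s + 2) (ins_g g s G) W ?I)
       differentiable (at Z)"
      by (intro diff_sum differentiable_diff dS)
    have d2: "(\<lambda>W. swap_slots r (s + 1) (ins_g g s G) W ?I - swap_slots r (s + 2) (ins_g g s G) W ?I)
       differentiable (at Z)" for r
      by (intro differentiable_diff dS)
    show ?thesis
      unfolding comm_rhs_def
      by (subst deebar.add, (intro differentiable_mult differentiable_const dI lI d1)+,
          subst deebar.cmult[OF dI[OF lI]], subst deebar.cmult[OF d1], subst deebar.sum[OF d2])
        (simp only: deebar.diff[OF dS dS])
  qed
  have "lower g (comm_rhs g k s G) Z J = of_int k / 2 * lower g (ins_g g s G) Z J +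
    1 / 2 * (\<Sum>r = 1..s. lower g (swap_slots r (s + 1) (ins_g g s G)) Z J - lower g (swap_slots r (s + 2) (ins_g g s G)) Z J)"
    (is "?l = ?r")
  proof -
    have "?l = (\<Sum>l\<in>UNIV. of_real (nsq g Z) * phi g Z l (last J) * (of_int k / 2 * deebar (\<lambda>W. ins_g g s G W ?I) (axis l 1) Z +
    1 / 2 * (\<Sum>r = 1..s. deebar (\<lambda>W. swap_slots r (s + 1) (ins_g g s G) W ?I) (axis l 1) Z -
      deebar (\<lambda>W. swap_slots r (s + 2) (ins_g g s G) W ?I) (axis l 1) Z)))"
      unfolding lower_def d sum_distrib_left by (intro sum.cong refl) (simp only: mult_ac)
    also have "\<dots> = of_int k / 2 * (\<Sum>l\<in>UNIV. of_real (nsq g Z) * phi g Z l (last J) * deebar (\<lambda>W. ins_g g s G W ?I) (axis l 1) Z) +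
     1 / 2 * (\<Sum>l\<in>UNIV. \<Sum>r = 1..s. of_real (nsq g Z) * phi g Z l (last J) * (deebar (\<lambda>W. swap_slots r (s + 1) (ins_g g s G) W ?I) (axis l 1) Z -
      deebar (\<lambda>W. swap_slots r (s + 2) (ins_g g s G) W ?I) (axis l 1) Z))"
      by (simp add: sum.distrib sum_distrib_left distrib_left mult_ac)
    also have "(\<Sum>l\<in>UNIV. \<Sum>r = 1..s. of_real (nsq g Z) * phi g Z l (last J) * (deebar (\<lambda>W. swap_slots r (s + 1) (ins_g g s G) W ?I) (axis l 1) Z -
      deebar (\<lambda>W. swap_slots r (s + 2) (ins_g g s G) W ?I) (axis l 1) Z)) =
      (\<Sum>r = 1..s. lower g (swap_slots r (s + 1) (ins_g g s G)) Z J - lower g (swap_slots r (s + 2) (ins_g g s G)) Z J)"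
      unfolding lower_def
      by (subst sum.swap) (simp add: sum_distrib_left sum_subtractf[symmetric] right_diff_distrib mult_ac)
    finally show ?thesis by (simp add: lower_def sum_distrib_left mult_ac)
  qed
  also have "\<dots> = of_int k / 2 * ins_g g s (lower g G) Z J +
    1 / 2 * (\<Sum>r = 1..s. swap_slots r (s + 1) (ins_g g s (lower g G)) Z J - swap_slots r (s + 2) (ins_g g s (lower g G)) Z J)"
  proof -
    have "lower g (swap_slots i j (ins_g g s G)) Z J = swap_slots i j (ins_g g s (lower g G)) Z J"
      if "1 \<le> i" "i \<le> s + 2" "1 \<le> j" "j \<le> s + 2" for i j
    proof -
      have "lower g (swap_slots i j (ins_g g s G)) Z J = swap_slots i j (lower g (ins_g g s G)) Z J"
        by (rule lower_swap_slots[of i "s + 2 + d"]) (use that J in auto)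
      then show ?thesis
        using J by (simp add: swap_slots_lswap lower_ins_g[OF G Z])
    qed
    then show ?thesis by (simp add: lower_ins_g[OF G Z J])
  qed
  finally show ?thesis by (simp add: comm_rhs_def)
qed

text \<open>In this form the condition refers only to the set of arguments, hence is visibly
  invariant under permutations of the slots.\<close>

lemma euler_set:
  "euler s F \<longleftrightarrow> (\<forall>Z\<in>A. \<forall>vs. length vs = s \<longrightarrow> (\<forall>v\<in>set vs. bil g v Z = 0) \<longrightarrow> Z \<in> set vs \<longrightarrow> ev (F Z) vs = 0)"
proof
  assume e: "euler s F"
  show "\<forall>Z\<in>A. \<forall>vs. length vs = s \<longrightarrow> (\<forall>v\<in>set vs. bil g v Z = 0) \<longrightarrow> Z \<in> set vs \<longrightarrow> ev (F Z) vs = 0"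
  proof (intro ballI allI impI)
    fix Z and vs :: "(complex^'m) list"
    assume *: "Z \<in> A" "length vs = s" "\<forall>v\<in>set vs. bil g v Z = 0" "Z \<in> set vs"
    obtain xs ys where "vs = xs @ Z # ys" using split_list[OF *(4)] by blast
    then show "ev (F Z) vs = 0"
      using e[unfolded euler_def, rule_format, OF *(1), of xs ys] * by auto
  qed
next
  assume *: "\<forall>Z\<in>A. \<forall>vs. length vs = s \<longrightarrow> (\<forall>v\<in>set vs. bil g v Z = 0) \<longrightarrow> Z \<in> set vs \<longrightarrow> ev (F Z) vs = 0"
  show "euler s F"
    unfolding euler_def
  proof (intro ballI allI impI)
    fix Z and xs ys :: "(complex^'m) list"
    assume "Z \<in> A" "length xs + length ys + 1 = s" "\<forall>v\<in>set (xs @ ys). bil g v Z = 0"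
    then show "ev (F Z) (xs @ Z # ys) = 0"
      using *[rule_format, of Z "xs @ Z # ys"] quad by auto
  qed
qed

lemma euler_swap:
  assumes "euler t F" "1 \<le> i" "i \<le> t" "1 \<le> j" "j \<le> t"
  shows "euler t (swap_slots i j F)"
  using assms unfolding euler_set by (auto simp: ev_swap_slots)

lemma euler_diff: "euler s F \<Longrightarrow> euler s G \<Longrightarrow> euler s (\<lambda>Z I. F Z I - G Z I)"
  by (simp add: euler_def ev_diff)

text \<open>If \<open>Z\<close> is an argument of the metric, the tangency of the other argument
  gives zero; otherwise it is an argument of \<open>G\<close>.\<close>

lemma euler_ins_g:
  assumes "euler s G"
  shows "euler (s + 2) (ins_g g s G)"
  unfolding euler_set
proof (intro ballI allI impI)
  fix Z and vs :: "(complex^'m) list"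
  assume *: "Z \<in> A" "length vs = s + 2" "\<forall>v\<in>set vs. bil g v Z = 0" "Z \<in> set vs"
  have o: "bil g (vs ! r) Z = 0" "bil g Z (vs ! r) = 0" if "r < s + 2" for r
    using * that by (auto simp: bil_sym[of Z])
  show "ev (ins_g g s G Z) vs = 0"
  proof (cases "Z \<in> set (take s vs)")
    case True
    moreover have "\<forall>v\<in>set (take s vs). bil g v Z = 0" using * by (auto dest: in_set_takeD)
    ultimately have "ev (G Z) (take s vs) = 0"
      using assms[unfolded euler_set, rule_format, OF *(1), of "take s vs"] * by auto
    then show ?thesis using * by (simp add: ev_ins_g)
  next
    case False
    obtain r where r: "r < s + 2" "vs ! r = Z" using * by (auto simp: in_set_conv_nth)
    have "\<not> r < s"
    proof
      assume "r < s"
      then have "Z \<in> set (take s vs)" using r * by (auto simp: in_set_conv_nth intro!: exI[of _ r])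
      then show False using False by simp
    qed
    then have "r = s \<or> r = s + 1" using r by auto
    then have "bil g (vs ! s) (vs ! (s + 1)) = 0" using r o by auto
    then show ?thesis using * by (simp add: ev_ins_g)
  qed
qed

lemma euler_comm_rhs:
  assumes "euler s G"
  shows "euler (s + 2) (comm_rhs g k s G)"
  unfolding euler_set
proof (intro ballI allI impI)
  fix Z and vs :: "(complex^'m) list"
  assume *: "Z \<in> A" "length vs = s + 2" "\<forall>v\<in>set vs. bil g v Z = 0" "Z \<in> set vs"
  note e = euler_ins_g[OF assms, unfolded euler_set, rule_format, OF *(1)]
  have "ev (ins_g g s G Z) (lswap i j vs) = 0" if "i < s + 2" "j < s + 2" for i j
    using that * by (intro e) auto
  then have "(\<Sum>r = 1..s. ev (ins_g g s G Z) (lswap (r - 1) s vs) - ev (ins_g g s G Z) (lswap (r - 1) (s + 1) vs)) = 0"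
    by (intro sum.neutral ballI) auto
  then show "ev (comm_rhs g k s G Z) vs = 0"
    using e[of vs] * by (simp add: ev_comm_rhs)
qed

text \<open>Both sides are unchanged when the arguments are replaced by their \<open>pih Z\<close>,
  and \<open>pih Z\<close> of a tangent vector is orthogonal to \<open>Z\<close> as well as to
  \<open>cj Z\<close>.\<close>

lemma sec_eq_eulerI:
  assumes F: "euler s F" and G: "euler s G"
    and eq: "\<And>Z vs. Z \<in> A \<Longrightarrow> length vs = s \<Longrightarrow> \<forall>v\<in>set vs. bil g v Z = 0 \<and> bil g v (cj Z) = 0 \<Longrightarrow> ev (F Z) vs = ev (G Z) vs"
  shows "sec_eq g A s F G"
  unfolding sec_eq_iff
proof (intro ballI allI impI)
  fix Z and vs :: "(complex^'m) list"
  assume *: "Z \<in> A" "length vs = s" "\<forall>v\<in>set vs. bil g v Z = 0"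
  have "ev (H Z) vs = ev (H Z) (map (pih Z) vs)" if "euler s H" for H
  proof -
    have "ev (H Z) (map (pih Z) (take r vs) @ Z # drop (Suc r) vs) = 0" if "r < length vs" for r
      using that * \<open>euler s H\<close>
      by (intro \<open>euler s H\<close>[unfolded euler_def, rule_format])
        (auto intro!: orth_pih_tangent dest: in_set_takeD in_set_dropD)
    then show ?thesis by (subst split_slot) simp
  qed
  moreover have "ev (F Z) (map (pih Z) vs) = ev (G Z) (map (pih Z) vs)"
    using * by (intro eq) (auto simp: orth_pih_tangent pih_orth pos)
  ultimately show "ev (F Z) vs = ev (G Z) vs" using F G by simp
qed

theorem commutator:
  assumes sec: "is_section g A k s F"
  shows "sec_eq g A (s + 2)
    (\<lambda>Z I. lower g (raise g k F) Z I - swap_slots (s + 1) (s + 2) (raise g (k - 1) (lower g F)) Z I)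
    (comm_rhs g k s F)"
proof (rule sec_eq_eulerI)
  have LR: "is_section g A k (s + 2) (lower g (raise g k F))"
    using is_section_lower[OF is_section_raise[OF sec]] by simp
  have RL: "is_section g A k (s + 2) (raise g (k - 1) (lower g F))"
    using is_section_raise[OF is_section_lower[OF sec]] by simp
  show "euler (s + 2) (\<lambda>Z I. lower g (raise g k F) Z I - swap_slots (s + 1) (s + 2) (raise g (k - 1) (lower g F)) Z I)"
    using LR RL by (intro euler_diff euler_swap) (auto simp: is_section_iff)
  show "euler (s + 2) (comm_rhs g k s F)"
    using sec by (intro euler_comm_rhs) (simp add: is_section_iff)
next
  fix Z and us :: "(complex^'m) list"
  assume Z: "Z \<in> A" and lu: "length us = s + 2" and o: "\<forall>v\<in>set us. bil g v Z = 0 \<and> bil g v (cj Z) = 0"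
  define vs a b where "vs = take s us" and "a = us ! s" and "b = us ! (s + 1)"
  have us: "us = vs @ [a, b]"
    using lu by (intro nth_equalityI) (auto simp: vs_def a_def b_def nth_append less_Suc_eq nth_Cons')
  have lv: "length vs = s" using lu by (simp add: vs_def)
  have 1: "lswap s (s + 1) us = vs @ [b, a]"
    unfolding us lswap_def using lv by (simp add: nth_append list_update_append)
  have s1: "lswap (r - 1) s us = vs[r - 1 := a] @ [vs ! (r - 1), b]" if "r \<in> {1..s}" for r
    unfolding us lswap_def using lv that by (auto simp: nth_append list_update_append)
  have s2: "lswap (r - 1) (s + 1) us = vs[r - 1 := b] @ [a, vs ! (r - 1)]" if "r \<in> {1..s}" for r
    unfolding us lswap_def using lv that by (auto simp: nth_append list_update_append)
  have ins: "ev (ins_g g s F Z) (ws @ [x, y]) = bil g x y * ev (F Z) ws" if "length ws = s" for ws x y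
    using that by (simp add: ev_ins_g nth_append)
  have "ev (\<lambda>I. lower g (raise g k F) Z I - swap_slots (s + 1) (s + 2) (raise g (k - 1) (lower g F)) Z I) us =
    ev (lower g (raise g k F) Z) (vs @ [a, b]) - ev (raise g (k - 1) (lower g F) Z) (vs @ [b, a])"
    using lu 1 by (simp add: ev_diff ev_swap_slots us)
  also have "\<dots> = of_int k / 2 * bil g a b * ev (F Z) vs + 1 / 2 * (\<Sum>r<s. bil g (vs ! r) b * ev (F Z) (vs[r := a]) -
       bil g (vs ! r) a * ev (F Z) (vs[r := b]))"
    by (rule commutator_orth[OF sec Z lv]) (use o us in auto)
  also have "(\<Sum>r<s. bil g (vs ! r) b * ev (F Z) (vs[r := a]) - bil g (vs ! r) a * ev (F Z) (vs[r := b])) =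
     (\<Sum>r = 1..s. bil g (vs ! (r - 1)) b * ev (F Z) (vs[r - 1 := a]) - bil g (vs ! (r - 1)) a * ev (F Z) (vs[r - 1 := b]))"
    by (rule sum.reindex_bij_witness[where i = "\<lambda>r. r - 1" and j = Suc]) auto
  also have "\<dots> = (\<Sum>r = 1..s. ev (ins_g g s F Z) (lswap (r - 1) s us) - ev (ins_g g s F Z) (lswap (r - 1) (s + 1) us))"
  proof (intro sum.cong refl)
    fix r assume r: "r \<in> {1..s}"
    show "bil g (vs ! (r - 1)) b * ev (F Z) (vs[r - 1 := a]) - bil g (vs ! (r - 1)) a * ev (F Z) (vs[r - 1 := b]) =
      ev (ins_g g s F Z) (lswap (r - 1) s us) - ev (ins_g g s F Z) (lswap (r - 1) (s + 1) us)"
      by (simp only: s1[OF r] s2[OF r] ins length_list_update lv bil_sym[of a "vs ! (r - 1)"])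
  qed
  also have "of_int k / 2 * bil g a b * ev (F Z) vs = of_int k / 2 * ev (ins_g g s F Z) us"
    by (simp add: us ins[OF lv])
  finally show "ev (\<lambda>I. lower g (raise g k F) Z I - swap_slots (s + 1) (s + 2) (raise g (k - 1) (lower g F)) Z I) us =
    ev (comm_rhs g k s F Z) us"
    using lu by (simp add: ev_comm_rhs)
qed

section \<open>Iterated lowering and nilpotency\<close>

lemma smrep_lowern: "smrep s F \<Longrightarrow> smrep (s + d) ((lower g ^^ d) F)"
  by (induction d) (auto dest: smrep_lower)

lemma lowern_sec_eq:
  "smrep s F \<Longrightarrow> smrep s G \<Longrightarrow> sec_eq g A s F G \<Longrightarrow> sec_eq g A (s + d) ((lower g ^^ d) F) ((lower g ^^ d) G)"
proof (induction d)
  case (Suc d)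
  then show ?case
    using lower_sec_eq[of "s + d"] smrep_difrep[OF smrep_lowern] by (simp del: sec_eq_def)
qed simp

lemma lowern_comb:
  assumes F: "smrep s F" and G: "smrep s G"
  shows "sec_eq g A (s + d) ((lower g ^^ d) (\<lambda>Z I. a * F Z I + b * G Z I))
    (\<lambda>Z I. a * (lower g ^^ d) F Z I + b * (lower g ^^ d) G Z I)"
proof (induction d)
  case (Suc d)
  have "sec_eq g A (s + d + 1) (lower g ((lower g ^^ d) (\<lambda>Z I. a * F Z I + b * G Z I)))
     (lower g (\<lambda>Z I. a * (lower g ^^ d) F Z I + b * (lower g ^^ d) G Z I))"
    by (intro lower_sec_eq smrep_difrep smrep_lowern smrep_add F G Suc)
  from sec_eq_trans[OF this lower_comb[OF smrep_difrep[OF smrep_lowern[OF F]] smrep_difrep[OF smrep_lowern[OF G]]]]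
  show ?case by simp
qed simp

lemma lowern_swap:
  assumes F: "smrep t F" and ij: "1 \<le> i" "i \<le> t" "1 \<le> j" "j \<le> t"
  shows "sec_eq g A (t + d) ((lower g ^^ d) (swap_slots i j F)) (swap_slots i j ((lower g ^^ d) F))"
proof (induction d)
  case (Suc d)
  have "sec_eq g A (t + d + 1) (lower g ((lower g ^^ d) (swap_slots i j F)))
     (lower g (swap_slots i j ((lower g ^^ d) F)))"
    by (intro lower_sec_eq smrep_difrep smrep_lowern smrep_swap F Suc)
  moreover have "sec_eq g A (t + d + 1) (lower g (swap_slots i j ((lower g ^^ d) F)))
     (swap_slots i j (lower g ((lower g ^^ d) F)))"
    by (rule sec_eq_pointwise, rule lower_swap_slots[of i "t + d"]) (use ij in auto)
  ultimately show ?case using sec_eq_trans by simp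
qed simp

lemma lowern_comm_rhs:
  assumes G: "smrep s G"
  shows "sec_eq g A (s + 2 + d) ((lower g ^^ d) (comm_rhs g k s G)) (comm_rhs g k s ((lower g ^^ d) G))"
proof (induction d)
  case (Suc d)
  have "smrep (s + 2) (comm_rhs g k s G)" using smrep_comm_rhs[of s 0] G by simp
  then have "sec_eq g A (s + 2 + d + 1) (lower g ((lower g ^^ d) (comm_rhs g k s G)))
     (lower g (comm_rhs g k s ((lower g ^^ d) G)))"
    by (intro lower_sec_eq smrep_difrep smrep_lowern smrep_comm_rhs G Suc)
  moreover have "sec_eq g A (s + 2 + d + 1) (lower g (comm_rhs g k s ((lower g ^^ d) G)))
     (comm_rhs g k s (lower g ((lower g ^^ d) G)))"
    by (rule sec_eq_pointwise, rule lower_comm_rhs[OF smrep_difrep[OF smrep_lowern[OF G]]]) auto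
  ultimately show ?case using sec_eq_trans by simp
qed simp

text \<open>Further lowerings pass through the interchange of slots and through
  \<open>comm_rhs\<close>, because their slots come behind. It is the recursion by which
  \<open>raise\<close> is moved to the left of all lowerings but those contained in
  \<open>F\<close>.\<close>

lemma lowern_raise:
  assumes sec: "is_section g A k s F"
  shows "sec_eq g A (s + 2 + d) ((lower g ^^ (d + 1)) (raise g k F))
    (\<lambda>Z I. swap_slots (s + 1) (s + 2) ((lower g ^^ d) (raise g (k - 1) (lower g F))) Z I +
      comm_rhs g k s ((lower g ^^ d) F) Z I)"
proof -
  have smF: "smrep s F" using sec by (simp add: is_section_iff)
  define R where "R = raise g (k - 1) (lower g F)"
  have smR: "smrep (s + 2) R"
    using smrep_raise[OF smrep_lower[OF smF]] by (simp add: R_def)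
  have smL: "smrep (s + 2) (lower g (raise g k F))"
    using smrep_lower[OF smrep_raise[OF smF]] by simp
  have smS: "smrep (s + 2) (swap_slots (s + 1) (s + 2) R)" by (rule smrep_swap[OF smR])
  have smC: "smrep (s + 2) (comm_rhs g k s F)" using smrep_comm_rhs[of s 0] smF by simp
  have "sec_eq g A (s + 2) (lower g (raise g k F))
      (\<lambda>Z I. 1 * swap_slots (s + 1) (s + 2) R Z I + 1 * comm_rhs g k s F Z I)"
    using commutator[OF sec] unfolding sec_eq_iff R_def[symmetric]
    by (simp add: ev_diff ev_add algebra_simps)
  from lowern_sec_eq[OF smL smrep_add[OF smS smC] this, of d]
  have 1: "sec_eq g A (s + 2 + d) ((lower g ^^ d) (lower g (raise g k F)))
    ((lower g ^^ d) (\<lambda>Z I. 1 * swap_slots (s + 1) (s + 2) R Z I + 1 * comm_rhs g k s F Z I))" .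
  note 2 = sec_eq_trans[OF 1 lowern_comb[OF smS smC, of d 1 1]]
  have 3: "sec_eq g A (s + 2 + d) (\<lambda>Z I. 1 * (lower g ^^ d) (swap_slots (s + 1) (s + 2) R) Z I + 1 * (lower g ^^ d) (comm_rhs g k s F) Z I)
     (\<lambda>Z I. swap_slots (s + 1) (s + 2) ((lower g ^^ d) R) Z I + comm_rhs g k s ((lower g ^^ d) F) Z I)"
    using lowern_swap[OF smR, of "s + 1" "s + 2" d] lowern_comm_rhs[OF smF, of d k]
    unfolding sec_eq_iff by (simp add: ev_add)
  show ?thesis
    using sec_eq_trans[OF 2 3] by (simp add: funpow_Suc_right R_def del: funpow.simps)
qed

lemma sec_eq_swap_add_zero:
  assumes "sec_eq g A (s + 2 + d) F (\<lambda>_ _. 0)" "sec_eq g A (s + d) G (\<lambda>_ _. 0)"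
  shows "sec_eq g A (s + 2 + d) (\<lambda>Z I. swap_slots (s + 1) (s + 2) F Z I + comm_rhs g k s G Z I) (\<lambda>_ _. 0)"
proof -
  have z: "swap_slots i j (\<lambda>_ _. 0) = (\<lambda>_ _. 0)" for i j by (simp add: swap_slots_def)
  have z': "comm_rhs g k s (\<lambda>_ _. 0) = (\<lambda>_ _. 0)"
    by (simp add: comm_rhs_def ins_g_def swap_slots_def)
  show ?thesis
    using swap_sec_eq[OF assms(1), of "s + 1" "s + 2"] comm_rhs_sec_eq[OF assms(2), of k]
    unfolding sec_eq_iff z z' by (simp add: ev_add)
qed

text \<open>Induction on \<open>d\<close> with \<open>F\<close> arbitrary: the recursion
  \<open>lowern_raise\<close> passes to \<open>lower g F\<close>, which has weight
  \<open>k - 1\<close>, one more slot, and is killed by one lowering less.\<close>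

lemma raise_nilpotent:
  assumes "is_section g A k s F" "sec_eq g A (s + d) ((lower g ^^ d) F) (\<lambda>_ _. 0)"
  shows "sec_eq g A (s + 1 + (d + 1)) ((lower g ^^ (d + 1)) (raise g k F)) (\<lambda>_ _. 0)"
  using assms
proof (induction d arbitrary: k s F)
  case 0
  have smF: "smrep s F" using 0(1) by (simp add: is_section_iff)
  \<comment> \<open>Zero is written as the multiple \<open>0 * F\<close>, so that the compatibility
    with classes and with scalars applies to it.\<close>
  have z: "sec_eq g A s F (\<lambda>Z I. 0 * F Z I)" using 0(2) by simp
  have "sec_eq g A (s + 1) (raise g k F) (raise g k (\<lambda>Z I. 0 * F Z I))"
    by (intro raise_sec_eq difrep_cmult smrep_difrep smF z)
  from sec_eq_trans[OF this raise_cmult[OF smrep_difrep[OF smF]]]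
  have z1: "sec_eq g A (s + 1) (raise g k F) (\<lambda>Z I. 0 * raise g k F Z I)" .
  have d1: "difrep (s + 1) (raise g k F)" by (intro smrep_difrep smrep_raise smF)
  have "sec_eq g A (s + 1 + 1) (lower g (raise g k F)) (lower g (\<lambda>Z I. 0 * raise g k F Z I))"
    by (rule lower_sec_eq[OF d1 difrep_cmult[OF d1] z1])
  from sec_eq_trans[OF this lower_cmult[OF d1]] show ?case by simp
next
  case (Suc d)
  have "sec_eq g A (s + 1 + d) ((lower g ^^ d) (lower g F)) (\<lambda>_ _. 0)"
    using Suc.prems(2) by (simp add: funpow_Suc_right del: funpow.simps)
  from Suc.IH[OF is_section_lower[OF Suc.prems(1)] this]
  have "sec_eq g A (s + 2 + (d + 1)) ((lower g ^^ (d + 1)) (raise g (k - 1) (lower g F))) (\<lambda>_ _. 0)"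
    by simp
  moreover have "sec_eq g A (s + (d + 1)) ((lower g ^^ (d + 1)) F) (\<lambda>_ _. 0)"
    using Suc.prems(2) by simp
  ultimately show ?case
    using sec_eq_trans[OF lowern_raise[OF Suc.prems(1), of "d + 1"] sec_eq_swap_add_zero] by simp
qed

end

section \<open>Holomorphic functions of several variables\<close>

lemma norm_smult: "norm (c *s v) = cmod c * norm (v :: complex^'m)"
  by (simp add: norm_vec_def norm_mult L2_set_right_distrib)

lemma scaleR_smult: "r *\<^sub>R x = complex_of_real r *s x"
  by (simp add: vec_eq_iff complex_eq_iff)

text \<open>The ambient counterpart of \<open>holo_on\<close>: the derivative is taken at the point
  instead of within the set.\<close>

definition cdiff_on :: "(complex^'m) set \<Rightarrow> (complex^'m \<Rightarrow> complex) \<Rightarrow> bool" where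
  "cdiff_on U f \<longleftrightarrow> (\<forall>z\<in>U. \<exists>f'. (f has_derivative f') (at z) \<and> (\<forall>c v. f' (c *s v) = c * f' v))"

lemma cdiff_onD:
  assumes "cdiff_on U f" "z \<in> U"
  shows "(f has_derivative frechet_derivative f (at z)) (at z)"
    "frechet_derivative f (at z) (c *s v) = c * frechet_derivative f (at z) v"
    "f differentiable (at z)" "dee f v z = frechet_derivative f (at z) v"
proof -
  obtain f' where f': "(f has_derivative f') (at z)" "\<And>c v. f' (c *s v) = c * f' v"
    using assms unfolding cdiff_on_def by blast
  have eq: "f' = frechet_derivative f (at z)" by (rule frechet_derivative_at[OF f'(1)])
  show 2: "frechet_derivative f (at z) (c *s v) = c * frechet_derivative f (at z) v" for c v
    using f'(2) by (simp add: eq)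
  show "(f has_derivative frechet_derivative f (at z)) (at z)" using f' eq by simp
  show "f differentiable (at z)" using f'(1) by (auto simp: differentiable_def)
  show "dee f v z = frechet_derivative f (at z) v"
    by (simp add: dee_def 2)
qed

lemma line_field_derivative:
  assumes "cdiff_on U f" "z + t *s v \<in> U"
  shows "((\<lambda>t. f (z + t *s v)) has_field_derivative frechet_derivative f (at (z + t *s v)) v) (at t)"
proof -
  have "((\<lambda>t. z + t *s v) has_derivative (\<lambda>h. h *s v)) (at t)"
    using has_derivative_add[OF has_derivative_const[of z]
      bounded_linear_imp_has_derivative[OF bounded_linear_smult_left[of v]]] by simp
  from has_derivative_compose[OF this cdiff_onD(1)[OF assms]] show ?thesis
    unfolding has_field_derivative_def
    by (rule has_derivative_eq_rhs) (simp add: fun_eq_iff cdiff_onD(2)[OF assms] mult.commute)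
qed

text \<open>Taylor's formula to first order on the disc of radius 1/4. Its second derivative is
  estimated by Cauchy's inequality on circles of radius 1/2, which gives
  \<open>2 * M / (1 / 2)\<^sup>2\<close>, that is \<open>8 * M\<close>.\<close>

lemma holomorphic_quadratic_bound:
  assumes hol: "\<phi> holomorphic_on ball 0 1" and M: "\<And>t. t \<in> ball 0 1 \<Longrightarrow> cmod (\<phi> t) \<le> M"
    and l: "cmod l \<le> 1 / 4"
  shows "cmod (\<phi> l - \<phi> 0 - deriv \<phi> 0 * l) \<le> 8 * M * (cmod l)\<^sup>2"
proof -
  have sub: "cball x (1 / 2) \<subseteq> ball 0 1" if "x \<in> cball 0 (1 / 4)" for x :: complex
  proof
    fix y assume "y \<in> cball x (1 / 2)"
    then have "norm y \<le> norm x + 1 / 2"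
      using norm_triangle_sub[of y x] by (simp add: dist_norm norm_minus_commute)
    then show "y \<in> ball 0 1" using that by simp
  qed
  have "cmod ((deriv ^^ 0) \<phi> l - (\<Sum>i\<le>1. (deriv ^^ i) \<phi> 0 * (l - 0) ^ i / fact i)) \<le> 8 * M * cmod (l - 0) ^ Suc 1 / fact 1"
  proof (rule complex_Taylor[of "cball 0 (1 / 4)" 1 "\<lambda>i. (deriv ^^ i) \<phi>"])
    fix i and x :: complex assume x: "x \<in> cball 0 (1 / 4)"
    have "x \<in> ball (0::complex) 1" using x by simp
    then have "((deriv ^^ i) \<phi> has_field_derivative deriv ((deriv ^^ i) \<phi>) x) (at x)"
      by (intro holomorphic_derivI[OF holomorphic_higher_deriv[OF hol open_ball] open_ball])
    then show "((deriv ^^ i) \<phi> has_field_derivative (deriv ^^ Suc i) \<phi> x) (at x within cball 0 (1 / 4))"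
      by (simp add: has_field_derivative_at_within)
  next
    fix x :: complex assume x: "x \<in> cball 0 (1 / 4)"
    have "cmod ((deriv ^^ 2) \<phi> x) \<le> fact 2 * M / (1 / 2) ^ 2"
    proof (rule Cauchy_inequality)
      show "\<phi> holomorphic_on ball x (1 / 2)"
        using sub[OF x] by (intro holomorphic_on_subset[OF hol]) (auto simp: subset_iff)
      show "continuous_on (cball x (1 / 2)) \<phi>"
        using holomorphic_on_imp_continuous_on[OF holomorphic_on_subset[OF hol sub[OF x]]] .
      show "cmod (\<phi> y) \<le> M" if "cmod (x - y) = 1 / 2" for y
        using sub[OF x] that by (intro M) (auto simp: subset_iff dist_norm)
    qed simp
    then show "cmod ((deriv ^^ Suc 1) \<phi> x) \<le> 8 * M"
      by (simp add: numeral_2_eq_2 power2_eq_square)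
  qed (use l in auto)
  then show ?thesis by (simp add: power2_eq_square diff_diff_eq)
qed

text \<open>Restriction to the complex line through \<open>z\<close> in direction \<open>h\<close>,
  scaled so that the unit disc is mapped into the ball of radius \<open>r\<close>. The increment
  \<open>h\<close> then belongs to the parameter \<open>norm h / r\<close>, at most 1/4.\<close>

lemma cdiff_quadratic_bound:
  assumes f: "cdiff_on U f" and r: "r > 0" "ball z r \<subseteq> U" and M: "\<And>w. w \<in> ball z r \<Longrightarrow> cmod (f w) \<le> M"
    and h: "4 * norm h \<le> r"
  shows "cmod (f (z + h) - f z - frechet_derivative f (at z) h) \<le> 8 * M / r\<^sup>2 * (norm h)\<^sup>2"
proof (cases "h = 0")
  case True
  have "z \<in> U" using r by auto
  then show ?thesis
    using True cdiff_onD(2)[OF f, of z 0 0] by simp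
next
  case False
  define v where "v = complex_of_real (r / norm h) *s h"
  define l where "l = norm h / r"
  have nv: "norm v = r" using False r by (simp add: v_def norm_smult norm_divide)
  have hv: "h = complex_of_real l *s v"
    using False r by (simp add: v_def l_def vector_smult_assoc)
  have inU: "z + t *s v \<in> ball z r" if "t \<in> ball 0 1" for t
    using that r by (simp add: dist_norm norm_smult nv)
  define \<phi> where "\<phi> = (\<lambda>t. f (z + t *s v))"
  have d: "(\<phi> has_field_derivative frechet_derivative f (at (z + t *s v)) v) (at t)" if "t \<in> ball 0 1" for t
    unfolding \<phi>_def using inU[OF that] r by (intro line_field_derivative[OF f]) auto
  then have hol: "\<phi> holomorphic_on ball 0 1"
    unfolding holomorphic_on_open[OF open_ball] by blast
  have zU: "z \<in> U" using r by auto
  have "cmod (\<phi> l - \<phi> 0 - deriv \<phi> 0 * l) \<le> 8 * M * (cmod l)\<^sup>2"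
  proof (rule holomorphic_quadratic_bound[OF hol])
    have "0 \<le> l" "l \<le> 1 / 4" using h r by (simp_all add: l_def field_simps)
    then show "cmod (complex_of_real l) \<le> 1 / 4" by simp
    show "cmod (\<phi> t) \<le> M" if "t \<in> ball 0 1" for t
      unfolding \<phi>_def by (rule M[OF inU[OF that]])
  qed
  moreover have "deriv \<phi> 0 * l = frechet_derivative f (at z) h"
    using DERIV_imp_deriv[OF d[of 0]] cdiff_onD(2)[OF f zU, of l v] by (simp add: hv mult.commute)
  moreover have "8 * M * (cmod l)\<^sup>2 = 8 * M / r\<^sup>2 * (norm h)\<^sup>2"
    using r by (simp add: l_def power_divide power_mult_distrib norm_divide)
  ultimately show ?thesis by (simp add: \<phi>_def hv[symmetric])
qed

text \<open>On each complex line the one-variable theorem makes the derivatives converge. The common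
  bound \<open>M\<close> makes the quadratic error estimate independent of \<open>n\<close>, so it
  survives in the limit and identifies the pointwise limit of the differentials as the differential
  of \<open>G\<close>.\<close>

lemma cdiff_uniform_limit:
  fixes F :: "nat \<Rightarrow> complex^'m \<Rightarrow> complex"
  assumes r: "r > 0" and F: "\<And>n. cdiff_on (ball z0 r) (F n)"
    and M: "\<And>n w. w \<in> ball z0 r \<Longrightarrow> cmod (F n w) \<le> M"
    and lim: "uniform_limit (ball z0 r) F G sequentially"
  shows "\<exists>T. (G has_derivative T) (at z0) \<and> (\<forall>c v. T (c *s v) = c * T v)"
proof -
  define D where "D = (\<lambda>n. frechet_derivative (F n) (at z0))"
  have z0: "z0 \<in> ball z0 r" using r by simp
  have conv: "convergent (\<lambda>n. D n h)" for h
  proof -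
    define S where "S = {t. cmod t * norm h < r}"
    have "open S" unfolding S_def by (intro open_Collect_less continuous_intros)
    have "0 \<in> S" using r by (simp add: S_def)
    have inS: "z0 + t *s h \<in> ball z0 r" if "t \<in> S" for t
      using that by (simp add: S_def dist_norm norm_smult)
    have d: "((\<lambda>t. F n (z0 + t *s h)) has_field_derivative frechet_derivative (F n) (at (z0 + t *s h)) h) (at t)"
      if "t \<in> S" for t n
      using line_field_derivative[OF F[of n], of z0 t h] inS[OF that] by simp
    have "\<exists>d. 0 < d \<and> cball t d \<subseteq> S \<and>
        uniform_limit (cball t d) (\<lambda>n t. F n (z0 + t *s h)) (\<lambda>t. G (z0 + t *s h)) sequentially" if tS: "t \<in> S" for t
    proof -
      obtain d where d: "d > 0" "cball t d \<subseteq> S"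
        using \<open>open S\<close>[unfolded open_contains_cball, rule_format, OF tS] by auto
      have "uniform_limit (cball t d) (\<lambda>n t. F n (z0 + t *s h)) (\<lambda>t. G (z0 + t *s h)) sequentially"
        unfolding uniform_limit_iff
      proof (intro allI impI)
        fix e :: real assume "e > 0"
        have "\<forall>\<^sub>F n in sequentially. \<forall>x\<in>ball z0 r. dist (F n x) (G x) < e"
          by (rule lim[unfolded uniform_limit_iff, rule_format, OF \<open>e > 0\<close>])
        then show "\<forall>\<^sub>F n in sequentially. \<forall>x\<in>cball t d. dist (F n (z0 + x *s h)) (G (z0 + x *s h)) < e"
          by (rule eventually_mono) (use d(2) inS in blast)
      qed
      with d show ?thesis by blast
    qed
    from has_complex_derivative_uniform_sequence[OF \<open>open S\<close> d this]
    obtain g' where "\<forall>x\<in>S. ((\<lambda>t. G (z0 + t *s h)) has_field_derivative g' x) (at x) \<and>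
      (\<lambda>n. frechet_derivative (F n) (at (z0 + x *s h)) h) \<longlonglongrightarrow> g' x" by blast
    from bspec[OF this \<open>0 \<in> S\<close>] show ?thesis by (auto simp: D_def convergent_def)
  qed
  define T where "T = (\<lambda>h. lim (\<lambda>n. D n h))"
  have T: "(\<lambda>n. D n h) \<longlonglongrightarrow> T h" for h
    using conv[of h] by (simp add: T_def convergent_LIMSEQ_iff)
  have lin: "linear (D n)" for n
    unfolding D_def by (rule has_derivative_linear[OF cdiff_onD(1)[OF F z0]])
  have Tadd: "T (x + y) = T x + T y" for x y
    using LIMSEQ_unique[OF T[of "x + y"]] tendsto_add[OF T[of x] T[of y]] by (simp add: linear_add[OF lin])
  have Tsc: "T (c *s x) = c * T x" for c x
    using LIMSEQ_unique[OF T[of "c *s x"]] tendsto_mult[OF tendsto_const T[of x], of c]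
    by (simp add: D_def cdiff_onD(2)[OF F z0])
  have bl: "bounded_linear T"
    unfolding linear_conv_bounded_linear[symmetric]
    by (intro linearI) (simp_all add: Tadd scaleR_smult Tsc scaleR_conv_of_real)
  have ptw: "(\<lambda>n. F n w) \<longlonglongrightarrow> G w" if "w \<in> ball z0 r" for w
    using tendsto_uniform_limitI[OF lim that] .
  have bound: "cmod (G (z0 + h) - G z0 - T h) \<le> 8 * M / r\<^sup>2 * (norm h)\<^sup>2" if h: "4 * norm h \<le> r" for h
  proof (rule LIMSEQ_le_const2)
    have "z0 + h \<in> ball z0 r" using h r norm_ge_zero[of h] by (simp add: dist_norm)
    then show "(\<lambda>n. cmod (F n (z0 + h) - F n z0 - D n h)) \<longlonglongrightarrow> cmod (G (z0 + h) - G z0 - T h)"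
      by (intro tendsto_intros ptw T z0)
    show "\<exists>N. \<forall>n\<ge>N. cmod (F n (z0 + h) - F n z0 - D n h) \<le> 8 * M / r\<^sup>2 * (norm h)\<^sup>2"
      unfolding D_def using cdiff_quadratic_bound[OF F r order.refl M h] by blast
  qed
  have "(G has_derivative T) (at z0)"
  proof (rule has_derivativeI_sandwich[where e = "r / 4" and H = "\<lambda>y. 8 * M / r\<^sup>2 * norm (y - z0)"])
    show "((\<lambda>y. 8 * M / r\<^sup>2 * norm (y - z0)) \<longlongrightarrow> 0) (at z0)"
      using r by (auto intro!: tendsto_eq_intros)
    fix y assume y: "y \<noteq> z0" "dist y z0 < r / 4"
    then have "cmod (G (z0 + (y - z0)) - G z0 - T (y - z0)) \<le> 8 * M / r\<^sup>2 * (norm (y - z0))\<^sup>2"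
      by (intro bound) (simp add: dist_norm)
    then show "cmod (G y - G z0 - T (y - z0)) / norm (y - z0) \<le> 8 * M / r\<^sup>2 * norm (y - z0)"
      using y by (simp add: divide_le_eq power2_eq_square mult.assoc)
  qed (use r bl in auto)
  with Tsc show ?thesis by blast
qed

lemma cdiff_on_shift:
  assumes f: "cdiff_on U f" and sub: "\<And>z. z \<in> V \<Longrightarrow> z + a \<in> U" "V \<subseteq> U"
  shows "cdiff_on V (\<lambda>z. c * (f (z + a) - f z))"
  unfolding cdiff_on_def
proof
  fix z assume z: "z \<in> V"
  let ?D1 = "frechet_derivative f (at (z + a))" and ?D0 = "frechet_derivative f (at z)"
  have zU: "z \<in> U" using z sub(2) by blast
  have "((\<lambda>z. z + a) has_derivative (\<lambda>h. h)) (at z)" by (auto intro!: derivative_eq_intros)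
  from has_derivative_compose[OF this cdiff_onD(1)[OF f sub(1)[OF z]]]
  have "((\<lambda>z. f (z + a)) has_derivative ?D1) (at z)" .
  from has_derivative_mult_right[OF has_derivative_diff[OF this cdiff_onD(1)[OF f zU]], of c]
  have "((\<lambda>z. c * (f (z + a) - f z)) has_derivative (\<lambda>h. c * (?D1 h - ?D0 h))) (at z)" .
  moreover have "c * (?D1 (k *s v) - ?D0 (k *s v)) = k * (c * (?D1 v - ?D0 v))" for k v
    by (simp only: cdiff_onD(2)[OF f sub(1)[OF z]] cdiff_onD(2)[OF f zU]) (simp add: algebra_simps)
  ultimately show "\<exists>f'. ((\<lambda>z. c * (f (z + a) - f z)) has_derivative f') (at z) \<and> (\<forall>c v. f' (c *s v) = c * f' v)"
    by blast
qed

text \<open>The directional derivative is a uniform limit of difference quotients. These are complex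
  differentiable, and the quadratic estimate bounds their error uniformly near the given
  point.\<close>

lemma cdiff_on_derivative:
  assumes U: "open U" and f: "cdiff_on U f"
  shows "cdiff_on U (\<lambda>z. frechet_derivative f (at z) b)"
  unfolding cdiff_on_def
proof
  fix z0 assume "z0 \<in> U"
  then obtain R where R: "R > 0" "cball z0 R \<subseteq> U" using U open_contains_cball by blast
  define r where "r = R / 2"
  have r: "r > 0" using R by (simp add: r_def)
  have sub: "w \<in> cball z0 R" if "z \<in> ball z0 r" "dist z w \<le> r" for z w
    using that dist_triangle[of z0 w z] by (simp add: r_def)
  have "continuous_on (cball z0 R) f"
    using R(2) cdiff_onD(3)[OF f] by (intro differentiable_imp_continuous_on)
      (auto simp: differentiable_on_def intro: differentiable_at_withinI)
  then have "bounded (f ` cball z0 R)"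
    by (intro compact_imp_bounded compact_continuous_image compact_cball)
  then obtain M where M: "\<And>w. w \<in> cball z0 R \<Longrightarrow> cmod (f w) \<le> M"
    unfolding bounded_iff by blast
  have "cmod (f z0) \<le> M" using R by (intro M) simp
  then have M0: "M \<ge> 0" using norm_ge_zero[of "f z0"] by linarith
  \<comment> \<open>The steps are \<open>b / (n + k0)\<close>; this start makes already the first
    one short enough for the quadratic estimate.\<close>
  obtain k0 :: nat where k0: "k0 > 0" "4 * norm b / r \<le> of_nat k0"
  proof -
    obtain k :: nat where "4 * norm b / r \<le> of_nat k" using real_arch_simple by blast
    then show thesis by (intro that[of "Suc k"]) auto
  qed
  define a where "a = (\<lambda>n. inverse (complex_of_nat (n + k0)) *s b)"
  define F where "F = (\<lambda>n z. of_nat (n + k0) * (f (z + a n) - f z))"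
  have na: "norm (a n) = norm b / (n + k0)" for n
    by (simp add: a_def norm_smult norm_inverse divide_inverse mult.commute)
       (metis norm_of_nat of_nat_add)
  have small: "4 * norm (a n) \<le> r" for n
  proof -
    have "4 * norm b \<le> r * of_nat k0" using k0 r by (simp add: field_simps)
    also have "\<dots> \<le> r * (n + k0)" using r by simp
    finally show ?thesis using k0(1) by (simp add: na divide_le_eq mult.commute)
  qed
  define C where "C = 8 * M / r\<^sup>2 * (norm b)\<^sup>2"
  have C0: "C \<ge> 0" using M0 by (simp add: C_def)
  have err: "cmod (F n z - frechet_derivative f (at z) b) \<le> C / (n + k0)" if z: "z \<in> ball z0 r" for n z
  proof -
    have zU: "z \<in> U" using sub[OF z, of z] r R by auto
    have "cmod (f (z + a n) - f z - frechet_derivative f (at z) (a n)) \<le> 8 * M / r\<^sup>2 * (norm (a n))\<^sup>2"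
    proof (rule cdiff_quadratic_bound[OF f r])
      show "ball z r \<subseteq> U" using sub[OF z] R(2) by force
      show "cmod (f w) \<le> M" if "w \<in> ball z r" for w using sub[OF z, of w] that by (intro M) auto
    qed (rule small)
    moreover have "F n z - frechet_derivative f (at z) b =
      of_nat (n + k0) * (f (z + a n) - f z - frechet_derivative f (at z) (a n))"
    proof -
      have "of_nat (n + k0) * frechet_derivative f (at z) (a n) = frechet_derivative f (at z) b"
        unfolding a_def using k0(1) by (simp only: cdiff_onD(2)[OF f zU]) (simp add: field_simps del: of_nat_add)
      then show ?thesis by (simp only: F_def right_diff_distrib)
    qed
    ultimately have "cmod (F n z - frechet_derivative f (at z) b) \<le> (n + k0) * (8 * M / r\<^sup>2 * (norm (a n))\<^sup>2)"
      by (simp only: norm_mult norm_of_nat mult_left_mono of_nat_0_le_iff)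
    also have "\<dots> = C / (n + k0)"
      using k0(1) by (simp add: na C_def power_divide power2_eq_square del: of_nat_add)
    finally show ?thesis .
  qed
  have F_bd: "cmod (F 0 z) \<le> k0 * (2 * M)" if z: "z \<in> ball z0 r" for z
  proof -
    have "cmod (f (z + a 0) - f z) \<le> 2 * M"
    proof -
      have "norm (a 0) \<le> r" using small[of 0] norm_ge_zero[of "a 0"] by linarith
      then have "cmod (f (z + a 0)) \<le> M" "cmod (f z) \<le> M"
        using sub[OF z, of "z + a 0"] sub[OF z, of z] r by (auto intro!: M simp: dist_norm)
      then show ?thesis using norm_triangle_ineq4[of "f (z + a 0)" "f z"] by linarith
    qed
    then show ?thesis by (simp add: F_def norm_mult mult_left_mono)
  qed
  \<comment> \<open>A bound independent of \<open>n\<close>: the quotient is compared with the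
    derivative, and the derivative with the quotient for \<open>n = 0\<close>, each at cost at most
    \<open>C\<close>.\<close>
  define B where "B = k0 * (2 * M) + C + C"
  have FB: "cmod (F n z) \<le> B" if z: "z \<in> ball z0 r" for n z
  proof -
    let ?d = "frechet_derivative f (at z) b"
    have le: "C / (m + k0) \<le> C" for m :: nat
      using C0 k0(1) divide_left_mono[of 1 "real (m + k0)" C] by simp
    have "cmod (F n z) \<le> cmod (F n z - ?d) + cmod ?d" using norm_triangle_sub[of "F n z" ?d] by simp
    moreover have "cmod ?d \<le> cmod (F 0 z) + cmod (F 0 z - ?d)"
      using norm_triangle_sub[of ?d "F 0 z"] by (simp add: norm_minus_commute)
    ultimately show ?thesis
      using err[OF z, of n] err[OF z, of 0] F_bd[OF z] le[of n] le[of 0] unfolding B_def by linarith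
  qed
  show "\<exists>f'. ((\<lambda>z. frechet_derivative f (at z) b) has_derivative f') (at z0) \<and> (\<forall>c v. f' (c *s v) = c * f' v)"
  proof (rule cdiff_uniform_limit[OF r _ FB])
    show "cdiff_on (ball z0 r) (F n)" for n
      unfolding F_def
    proof (rule cdiff_on_shift[OF f])
      fix z assume z: "z \<in> ball z0 r"
      have "norm (a n) \<le> r" using small[of n] norm_ge_zero[of "a n"] by linarith
      then show "z + a n \<in> U" using sub[OF z, of "z + a n"] R(2) by (auto simp: dist_norm)
    next
      show "ball z0 r \<subseteq> U" using R r by (auto simp: r_def)
    qed
    show "uniform_limit (ball z0 r) F (\<lambda>z. frechet_derivative f (at z) b) sequentially"
    proof (rule uniform_limitI)
      fix e :: real assume e: "e > 0"
      have "(\<lambda>n. C / (real (n + k0))) \<longlonglongrightarrow> 0"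
        using LIMSEQ_ignore_initial_segment[OF lim_const_over_n[of C], of k0] by simp
      then have "\<forall>\<^sub>F n in sequentially. C / (real (n + k0)) < e"
        using e by (rule order_tendstoD)
      then show "\<forall>\<^sub>F n in sequentially. \<forall>x\<in>ball z0 r. dist (F n x) (frechet_derivative f (at x) b) < e"
      proof (rule eventually_mono)
        fix n assume n: "C / (real (n + k0)) < e"
        show "\<forall>x\<in>ball z0 r. dist (F n x) (frechet_derivative f (at x) b) < e"
        proof
          fix z assume "z \<in> ball z0 r"
          from err[OF this, of n] n show "dist (F n z) (frechet_derivative f (at z) b) < e"
            by (simp add: dist_norm)
        qed
      qed
    qed
  qed
qed

section \<open>Termwise differentiation of Fourier series\<close>

text \<open>Convergence at two imaginary parameters dominates the coefficients with an exponential
  weight in the frequency. Half of this weight absorbs the square of the frequency in the Taylor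
  remainder, so the termwise derivative is the derivative of the sum.\<close>

lemma fourier_derivative:
  fixes a :: "'i \<Rightarrow> complex" and \<xi> :: "'i \<Rightarrow> real"
  assumes e: "e > 0"
    and sums: "\<And>t. cmod t \<le> e \<Longrightarrow> ((\<lambda>\<alpha>. a \<alpha> * exp (t * (\<i> * of_real (\<xi> \<alpha>)))) has_sum h t) UNIV"
    and der: "(h has_field_derivative d) (at 0)"
  shows "((\<lambda>\<alpha>. a \<alpha> * (\<i> * of_real (\<xi> \<alpha>))) has_sum d) UNIV"
proof -
  let ?y = "\<lambda>\<alpha>. \<i> * complex_of_real (\<xi> \<alpha>)"
  define S where "S = (\<lambda>\<alpha>. cmod (a \<alpha>) * exp (e * \<bar>\<xi> \<alpha>\<bar>))"
  have s1: "(\<lambda>\<alpha>. cmod (a \<alpha> * exp (t * ?y \<alpha>))) summable_on UNIV" if "cmod t \<le> e" for t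
    using has_sum_imp_summable[OF sums[OF that]] by (rule summable_on_iff_abs_summable_on_complex[THEN iffD1])
  have ex: "cmod (a \<alpha> * exp (of_real s * \<i> * ?y \<alpha>)) = cmod (a \<alpha>) * exp (- s * \<xi> \<alpha>)" for s \<alpha>
    by (simp add: norm_mult)
  \<comment> \<open>At \<i> times \<open>e\<close> and its negative the exponentials are real, and
    for either sign of the frequency one of the two is
    \<open>exp (e * \<bar>\<xi> \<alpha>\<bar>)\<close>.\<close>
  have "(\<lambda>\<alpha>. cmod (a \<alpha> * exp (of_real e * \<i> * ?y \<alpha>)) + cmod (a \<alpha> * exp (of_real (- e) * \<i> * ?y \<alpha>))) summable_on UNIV"
    using e by (intro summable_on_add s1) (auto simp: norm_mult)
  then have sumS: "S summable_on UNIV"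
  proof (rule summable_on_comparison_test)
    fix \<alpha>
    show "S \<alpha> \<le> cmod (a \<alpha> * exp (of_real e * \<i> * ?y \<alpha>)) + cmod (a \<alpha> * exp (of_real (- e) * \<i> * ?y \<alpha>))"
      unfolding ex S_def distrib_left[symmetric]
      by (intro mult_left_mono) (cases "\<xi> \<alpha> \<ge> 0", auto)
    show "0 \<le> S \<alpha>" by (simp add: S_def)
  qed
  \<comment> \<open>Only half of the exponent is spent here; the other half is needed to bound the
    exponential in the remainder for parameters of modulus at most \<open>e / 2\<close>.\<close>
  have quad: "(e * \<bar>x\<bar> / 2)\<^sup>2 / 2 \<le> exp (e * \<bar>x\<bar> / 2)" for x :: real
    using exp_lower_Taylor_quadratic[of "e * \<bar>x\<bar> / 2"] e by (smt (verit) mult_nonneg_nonneg abs_ge_zero divide_nonneg_pos)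
  have lin: "e * \<bar>x\<bar> \<le> exp (e * \<bar>x\<bar>)" for x :: real
    using exp_ge_add_one_self[of "e * \<bar>x\<bar>"] by linarith
  have sumY: "(\<lambda>\<alpha>. cmod (a \<alpha> * ?y \<alpha>)) summable_on UNIV"
  proof (rule summable_on_comparison_test)
    show "(\<lambda>\<alpha>. inverse e * S \<alpha>) summable_on UNIV"
      using sumS by (rule summable_on_cmult_right)
    fix \<alpha>
    have "cmod (a \<alpha>) * (e * \<bar>\<xi> \<alpha>\<bar>) \<le> S \<alpha>"
      unfolding S_def by (intro mult_left_mono lin) simp
    then show "cmod (a \<alpha> * ?y \<alpha>) \<le> inverse e * S \<alpha>"
      using e by (simp add: norm_mult field_simps)
  qed simp
  then obtain d' where d': "((\<lambda>\<alpha>. a \<alpha> * ?y \<alpha>) has_sum d') UNIV"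
    using abs_summable_summable[OF sumY] by (auto simp: summable_on_def)
  \<comment> \<open>The 8 is what \<open>quad\<close> costs when it is solved for the square of the
    frequency.\<close>
  define K where "K = 8 / e\<^sup>2 * infsum S UNIV"
  have bound: "cmod (h t - h 0 - t * d') \<le> K * (cmod t)\<^sup>2" if t: "cmod t \<le> e / 2" for t
  proof -
    have te: "cmod t \<le> e" using t e by simp
    have "((\<lambda>\<alpha>. a \<alpha> * exp (t * ?y \<alpha>) + (- 1) * (a \<alpha> * exp (0 * ?y \<alpha>)) + (- t) * (a \<alpha> * ?y \<alpha>)) has_sum
      h t + (- 1) * h 0 + (- t) * d') UNIV"
      by (intro has_sum_add has_sum_cmult_right sums te d') (use e in simp)
    then have "((\<lambda>\<alpha>. a \<alpha> * (exp (t * ?y \<alpha>) - 1 - t * ?y \<alpha>)) has_sum h t - h 0 - t * d') UNIV"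
      by (simp add: algebra_simps)
    moreover have "((\<lambda>\<alpha>. (cmod t)\<^sup>2 * (8 / e\<^sup>2) * S \<alpha>) has_sum (cmod t)\<^sup>2 * (8 / e\<^sup>2) * infsum S UNIV) UNIV"
      using sumS by (intro has_sum_cmult_right has_sum_infsum)
    ultimately have "cmod (h t - h 0 - t * d') \<le> (cmod t)\<^sup>2 * (8 / e\<^sup>2) * infsum S UNIV"
    proof (rule norm_infsum_le)
      fix \<alpha>
      have "cmod (exp (t * ?y \<alpha>) - 1 - t * ?y \<alpha>) \<le> exp \<bar>Re (t * ?y \<alpha>)\<bar> * (cmod (t * ?y \<alpha>))\<^sup>2"
        using Taylor_exp[of "t * ?y \<alpha>" 1] by (simp add: diff_diff_eq power2_eq_square)
      also have "\<dots> \<le> exp (e * \<bar>\<xi> \<alpha>\<bar> / 2) * ((cmod t)\<^sup>2 * (8 / e\<^sup>2 * exp (e * \<bar>\<xi> \<alpha>\<bar> / 2)))"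
      proof (rule mult_mono)
        have "\<bar>Re (t * ?y \<alpha>)\<bar> \<le> cmod t * \<bar>\<xi> \<alpha>\<bar>"
          using abs_Re_le_cmod[of "t * ?y \<alpha>"] by (simp add: norm_mult)
        also have "\<dots> \<le> e / 2 * \<bar>\<xi> \<alpha>\<bar>" using t by (intro mult_right_mono) auto
        finally show "exp \<bar>Re (t * ?y \<alpha>)\<bar> \<le> exp (e * \<bar>\<xi> \<alpha>\<bar> / 2)" by simp
        have "(\<xi> \<alpha>)\<^sup>2 \<le> 8 / e\<^sup>2 * exp (e * \<bar>\<xi> \<alpha>\<bar> / 2)"
          using quad[of "\<xi> \<alpha>"] e by (simp add: field_simps power2_eq_square)
        from mult_left_mono[OF this zero_le_power2[of "cmod t"]]
        show "(cmod (t * ?y \<alpha>))\<^sup>2 \<le> (cmod t)\<^sup>2 * (8 / e\<^sup>2 * exp (e * \<bar>\<xi> \<alpha>\<bar> / 2))"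
          by (simp add: norm_mult power_mult_distrib)
      qed auto
      also have "\<dots> = (cmod t)\<^sup>2 * (8 / e\<^sup>2) * exp (e * \<bar>\<xi> \<alpha>\<bar>)"
        by (simp add: mult_exp_exp[symmetric] exp_add[symmetric] mult_ac)
      finally have "cmod (exp (t * ?y \<alpha>) - 1 - t * ?y \<alpha>) \<le> (cmod t)\<^sup>2 * (8 / e\<^sup>2) * exp (e * \<bar>\<xi> \<alpha>\<bar>)" .
      from mult_left_mono[OF this norm_ge_zero[of "a \<alpha>"]]
      show "cmod (a \<alpha> * (exp (t * ?y \<alpha>) - 1 - t * ?y \<alpha>)) \<le> (cmod t)\<^sup>2 * (8 / e\<^sup>2) * S \<alpha>"
        unfolding norm_mult[of "a \<alpha>"] S_def by (simp only: mult_ac)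
    qed
    then show ?thesis by (simp add: K_def mult_ac)
  qed
  have "(h has_field_derivative d') (at 0)"
    unfolding has_field_derivative_def
  proof (rule has_derivativeI_sandwich[where e = "e / 2" and H = "\<lambda>t. K * norm t"])
    show "((\<lambda>t. K * norm t) \<longlongrightarrow> 0) (at (0::complex))" by (auto intro!: tendsto_eq_intros)
    fix t :: complex assume t: "t \<noteq> 0" "dist t 0 < e / 2"
    then have "cmod (h t - h 0 - t * d') \<le> K * (cmod t)\<^sup>2" by (intro bound) simp
    then show "norm (h t - h 0 - d' * (t - 0)) / norm (t - 0) \<le> K * norm t"
      using t by (simp add: divide_le_eq power2_eq_square mult_ac)
  qed (use e in \<open>auto intro: bounded_linear_mult_right\<close>)
  then have "d' = d" using der by (rule DERIV_unique)
  with d' show ?thesis by simp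
qed

section \<open>Polynomials with holomorphic coefficients\<close>

lemma holo_on_cong: "holo_on S h \<Longrightarrow> (\<And>z. z \<in> S \<Longrightarrow> h' z = h z) \<Longrightarrow> holo_on S h'"
  unfolding holo_on_def by (metis has_derivative_transform)

lemma holo_on_add:
  assumes "holo_on S h" "holo_on S h'"
  shows "holo_on S (\<lambda>z. h z + h' z)"
  unfolding holo_on_def
proof
  fix z assume "z \<in> S"
  obtain d where d: "(h has_derivative d) (at z within S)" "\<forall>c v. d (c *s v) = c * d v"
    using assms(1) \<open>z \<in> S\<close> unfolding holo_on_def by blast
  obtain d' where d': "(h' has_derivative d') (at z within S)" "\<forall>c v. d' (c *s v) = c * d' v"
    using assms(2) \<open>z \<in> S\<close> unfolding holo_on_def by blast
  show "\<exists>d. ((\<lambda>z. h z + h' z) has_derivative d) (at z within S) \<and> (\<forall>c v. d (c *s v) = c * d v)"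
    using has_derivative_add[OF d(1) d'(1)] d(2) d'(2) by (intro exI[of _ "\<lambda>v. d v + d' v"]) (simp add: algebra_simps)
qed

lemma holo_on_const: "holo_on S (\<lambda>z. c)"
  unfolding holo_on_def
proof
  fix z assume "z \<in> S"
  show "\<exists>d. ((\<lambda>z. c) has_derivative d) (at z within S) \<and> (\<forall>c v. d (c *s v) = c * d v)"
    by (intro exI[of _ "\<lambda>v. 0"]) simp
qed

lemma holo_on_cmult:
  assumes "holo_on S h"
  shows "holo_on S (\<lambda>z. a * h z)"
  unfolding holo_on_def
proof
  fix z assume "z \<in> S"
  obtain d where d: "(h has_derivative d) (at z within S)" "\<forall>c v. d (c *s v) = c * d v"
    using assms(1) \<open>z \<in> S\<close> unfolding holo_on_def by blast
  show "\<exists>d. ((\<lambda>z. a * h z) has_derivative d) (at z within S) \<and> (\<forall>c v. d (c *s v) = c * d v)"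
    using has_derivative_mult_right[OF d(1), of a] d(2) by (intro exI[of _ "\<lambda>v. a * d v"]) simp
qed

text \<open>The first function is the constant term of the second one.\<close>

inductive hpoly :: "(complex^'m) set \<Rightarrow> nat \<Rightarrow> (complex^'m \<Rightarrow> nat \<Rightarrow> complex) \<Rightarrow>
    (complex^'m \<Rightarrow> complex) \<Rightarrow> (complex^'m \<Rightarrow> complex) \<Rightarrow> bool"
  for S :: "(complex^'m) set" and n :: nat and \<nu> :: "complex^'m \<Rightarrow> nat \<Rightarrow> complex" where
  coeff: "holo_on S h \<Longrightarrow> (\<And>z. z \<in> S \<Longrightarrow> c z = h z) \<Longrightarrow> (\<And>z. z \<in> S \<Longrightarrow> q z = h z) \<Longrightarrow> hpoly S n \<nu> c q"
| sum: "hpoly S n \<nu> c q \<Longrightarrow> hpoly S n \<nu> c' q' \<Longrightarrow> (\<And>z. z \<in> S \<Longrightarrow> c'' z = c z + c' z) \<Longrightarrow>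
    (\<And>z. z \<in> S \<Longrightarrow> q'' z = q z + q' z) \<Longrightarrow> hpoly S n \<nu> c'' q''"
| var: "hpoly S n \<nu> c q \<Longrightarrow> j < n \<Longrightarrow> (\<And>z. z \<in> S \<Longrightarrow> c' z = 0) \<Longrightarrow>
    (\<And>z. z \<in> S \<Longrightarrow> q' z = \<nu> z j * q z) \<Longrightarrow> hpoly S n \<nu> c' q'"

lemma hpoly_zero: "hpoly S n \<nu> (\<lambda>z. 0) (\<lambda>z. 0)"
  by (rule hpoly.coeff[OF holo_on_const[of S 0]]) auto

lemma hpoly_cong:
  "hpoly S n \<nu> c q \<Longrightarrow> (\<And>z. z \<in> S \<Longrightarrow> c' z = c z) \<Longrightarrow> (\<And>z. z \<in> S \<Longrightarrow> q' z = q z) \<Longrightarrow> hpoly S n \<nu> c' q'"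
  by (rule hpoly.sum[OF _ hpoly_zero]) auto

lemma hpoly_holo: "hpoly S n \<nu> c q \<Longrightarrow> holo_on S c"
  by (induction rule: hpoly.induct)
    (auto intro: holo_on_cong holo_on_cong[OF holo_on_add] holo_on_cong[OF holo_on_const[of _ 0]])

lemma hpoly_cmult: "hpoly S n \<nu> c q \<Longrightarrow> hpoly S n \<nu> (\<lambda>z. a * c z) (\<lambda>z. a * q z)"
proof (induction rule: hpoly.induct)
  case (coeff h c q)
  show ?case by (rule hpoly.coeff[OF holo_on_cmult[OF coeff(1), of a]]) (simp_all add: coeff)
next
  case (sum c q c' q' c'' q'')
  show ?case by (rule hpoly.sum[OF sum.IH]) (simp_all add: sum.hyps distrib_left)
next
  case (var c q j c' q')
  show ?case by (rule hpoly.var[OF var.IH var.hyps(2)]) (simp_all add: var.hyps)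
qed

lemma hpoly_sum:
  "(\<And>i. i \<in> I \<Longrightarrow> hpoly S n \<nu> (c i) (q i)) \<Longrightarrow> hpoly S n \<nu> (\<lambda>z. \<Sum>i\<in>I. c i z) (\<lambda>z. \<Sum>i\<in>I. q i z)"
proof (induction I rule: infinite_finite_induct)
  case (insert x F)
  show ?case
    by (rule hpoly.sum[of S n \<nu> "c x" "q x" "\<lambda>z. \<Sum>i\<in>F. c i z" "\<lambda>z. \<Sum>i\<in>F. q i z"])
      (use insert in auto)
qed (simp_all add: hpoly_zero)

text \<open>The explicit representation that \<open>cusp_condition\<close> uses, with its constant
  term named. It is equivalent to \<open>hpoly\<close>, which serves for inductions.\<close>

definition hpoly_rep where
  "hpoly_rep S n \<nu> c q \<longleftrightarrow> (\<exists>N (h :: (nat \<Rightarrow> nat) \<Rightarrow> complex^'m \<Rightarrow> complex).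
     finite N \<and> (\<lambda>_. 0) \<in> N \<and> (\<forall>p\<in>N. \<forall>j\<ge>n. p j = 0) \<and> (\<forall>p\<in>N. holo_on S (h p)) \<and>
     (\<forall>z\<in>S. q z = (\<Sum>p\<in>N. h p z * (\<Prod>j<n. \<nu> z j ^ p j))) \<and> (\<forall>z\<in>S. c z = h (\<lambda>_. 0) z))"

lemma hpoly_repI: "hpoly S n \<nu> c q \<Longrightarrow> hpoly_rep S n \<nu> c q"
proof (induction rule: hpoly.induct)
  case (coeff h c q)
  then show ?case
    unfolding hpoly_rep_def by (intro exI[of _ "{\<lambda>_. 0}"] exI[of _ "\<lambda>_. h"]) auto
next
  case (sum c q c' q' c'' q'')
  obtain N h where N: "finite N" "(\<lambda>_. 0) \<in> N" "\<forall>p\<in>N. \<forall>j\<ge>n. p j = 0" "\<forall>p\<in>N. holo_on S (h p)"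
    "\<forall>z\<in>S. q z = (\<Sum>p\<in>N. h p z * (\<Prod>j<n. \<nu> z j ^ p j))" "\<forall>z\<in>S. c z = h (\<lambda>_. 0) z"
    using sum.IH(1) unfolding hpoly_rep_def by blast
  obtain N' h' where N': "finite N'" "(\<lambda>_. 0) \<in> N'" "\<forall>p\<in>N'. \<forall>j\<ge>n. p j = 0" "\<forall>p\<in>N'. holo_on S (h' p)"
    "\<forall>z\<in>S. q' z = (\<Sum>p\<in>N'. h' p z * (\<Prod>j<n. \<nu> z j ^ p j))" "\<forall>z\<in>S. c' z = h' (\<lambda>_. 0) z"
    using sum.IH(2) unfolding hpoly_rep_def by blast
  \<comment> \<open>Coefficients outside their own index set are set to 0, as nothing is known about
    \<open>h\<close> and \<open>h'\<close> there.\<close>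
  define k where "k = (\<lambda>p z. (if p \<in> N then h p z else 0) + (if p \<in> N' then h' p z else 0))"
  have hol: "holo_on S (k p)" for p
    unfolding k_def using N(4) N'(4)
    by (cases "p \<in> N"; cases "p \<in> N'") (auto intro: holo_on_add holo_on_const)
  have "q'' z = (\<Sum>p\<in>N \<union> N'. k p z * (\<Prod>j<n. \<nu> z j ^ p j))" if "z \<in> S" for z
  proof -
    have "(\<Sum>p\<in>N \<union> N'. k p z * (\<Prod>j<n. \<nu> z j ^ p j)) =
      (\<Sum>p\<in>N \<union> N'. (if p \<in> N then h p z * (\<Prod>j<n. \<nu> z j ^ p j) else 0)) +
      (\<Sum>p\<in>N \<union> N'. (if p \<in> N' then h' p z * (\<Prod>j<n. \<nu> z j ^ p j) else 0))"
      unfolding k_def sum.distrib[symmetric] by (intro sum.cong) (auto simp: distrib_right)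
    also have "\<dots> = q z + q' z"
      using N(1,5) N'(1,5) that by (simp add: sum.If_cases Int_absorb1)
    finally show ?thesis using sum.hyps that by simp
  qed
  moreover have "c'' z = k (\<lambda>_. 0) z" if "z \<in> S" for z
    using N(2,6) N'(2,6) sum.hyps that by (simp add: k_def)
  ultimately show ?case
    unfolding hpoly_rep_def using N N' hol by (intro exI[of _ "N \<union> N'"] exI[of _ k]) auto
next
  case (var c q j c' q')
  obtain N h where N: "finite N" "(\<lambda>_. 0) \<in> N" "\<forall>p\<in>N. \<forall>j\<ge>n. p j = 0" "\<forall>p\<in>N. holo_on S (h p)"
    "\<forall>z\<in>S. q z = (\<Sum>p\<in>N. h p z * (\<Prod>j<n. \<nu> z j ^ p j))" "\<forall>z\<in>S. c z = h (\<lambda>_. 0) z"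
    using var.IH unfolding hpoly_rep_def by blast
  \<comment> \<open>Multiplication by a variable shifts the multi-indices injectively and never hits
    0. The index 0 is therefore adjoined with coefficient 0, in accordance with the vanishing
    constant term.\<close>
  define up where "up = (\<lambda>p :: nat \<Rightarrow> nat. p(j := p j + 1))"
  define k where "k = (\<lambda>p z. if p j = 0 then 0 else h (p(j := p j - 1)) z)"
  have inj: "inj_on up N" by (auto simp: inj_on_def up_def fun_eq_iff split: if_splits)
  have upk: "k (up p) = h p" for p by (simp add: k_def up_def fun_eq_iff)
  have k0: "k (\<lambda>_. 0) z = 0" for z by (simp add: k_def)
  have n0: "(\<lambda>_. 0) \<notin> up ` N"
  proof
    assume "(\<lambda>_. 0) \<in> up ` N"
    then obtain p where "(\<lambda>_. 0) = up p" by auto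
    from fun_cong[OF this, of j] show False by (simp add: up_def)
  qed
  have "q' z = (\<Sum>p\<in>insert (\<lambda>_. 0) (up ` N). k p z * (\<Prod>i<n. \<nu> z i ^ p i))" if "z \<in> S" for z
  proof -
    have "(\<Prod>i<n. \<nu> z i ^ up p i) = \<nu> z j * (\<Prod>i<n. \<nu> z i ^ p i)" for p
      using var.hyps(2) by (simp add: up_def prod.remove[of "{..<n}" j] mult.assoc)
    then have "(\<Sum>p\<in>insert (\<lambda>_. 0) (up ` N). k p z * (\<Prod>i<n. \<nu> z i ^ p i)) =
      (\<Sum>p\<in>N. h p z * (\<nu> z j * (\<Prod>i<n. \<nu> z i ^ p i)))"
      using N(1) n0 by (simp add: k0 sum.reindex[OF inj] upk)
    also have "\<dots> = \<nu> z j * q z"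
      using N(5) that by (simp add: sum_distrib_left mult_ac)
    finally show ?thesis using var.hyps that by simp
  qed
  moreover have "\<forall>p\<in>insert (\<lambda>_. 0) (up ` N). holo_on S (k p)"
    using N(4) upk k0 holo_on_cong[OF holo_on_const[of S 0]] by auto
  moreover have "\<forall>p\<in>insert (\<lambda>_. 0) (up ` N). \<forall>j\<ge>n. p j = 0"
    using N(3) var.hyps(2) by (auto simp: up_def)
  ultimately show ?case
    unfolding hpoly_rep_def using N(1) var.hyps(3) k0
    by (intro exI[of _ "insert (\<lambda>_. 0) (up ` N)"] exI[of _ k]) auto
qed

lemma hpoly_power:
  assumes "hpoly S n \<nu> c q" "j < n"
  shows "hpoly S n \<nu> (\<lambda>z. if m = 0 then c z else 0) (\<lambda>z. \<nu> z j ^ m * q z)"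
proof (induction m)
  case (Suc m)
  show ?case by (rule hpoly.var[OF Suc assms(2)]) auto
qed (simp add: assms)

lemma hpoly_monomial:
  assumes "hpoly S n \<nu> c q" "m \<le> n"
  shows "hpoly S n \<nu> (\<lambda>z. if \<forall>j<m. p j = 0 then c z else 0) (\<lambda>z. (\<Prod>j<m. \<nu> z j ^ p j) * q z)"
  using assms(2)
proof (induction m)
  case (Suc m)
  have "m < n" using Suc.prems by simp
  show ?case
    by (rule hpoly_cong[OF hpoly_power[OF Suc.IH[OF less_imp_le[OF \<open>m < n\<close>]] \<open>m < n\<close>, of "p m"]])
      (auto simp: less_Suc_eq mult_ac)
qed (simp add: assms(1))

lemma hpoly_repD:
  assumes "hpoly_rep S n \<nu> c q"
  shows "hpoly S n \<nu> c q"
proof -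
  obtain N h where N: "finite N" "(\<lambda>_. 0) \<in> N" "\<forall>p\<in>N. \<forall>j\<ge>n. p j = 0" "\<forall>p\<in>N. holo_on S (h p)"
    "\<forall>z\<in>S. q z = (\<Sum>p\<in>N. h p z * (\<Prod>j<n. \<nu> z j ^ p j))" "\<forall>z\<in>S. c z = h (\<lambda>_. 0) z"
    using assms unfolding hpoly_rep_def by blast
  have "hpoly S n \<nu> (\<lambda>z. if \<forall>j<n. p j = 0 then h p z else 0) (\<lambda>z. (\<Prod>j<n. \<nu> z j ^ p j) * h p z)" if "p \<in> N" for p
    by (rule hpoly_monomial) (use N(4) that in \<open>auto intro: hpoly.coeff\<close>)
  from hpoly_sum[of N, OF this]
  have *: "hpoly S n \<nu> (\<lambda>z. \<Sum>p\<in>N. if \<forall>j<n. p j = 0 then h p z else 0) (\<lambda>z. \<Sum>p\<in>N. (\<Prod>j<n. \<nu> z j ^ p j) * h p z)"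
    by simp
  have "(\<forall>j<n. p j = 0) \<longleftrightarrow> p = (\<lambda>_. 0)" if "p \<in> N" for p
    using N(3) that by (auto simp: fun_eq_iff) (metis not_le)
  then have "(\<Sum>p\<in>N. if \<forall>j<n. p j = 0 then h p z else 0) = (\<Sum>p\<in>N. if p = (\<lambda>_. 0) then h p z else 0)" for z
    by (intro sum.cong) auto
  then have "(\<Sum>p\<in>N. if \<forall>j<n. p j = 0 then h p z else 0) = h (\<lambda>_. 0) z" for z
    using N(1,2) by simp
  then show ?thesis
    using N(5,6) by (intro hpoly_cong[OF *]) (simp_all add: mult.commute)
qed

lemma holomorphic_vector:
  fixes x :: "complex^'m \<Rightarrow> complex^'m"
  assumes "(x has_derivative x') (at z)" "\<And>v. x' (\<i> *s v) = \<i> *s x' v"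
  shows "vdiff z x" "dee.\<delta>v v z x = x' v"
proof -
  have c: "((\<lambda>w. x w $ i) has_derivative (\<lambda>v. x' v $ i)) (at z)" for i
    by (rule bounded_linear.has_derivative[OF bounded_linear_vec_nth assms(1)])
  then show "vdiff z x" by (auto simp: vdiff_def differentiable_def)
  show "dee.\<delta>v v z x = x' v"
    by (simp add: dee.\<delta>v_def vec_eq_iff dee_has_derivative[OF c] assms(2))
qed

lemma vdiff_cj_comp:
  assumes "vdiff z x"
  shows "vdiff z (\<lambda>w. cj (x w))"
  unfolding vdiff_def
proof
  fix i
  obtain D where "((\<lambda>w. x w $ i) has_derivative D) (at z)"
    using assms unfolding vdiff_def differentiable_def by blast
  from bounded_linear.has_derivative[OF bounded_linear_cnj this]
  show "(\<lambda>w. cj (x w) $ i) differentiable (at z)" by (auto simp: differentiable_def)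
qed

section \<open>Tube domains\<close>

text \<open>\<open>K\<close> is the inverse Gram matrix of the basis \<open>B\<close> of \<open>{E, F\<^sub>0}\<^sup>\<bottom>\<close>.\<close>

locale tube = quad_cone g A for g :: "int^'m^'m" and A +
  fixes E F\<^sub>0 :: "complex^'m" and B :: "nat \<Rightarrow> complex^'m" and n :: nat and K :: "nat \<Rightarrow> nat \<Rightarrow> complex"
    and \<Omega> :: "(complex^'m) set"
  assumes EE: "bil g E E = 0" and FF: "bil g F\<^sub>0 F\<^sub>0 = 0" and EF: "bil g E F\<^sub>0 = 1"
    and cjE: "cj E = E" and cjF: "cj F\<^sub>0 = F\<^sub>0"
    and B: "\<And>j. j < n \<Longrightarrow> bil g E (B j) = 0" "\<And>j. j < n \<Longrightarrow> bil g F\<^sub>0 (B j) = 0"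
      "\<And>j. j < n \<Longrightarrow> cj (B j) = B j"
    and K: "\<And>y. cj y = y \<Longrightarrow> bil g E y = 0 \<Longrightarrow> bil g F\<^sub>0 y = 0 \<Longrightarrow>
      y = (\<Sum>l<n. \<Sum>m<n. (K l m * bil g (B m) y) *s B l)"
    and \<Omega>: "\<And>z. z \<in> \<Omega> \<Longrightarrow> bil g E z = 0" "\<And>z. z \<in> \<Omega> \<Longrightarrow> bil g F\<^sub>0 z = 0"
      "\<And>z. z \<in> \<Omega> \<Longrightarrow> (- bil g z z / 2) *s E + z + F\<^sub>0 \<in> A"
    and \<Omega>_open: "\<And>z. z \<in> \<Omega> \<Longrightarrow> \<exists>e>0. \<forall>w. bil g E w = 0 \<longrightarrow> bil g F\<^sub>0 w = 0 \<longrightarrow> dist w z < e \<longrightarrow> w \<in> \<Omega>"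
begin

definition \<Phi> :: "complex^'m \<Rightarrow> complex^'m" where "\<Phi> z = (- bil g z z / 2) *s E + z + F\<^sub>0"
definition d\<Phi> :: "complex^'m \<Rightarrow> complex^'m \<Rightarrow> complex^'m" where "d\<Phi> z v = v - bil g z v *s E"
text \<open>Composition with the projection \<open>P\<close> onto \<open>{E, F\<^sub>0}\<^sup>\<bottom>\<close> extends functions on \<open>\<Omega>\<close> to an open set,
  where the ambient Wirtinger derivatives apply.\<close>

definition P :: "complex^'m \<Rightarrow> complex^'m" where "P z = z - bil g z F\<^sub>0 *s E - bil g z E *s F\<^sub>0"
text \<open>The imaginary part as a complex vector, so that \<open>Q\<close> is the norm of the
  imaginary part and Wirtinger derivatives can be applied to both.\<close>

definition yc :: "complex^'m \<Rightarrow> complex^'m" where "yc z = (1 / (2 * \<i>)) *s (z - cj z)"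
definition Q :: "complex^'m \<Rightarrow> complex" where "Q z = bil g (yc z) (yc z)"
text \<open>The logarithmic derivative of \<open>Q\<close> along \<open>B j\<close> in closed form;
  \<open>nu_tube_eq\<close> identifies it with \<open>nu_tube\<close>.\<close>

definition \<nu> :: "complex^'m \<Rightarrow> nat \<Rightarrow> complex" where "\<nu> z j = - \<i> * bil g (B j) (yc z) / Q z"
definition U :: "(complex^'m) set" where "U = {w. P w \<in> \<Omega>}"
definition D :: "nat \<Rightarrow> (complex^'m \<Rightarrow> complex) \<Rightarrow> complex^'m \<Rightarrow> complex" where
  "D j u z = dee (\<lambda>w. u (P w)) (B j) z"
text \<open>The pullback along \<Phi>, evaluated on vectors; on basis vectors \<open>B j\<close> it
  gives the coefficients of \<open>pull_tube\<close>.\<close>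

definition pe :: "'m mdiff \<Rightarrow> complex^'m \<Rightarrow> (complex^'m) list \<Rightarrow> complex" where
  "pe G z us = ev (G (\<Phi> z)) (map (d\<Phi> z) us)"

lemma \<Phi>A: "z \<in> \<Omega> \<Longrightarrow> \<Phi> z \<in> A"
  using \<Omega>(3) by (simp add: \<Phi>_def)

lemmas bsym = bil_sym[of F\<^sub>0 E] bil_sym[of "B j" E for j] bil_sym[of "B j" F\<^sub>0 for j]

lemma P_fix: "bil g E z = 0 \<Longrightarrow> bil g F\<^sub>0 z = 0 \<Longrightarrow> P z = z"
  by (simp add: P_def bil_sym[of z])

lemma P_\<Omega>: "z \<in> \<Omega> \<Longrightarrow> P z = z"
  by (simp add: P_fix \<Omega>)

lemma P_B: "j < n \<Longrightarrow> P (B j) = B j"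
  by (simp add: P_fix B)

lemma P_orth: "bil g E (P z) = 0" "bil g F\<^sub>0 (P z) = 0"
  by (simp_all add: P_def bil_lin EE FF EF bsym(1) bil_sym[of z])

lemma P_lin: "P (x + y) = P x + P y" "P (x - y) = P x - P y" "P (c *s x) = c *s P x"
  by (simp_all add: P_def bil_lin vec_eq_iff algebra_simps)

lemma P_E: "P E = 0" "P F\<^sub>0 = 0"
  by (simp_all add: P_def EE FF EF bsym(1))

lemma P_bounded: "bounded_linear P"
  by (rule bounded_linear_complexI) (simp_all add: P_lin)

lemma P_derivative: "(P has_derivative P) (at z within S)"
  by (rule bounded_linear_imp_has_derivative[OF P_bounded])

lemma \<Omega>_U: "z \<in> \<Omega> \<Longrightarrow> z \<in> U"
  by (simp add: U_def P_\<Omega>)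

lemma open_U: "open U"
  unfolding open_dist
proof
  fix z assume "z \<in> U"
  then have "P z \<in> \<Omega>" by (simp add: U_def)
  then obtain e where e: "e > 0" "\<And>w. bil g E w = 0 \<Longrightarrow> bil g F\<^sub>0 w = 0 \<Longrightarrow> dist w (P z) < e \<Longrightarrow> w \<in> \<Omega>"
    using \<Omega>_open by blast
  have "isCont P z" using P_bounded by (rule linear_continuous_at)
  then obtain d where d: "d > 0" "\<And>w. dist w z < d \<Longrightarrow> dist (P w) (P z) < e"
    using e(1) unfolding continuous_at_eps_delta by blast
  then show "\<exists>d>0. \<forall>w. dist w z < d \<longrightarrow> w \<in> U"
    using e(2) P_orth by (auto simp: U_def intro!: exI[of _ d])
qed

lemma eventually_U: "z \<in> \<Omega> \<Longrightarrow> eventually (\<lambda>w. P w \<in> \<Omega>) (nhds z)"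
  using open_U \<Omega>_U unfolding eventually_nhds by (intro exI[of _ U]) (auto simp: U_def)

lemma \<Phi>_derivative: "(\<Phi> has_derivative d\<Phi> z) (at z)"
proof -
  have "(\<lambda>z. bil g z z) differentiable (at z)" by (intro diff_bil vdiff_id)
  then have "((\<lambda>z. bil g z z) has_derivative frechet_derivative (\<lambda>z. bil g z z) (at z)) (at z)"
    by (simp add: frechet_derivative_works)
  moreover have "frechet_derivative (\<lambda>z. bil g z z) (at z) = (\<lambda>v. 2 * bil g z v)"
    by (rule ext) (simp add: dee_plus_deebar dee.bil[OF vdiff_id vdiff_id] deebar.bil[OF vdiff_id vdiff_id] bil_sym[of _ z])
  ultimately have 1: "((\<lambda>z. bil g z z) has_derivative (\<lambda>v. 2 * bil g z v)) (at z)"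
    by simp
  have "((\<lambda>z. (- 1 / 2) * bil g z z) has_derivative (\<lambda>v. (- 1 / 2) * (2 * bil g z v))) (at z)"
    by (rule has_derivative_mult_right[OF 1])
  from bounded_linear.has_derivative[OF bounded_linear_smult_left[of E] this]
  have "((\<lambda>z. ((- 1 / 2) * bil g z z) *s E) has_derivative (\<lambda>v. ((- 1 / 2) * (2 * bil g z v)) *s E)) (at z)" .
  from has_derivative_add[OF has_derivative_add[OF this has_derivative_ident] has_derivative_const[of F\<^sub>0]]
  have "((\<lambda>z. ((- 1 / 2) * bil g z z) *s E + z + F\<^sub>0) has_derivative (\<lambda>v. ((- 1 / 2) * (2 * bil g z v)) *s E + v + 0)) (at z)" .
  moreover have "(\<lambda>z. ((- 1 / 2) * bil g z z) *s E + z + F\<^sub>0) = \<Phi>"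
    by (simp add: fun_eq_iff \<Phi>_def)
  moreover have "(\<lambda>v. ((- 1 / 2) * (2 * bil g z v)) *s E + v + 0) = d\<Phi> z"
    by (simp add: fun_eq_iff d\<Phi>_def vec_eq_iff)
  ultimately show ?thesis by (simp only:)
qed

lemma frechet_\<Phi>: "frechet_derivative \<Phi> (at z) = d\<Phi> z"
  using frechet_derivative_at[OF \<Phi>_derivative] by simp

lemma d\<Phi>_lin: "d\<Phi> z (x + y) = d\<Phi> z x + d\<Phi> z y" "d\<Phi> z (c *s x) = c *s d\<Phi> z x"
  by (simp_all add: d\<Phi>_def bil_lin vec_eq_iff algebra_simps)

lemma d\<Phi>_sum: "d\<Phi> z (\<Sum>i\<in>I. f i) = (\<Sum>i\<in>I. d\<Phi> z (f i))"
  by (induction I rule: infinite_finite_induct) (simp_all add: d\<Phi>_lin, simp_all add: d\<Phi>_def)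

lemma \<Phi>P_derivative: "((\<lambda>w. \<Phi> (P w)) has_derivative (\<lambda>v. d\<Phi> (P z) (P v))) (at z)"
  by (rule has_derivative_compose[OF P_derivative \<Phi>_derivative])

lemma \<Phi>P_ilin: "d\<Phi> (P z) (P (\<i> *s v)) = \<i> *s d\<Phi> (P z) (P v)"
  by (simp add: P_lin d\<Phi>_lin)

lemmas \<Phi>P_vector = holomorphic_vector[OF \<Phi>P_derivative \<Phi>P_ilin]
lemmas P_vector = holomorphic_vector[OF P_derivative P_lin(3)]

lemma d\<Phi>_orth:
  assumes "bil g E z = 0" "bil g F\<^sub>0 z = 0" "bil g E v = 0" "bil g F\<^sub>0 v = 0"
  shows "bil g (d\<Phi> z v) (\<Phi> z) = 0"
  using assms by (simp add: d\<Phi>_def \<Phi>_def bil_lin EE EF bil_sym[of v E] bil_sym[of v F\<^sub>0] bil_sym[of v z])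

lemma d\<Phi>_iso:
  assumes "bil g E u = 0" "bil g E v = 0"
  shows "bil g (d\<Phi> z u) (d\<Phi> z v) = bil g u v"
  using assms by (simp add: d\<Phi>_def bil_lin EE bil_sym[of u E])

lemma \<Phi>_E: "bil g E z = 0 \<Longrightarrow> bil g (\<Phi> z) E = 1"
  by (simp add: \<Phi>_def bil_lin EE EF bsym(1) bil_sym[of z E])

lemma cj_orth: "bil g E z = 0 \<Longrightarrow> bil g E (cj z) = 0" "bil g F\<^sub>0 z = 0 \<Longrightarrow> bil g F\<^sub>0 (cj z) = 0"
  using bil_cnj[of g E z] bil_cnj[of g F\<^sub>0 z] by (simp_all add: cjE cjF)

lemma cj_\<Phi>: "cj (\<Phi> z) = (- bil g (cj z) (cj z) / 2) *s E + cj z + F\<^sub>0"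
  unfolding \<Phi>_def cj_add cj_scale cjE cjF by (simp add: bil_cnj)

lemma N_\<Phi>:
  assumes "bil g E z = 0" "bil g F\<^sub>0 z = 0"
  shows "N (\<Phi> z) = 2 * Q z"
proof -
  have c: "bil g E (cj z) = 0" "bil g F\<^sub>0 (cj z) = 0" using assms cj_orth by auto
  have "N (\<Phi> z) = - bil g z z / 2 - bil g (cj z) (cj z) / 2 + bil g z (cj z)"
    using assms c unfolding N_def cj_\<Phi> unfolding \<Phi>_def
    by (simp add: bil_lin EE FF EF bsym(1) bil_sym[of z E] bil_sym[of z F\<^sub>0])
  also have "\<dots> = 2 * Q z"
    by (simp add: Q_def yc_def bil_lin bil_sym[of "cj z" z] field_simps)
  finally show ?thesis .
qed

lemma Q_nz: "z \<in> \<Omega> \<Longrightarrow> Q z \<noteq> 0"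
  using N_nz[OF pos[OF \<Phi>A]] N_\<Phi>[of z] \<Omega> by force

lemma vdiff_yc: "vdiff z yc"
  unfolding yc_def by (intro vdiff_scale vdiff_diff vdiff_id vdiff_cj) simp

lemma dee_yc: "dee.\<delta>v v z yc = (1 / (2 * \<i>)) *s v"
  unfolding yc_def
  by (subst dee.\<delta>v_scale) (simp_all add: vdiff_diff dee.\<delta>v_diff)

lemma diff_Q: "Q differentiable (at z)"
  unfolding Q_def[abs_def] by (intro diff_bil vdiff_yc)

lemma dee_Q: "dee Q v z = - \<i> * bil g v (yc z)"
  unfolding Q_def[abs_def]
  by (subst dee.bil[OF vdiff_yc vdiff_yc]) (simp add: dee_yc bil_lin bil_sym[of _ v] field_simps)

lemma dee_P_chain:
  assumes "f differentiable (at (P z))"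
  shows "dee (\<lambda>w. f (P w)) v z = dee f (P v) (P z)" "(\<lambda>w. f (P w)) differentiable (at z)"
  using dee_linear_chain[where B = P, OF P_lin(1,3) assms] by simp_all

lemma diff_QP: "(\<lambda>w. Q (P w)) differentiable (at z)"
  by (rule dee_P_chain(2)[OF diff_Q])

lemma D_Q: "z \<in> \<Omega> \<Longrightarrow> j < n \<Longrightarrow> D j Q z = \<nu> z j * Q z"
  unfolding D_def using Q_nz by (simp add: dee_P_chain[OF diff_Q] dee_Q P_\<Omega> P_B \<nu>_def)

lemma cj_yc: "cj (yc z) = yc z"
  by (simp add: yc_def cj_scale cj_diff vec_eq_iff field_simps)

lemma yc_orth: "z \<in> \<Omega> \<Longrightarrow> bil g E (yc z) = 0" "z \<in> \<Omega> \<Longrightarrow> bil g F\<^sub>0 (yc z) = 0"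
  using \<Omega> cj_orth by (simp_all add: yc_def bil_lin)

text \<open>Because \<open>K\<close> inverts the Gram matrix, the imaginary part divided by its norm
  is linear in \<nu>.\<close>

lemma yc_expand:
  assumes z: "z \<in> \<Omega>"
  shows "(\<i> / Q z) *s yc z = - (\<Sum>l<n. \<Sum>m<n. (K l m * \<nu> z m) *s B l)"
proof -
  have "(\<i> / Q z) *s yc z = (\<i> / Q z) *s (\<Sum>l<n. \<Sum>m<n. (K l m * bil g (B m) (yc z)) *s B l)"
    using K[OF cj_yc yc_orth[OF z]] by simp
  also have "\<dots> = - (\<Sum>l<n. \<Sum>m<n. (K l m * \<nu> z m) *s B l)"
    by (simp add: vec_eq_iff sum_distrib_left sum_negf[symmetric] \<nu>_def mult_ac)
  finally show ?thesis .
qed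

text \<open>Differentiating numerator and denominator leaves \<open>1 / Q z\<close> as the only term
  that is not visibly polynomial. It is the pairing of the imaginary part, divided by
  \<open>Q z\<close>, with itself, hence by \<open>yc_expand\<close> a quadratic form in \<nu>. So
  the derivative has neither a constant nor a linear term.\<close>

lemma D_\<nu>:
  assumes z: "z \<in> \<Omega>" and i: "i < n" and j: "j < n"
  shows "D j (\<lambda>z. \<nu> z i) z = - (\<nu> z i * \<nu> z j) +
      bil g (B i) (B j) / 2 * (\<Sum>l<n. \<Sum>m<n. K l m * (\<nu> z m * \<nu> z l))"
    and "(\<lambda>w. \<nu> (P w) i) differentiable (at z)"
proof -
  have QP: "Q (P z) \<noteq> 0" using Q_nz[OF z] P_\<Omega>[OF z] by simp
  have vd: "vdiff z (\<lambda>w. yc (P w))"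
    unfolding vdiff_def using dee_P_chain(2)[of "\<lambda>w. yc w $ i" z for i] vdiff_yc[of "P z"]
    by (auto simp: vdiff_def)
  have d1: "(\<lambda>w. bil g (B i) (yc (P w))) differentiable (at z)" by (intro diff_bil vdiff_const vd)
  have d2: "(\<lambda>w. - \<i> * bil g (B i) (yc (P w))) differentiable (at z)"
    by (intro differentiable_mult d1 differentiable_const)
  show "(\<lambda>w. \<nu> (P w) i) differentiable (at z)"
    unfolding \<nu>_def by (intro differentiable_divide d2 diff_QP QP)
  have "dee (\<lambda>w. bil g (B i) (yc w)) v z' = bil g (B i) v / (2 * \<i>)" for v z'
    by (subst dee.bil[OF vdiff_const vdiff_yc]) (simp add: dee_yc bil_lin)
  then have e1: "dee (\<lambda>w. bil g (B i) (yc (P w))) (B j) z = bil g (B i) (B j) / (2 * \<i>)"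
    using j by (subst dee_P_chain(1)[OF diff_bil[OF vdiff_const vdiff_yc]]) (simp add: P_B)
  have e2: "dee (\<lambda>w. Q (P w)) (B j) z = \<nu> z j * Q z"
    using D_Q[OF z j] by (simp add: D_def)
  have m1: "D j (\<lambda>z. \<nu> z i) z = - (bil g (B i) (B j) / 2) * (1 / Q z) - \<nu> z i * \<nu> z j"
    unfolding D_def \<nu>_def[of _ i]
    by (subst dee.divide[OF d2 diff_QP QP], subst dee.cmult[OF d1], subst e1, subst e2)
      (use Q_nz[OF z] in \<open>simp add: P_\<Omega>[OF z] field_simps power2_eq_square\<close>)
  have m2: "1 / Q z = - (\<Sum>l<n. \<Sum>m<n. K l m * (\<nu> z m * \<nu> z l))"
  proof -
    have "1 / Q z = - \<i> * bil g ((\<i> / Q z) *s yc z) (yc z) / Q z"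
      using Q_nz[OF z] by (simp add: bil_lin Q_def[symmetric])
    also have "\<dots> = \<i> * (\<Sum>l<n. \<Sum>m<n. K l m * \<nu> z m * bil g (B l) (yc z)) / Q z"
      by (simp only: yc_expand[OF z] bil_minus_left bil_sum_left bil_scale_left) simp
    also have "\<dots> = - (\<Sum>l<n. \<Sum>m<n. K l m * (\<nu> z m * \<nu> z l))"
      by (simp add: \<nu>_def[of _ l for l] sum_distrib_left sum_divide_distrib sum_negf[symmetric] mult_ac)
    finally show ?thesis .
  qed
  show "D j (\<lambda>z. \<nu> z i) z = - (\<nu> z i * \<nu> z j) +
      bil g (B i) (B j) / 2 * (\<Sum>l<n. \<Sum>m<n. K l m * (\<nu> z m * \<nu> z l))"
    unfolding m1 m2 by simp
qed

lemma euler_map_pih: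
  assumes F: "euler s G" and Z: "Z \<in> A" and vs: "length vs = s" "\<forall>v\<in>set vs. bil g v Z = 0"
  shows "ev (G Z) vs = ev (G Z) (map (pih Z) vs)"
proof -
  have "map (\<lambda>x. pip Z (pih Z x)) vs = map (pih Z) vs"
    using vs by (intro map_cong refl pip_fix orth_pih_tangent[OF Z]) simp
  with euler_pih[OF F Z vs] show ?thesis by simp
qed

text \<open>By the contraction conditions a section sees tangent vectors only modulo the line
  through \<open>Z\<close>.\<close>

lemma euler_shift:
  assumes F: "euler s G" and Z: "Z \<in> A" and js: "length js = s" and y: "\<And>a. a \<in> set js \<Longrightarrow> bil g (y a) Z = 0"
  shows "ev (G Z) (map (\<lambda>a. y a + c a *s Z) js) = ev (G Z) (map y js)"
proof -
  have "pih Z (v + b *s Z) = pih Z v" for v b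
    using pih_self[OF pos[OF Z]] N_nz[OF pos[OF Z]]
    by (simp add: pih_def bil_lin add_divide_distrib vec_eq_iff algebra_simps N_def)
  then have "map (pih Z) (map (\<lambda>a. y a + c a *s Z) js) = map (pih Z) (map y js)" by simp
  moreover have "ev (G Z) (map (\<lambda>a. y a + c a *s Z) js) = ev (G Z) (map (pih Z) (map (\<lambda>a. y a + c a *s Z) js))"
    by (rule euler_map_pih[OF F Z]) (use js y in \<open>auto simp: bil_lin quad[OF Z]\<close>)
  moreover have "ev (G Z) (map y js) = ev (G Z) (map (pih Z) (map y js))"
    by (rule euler_map_pih[OF F Z]) (use js y in auto)
  ultimately show ?thesis by (simp only:)
qed

text \<open>The tangent space of the cone is the sum of the image of \<open>d\<Phi> p\<close> and
  the line through \<open>\<Phi> p\<close>. Pairing with \<open>E\<close> kills the image and is 1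
  on \<open>\<Phi> p\<close>, so it reads off the second component.\<close>

lemma tangent_split:
  assumes p: "bil g E p = 0" "bil g F\<^sub>0 p = 0" and x: "bil g x (\<Phi> p) = 0"
  shows "x = d\<Phi> p (P x - bil g x E *s p) + bil g x E *s \<Phi> p"
proof -
  have a1: "bil g x F\<^sub>0 = bil g x E * bil g p p / 2 - bil g p x"
    using x by (simp add: \<Phi>_def bil_lin bil_sym[of x p] field_simps)
  have a2: "bil g p (P x) = bil g p x"
    using p by (simp add: P_def bil_lin bil_sym[of p E] bil_sym[of p F\<^sub>0])
  have "d\<Phi> p (P x - bil g x E *s p) = P x - bil g x E *s p - (bil g p x - bil g x E * bil g p p) *s E"
    by (simp add: d\<Phi>_def bil_lin a2)
  then show ?thesis
    by (simp add: \<Phi>_def P_def a1 vec_eq_iff field_simps)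
qed

end

section \<open>The raising operator in tube coordinates\<close>

context tube
begin

lemma comp_\<Phi>P:
  assumes z: "z \<in> \<Omega>" and f: "f differentiable (at (\<Phi> z))"
  shows "(\<lambda>w. f (\<Phi> (P w))) differentiable (at z)"
    and "dee (\<lambda>w. f (\<Phi> (P w))) v z = dee f (d\<Phi> z (P v)) (\<Phi> z)"
proof -
  have f': "f differentiable (at (\<Phi> (P z)))" using f by (simp add: P_\<Omega>[OF z])
  then show "(\<lambda>w. f (\<Phi> (P w))) differentiable (at z)"
    using has_derivative_compose[OF \<Phi>P_derivative] unfolding differentiable_def by blast
  show "dee (\<lambda>w. f (\<Phi> (P w))) v z = dee f (d\<Phi> z (P v)) (\<Phi> z)"
    using dee_chain(1)[OF \<Phi>P_derivative \<Phi>P_ilin f'] by (simp add: P_\<Omega>[OF z])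
qed

lemma \<delta>v_P:
  assumes x: "vdiff z x"
  shows "vdiff z (\<lambda>w. P (x w))" "dee.\<delta>v v z (\<lambda>w. P (x w)) = P (dee.\<delta>v v z x)"
proof -
  have d: "(\<lambda>w. bil g (x w) F\<^sub>0) differentiable (at z)" "(\<lambda>w. bil g (x w) E) differentiable (at z)"
    by (intro diff_bil x vdiff_const)+
  note vd = vdiff_diff[OF x vdiff_scale[OF d(1) vdiff_const]]
  show "vdiff z (\<lambda>w. P (x w))"
    unfolding P_def by (intro vdiff_diff[OF vd] vdiff_scale d vdiff_const)
  show "dee.\<delta>v v z (\<lambda>w. P (x w)) = P (dee.\<delta>v v z x)"
    unfolding P_def
    by (simp add: dee.\<delta>v_diff[OF vd vdiff_scale[OF d(2) vdiff_const]]
        dee.\<delta>v_diff[OF x vdiff_scale[OF d(1) vdiff_const]] dee.\<delta>v_scale[OF d(1) vdiff_const]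
        dee.\<delta>v_scale[OF d(2) vdiff_const] dee.bil[OF x vdiff_const])
qed

text \<open>The moving frame inside \<open>raise\<close> is, modulo the line through the moving
  point, the image under \<open>d\<Phi>\<close> of a moving frame in the tube, and
  \<open>euler_shift\<close> discards the difference. At \<open>z\<close> the tube frame is
  \<open>B\<close>; its derivative yields the slot terms, and the power of the norm yields the term
  with \<open>k\<close>.\<close>

lemma raise_tube:
  assumes G: "difrep s G" "euler s G" and z: "z \<in> \<Omega>" and js: "length js = s" "set js \<subseteq> {..<n}" and j: "j < n"
  shows "pe (raise g k G) z (map B js @ [B j]) = D j (\<lambda>z. pe G z (map B js)) z +
    of_int k * (\<nu> z j * pe G z (map B js)) +
    (\<Sum>i<s. \<nu> z (js ! i) * pe G z ((map B js)[i := B j]) -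
       bil g (B (js ! i)) (B j) * (\<Sum>l<n. \<Sum>m<n. K l m * (\<nu> z m * pe G z ((map B js)[i := B l]))))"
proof -
  define Z where "Z = \<Phi> z"
  have Z: "Z \<in> A" using \<Phi>A[OF z] by (simp add: Z_def)
  have p: "nsq g Z > 0" and nz: "N Z \<noteq> 0" using pos[OF Z] N_nz by auto
  have zE: "bil g E z = 0" "bil g F\<^sub>0 z = 0" using \<Omega> z by auto
  have NZ: "N Z = 2 * Q z" using N_\<Phi>[OF zE] by (simp add: Z_def)
  have Qz: "Q z \<noteq> 0" by (rule Q_nz[OF z])
  have Pz: "P z = z" by (rule P_\<Omega>[OF z])
  define x0 where "x0 = (\<lambda>a. pih Z (d\<Phi> z (B a)))"
  define X where "X = (\<lambda>a w. pip (\<Phi> (P w)) (x0 a))"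
  \<comment> \<open>The component of \<open>X a w\<close> in the tube according to
    \<open>tangent_split\<close>.\<close>
  define W where "W = (\<lambda>a w. P (X a w) - bil g (X a w) E *s P w)"
  \<comment> \<open>The pulled back tensor in ambient coordinates. Composition with \<open>P\<close>
    defines it near \<open>z\<close> in the full space, so the Leibniz rule for moving frames
    applies.\<close>
  define H where "H = (\<lambda>w I. ev (G (\<Phi> (P w))) (map (\<lambda>i. d\<Phi> (P w) (axis i 1)) I))"
  have evH: "ev (H w) us = ev (G (\<Phi> (P w))) (map (d\<Phi> (P w)) us)" for w us
  proof -
    have "(\<Sum>j\<in>UNIV. v $ j *s d\<Phi> q (axis j 1)) = d\<Phi> q v" for q v
    proof -
      have "(\<Sum>j\<in>UNIV. v $ j *s d\<Phi> q (axis j 1)) = d\<Phi> q (\<Sum>j\<in>UNIV. v $ j *s axis j 1)"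
        by (simp only: d\<Phi>_sum d\<Phi>_lin)
      then show ?thesis by (simp only: vec_axis_expand[symmetric])
    qed
    then show ?thesis by (simp add: H_def ev_ev)
  qed
  have peH: "ev (H w) us = pe G (P w) us" for w us by (simp add: evH pe_def)
  have dH: "(\<lambda>w. H w I) differentiable (at z)" if "length I = s" for I
    unfolding H_def
  proof (rule diff_evf)
    show "(\<lambda>w. G (\<Phi> (P w)) J) differentiable (at z)" if "length J = length I" for J
      by (rule comp_\<Phi>P(1)[OF z])
        (use G(1) Z that \<open>length I = s\<close> in \<open>auto simp: difrep_def Z_def\<close>)
    show "vdiff z (\<lambda>w. d\<Phi> (P w) (axis a 1))" for a
      unfolding d\<Phi>_def by (intro vdiff_diff vdiff_const vdiff_scale diff_bil P_vector(1))
  qed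
  \<comment> \<open>The coefficient of the part that \<open>pih\<close> removes. It turns out to be
    \<open>\<nu> z a\<close> and accounts for the slot terms with \<open>B j\<close>.\<close>
  define \<mu> where "\<mu> = (\<lambda>a. bil g (d\<Phi> z (B a)) (cj Z) / N Z)"
  have x0: "x0 a = d\<Phi> z (B a) - \<mu> a *s Z" for a by (simp add: x0_def pih_def \<mu>_def)
  have orth: "bil g (d\<Phi> z (B a)) Z = 0" if "a < n" for a
    unfolding Z_def using d\<Phi>_orth zE B that by blast
  have x0Z: "bil g (x0 a) Z = 0" if "a < n" for a
    unfolding x0_def by (rule orth_pih_tangent[OF Z orth[OF that]])
  have ZE: "bil g Z E = 1" using \<Phi>_E[OF zE(1)] by (simp add: Z_def)
  have x0E: "bil g (x0 a) E = - \<mu> a" if "a < n" for a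
    using B(1)[OF that] by (simp add: x0 bil_lin ZE d\<Phi>_def EE bil_sym[of "B a" E])
  have PZ: "P Z = z"
    unfolding Z_def \<Phi>_def by (simp only: P_lin P_E Pz) simp
  have PdB: "P (d\<Phi> z (B a)) = B a" if "a < n" for a
    by (simp add: d\<Phi>_def P_lin P_E P_B[OF that])
  have cjz: "bil g E (cj z) = 0" "bil g F\<^sub>0 (cj z) = 0" using zE cj_orth by auto
  have cjZ: "cj Z = (- bil g (cj z) (cj z) / 2) *s E + cj z + F\<^sub>0" by (simp add: Z_def cj_\<Phi>)
  have PcZ: "P (cj Z) = cj z" unfolding cjZ by (simp only: P_lin P_E P_fix[OF cjz]) simp
  have cZE: "bil g (cj Z) E = 1"
    unfolding cjZ using cjz by (simp add: bil_lin EE bsym(1) EF bil_sym[of "cj z" E])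
  have \<mu>\<nu>: "\<mu> a = \<nu> z a" if "a < n" for a
  proof -
    have "bil g (d\<Phi> z (B a)) (cj Z) = bil g (B a) (cj z) - bil g (B a) z"
      unfolding cjZ d\<Phi>_def using B[OF that] cjz
      by (simp add: bil_lin EE EF bil_sym[of "B a" E] bil_sym[of "B a" F\<^sub>0] bil_sym[of z "B a"])
    also have "\<dots> = - (2 * \<i>) * bil g (B a) (yc z)"
      by (simp add: yc_def bil_lin algebra_simps)
    finally show ?thesis using Qz by (simp add: \<mu>_def \<nu>_def NZ)
  qed
  have Wz: "W a z = B a" if "a < n" for a
  proof -
    have "X a z = x0 a" using x0Z[OF that] by (simp add: X_def Pz pip_fix Z_def[symmetric])
    then show ?thesis
      by (simp add: W_def x0E[OF that] Pz) (simp add: x0 P_lin PdB[OF that] PZ)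
  qed
  have v\<Phi>: "vdiff z (\<lambda>w. \<Phi> (P w))" by (rule \<Phi>P_vector(1))
  have \<delta>\<Phi>: "dee.\<delta>v (B j) z (\<lambda>w. \<Phi> (P w)) = d\<Phi> z (B j)"
    using \<Phi>P_vector(2)[of "B j" z] by (simp add: Pz P_B[OF j])
  have dN: "(\<lambda>w. N (\<Phi> (P w))) differentiable (at z)"
    by (rule comp_\<Phi>P(1)[OF z diff_N])
  have nzP: "N (\<Phi> (P z)) \<noteq> 0" using nz by (simp add: Pz Z_def)
  have db: "(\<lambda>w. bil g (x0 a) (\<Phi> (P w))) differentiable (at z)" for a
    by (intro diff_bil vdiff_const v\<Phi>)
  have d\<gamma>: "(\<lambda>w. bil g (x0 a) (\<Phi> (P w)) / N (\<Phi> (P w))) differentiable (at z)" for a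
    by (intro differentiable_divide db dN nzP)
  have vX: "vdiff z (X a)" for a
    unfolding X_def pip_def by (intro vdiff_diff vdiff_const vdiff_scale d\<gamma> vdiff_cj_comp v\<Phi>)
  have \<delta>X: "dee.\<delta>v (B j) z (X a) = (- (bil g (B a) (B j) / N Z)) *s cj Z" if a: "a < n" for a
  proof -
    have "bil g (x0 a) (d\<Phi> z (B j)) = bil g (B a) (B j)"
      using orth[OF j] B a j by (simp add: x0 bil_lin d\<Phi>_iso bil_sym[of Z])
    then have "dee (\<lambda>w. bil g (x0 a) (\<Phi> (P w))) (B j) z = bil g (B a) (B j)"
      by (subst dee.bil[OF vdiff_const v\<Phi>]) (simp add: \<delta>\<Phi>)
    then have "dee (\<lambda>w. bil g (x0 a) (\<Phi> (P w)) / N (\<Phi> (P w))) (B j) z = bil g (B a) (B j) / N Z"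
      using x0Z[OF a] by (subst dee.divide[OF db dN nzP]) (simp add: Pz Z_def[symmetric])
    then show ?thesis
      unfolding X_def pip_def using x0Z[OF a]
      by (subst dee.\<delta>v_diff[OF vdiff_const vdiff_scale[OF d\<gamma> vdiff_cj_comp[OF v\<Phi>]]],
          subst dee.\<delta>v_scale[OF d\<gamma> vdiff_cj_comp[OF v\<Phi>]])
        (simp add: Pz Z_def[symmetric] vec_eq_iff)
  qed
  have dXE: "(\<lambda>w. bil g (X a w) E) differentiable (at z)" for a by (intro diff_bil vX vdiff_const)
  have vW: "vdiff z (W a)" for a
    unfolding W_def by (intro vdiff_diff \<delta>v_P(1) vX vdiff_scale dXE P_vector(1))
  \<comment> \<open>The projections of \<open>cj Z\<close> and of the moving point contribute
    multiples of \<open>cj z\<close> and \<open>z\<close> with opposite coefficients. Together they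
    form a multiple of the imaginary part, which \<open>yc_expand\<close> makes linear in
    \<nu>.\<close>
  have \<delta>W: "dee.\<delta>v (B j) z (W a) = \<nu> z a *s B j - bil g (B a) (B j) *s (\<Sum>l<n. \<Sum>m<n. (K l m * \<nu> z m) *s B l)"
    if a: "a < n" for a
  proof -
    have Xz: "X a z = x0 a" using x0Z[OF a] by (simp add: X_def Pz pip_fix Z_def[symmetric])
    have "dee.\<delta>v (B j) z (W a) = P (dee.\<delta>v (B j) z (X a)) -
      (bil g (X a z) E *s dee.\<delta>v (B j) z (\<lambda>w. P w) + dee (\<lambda>w. bil g (X a w) E) (B j) z *s P z)"
      unfolding W_def
      by (subst dee.\<delta>v_diff[OF \<delta>v_P(1)[OF vX] vdiff_scale[OF dXE P_vector(1)]])
        (simp only: \<delta>v_P(2)[OF vX] dee.\<delta>v_scale[OF dXE P_vector(1)])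
    also have "\<dots> = (- (bil g (B a) (B j) / N Z)) *s cj z - (- \<mu> a *s B j + (- (bil g (B a) (B j) / N Z)) *s z)"
      by (simp only: dee.bil[OF vX vdiff_const] \<delta>X[OF a] P_lin PcZ Xz x0E[OF a] P_vector(2) P_B[OF j] Pz
          dee.\<delta>v_const bil_zero_right bil_scale_left cZE) simp
    also have "\<dots> = \<mu> a *s B j + bil g (B a) (B j) *s ((\<i> / Q z) *s yc z)"
      using Qz by (simp add: NZ yc_def vec_eq_iff field_simps)
    also have "\<dots> = \<nu> z a *s B j - bil g (B a) (B j) *s (\<Sum>l<n. \<Sum>m<n. (K l m * \<nu> z m) *s B l)"
      by (simp only: yc_expand[OF z] \<mu>\<nu>[OF a]) simp
    finally show ?thesis .
  qed

  define u where "u = (\<lambda>Y. (N Y / 2) powi k * ev (G Y) (map (\<lambda>x. pip Y (pih Z x)) (map (d\<Phi> z) (map B js))))"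
  have lenB: "length (map (d\<Phi> z) (map B js)) = s" using js by simp
  have du: "u differentiable (at (\<Phi> z))"
    unfolding u_def using Z by (intro differentiable_mult diff_Npowi pos diff_ev_pip[OF G(1)] lenB) (simp_all add: Z_def)
  define e where "e = (\<lambda>w. ev (H w) (map (\<lambda>a. W a w) js))"
  have near: "u (\<Phi> (P w)) = Q (P w) powi k * e w" if w: "P w \<in> \<Omega>" for w
  proof -
    have V: "bil g E (P w) = 0" "bil g F\<^sub>0 (P w) = 0" by (rule P_orth)+
    have A': "\<Phi> (P w) \<in> A" by (rule \<Phi>A[OF w])
    have WV: "bil g E (W a w) = 0" "bil g F\<^sub>0 (W a w) = 0" for a
      by (simp_all add: W_def bil_lin P_orth)
    have "X a w = d\<Phi> (P w) (W a w) + bil g (X a w) E *s \<Phi> (P w)" for a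
      unfolding W_def by (rule tangent_split[OF V]) (simp add: X_def pip_orth pos[OF A'])
    then have "map (\<lambda>x. pip (\<Phi> (P w)) (pih Z x)) (map (d\<Phi> z) (map B js)) =
        map (\<lambda>a. d\<Phi> (P w) (W a w) + bil g (X a w) E *s \<Phi> (P w)) js"
      by (simp add: X_def x0_def)
    then have "ev (G (\<Phi> (P w))) (map (\<lambda>x. pip (\<Phi> (P w)) (pih Z x)) (map (d\<Phi> z) (map B js))) =
        ev (G (\<Phi> (P w))) (map (\<lambda>a. d\<Phi> (P w) (W a w)) js)"
      using d\<Phi>_orth[OF V WV] by (simp only: euler_shift[OF G(2) A' js(1)])
    also have "\<dots> = e w" by (simp add: e_def evH o_def)
    finally show ?thesis by (simp add: u_def N_\<Phi>[OF V])
  qed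
  have de: "e differentiable (at z)"
    unfolding e_def by (rule diff_evf) (use dH js vW in auto)
  have mW: "map (\<lambda>a. W a z) js = map B js"
    using js(2) Wz by (intro map_cong refl) auto
  have ez: "e z = pe G z (map B js)" by (simp add: e_def mW peH Pz)
  have dee_e: "dee e (B j) z = D j (\<lambda>z. pe G z (map B js)) z +
    (\<Sum>i<s. \<nu> z (js ! i) * pe G z ((map B js)[i := B j]) -
       bil g (B (js ! i)) (B j) * (\<Sum>l<n. \<Sum>m<n. K l m * (\<nu> z m * pe G z ((map B js)[i := B l]))))"
  proof -
    have "dee e (B j) z = ev (\<lambda>I. dee (\<lambda>w. H w I) (B j) z) (map (\<lambda>a. W a z) js) +
      (\<Sum>i<length js. ev (H z) ((map (\<lambda>a. W a z) js)[i := dee.\<delta>v (B j) z (W (js ! i))]))"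
      unfolding e_def by (rule dee.ev_mapf) (use dH js vW in auto)
    also have "ev (\<lambda>I. dee (\<lambda>w. H w I) (B j) z) (map (\<lambda>a. W a z) js) = D j (\<lambda>z. pe G z (map B js)) z"
      unfolding mW D_def peH[symmetric] by (rule dee.ev_const[symmetric]) (use dH js in auto)
    also have "(\<Sum>i<length js. ev (H z) ((map (\<lambda>a. W a z) js)[i := dee.\<delta>v (B j) z (W (js ! i))])) =
      (\<Sum>i<s. \<nu> z (js ! i) * pe G z ((map B js)[i := B j]) -
       bil g (B (js ! i)) (B j) * (\<Sum>l<n. \<Sum>m<n. K l m * (\<nu> z m * pe G z ((map B js)[i := B l]))))"
      unfolding mW js(1)
    proof (intro sum.cong refl)
      fix i assume "i \<in> {..<s}"
      then have i: "i < length (map B js)" and a: "js ! i < n" using js by (auto simp: subset_iff)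
      show "ev (H z) ((map B js)[i := dee.\<delta>v (B j) z (W (js ! i))]) =
         \<nu> z (js ! i) * pe G z ((map B js)[i := B j]) -
       bil g (B (js ! i)) (B j) * (\<Sum>l<n. \<Sum>m<n. K l m * (\<nu> z m * pe G z ((map B js)[i := B l])))"
        unfolding \<delta>W[OF a] ev_upd_diff[OF i] ev_upd_scale[OF i] ev_upd_sum[OF i] peH Pz
        by (simp only: mult.assoc)
    qed
    finally show ?thesis .
  qed
  have dQk: "(\<lambda>w. Q (P w) powi k) differentiable (at z)" by (rule diff_powi[OF diff_QP]) (simp add: Pz Qz)
  have "pe (raise g k G) z (map B js @ [B j]) = (N Z / 2) powi (- k) * dee u (d\<Phi> z (B j)) Z"
    using ev_raise_A[OF G(1) Z lenB, of k "d\<Phi> z (B j)"] by (simp only: pe_def map_append list.map Z_def[symmetric] u_def)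
  also have "dee u (d\<Phi> z (B j)) Z = dee (\<lambda>w. u (\<Phi> (P w))) (B j) z"
    by (simp only: comp_\<Phi>P(2)[OF z du] P_B[OF j] Z_def)
  also have "\<dots> = dee (\<lambda>w. Q (P w) powi k * e w) (B j) z"
    by (rule dee.cong, rule eventually_mono[OF eventually_U[OF z]]) (rule near)
  also have "\<dots> = Q z powi k * (dee e (B j) z + of_int k * (\<nu> z j * e z))"
  proof -
    have "dee (\<lambda>w. Q (P w)) (B j) z = \<nu> z j * Q z" using D_Q[OF z j] by (simp add: D_def)
    then have "dee (\<lambda>w. Q (P w) powi k) (B j) z = of_int k * Q z powi k * \<nu> z j"
      using dee.powi[OF diff_QP] Qz by (simp add: Pz)
    then show ?thesis
      by (subst dee.mult[OF dQk de]) (simp add: Pz algebra_simps)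
  qed
  also have "(N Z / 2) powi (- k) * \<dots> = dee e (B j) z + of_int k * (\<nu> z j * e z)"
    using powi_cancel_N[OF p, of k] by (simp add: NZ mult.assoc[symmetric])
  finally show ?thesis unfolding dee_e ez by simp
qed

section \<open>Differentiation of polynomials in the functions nu\<close>

lemma D_cong:
  assumes z: "z \<in> \<Omega>" and eq: "\<And>w. w \<in> \<Omega> \<Longrightarrow> u w = u' w"
  shows "D j u z = D j u' z" "(\<lambda>w. u (P w)) differentiable (at z) \<longleftrightarrow> (\<lambda>w. u' (P w)) differentiable (at z)"
proof -
  have ev: "eventually (\<lambda>w. u (P w) = u' (P w)) (nhds z)"
    using eventually_U[OF z] by (rule eventually_mono) (rule eq)
  show "D j u z = D j u' z" unfolding D_def by (rule dee.cong[OF ev])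
  show "(\<lambda>w. u (P w)) differentiable (at z) \<longleftrightarrow> (\<lambda>w. u' (P w)) differentiable (at z)"
    by (rule differentiable_cong_ev[OF ev])
qed

text \<open>The projection maps the open set \<open>U\<close> into \<Omega>, so composing with it
  turns the derivative within \<Omega> into an ambient one.\<close>

lemma holo_cdiff:
  assumes "holo_on \<Omega> h"
  shows "cdiff_on U (\<lambda>w. h (P w))"
  unfolding cdiff_on_def
proof
  fix z assume z: "z \<in> U"
  then obtain h' where h': "(h has_derivative h') (at (P z) within \<Omega>)" "\<And>c v. h' (c *s v) = c * h' v"
    using assms unfolding holo_on_def U_def by blast
  have "(h has_derivative h') (at (P z) within P ` U)"
    by (rule has_derivative_subset[OF h'(1)]) (auto simp: U_def)
  from has_derivative_in_compose[OF P_derivative this]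
  have "((\<lambda>w. h (P w)) has_derivative (\<lambda>v. h' (P v))) (at z)"
    by (simp add: at_within_open[OF z open_U])
  then show "\<exists>f'. ((\<lambda>w. h (P w)) has_derivative f') (at z) \<and> (\<forall>c v. f' (c *s v) = c * f' v)"
    by (intro exI[of _ "\<lambda>v. h' (P v)"]) (simp add: h'(2) P_lin)
qed

lemma D_holo:
  assumes h: "holo_on \<Omega> h"
  shows "holo_on \<Omega> (D j h)"
proof -
  have "cdiff_on U (\<lambda>z. frechet_derivative (\<lambda>w. h (P w)) (at z) (B j))"
    by (rule cdiff_on_derivative[OF open_U holo_cdiff[OF h]])
  then have "holo_on \<Omega> (\<lambda>z. frechet_derivative (\<lambda>w. h (P w)) (at z) (B j))"
    unfolding cdiff_on_def holo_on_def using \<Omega>_U has_derivative_at_withinI by blast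
  then show ?thesis
    by (rule holo_on_cong) (simp add: D_def cdiff_onD(4)[OF holo_cdiff[OF h] \<Omega>_U])
qed

text \<open>Every term of the derivative of \<nu> is quadratic, so differentiation never feeds into
  the constant term, which is simply differentiated itself. Differentiability is carried along,
  since the product rule needs it in the induction.\<close>

lemma hpoly_D:
  assumes "hpoly \<Omega> n \<nu> c q" and j: "j < n"
  shows "hpoly \<Omega> n \<nu> (D j c) (D j q) \<and>
    (\<forall>z\<in>\<Omega>. (\<lambda>w. q (P w)) differentiable (at z) \<and> (\<lambda>w. c (P w)) differentiable (at z))"
  using assms(1)
proof (induction rule: hpoly.induct)
  case (coeff h c q)
  have "(\<lambda>w. h (P w)) differentiable (at z)" if "z \<in> \<Omega>" for z
    by (rule cdiff_onD(3)[OF holo_cdiff[OF coeff(1)] \<Omega>_U[OF that]])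
  then show ?case
    using hpoly.coeff[OF D_holo[OF coeff(1), of j], where c = "D j c" and q = "D j q"] coeff(2,3)
      D_cong(1)[where u = c and u' = h and j = j] D_cong(1)[where u = q and u' = h and j = j] D_cong(2)[where u = c and u' = h] D_cong(2)[where u = q and u' = h] by simp
next
  case (sum c q c' q' c'' q'')
  have d: "(\<lambda>w. c (P w) + c' (P w)) differentiable (at z)" "(\<lambda>w. q (P w) + q' (P w)) differentiable (at z)"
    if "z \<in> \<Omega>" for z using sum.IH that by auto
  have "D j c'' z = D j c z + D j c' z" "D j q'' z = D j q z + D j q' z" if z: "z \<in> \<Omega>" for z
    using sum.IH sum.hyps z D_cong(1)[OF z, where u = "c''" and u' = "\<lambda>w. c w + c' w" and j = j] D_cong(1)[OF z, where u = "q''" and u' = "\<lambda>w. q w + q' w" and j = j]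
    by (simp_all add: D_def dee.add)
  then have "hpoly \<Omega> n \<nu> (D j c'') (D j q'')"
    using hpoly.sum sum.IH by blast
  moreover have "(\<lambda>w. c'' (P w)) differentiable (at z)" "(\<lambda>w. q'' (P w)) differentiable (at z)" if z: "z \<in> \<Omega>" for z
    using d[OF z] D_cong(2)[OF z, where u = "c''" and u' = "\<lambda>w. c w + c' w"] D_cong(2)[OF z, where u = "q''" and u' = "\<lambda>w. q w + q' w"] sum.hyps
    by auto
  ultimately show ?case by blast
next
  case (var c q i c' q')
  have dq: "(\<lambda>w. q (P w)) differentiable (at z)" if "z \<in> \<Omega>" for z using var.IH that by blast
  have "D j q' z = \<nu> z i * D j q z + (- 1 * (\<nu> z i * (\<nu> z j * q z)) +
      (\<Sum>l<n. \<Sum>m<n. bil g (B i) (B j) / 2 * K l m * (\<nu> z m * (\<nu> z l * q z))))" if z: "z \<in> \<Omega>" for z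
  proof -
    have "D j q' z = D j (\<lambda>w. \<nu> w i * q w) z" by (rule D_cong(1)[OF z]) (simp add: var.hyps)
    also have "\<dots> = \<nu> z i * D j q z + D j (\<lambda>z. \<nu> z i) z * q z"
      unfolding D_def using dee.mult[OF D_\<nu>(2)[OF z var.hyps(2) j] dq[OF z]] by (simp add: P_\<Omega>[OF z])
    also have "\<dots> = \<nu> z i * D j q z + (- 1 * (\<nu> z i * (\<nu> z j * q z)) +
      (\<Sum>l<n. \<Sum>m<n. bil g (B i) (B j) / 2 * K l m * (\<nu> z m * (\<nu> z l * q z))))"
      unfolding D_\<nu>(1)[OF z var.hyps(2) j]
      by (simp only: sum_distrib_right sum_distrib_left left_diff_distrib distrib_right) (simp add: algebra_simps sum_distrib_left)
    finally show ?thesis .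
  qed
  moreover have "hpoly \<Omega> n \<nu> (\<lambda>z. 0) (\<lambda>z. \<nu> z i * D j q z + (- 1 * (\<nu> z i * (\<nu> z j * q z)) +
      (\<Sum>l<n. \<Sum>m<n. bil g (B i) (B j) / 2 * K l m * (\<nu> z m * (\<nu> z l * q z)))))"
  proof -
    have 1: "hpoly \<Omega> n \<nu> (\<lambda>z. 0) (\<lambda>z. \<nu> z i * D j q z)"
      by (rule hpoly.var[of _ _ _ "D j c" "D j q"]) (use var in auto)
    have 2: "hpoly \<Omega> n \<nu> (\<lambda>z. 0) (\<lambda>z. \<nu> z a * q z)" if "a < n" for a
      by (rule hpoly.var[OF var.hyps(1) that]) auto
    have 3: "hpoly \<Omega> n \<nu> (\<lambda>z. 0) (\<lambda>z. r * (\<nu> z b * (\<nu> z a * q z)))" if "a < n" "b < n" for a b r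
      using hpoly_cmult[OF hpoly.var[OF 2[OF that(1)] that(2), of "\<lambda>z. 0" "\<lambda>z. \<nu> z b * (\<nu> z a * q z)"], of r] by simp
    have 4: "hpoly \<Omega> n \<nu> (\<lambda>z. 0) (\<lambda>z. \<Sum>l<n. \<Sum>m<n. bil g (B i) (B j) / 2 * K l m * (\<nu> z m * (\<nu> z l * q z)))"
    proof -
      have "hpoly \<Omega> n \<nu> (\<lambda>z. \<Sum>l<n. \<Sum>m<n. 0)
        (\<lambda>z. \<Sum>l<n. \<Sum>m<n. bil g (B i) (B j) / 2 * K l m * (\<nu> z m * (\<nu> z l * q z)))"
        by (intro hpoly_sum 3) auto
      then show ?thesis by (simp only: sum.neutral_const)
    qed
    show ?thesis
      by (rule hpoly.sum[OF 1 hpoly.sum[OF 3[OF j var.hyps(2), of "- 1"] 4]]) auto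
  qed
  moreover have "D j c' z = 0" if z: "z \<in> \<Omega>" for z
    using D_cong(1)[OF z, where u = "c'" and u' = "\<lambda>_. 0" and j = j] var.hyps by (simp add: D_def)
  ultimately have "hpoly \<Omega> n \<nu> (D j c') (D j q')"
    by (intro hpoly_cong[where c' = "D j c'" and q' = "D j q'"]) auto
  moreover have "(\<lambda>w. q' (P w)) differentiable (at z)" "(\<lambda>w. c' (P w)) differentiable (at z)" if z: "z \<in> \<Omega>" for z
    using D_cong(2)[OF z, where u = "q'" and u' = "\<lambda>w. \<nu> w i * q w"] D_cong(2)[OF z, where u = "c'" and u' = "\<lambda>_. 0"] var.hyps
      D_\<nu>(2)[OF z var.hyps(2) j] dq[OF z] by (auto intro!: differentiable_mult)
  ultimately show ?case by blast
qed

section \<open>Regular Fourier expansions and the cusp condition for tensors\<close>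

lemma regular_fourier_cong:
  "regular_fourier g \<Omega> h \<Longrightarrow> (\<And>z. z \<in> \<Omega> \<Longrightarrow> h' z = h z) \<Longrightarrow> regular_fourier g \<Omega> h'"
  unfolding regular_fourier_def by simp

lemma regular_fourier_zero: "regular_fourier g \<Omega> (\<lambda>z. 0)"
  unfolding regular_fourier_def by (intro exI[of _ "\<lambda>_. 0"]) simp

lemma regular_fourier_cmult: "regular_fourier g \<Omega> h \<Longrightarrow> regular_fourier g \<Omega> (\<lambda>z. a * h z)"
  unfolding regular_fourier_def
proof (elim exE conjE)
  fix c :: "real^'m \<Rightarrow> complex"
  assume c: "\<forall>\<alpha>. c \<alpha> \<noteq> 0 \<longrightarrow> \<alpha> \<in> closure (vmap Im ` \<Omega>)"
    "\<forall>z\<in>\<Omega>. ((\<lambda>\<alpha>. c \<alpha> * exp (2 * of_real pi * \<i> * bil g (vmap of_real \<alpha>) z)) has_sum h z) UNIV"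
  show "\<exists>c. (\<forall>\<alpha>. c \<alpha> \<noteq> 0 \<longrightarrow> \<alpha> \<in> closure (vmap Im ` \<Omega>)) \<and>
    (\<forall>z\<in>\<Omega>. ((\<lambda>\<alpha>. c \<alpha> * exp (2 * of_real pi * \<i> * bil g (vmap of_real \<alpha>) z)) has_sum a * h z) UNIV)"
    using c by (intro exI[of _ "\<lambda>\<alpha>. a * c \<alpha>"]) (auto simp: mult.assoc intro!: has_sum_cmult_right)
qed

lemma regular_fourier_add:
  assumes "regular_fourier g \<Omega> h" "regular_fourier g \<Omega> h'"
  shows "regular_fourier g \<Omega> (\<lambda>z. h z + h' z)"
proof -
  let ?e = "\<lambda>\<alpha> z. exp (2 * of_real pi * \<i> * bil g (vmap of_real \<alpha>) z)"
  obtain c where c: "\<And>\<alpha>. c \<alpha> \<noteq> 0 \<Longrightarrow> \<alpha> \<in> closure (vmap Im ` \<Omega>)"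
    "\<And>z. z \<in> \<Omega> \<Longrightarrow> ((\<lambda>\<alpha>. c \<alpha> * ?e \<alpha> z) has_sum h z) UNIV"
    using assms(1) unfolding regular_fourier_def by blast
  obtain c' where c': "\<And>\<alpha>. c' \<alpha> \<noteq> 0 \<Longrightarrow> \<alpha> \<in> closure (vmap Im ` \<Omega>)"
    "\<And>z. z \<in> \<Omega> \<Longrightarrow> ((\<lambda>\<alpha>. c' \<alpha> * ?e \<alpha> z) has_sum h' z) UNIV"
    using assms(2) unfolding regular_fourier_def by blast
  have "((\<lambda>\<alpha>. (c \<alpha> + c' \<alpha>) * ?e \<alpha> z) has_sum h z + h' z) UNIV" if "z \<in> \<Omega>" for z
    using has_sum_add[OF c(2)[OF that] c'(2)[OF that]] by (simp add: distrib_right)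
  moreover have "\<alpha> \<in> closure (vmap Im ` \<Omega>)" if "c \<alpha> + c' \<alpha> \<noteq> 0" for \<alpha>
    using c(1)[of \<alpha>] c'(1)[of \<alpha>] that by (cases "c \<alpha> = 0") auto
  ultimately show ?thesis
    unfolding regular_fourier_def by (intro exI[of _ "\<lambda>\<alpha>. c \<alpha> + c' \<alpha>"]) blast
qed

text \<open>The series is restricted to the complex line through \<open>z\<close> in direction
  \<open>B j\<close>. Differentiation multiplies each coefficient by a number, so no new frequencies
  appear.\<close>

lemma regular_fourier_D:
  assumes h: "holo_on \<Omega> h" and reg: "regular_fourier g \<Omega> h" and j: "j < n"
  shows "regular_fourier g \<Omega> (D j h)"
proof -
  let ?e = "\<lambda>\<alpha> z. exp (2 * of_real pi * \<i> * bil g (vmap of_real \<alpha>) z)"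
  obtain c where c: "\<And>\<alpha>. c \<alpha> \<noteq> 0 \<Longrightarrow> \<alpha> \<in> closure (vmap Im ` \<Omega>)"
    "\<And>z. z \<in> \<Omega> \<Longrightarrow> ((\<lambda>\<alpha>. c \<alpha> * ?e \<alpha> z) has_sum h z) UNIV"
    using reg unfolding regular_fourier_def by blast
  \<comment> \<open>Frequency and \<open>B j\<close> are both real, so the exponent along the line
    is \<i> times a real number times the parameter, as \<open>fourier_derivative\<close>
    requires.\<close>
  define \<xi> where "\<xi> = (\<lambda>\<alpha> :: real^'m. 2 * pi * Re (bil g (vmap of_real \<alpha>) (B j)))"
  have real: "2 * of_real pi * \<i> * bil g (vmap of_real \<alpha>) (B j) = \<i> * of_real (\<xi> \<alpha>)" for \<alpha> :: "real^'m"
  proof -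
    have "cj (vmap of_real \<alpha>) = vmap of_real \<alpha>" by (simp add: vmap_def vec_eq_iff)
    then have "cnj (bil g (vmap of_real \<alpha>) (B j)) = bil g (vmap of_real \<alpha>) (B j)"
      by (simp add: bil_cnj B(3)[OF j])
    then have "bil g (vmap of_real \<alpha>) (B j) = of_real (Re (bil g (vmap of_real \<alpha>) (B j)))"
      by (simp add: complex_eq_iff)
    moreover have "\<i> * complex_of_real (\<xi> \<alpha>) = 2 * of_real pi * \<i> * of_real (Re (bil g (vmap of_real \<alpha>) (B j)))"
      by (simp add: \<xi>_def)
    ultimately show ?thesis by (simp only:)
  qed
  have "((\<lambda>\<alpha>. (c \<alpha> * (\<i> * of_real (\<xi> \<alpha>))) * ?e \<alpha> z) has_sum D j h z) UNIV" if z: "z \<in> \<Omega>" for z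
  proof -
    obtain e where e: "e > 0" "\<And>w. bil g E w = 0 \<Longrightarrow> bil g F\<^sub>0 w = 0 \<Longrightarrow> dist w z < e \<Longrightarrow> w \<in> \<Omega>"
      using \<Omega>_open[OF z] by blast
    \<comment> \<open>Complex parameters up to modulus \<open>r\<close> must stay in \<Omega>; the
      imaginary ones provide the domination of the series.\<close>
    define r where "r = e / (norm (B j) + 1)"
    have r: "r > 0" using e(1) norm_ge_zero[of "B j"] by (simp add: r_def add_nonneg_pos)
    have r': "r * norm (B j) < e"
    proof -
      have "r * (norm (B j) + 1) = e" using norm_ge_zero[of "B j"] by (simp add: r_def add_nonneg_eq_0_iff)
      then show ?thesis using r by (simp add: distrib_left)
    qed
    have V: "bil g E (z + t *s B j) = 0" "bil g F\<^sub>0 (z + t *s B j) = 0" for t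
      using \<Omega>[OF z] B[OF j] by (simp_all add: bil_lin)
    have in\<Omega>: "z + t *s B j \<in> \<Omega>" if "cmod t \<le> r" for t
    proof (rule e(2)[OF V])
      have "cmod t * norm (B j) \<le> r * norm (B j)" using that by (rule mult_right_mono) simp
      then show "dist (z + t *s B j) z < e" using r' by (simp add: dist_norm norm_smult)
    qed
    have "((\<lambda>\<alpha>. (c \<alpha> * ?e \<alpha> z) * (\<i> * of_real (\<xi> \<alpha>))) has_sum D j h z) UNIV"
    proof (rule fourier_derivative[OF r])
      fix t assume t: "cmod t \<le> r"
      have "2 * of_real pi * \<i> * bil g (vmap of_real \<alpha>) (z + t *s B j) =
        2 * of_real pi * \<i> * bil g (vmap of_real \<alpha>) z + t * (\<i> * of_real (\<xi> \<alpha>))" for \<alpha> :: "real^'m"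
        unfolding real[symmetric] by (simp add: bil_lin algebra_simps)
      then show "((\<lambda>\<alpha>. c \<alpha> * ?e \<alpha> z * exp (t * (\<i> * of_real (\<xi> \<alpha>)))) has_sum h (z + t *s B j)) UNIV"
        using c(2)[OF in\<Omega>[OF t]] by (simp only: exp_add mult.assoc)
    next
      have zU: "z + 0 *s B j \<in> U" using \<Omega>_U[OF z] by simp
      from line_field_derivative[OF holo_cdiff[OF h] zU]
      have "((\<lambda>t. h (P (z + t *s B j))) has_field_derivative D j h z) (at 0)"
        by (simp add: D_def cdiff_onD(4)[OF holo_cdiff[OF h] \<Omega>_U[OF z]])
      then show "((\<lambda>t. h (z + t *s B j)) has_field_derivative D j h z) (at 0)"
        by (simp add: P_fix[OF V])
    qed
    then show ?thesis by (simp add: mult_ac)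
  qed
  moreover have "\<alpha> \<in> closure (vmap Im ` \<Omega>)" if "c \<alpha> * (\<i> * of_real (\<xi> \<alpha>)) \<noteq> 0" for \<alpha>
    using c(1) that by auto
  ultimately show ?thesis
    unfolding regular_fourier_def by (intro exI[of _ "\<lambda>\<alpha>. c \<alpha> * (\<i> * of_real (\<xi> \<alpha>))"]) blast
qed

text \<open>The cusp condition for a single coefficient. As in \<open>cusp_condition\<close>, one
  representation with regular constant term is asked for.\<close>

definition cuspval :: "(complex^'m \<Rightarrow> complex) \<Rightarrow> bool" where
  "cuspval q \<longleftrightarrow> (\<exists>c. hpoly \<Omega> n \<nu> c q \<and> regular_fourier g \<Omega> c)"

lemma cuspval_cong: "cuspval q \<Longrightarrow> (\<And>z. z \<in> \<Omega> \<Longrightarrow> q' z = q z) \<Longrightarrow> cuspval q'"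
  unfolding cuspval_def using hpoly_cong by blast

lemma cuspval_zero: "cuspval (\<lambda>z. 0)"
  unfolding cuspval_def using hpoly_zero regular_fourier_zero by blast

lemma cuspval_add: "cuspval q \<Longrightarrow> cuspval q' \<Longrightarrow> cuspval (\<lambda>z. q z + q' z)"
  unfolding cuspval_def by (elim exE conjE, rule exI, rule conjI, erule (1) hpoly.sum, rule refl, rule refl)
    (rule regular_fourier_add)

lemma cuspval_cmult: "cuspval q \<Longrightarrow> cuspval (\<lambda>z. a * q z)"
  unfolding cuspval_def using hpoly_cmult regular_fourier_cmult by blast

lemma cuspval_diff: "cuspval q \<Longrightarrow> cuspval q' \<Longrightarrow> cuspval (\<lambda>z. q z - q' z)"
  using cuspval_add[of q "\<lambda>z. - 1 * q' z"] cuspval_cmult[of q' "- 1"] by simp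

lemma cuspval_sum: "(\<And>i. i \<in> I \<Longrightarrow> cuspval (q i)) \<Longrightarrow> cuspval (\<lambda>z. \<Sum>i\<in>I. q i z)"
  by (induction I rule: infinite_finite_induct) (simp_all add: cuspval_zero cuspval_add)

lemma cuspval_\<nu>: "cuspval q \<Longrightarrow> j < n \<Longrightarrow> cuspval (\<lambda>z. \<nu> z j * q z)"
  unfolding cuspval_def using hpoly.var[of \<Omega> n \<nu> _ q j "\<lambda>z. 0" "\<lambda>z. \<nu> z j * q z"] regular_fourier_zero by blast

lemma cuspval_D: "cuspval q \<Longrightarrow> j < n \<Longrightarrow> cuspval (D j q)"
  unfolding cuspval_def
  by (elim exE conjE, rule exI, rule conjI, erule (1) hpoly_D[THEN conjunct1], erule (1) regular_fourier_D[OF hpoly_holo])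

definition cusp_tensor :: "nat \<Rightarrow> 'm mdiff \<Rightarrow> bool" where
  "cusp_tensor s G \<longleftrightarrow> (\<forall>J. length J = s \<longrightarrow> set J \<subseteq> {..<n} \<longrightarrow> cuspval (\<lambda>z. pe G z (map B J)))"

lemma pe_sec_eq:
  assumes "sec_eq g A s F G" "z \<in> \<Omega>" "length J = s" "set J \<subseteq> {..<n}"
  shows "pe F z (map B J) = pe G z (map B J)"
  unfolding pe_def
  by (rule sec_eq_evD[OF assms(1) \<Phi>A[OF assms(2)]])
    (use assms \<Omega> B in \<open>auto intro!: d\<Phi>_orth\<close>)

lemma cusp_tensor_cong: "cusp_tensor s G \<Longrightarrow> sec_eq g A s F G \<Longrightarrow> cusp_tensor s F"
  unfolding cusp_tensor_def by (intro allI impI) (rule cuspval_cong, blast, rule pe_sec_eq)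

lemma cusp_tensor_add: "cusp_tensor s F \<Longrightarrow> cusp_tensor s G \<Longrightarrow> cusp_tensor s (\<lambda>Z I. F Z I + G Z I)"
  unfolding cusp_tensor_def by (simp add: pe_def ev_add cuspval_add)

lemma lswap_map: "i < length J \<Longrightarrow> j < length J \<Longrightarrow> lswap i j (map f J) = map f (lswap i j J)"
  by (simp add: lswap_def map_update)

lemma cusp_tensor_swap:
  assumes G: "cusp_tensor t G" and ij: "1 \<le> i" "i \<le> t" "1 \<le> j" "j \<le> t"
  shows "cusp_tensor t (swap_slots i j G)"
  unfolding cusp_tensor_def
proof (intro allI impI)
  fix J assume J: "length J = t" "set J \<subseteq> {..<n}"
  have "pe (swap_slots i j G) z (map B J) = pe G z (map B (lswap (i - 1) (j - 1) J))" for z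
    unfolding pe_def using J ij by (subst ev_swap_slots) (auto simp: lswap_map)
  moreover have "cuspval (\<lambda>z. pe G z (map B (lswap (i - 1) (j - 1) J)))"
    by (rule G[unfolded cusp_tensor_def, rule_format]) (use J ij in auto)
  ultimately show "cuspval (\<lambda>z. pe (swap_slots i j G) z (map B J))" by simp
qed

text \<open>Since \<open>d\<Phi>\<close> is isometric on the basis vectors, the pulled back metric
  has the constant coefficients \<open>bil g (B i) (B j)\<close>.\<close>

lemma cusp_tensor_ins_g:
  assumes G: "cusp_tensor (s + d) G"
  shows "cusp_tensor (s + 2 + d) (ins_g g s G)"
  unfolding cusp_tensor_def
proof (intro allI impI)
  fix J assume J: "length J = s + 2 + d" "set J \<subseteq> {..<n}"
  have lt: "J ! r < n" if "r < s + 2 + d" for r using J that by (auto simp: subset_iff)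
  have "pe (ins_g g s G) z (map B J) = bil g (B (J ! s)) (B (J ! (s + 1))) * pe G z (map B (take s J @ drop (s + 2) J))" for z
    unfolding pe_def using J lt B
    by (subst ev_ins_g) (auto simp: d\<Phi>_iso take_map drop_map)
  moreover have "cuspval (\<lambda>z. pe G z (map B (take s J @ drop (s + 2) J)))"
    by (rule G[unfolded cusp_tensor_def, rule_format]) (use J in \<open>auto dest: in_set_takeD in_set_dropD\<close>)
  ultimately show "cuspval (\<lambda>z. pe (ins_g g s G) z (map B J))" by (simp add: cuspval_cmult)
qed

lemma cusp_tensor_comm_rhs:
  assumes G: "cusp_tensor (s + d) G"
  shows "cusp_tensor (s + 2 + d) (comm_rhs g k s G)"
  unfolding cusp_tensor_def
proof (intro allI impI)
  fix J assume J: "length J = s + 2 + d" "set J \<subseteq> {..<n}"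
  have i: "cuspval (\<lambda>z. pe (ins_g g s G) z (map B J))"
    using cusp_tensor_ins_g[OF G] J unfolding cusp_tensor_def by blast
  have sw: "cuspval (\<lambda>z. pe (swap_slots a b (ins_g g s G)) z (map B J))" if "1 \<le> a" "a \<le> s + 2" "1 \<le> b" "b \<le> s + 2" for a b
    using cusp_tensor_swap[OF cusp_tensor_ins_g[OF G], of a b] that J unfolding cusp_tensor_def by simp
  have "cuspval (\<lambda>z. of_int k / 2 * pe (ins_g g s G) z (map B J) + 1 / 2 *
    (\<Sum>r = 1..s. pe (swap_slots r (s + 1) (ins_g g s G)) z (map B J) - pe (swap_slots r (s + 2) (ins_g g s G)) z (map B J)))"
    by (intro cuspval_add cuspval_cmult cuspval_sum cuspval_diff i sw) auto
  then show "cuspval (\<lambda>z. pe (comm_rhs g k s G) z (map B J))"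
    by (rule cuspval_cong) (simp only: pe_def comm_rhs_def ev_add ev_scale ev_sum ev_diff)
qed

lemma cusp_tensor_raise:
  assumes sec: "is_section g A k s G" and G: "cusp_tensor s G"
  shows "cusp_tensor (s + 1) (raise g k G)"
  unfolding cusp_tensor_def
proof (intro allI impI)
  fix J assume J: "length J = s + 1" "set J \<subseteq> {..<n}"
  have dG: "difrep s G" "euler s G" using sec smrep_difrep by (auto simp: is_section_iff)
  have "J \<noteq> []" using J by auto
  then obtain js j where Jj: "J = js @ [j]" by (metis append_butlast_last_id)
  have js: "length js = s" "set js \<subseteq> {..<n}" and j: "j < n" using J Jj by auto
  have lt: "js ! i < n" if "i < s" for i using js that by (auto simp: subset_iff)
  have base: "cuspval (\<lambda>z. pe G z (map B js))" using G js unfolding cusp_tensor_def by blast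
  have upd: "cuspval (\<lambda>z. pe G z ((map B js)[i := B l]))" if "l < n" for i l
  proof -
    have "set (js[i := l]) \<subseteq> {..<n}"
      using set_update_subset_insert[of js i l] js(2) that by auto
    then have "cuspval (\<lambda>z. pe G z (map B (js[i := l])))"
      using G js unfolding cusp_tensor_def by simp
    then show ?thesis by (simp add: map_update)
  qed
  have "cuspval (\<lambda>z. D j (\<lambda>z. pe G z (map B js)) z +
    of_int k * (\<nu> z j * pe G z (map B js)) +
    (\<Sum>i<s. \<nu> z (js ! i) * pe G z ((map B js)[i := B j]) -
       bil g (B (js ! i)) (B j) * (\<Sum>l<n. \<Sum>m<n. K l m * (\<nu> z m * pe G z ((map B js)[i := B l])))))"
    by (intro cuspval_add cuspval_cmult cuspval_sum cuspval_diff cuspval_\<nu> base upd j cuspval_D lt) auto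
  then show "cuspval (\<lambda>z. pe (raise g k G) z (map B J))"
    by (rule cuspval_cong) (simp add: Jj raise_tube[OF dG _ js j])
qed

text \<open>The same recursion as for nilpotency. The assumption covers all iterates, because the
  induction hypothesis is applied to \<open>lower g F\<close>, whose iterates are those of
  \<open>F\<close> shifted by one.\<close>

lemma cusp_tensor_lowern_raise:
  assumes "is_section g A k s F" "\<And>d. cusp_tensor (s + d) ((lower g ^^ d) F)"
  shows "cusp_tensor (s + 1 + d) ((lower g ^^ d) (raise g k F))"
  using assms
proof (induction d arbitrary: k s F)
  case 0
  then show ?case using cusp_tensor_raise[OF 0(1)] 0(2)[of 0] by simp
next
  case (Suc d)
  have "cusp_tensor (s + 1 + d') ((lower g ^^ d') (lower g F))" for d'
    using Suc.prems(2)[of "Suc d'"] by (simp add: funpow_Suc_right del: funpow.simps)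
  from Suc.IH[OF is_section_lower[OF Suc.prems(1)] this]
  have "cusp_tensor (s + 2 + d) ((lower g ^^ d) (raise g (k - 1) (lower g F)))" by simp
  then have "cusp_tensor (s + 2 + d) (\<lambda>Z I. swap_slots (s + 1) (s + 2) ((lower g ^^ d) (raise g (k - 1) (lower g F))) Z I +
      comm_rhs g k s ((lower g ^^ d) F) Z I)"
    by (intro cusp_tensor_add cusp_tensor_swap cusp_tensor_comm_rhs Suc.prems(2)) auto
  from cusp_tensor_cong[OF this lowern_raise[OF Suc.prems(1), of d]] show ?case by simp
qed

end

section \<open>The cone over the period domain\<close>

lemma cline_self: "Z \<in> cline Z"
  unfolding cline_def by (auto intro!: exI[of _ 1])

lemma cline_smult:
  assumes "c \<noteq> 0"
  shows "cline (c *s Z) = cline Z"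
proof -
  have "\<exists>d. a *s (c *s Z) = d *s Z \<and> d \<noteq> 0" if "a \<noteq> 0" for a
    using assms that by (intro exI[of _ "a * c"]) simp
  moreover have "\<exists>d. a *s Z = d *s (c *s Z) \<and> d \<noteq> 0" if "a \<noteq> 0" for a
    using assms that by (intro exI[of _ "a / c"]) simp
  ultimately show ?thesis unfolding cline_def by blast
qed

lemma nsq_smult: "nsq g (c *s Z) = (cmod c)\<^sup>2 * nsq g Z"
proof -
  have "bil g (c *s Z) (cj (c *s Z)) = of_real ((cmod c)\<^sup>2) * bil g Z (cj Z)"
    unfolding complex_norm_square by (simp add: cj_scale bil_lin)
  then show ?thesis by (simp add: nsq_def)
qed

lemma period_setD:
  assumes "cline Z \<in> period_set g"
  shows "bil g Z Z = 0" and "nsq g Z > 0"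
proof -
  obtain W where W: "cline Z = cline W" "bil g W W = 0" "nsq g W > 0"
    using assms by (auto simp: period_set_def nsq_def)
  then obtain c where c: "Z = c *s W" "c \<noteq> 0"
    using cline_self[of Z] by (auto simp: cline_def)
  show "bil g Z Z = 0" using W by (simp add: c bil_lin)
  show "nsq g Z > 0" using W c(2) by (simp add: c nsq_smult)
qed

lemma nsq_pos_nonzero: "nsq g Z > 0 \<Longrightarrow> Z \<noteq> 0"
  by (auto simp: nsq_def)

lemma topspace_proj_space:
  fixes Z :: "complex^'m"
  assumes "Z \<noteq> 0"
  shows "cline Z \<in> topspace proj_space"
proof -
  have "{Z :: complex^'m. Z \<noteq> 0 \<and> cline Z \<in> cline ` (- {0})} = - {0}" by auto
  then have "openin proj_space (cline ` (- {0 :: complex^'m}))"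
    unfolding openin_proj_space by (simp add: open_Compl)
  from openin_subset[OF this] assms show ?thesis by auto
qed

text \<open>The substantial axiom is \<open>path\<close>: the image of the curve in the period set
  is connected and meets the component \<open>D\<close>, so maximality of components puts it inside
  \<open>D\<close>.\<close>

lemma quad_cone_Aff:
  fixes g :: "int^'m^'m"
  assumes "even_lattice g" and D: "is_domain g D"
  shows "quad_cone g (Aff D)"
proof
  show "g $ a $ b = g $ b $ a" for a b using assms by (simp add: even_lattice_def)
  have D': "D \<in> connected_components_of (subtopology proj_space (period_set g))"
    using D by (simp add: is_domain_def)
  have "D \<subseteq> period_set g"
    using connected_components_of_subset[OF D'] by (auto simp: topspace_subtopology)
  then have per: "cline Z \<in> period_set g" if "Z \<in> Aff D" for Z using that by (auto simp: Aff_def)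
  show "bil g Z Z = 0" "nsq g Z > 0" if "Z \<in> Aff D" for Z using period_setD[OF per[OF that]] .
  show "c *s Z \<in> Aff D" if "Z \<in> Aff D" "c \<noteq> 0" for Z c
    using that by (simp add: Aff_def cline_smult)
  show "\<gamma> 1 \<in> Aff D" if c: "continuous_on {0..1} \<gamma>" and 0: "\<gamma> 0 \<in> Aff D"
    and q: "\<And>t. t \<in> {0..1} \<Longrightarrow> bil g (\<gamma> t) (\<gamma> t) = 0 \<and> nsq g (\<gamma> t) > 0" for \<gamma> :: "real \<Rightarrow> complex^'m"
  proof -
    have nz: "\<gamma> t \<noteq> 0" if "t \<in> {0..1}" for t using q[OF that] nsq_pos_nonzero by blast
    have "continuous_map (top_of_set {0..1}) proj_space (\<lambda>t. cline (\<gamma> t))"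
      unfolding continuous_map_def
    proof (intro conjI allI impI)
      show "(\<lambda>t. cline (\<gamma> t)) \<in> topspace (top_of_set {0..1}) \<rightarrow> topspace proj_space"
        by (auto intro!: topspace_proj_space nz)
      fix U assume "openin proj_space (U :: (complex^'m) set set)"
      then have "open {Z. Z \<noteq> 0 \<and> cline Z \<in> U}" by (simp add: openin_proj_space)
      from continuous_openin_preimage_gen[OF c this]
      have "openin (top_of_set {0..1}) ({0..1} \<inter> \<gamma> -` {Z. Z \<noteq> 0 \<and> cline Z \<in> U})" .
      moreover have "{0..1} \<inter> \<gamma> -` {Z. Z \<noteq> 0 \<and> cline Z \<in> U} = {t \<in> topspace (top_of_set {0..1}). cline (\<gamma> t) \<in> U}"
        using nz by auto
      ultimately show "openin (top_of_set {0..1}) {t \<in> topspace (top_of_set {0..1}). cline (\<gamma> t) \<in> U}"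
        by simp
    qed
    moreover have "(\<lambda>t. cline (\<gamma> t)) \<in> topspace (top_of_set {0..1}) \<rightarrow> period_set g"
      using q nz by (auto simp: period_set_def nsq_def)
    ultimately have "continuous_map (top_of_set {0..1}) (subtopology proj_space (period_set g)) (\<lambda>t. cline (\<gamma> t))"
      by (simp add: continuous_map_in_subtopology)
    moreover have "connectedin (top_of_set {0..1}) {0..1::real}" by simp
    ultimately have conn: "connectedin (subtopology proj_space (period_set g)) ((\<lambda>t. cline (\<gamma> t)) ` {0..1})"
      by (rule connectedin_continuous_map_image)
    have "cline (\<gamma> 0) \<in> D \<inter> (\<lambda>t. cline (\<gamma> t)) ` {0..1}" using 0 by (auto simp: Aff_def)
    then have "\<not> disjnt D ((\<lambda>t. cline (\<gamma> t)) ` {0..1})" by (auto simp: disjnt_def)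
    from connected_components_of_maximal[OF D' conn this] show ?thesis
      using nz[of 1] by (auto simp: Aff_def)
  qed
qed

lemma Oplus_Aff:
  assumes "even_lattice g" "is_domain g D" and A: "A \<in> carrier (Oplus g D)" and Z: "Z \<in> Aff D"
  shows "cmat A *v Z \<in> Aff D"
proof -
  interpret quad_cone g "Aff D" by (rule quad_cone_Aff[OF assms(1,2)])
  have A': "\<forall>x y. bil g (A *v x) (A *v y) = bil g x y" "(\<lambda>l. (\<lambda>Z. cmat A *v Z) ` l) ` D = D"
    using A by (simp_all add: Oplus_def)
  have "nsq g (cmat A *v Z) = nsq g Z"
    by (simp add: nsq_def cj_cmat bil_cmat[OF A'(1)])
  then have nz: "cmat A *v Z \<noteq> 0" using pos[OF Z] nsq_pos_nonzero[of g "cmat A *v Z"] by simp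
  have "cline (cmat A *v Z) = (\<lambda>Z. cmat A *v Z) ` cline Z"
    unfolding cline_def image_def by (auto simp: vector_scalar_commute)
  then have "cline (cmat A *v Z) \<in> D" using A'(2) Z by (auto simp: Aff_def)
  then show ?thesis using nz by (simp add: Aff_def)
qed

section \<open>Cusps\<close>

lemma bil_of_real: "bil g (vmap of_real x) (vmap of_real y) = (of_real (bil g x y) :: complex)"
  by (simp add: bil_def vmap_def)

lemma bil_of_int: "bil g (vmap of_int x) (vmap of_int y) = of_int (bil g x y)"
  by (simp add: bil_def vmap_def)

lemma bil_of_rat: "bil g (vmap of_rat x) (vmap of_rat y) = (of_rat (bil g x y) :: 'a::field_char_0)"
  by (simp add: bil_def vmap_def of_rat_sum of_rat_mult)

lemma vmap_of_rat_of_int: "vmap of_rat (vmap of_int x) = (vmap of_int x :: 'a::field_char_0^'m)"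
  by (simp add: vmap_def)

lemma of_real_of_rat: "complex_of_real (of_rat q) = of_rat q"
  by (cases q) (simp add: of_rat_rat)

lemma vmap_of_real: "vmap complex_of_real (vmap of_int x) = vmap of_int x"
  "vmap complex_of_real (vmap of_rat y) = vmap of_rat y"
  by (simp_all add: vmap_def of_real_of_rat)

lemma vmap_Im: "vmap of_real (vmap Im z) = (1 / (2 * \<i>)) *s (z - cj z)"
  by (simp add: vec_eq_iff vmap_def complex_eq_iff)

lemma cusp_pairD:
  assumes "cusp_pair g e f"
  shows "bil g (vmap of_int e) (vmap of_int e) = (0 :: 'a::field_char_0)"
    and "bil g (vmap of_rat f) (vmap of_rat f) = (0 :: 'a)"
    and "bil g (vmap of_int e) (vmap of_rat f) = (1 :: 'a)"
proof -
  show "bil g (vmap of_int e) (vmap of_int e) = (0 :: 'a)" "bil g (vmap of_rat f) (vmap of_rat f) = (0 :: 'a)"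
    using assms by (simp_all add: bil_of_int bil_of_rat cusp_pair_def)
  have "bil g (vmap of_int e) (vmap of_rat f) = (of_rat (bil g (vmap of_int e) f) :: 'a)"
    unfolding bil_of_rat[symmetric] vmap_of_rat_of_int ..
  then show "bil g (vmap of_int e) (vmap of_rat f) = (1 :: 'a)" using assms by (simp add: cusp_pair_def)
qed

lemma bil_scaleR:
  "bil g (r *\<^sub>R x) y = r * bil g x y" "bil g x (r *\<^sub>R y) = r * bil g x (y :: real^'m)"
  by (simp_all add: bil_def sum_distrib_left algebra_simps)

text \<open>Orthogonal vectors without isotropic ones among them are independent. There are as many
  as the dimension, so they span, and \<open>y\<close> has zero coordinates with respect to
  them.\<close>

lemma has_signature_nondegenerate:
  fixes y :: "real^'m"
  assumes "has_signature g p q" and y: "\<And>x. bil g x y = 0"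
  shows "y = 0"
proof -
  obtain b :: "'m \<Rightarrow> real^'m" where b: "\<And>i j. i \<noteq> j \<Longrightarrow> bil g (b i) (b j) = 0" "\<And>i. bil g (b i) (b i) \<noteq> 0"
    using assms(1) unfolding has_signature_def by blast
  define S where "S = (\<lambda>u :: real^'m. \<Sum>i\<in>UNIV. (u $ i) *\<^sub>R b i)"
  have lin: "linear S"
    by (rule linearI) (simp_all add: S_def scaleR_add_left sum.distrib scaleR_sum_right)
  have coord: "bil g (b i) (S u) = u $ i * bil g (b i) (b i)" for i u
  proof -
    have "bil g (b i) (S u) = (\<Sum>j\<in>UNIV. u $ j * bil g (b i) (b j))"
      by (simp add: S_def bil_sum_right bil_scaleR)
    also have "\<dots> = (\<Sum>j\<in>UNIV. if j = i then u $ i * bil g (b i) (b i) else 0)"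
      by (rule sum.cong) (auto simp: b(1))
    finally show ?thesis by simp
  qed
  have "u = 0" if "S u = 0" for u
    using coord[of _ u] b(2) that by (simp add: vec_eq_iff)
  then have "inj S" by (simp add: linear_injective_0[OF lin])
  then have "surj S" by (rule linear_injective_imp_surjective[OF lin]) simp
  then obtain u where u: "y = S u" by blast
  have "u = 0" using coord[of _ u] b(2) y[of "b i" for i] by (simp add: u vec_eq_iff)
  then show ?thesis using linear_0[OF lin] by (simp add: u)
qed

text \<open>On the orthogonal complement of \<open>e\<close> and \<open>f\<close> the map \<phi> is
  injective: a vector in its kernel is orthogonal to the complement and to \<open>e\<close> and
  \<open>f\<close>, hence to everything. A linear left inverse of \<phi>, expanded in the basis,
  provides the matrix.\<close>

lemma coord_basis_dual:
  fixes g :: "int^'m^'m" and e :: "int^'m"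
  assumes sym: "\<And>a b. g $ a $ b = g $ b $ a" and sig: "has_signature g p q" and ef: "cusp_pair g e f"
    and b: "is_coord_basis g e f n b"
  shows "\<exists>K. \<forall>y. bil g (vmap of_int e) y = 0 \<longrightarrow> bil g (vmap of_rat f) y = 0 \<longrightarrow>
    y = (\<Sum>l<n. \<Sum>m<n. (K l m * bil g (b m) y) *\<^sub>R b l)"
proof -
  interpret sym_form g using sym by unfold_locales
  let ?E = "vmap of_int e :: real^'m" and ?F = "vmap of_rat f :: real^'m"
  define V where "V = {y. bil g ?E y = 0 \<and> bil g ?F y = 0}"
  have V: "span (b ` {..<n}) = V" and inj: "inj_on b {..<n}" and ind: "independent (b ` {..<n})"
    using b by (simp_all add: is_coord_basis_def V_def)
  have sub: "subspace V" unfolding V[symmetric] by (rule subspace_span)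
  define \<phi> where "\<phi> = (\<lambda>y. \<Sum>m<n. bil g (b m) y *\<^sub>R b m)"
  have lin: "linear \<phi>"
    by (rule linearI) (simp_all add: \<phi>_def bil_add_right bil_scaleR scaleR_add_left sum.distrib scaleR_sum_right)
  have "y = 0" if y: "y \<in> V" and 0: "\<phi> y = 0" for y
  proof -
    have "(\<Sum>v\<in>b ` {..<n}. bil g v y *\<^sub>R v) = 0"
      using 0 by (simp add: \<phi>_def sum.reindex[OF inj])
    then have bm: "bil g v y = 0" if "v \<in> b ` {..<n}" for v
      using ind that independentD[of "b ` {..<n}" "b ` {..<n}" "\<lambda>v. bil g v y"] by auto
    have "subspace {v. bil g v y = 0}" by (auto simp: subspace_def bil_lin bil_scaleR)
    then have "span (b ` {..<n}) \<subseteq> {v. bil g v y = 0}" by (intro span_minimal) (use bm in auto)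
    then have orth: "bil g v y = 0" if "v \<in> V" for v using that V by auto
    show "y = 0"
    proof (rule has_signature_nondegenerate[OF sig])
      fix x
      \<comment> \<open>The hyperbolic pair splits off: this is the projection of \<open>x\<close>
        to the orthogonal complement of both vectors.\<close>
      have "x - bil g x ?F *\<^sub>R ?E - bil g x ?E *\<^sub>R ?F \<in> V"
        by (simp add: V_def bil_lin bil_scaleR cusp_pairD[OF ef] bil_sym[of ?F ?E] bil_sym[of x])
      from orth[OF this] show "bil g x y = 0"
        using y by (simp add: V_def bil_lin bil_scaleR)
    qed
  qed
  then have "inj_on \<phi> V"
    by (simp add: linear_inj_on_iff_eq_0[OF lin sub])
  then obtain G where G: "range G \<subseteq> V" "linear G" "\<forall>v\<in>V. G (\<phi> v) = v"
    using linear_exists_left_inverse_on[OF lin sub] by blast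
  have "\<exists>k. G v = (\<Sum>l<n. k l *\<^sub>R b l)" for v
  proof -
    have "G v \<in> span (b ` {..<n})" using G(1) V by auto
    then obtain u where "G v = (\<Sum>w\<in>b ` {..<n}. u w *\<^sub>R w)"
      by (auto simp: span_finite)
    then show ?thesis by (intro exI[of _ "\<lambda>l. u (b l)"]) (simp add: sum.reindex[OF inj])
  qed
  then obtain k where k: "\<And>v. G v = (\<Sum>l<n. k v l *\<^sub>R b l)" by metis
  have "y = (\<Sum>l<n. \<Sum>m<n. (k (b m) l * bil g (b m) y) *\<^sub>R b l)" if "y \<in> V" for y
  proof -
    have "y = G (\<phi> y)" using G(3) that by simp
    also have "\<dots> = (\<Sum>m<n. bil g (b m) y *\<^sub>R G (b m))"
      by (simp add: \<phi>_def linear_sum[OF G(2)] linear_scale[OF G(2)])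
    also have "\<dots> = (\<Sum>m<n. \<Sum>l<n. (k (b m) l * bil g (b m) y) *\<^sub>R b l)"
      unfolding k by (simp add: scaleR_sum_right mult.commute)
    finally show ?thesis by (subst sum.swap)
  qed
  then show ?thesis by (intro exI[of _ "\<lambda>l m. k (b m) l"]) (simp add: V_def)
qed

lemma tube_domainD:
  assumes "is_tube_domain g A e f \<Omega>" "z \<in> \<Omega>"
  shows "bil g (vmap of_int e) z = 0" and "bil g (vmap of_rat f) z = 0"
    and "bil g (vmap Im z) (vmap Im z) > 0" and "tube_map g e f z \<in> A"
proof -
  have "\<Omega> \<in> components {z. bil g (vmap of_int e) z = 0 \<and> bil g (vmap of_rat f) z = 0 \<and>
      bil g (vmap Im z) (vmap Im z) > 0}"
    using assms(1) by (simp add: is_tube_domain_def)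
  from subsetD[OF in_components_subset[OF this] assms(2)]
  show "bil g (vmap of_int e) z = 0" "bil g (vmap of_rat f) z = 0" "bil g (vmap Im z) (vmap Im z) > 0"
    by simp_all
  show "tube_map g e f z \<in> A" using assms by (auto simp: is_tube_domain_def)
qed

text \<open>A small ball intersected with the linear subspace is convex, hence connected, and lies
  in the positive locus; being maximal, the component contains it.\<close>

lemma tube_domain_open:
  fixes g :: "int^'m^'m"
  assumes \<Omega>: "is_tube_domain g A e f \<Omega>" and z: "z \<in> \<Omega>"
  shows "\<exists>d>0. \<forall>w. bil g (vmap of_int e) w = 0 \<longrightarrow> bil g (vmap of_rat f) w = 0 \<longrightarrow> dist w z < d \<longrightarrow> w \<in> \<Omega>"
proof -
  let ?q = "\<lambda>z :: complex^'m. bil g (vmap Im z) (vmap Im z)"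
  let ?V = "{w :: complex^'m. bil g (vmap of_int e) w = 0 \<and> bil g (vmap of_rat f) w = 0}"
  have comp: "\<Omega> \<in> components {z. bil g (vmap of_int e) z = 0 \<and> bil g (vmap of_rat f) z = 0 \<and> ?q z > 0}"
    using \<Omega> by (simp add: is_tube_domain_def)
  have zV: "z \<in> ?V" "?q z > 0" using tube_domainD[OF \<Omega> z] by auto
  have "continuous_on UNIV ?q" unfolding bil_def vmap_def by (intro continuous_intros)
  then have "open {z. ?q z > 0}" by (intro open_Collect_less) auto
  then obtain d where d: "d > 0" "ball z d \<subseteq> {z. ?q z > 0}"
    using zV(2) unfolding open_contains_ball by blast
  have sc: "r *\<^sub>R x = complex_of_real r *s x" for r and x :: "complex^'m"
    by (simp add: vec_eq_iff complex_eq_iff)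
  have "convex ?V" by (simp add: convex_def bil_lin sc)
  then have "connected (ball z d \<inter> ?V)" by (intro convex_connected convex_Int convex_ball)
  then have "ball z d \<inter> ?V \<subseteq> \<Omega>"
    by (rule components_maximal[OF comp]) (use d z zV in auto)
  then show ?thesis using d(1) by (intro exI[of _ d]) (auto simp: dist_commute)
qed

context tube
begin

lemma pull_tube_pe:
  assumes "tube_map g e f = \<Phi>" "\<And>j. vmap of_real (b j) = B j"
  shows "pull_tube g e f b G z J = pe G z (map B J)"
  by (simp add: pull_tube_def pe_def subst_slots_ev assms frechet_\<Phi> o_def)

text \<open>\<open>Q\<close> takes real values everywhere, so its differential is real and the
  logarithm can be differentiated through \<open>Q\<close> itself; the result is the quotient of
  \<open>dee Q\<close> by \<open>Q\<close>.\<close>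

lemma nu_tube_eq:
  assumes b: "vmap of_real (b j) = B j" and pos: "bil g (vmap Im z) (vmap Im z) > 0"
  shows "nu_tube g b z j = \<nu> z j"
proof -
  define q where "q = (\<lambda>w :: complex^'m. bil g (vmap Im w) (vmap Im w))"
  have qQ: "of_real (q w) = Q w" for w
    unfolding q_def Q_def yc_def vmap_Im[symmetric] bil_of_real ..
  define Q' where "Q' = frechet_derivative Q (at z)"
  have dQ: "(Q has_derivative Q') (at z)"
    using diff_Q by (simp add: Q'_def frechet_derivative_works[symmetric])
  have "((\<lambda>w. Re (Q w)) has_derivative (\<lambda>v. Re (Q' v))) (at z)"
    by (rule bounded_linear.has_derivative[OF bounded_linear_Re dQ])
  moreover have "(\<lambda>w. Re (Q w)) = q" by (simp add: fun_eq_iff qQ[symmetric])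
  ultimately have dq: "(q has_derivative (\<lambda>v. Re (Q' v))) (at z)" by simp
  have "((\<lambda>w. complex_of_real (q w)) has_derivative (\<lambda>v. of_real (Re (Q' v)))) (at z)"
    by (rule bounded_linear.has_derivative[OF bounded_linear_of_real dq])
  then have "(Q has_derivative (\<lambda>v. of_real (Re (Q' v)))) (at z)" by (simp add: qQ)
  from has_derivative_unique[OF this dQ] have re: "of_real (Re (Q' v)) = Q' v" for v
    by (rule fun_cong)
  have "q z > 0" using pos by (simp add: q_def)
  then have "((\<lambda>w. complex_of_real (ln (q w))) has_derivative (\<lambda>v. of_real (Re (Q' v) / q z))) (at z)"
    using dq by (auto intro!: derivative_eq_intros simp: divide_inverse)
  from dee_has_derivative[OF this]
  have "dee (\<lambda>w. complex_of_real (ln (q w))) (B j) z = (Q' (B j) - \<i> * Q' (\<i> *s B j)) / 2 / Q z"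
    by (simp add: re qQ diff_divide_distrib mult.commute)
  also have "\<dots> = \<nu> z j"
    using dee_Q[of "B j" z] by (simp add: dee_def Q'_def \<nu>_def)
  finally show ?thesis by (simp add: nu_tube_def q_def b)
qed

lemma cuspval_iff:
  "cuspval q \<longleftrightarrow> (\<exists>N (h :: (nat \<Rightarrow> nat) \<Rightarrow> complex^'m \<Rightarrow> complex).
     finite N \<and> (\<lambda>_. 0) \<in> N \<and> (\<forall>p\<in>N. \<forall>j\<ge>n. p j = 0) \<and> (\<forall>p\<in>N. holo_on \<Omega> (h p)) \<and>
     (\<forall>z\<in>\<Omega>. q z = (\<Sum>p\<in>N. h p z * (\<Prod>j<n. \<nu> z j ^ p j))) \<and> regular_fourier g \<Omega> (h (\<lambda>_. 0)))"
  (is "?l = ?r")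
proof
  assume ?l
  then obtain c where c: "hpoly \<Omega> n \<nu> c q" "regular_fourier g \<Omega> c" unfolding cuspval_def by blast
  obtain N h where N: "finite N" "(\<lambda>_. 0) \<in> N" "\<forall>p\<in>N. \<forall>j\<ge>n. p j = 0" "\<forall>p\<in>N. holo_on \<Omega> (h p)"
    "\<forall>z\<in>\<Omega>. q z = (\<Sum>p\<in>N. h p z * (\<Prod>j<n. \<nu> z j ^ p j))" and h: "\<forall>z\<in>\<Omega>. c z = h (\<lambda>_. 0) z"
    using hpoly_repI[OF c(1)] unfolding hpoly_rep_def by blast
  have "regular_fourier g \<Omega> (h (\<lambda>_. 0))"
    by (rule regular_fourier_cong[OF c(2)]) (simp add: h)
  with N show ?r by blast
next
  assume ?r
  then obtain N h where N: "finite N" "(\<lambda>_. 0) \<in> N" "\<forall>p\<in>N. \<forall>j\<ge>n. p j = 0" "\<forall>p\<in>N. holo_on \<Omega> (h p)"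
    "\<forall>z\<in>\<Omega>. q z = (\<Sum>p\<in>N. h p z * (\<Prod>j<n. \<nu> z j ^ p j))" and r: "regular_fourier g \<Omega> (h (\<lambda>_. 0))"
    by blast
  have "hpoly_rep \<Omega> n \<nu> (h (\<lambda>_. 0)) q"
    unfolding hpoly_rep_def using N by blast
  from hpoly_repD[OF this] r show ?l unfolding cuspval_def by blast
qed

lemma cuspval_pull_tube:
  assumes "tube_map g e f = \<Phi>" "\<And>j. vmap of_real (b j) = B j"
    and "\<And>z. z \<in> \<Omega> \<Longrightarrow> bil g (vmap Im z) (vmap Im z) > 0"
  shows "(\<exists>N (h :: (nat \<Rightarrow> nat) \<Rightarrow> complex^'m \<Rightarrow> complex).
      finite N \<and> (\<lambda>_. 0) \<in> N \<and> (\<forall>p\<in>N. \<forall>j\<ge>n. p j = 0) \<and> (\<forall>p\<in>N. holo_on \<Omega> (h p)) \<and>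
      (\<forall>z\<in>\<Omega>. pull_tube g e f b G z J = (\<Sum>p\<in>N. h p z * (\<Prod>j<n. nu_tube g b z j ^ p j))) \<and>
      regular_fourier g \<Omega> (h (\<lambda>_. 0)))
    \<longleftrightarrow> cuspval (\<lambda>z. pe G z (map B J))"
  unfolding cuspval_iff by (simp add: pull_tube_pe[OF assms(1,2)] nu_tube_eq[OF assms(2) assms(3)] cong: conj_cong ball_cong)

end

lemma tube_at_cusp:
  fixes g :: "int^'m^'m"
  assumes "even_lattice g" "has_signature g p q" "is_domain g D"
    and ef: "cusp_pair g e f" and \<Omega>: "is_tube_domain g (Aff D) e f \<Omega>" and b: "is_coord_basis g e f n b"
  obtains K where "tube g (Aff D) (vmap of_int e) (vmap of_rat f) (\<lambda>j. vmap of_real (b j)) n K \<Omega>"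
proof -
  interpret quad_cone g "Aff D" by (rule quad_cone_Aff[OF assms(1,3)])
  obtain K where K: "\<And>y. bil g (vmap of_int e) y = 0 \<Longrightarrow> bil g (vmap of_rat f) y = 0 \<Longrightarrow>
    y = (\<Sum>l<n. \<Sum>m<n. (K l m * bil g (b m) y) *\<^sub>R b l)"
    using coord_basis_dual[OF sym assms(2) ef b] by blast
  have "tube g (Aff D) (vmap of_int e) (vmap of_rat f) (\<lambda>j. vmap of_real (b j)) n (\<lambda>l m. of_real (K l m)) \<Omega>"
  proof
    show "cj (vmap of_int e) = vmap of_int e" "cj (vmap of_rat f) = vmap of_rat f"
      by (simp_all add: vec_eq_iff vmap_def of_real_of_rat[symmetric])
    have bV: "bil g (vmap of_int e) (b j) = 0" "bil g (vmap of_rat f) (b j) = 0" if "j < n" for j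
      using b span_base[of "b j" "b ` {..<n}"] that by (auto simp: is_coord_basis_def)
    show "bil g (vmap of_int e) (vmap complex_of_real (b j)) = 0"
      "bil g (vmap of_rat f) (vmap complex_of_real (b j)) = 0" if "j < n" for j
      unfolding vmap_of_real[symmetric] bil_of_real by (simp_all add: bV[OF that])
    show "cj (vmap of_real (b j)) = vmap of_real (b j)" for j
      by (simp add: vec_eq_iff vmap_def)
    show "y = (\<Sum>l<n. \<Sum>m<n. (of_real (K l m) * bil g (vmap of_real (b m)) y) *s vmap of_real (b l))"
      if y: "cj y = y" "bil g (vmap of_int e) y = 0" "bil g (vmap of_rat f) y = 0" for y :: "complex^'m"
    proof -
      \<comment> \<open>A vector fixed by conjugation comes from a real vector, to which the real
        dual basis formula applies.\<close>
      obtain x :: "real^'m" where x: "vmap of_real x = y"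
        using y(1) by (intro that[of "vmap Re y"]) (simp add: vec_eq_iff vmap_def complex_eq_iff)
      have "complex_of_real (bil g (vmap of_int e) x) = 0" "complex_of_real (bil g (vmap of_rat f) x) = 0"
        using y(2,3) by (simp_all only: bil_of_real[symmetric] vmap_of_real x)
      then have xe: "x = (\<Sum>l<n. \<Sum>m<n. (K l m * bil g (b m) x) *\<^sub>R b l)"
        by (intro K) simp_all
      have "complex_of_real (x $ i) = (\<Sum>l<n. \<Sum>m<n. of_real (K l m) * of_real (bil g (b m) x) * of_real (b l $ i))" for i
        using arg_cong[OF xe, of "\<lambda>v :: real^'m. complex_of_real (v $ i)"] by simp
      then show ?thesis
        unfolding x[symmetric] bil_of_real by (simp add: vec_eq_iff) (simp add: vmap_def)
    qed
    show "bil g (vmap of_int e) z = 0" "bil g (vmap of_rat f) z = 0" if "z \<in> \<Omega>" for z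
      by (rule tube_domainD[OF \<Omega> that])+
    show "(- bil g z z / 2) *s vmap of_int e + z + vmap of_rat f \<in> Aff D" if "z \<in> \<Omega>" for z
      using tube_domainD(4)[OF \<Omega> that] by (simp add: tube_map_def)
    show "\<exists>d>0. \<forall>w. bil g (vmap of_int e) w = 0 \<longrightarrow> bil g (vmap of_rat f) w = 0 \<longrightarrow> dist w z < d \<longrightarrow> w \<in> \<Omega>"
      if "z \<in> \<Omega>" for z using tube_domain_open[OF \<Omega> that] .
  qed (rule cusp_pairD[OF ef])+
  then show thesis by (rule that)
qed

text \<open>The condition is imposed on all iterated lowerings at once, so lowering merely shifts
  \<open>d\<close>.\<close>

lemma cusp_condition_lower:
  assumes "cusp_condition g n A s F"
  shows "cusp_condition g n A (s + 1) (lower g F)"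
  unfolding cusp_condition_def
proof (intro allI impI, elim conjE)
  fix e f \<Omega> b d J
  assume *: "cusp_pair g e f" "is_tube_domain g A e f \<Omega>" "is_coord_basis g e f n b"
    "length J = s + 1 + d" "set J \<subseteq> {..<n}"
  have "(lower g ^^ d) (lower g F) = (lower g ^^ Suc d) F" by (simp only: funpow_Suc_right o_apply)
  then show "\<exists>N (h :: (nat \<Rightarrow> nat) \<Rightarrow> complex^'a \<Rightarrow> complex).
      finite N \<and> (\<lambda>_. 0) \<in> N \<and> (\<forall>p\<in>N. \<forall>j\<ge>n. p j = 0) \<and> (\<forall>p\<in>N. holo_on \<Omega> (h p)) \<and>
      (\<forall>z\<in>\<Omega>. pull_tube g e f b ((lower g ^^ d) (lower g F)) z J = (\<Sum>p\<in>N. h p z * (\<Prod>j<n. nu_tube g b z j ^ p j))) \<and>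
      regular_fourier g \<Omega> (h (\<lambda>_. 0))"
    using assms[unfolded cusp_condition_def, rule_format, of e f \<Omega> b J "Suc d"] * by simp
qed

lemma cusp_condition_raise:
  fixes g :: "int^'m^'m"
  assumes lat: "even_lattice g" "has_signature g p q" "is_domain g D"
    and sec: "is_section g (Aff D) k s F" and cusp: "cusp_condition g n (Aff D) s F"
  shows "cusp_condition g n (Aff D) (s + 1) (raise g k F)"
  unfolding cusp_condition_def
proof (intro allI impI, elim conjE)
  fix e f \<Omega> b d J
  assume ef: "cusp_pair g e f" and dom: "is_tube_domain g (Aff D) e f \<Omega>" and b: "is_coord_basis g e f n b"
    and J: "length J = s + 1 + d" "set J \<subseteq> {..<n}"
  obtain K where "tube g (Aff D) (vmap of_int e) (vmap of_rat f) (\<lambda>j. vmap of_real (b j)) n K \<Omega>"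
    using tube_at_cusp[OF lat ef dom b] .
  then interpret tube g "Aff D" "vmap of_int e" "vmap of_rat f" "\<lambda>j. vmap of_real (b j)" n K \<Omega> .
  have tm: "tube_map g e f = \<Phi>" by (simp add: fun_eq_iff tube_map_def \<Phi>_def)
  have pos: "bil g (vmap Im z) (vmap Im z) > 0" if "z \<in> \<Omega>" for z
    by (rule tube_domainD(3)[OF dom that])
  note pull = cuspval_pull_tube[where e = e and f = f and b = b, OF tm refl pos]
  have "cusp_tensor (s + d) ((lower g ^^ d) F)" for d
    unfolding cusp_tensor_def
  proof (intro allI impI)
    fix J assume J: "length J = s + d" "set J \<subseteq> {..<n}"
    show "cuspval (\<lambda>z. pe ((lower g ^^ d) F) z (map (\<lambda>j. vmap of_real (b j)) J))"
      by (rule iffD1[OF pull cusp[unfolded cusp_condition_def, rule_format]])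
        (assumption, intro conjI ef dom b J)
  qed
  from cusp_tensor_lowern_raise[OF sec this, of d] J
  have val: "cuspval (\<lambda>z. pe ((lower g ^^ d) (raise g k F)) z (map (\<lambda>j. vmap of_real (b j)) J))"
    unfolding cusp_tensor_def by simp
  show "\<exists>N (h :: (nat \<Rightarrow> nat) \<Rightarrow> complex^'m \<Rightarrow> complex).
      finite N \<and> (\<lambda>_. 0) \<in> N \<and> (\<forall>p\<in>N. \<forall>j\<ge>n. p j = 0) \<and> (\<forall>p\<in>N. holo_on \<Omega> (h p)) \<and>
      (\<forall>z\<in>\<Omega>. pull_tube g e f b ((lower g ^^ d) (raise g k F)) z J = (\<Sum>p\<in>N. h p z * (\<Prod>j<n. nu_tube g b z j ^ p j))) \<and>
      regular_fourier g \<Omega> (h (\<lambda>_. 0))"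
    by (rule iffD2[OF pull val])
qed

section \<open>The operators on almost-holomorphic modular forms\<close>

lemma ins_g_tensor: "length I = s + 2 \<Longrightarrow> ins_g g s F Z I = tensor s F (gmetric g) Z I"
  by (simp add: ins_g_def tensor_def gmetric_def)

lemma comm_rhs_tensor:
  assumes "length I = s + 2"
  shows "comm_rhs g k s F Z I = of_int k / 2 * tensor s F (gmetric g) Z I
    + 1 / 2 * (\<Sum>r = 1..s. swap_slots r (s + 1) (tensor s F (gmetric g)) Z I
                             - swap_slots r (s + 2) (tensor s F (gmetric g)) Z I)"
  using assms by (simp add: comm_rhs_def swap_slots_def ins_g_tensor)

lemma AHMod_lower_raise:
  fixes g :: "int^'m^'m"
  assumes lat: "even_lattice g" "has_signature g p q" "is_domain g D"
    and \<Gamma>: "\<Gamma> \<subseteq> carrier (Oplus g D)" and F: "F \<in> AHMod g n D \<Gamma> k s"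
  shows "lower g F \<in> AHMod g n D \<Gamma> (k - 1) (s + 1)" and "raise g k F \<in> AHMod g n D \<Gamma> (k + 1) (s + 1)"
proof -
  interpret quad_cone g "Aff D" by (rule quad_cone_Aff[OF lat(1,3)])
  have sec: "is_section g (Aff D) k s F"
    and inv: "\<And>A. A \<in> \<Gamma> \<Longrightarrow> sec_eq g (Aff D) s (pull_mat A F) F"
    and cusp: "n \<le> 2 \<Longrightarrow> cusp_condition g n (Aff D) s F"
    using F by (auto simp: AHMod_def)
  obtain d where d: "sec_eq g (Aff D) (s + d + 1) ((lower g ^^ (d + 1)) F) (\<lambda>_ _. 0)"
    using F unfolding AHMod_def by blast
  have sm: "smrep s F" and df: "difrep s F"
    using sec smrep_difrep by (auto simp: is_section_iff)
  have A: "\<forall>x y. bil g (A *v x) (A *v y) = bil g x y" if "A \<in> \<Gamma>" for A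
    using \<Gamma> that by (auto simp: Oplus_def)
  have AD: "cmat A *v Z \<in> Aff D" if "A \<in> \<Gamma>" "Z \<in> Aff D" for A Z
    using Oplus_Aff[OF lat(1,3) _ that(2)] \<Gamma> that(1) by blast
  let ?G = "(lower g ^^ (d + 1)) F"
  have dG: "difrep (s + d + 1) ?G"
    using smrep_difrep[OF smrep_lowern[OF sm, of "d + 1"]] by (simp only: add.assoc)
  \<comment> \<open>Again zero as a multiple of a representative, so that one more lowering of it is
    zero.\<close>
  have "sec_eq g (Aff D) (s + d + 1) ?G (\<lambda>Z I. 0 * ?G Z I)" using d by simp
  from lower_sec_eq[OF dG difrep_cmult[OF dG] this]
  have "sec_eq g (Aff D) (s + d + 1 + 1) (lower g ?G) (lower g (\<lambda>Z I. 0 * ?G Z I))" .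
  from sec_eq_trans[OF this lower_cmult[OF dG]]
  have "sec_eq g (Aff D) (s + d + 1 + 1) (lower g ?G) (\<lambda>_ _. 0)" by simp
  moreover have "lower g ?G = (lower g ^^ (d + 1)) (lower g F)" by (rule funpow_swap1)
  ultimately have "sec_eq g (Aff D) (s + 1 + d + 1) ((lower g ^^ (d + 1)) (lower g F)) (\<lambda>_ _. 0)"
    by (simp only: ac_simps)
  then show "lower g F \<in> AHMod g n D \<Gamma> (k - 1) (s + 1)"
    using is_section_lower[OF sec] invariant_lower[OF A AD df inv] cusp_condition_lower[OF cusp]
    unfolding AHMod_def by blast
  have "sec_eq g (Aff D) (s + (d + 1)) ?G (\<lambda>_ _. 0)" using d by (simp only: add.assoc)
  from raise_nilpotent[OF sec this]
  have "sec_eq g (Aff D) (s + 1 + (d + 1) + 1) ((lower g ^^ (d + 1 + 1)) (raise g k F)) (\<lambda>_ _. 0)"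
    by (simp only: add.assoc)
  then show "raise g k F \<in> AHMod g n D \<Gamma> (k + 1) (s + 1)"
    using is_section_raise[OF sec] invariant_raise[OF A AD df inv] cusp_condition_raise[OF lat sec cusp]
    unfolding AHMod_def by blast
qed

text \<open>Sections are classes of representatives, so the operators are maps on them by the second
  clause. The derivation property consists of linearity and the Leibniz rules, in which
  \<open>move_last\<close> brings the new factor behind those of \<open>G\<close>.\<close>

theorem theorem1p2:
  fixes g :: "int^'m^'m" and n :: nat
    and D :: "(complex^'m) set set" and \<Gamma> :: "(int^'m^'m) set"
  assumes "even_lattice g" and "has_signature g 2 n"
    and "is_domain g D"
    and "subgroup \<Gamma> (Oplus g D)" and "finite (rcosets\<^bsub>Oplus g D\<^esub> \<Gamma>)"
  shows
    "(\<forall>k s. \<forall>F\<in>AHMod g n D \<Gamma> k s.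
        lower g F \<in> AHMod g n D \<Gamma> (k - 1) (s + 1) \<and>
        raise g k F \<in> AHMod g n D \<Gamma> (k + 1) (s + 1)) \<and>
    (\<forall>k s. \<forall>F\<in>AHMod g n D \<Gamma> k s. \<forall>G\<in>AHMod g n D \<Gamma> k s.
        sec_eq g (Aff D) s F G \<longrightarrow>
          sec_eq g (Aff D) (s + 1) (lower g F) (lower g G) \<and>
          sec_eq g (Aff D) (s + 1) (raise g k F) (raise g k G)) \<and>
    (\<forall>k s. \<forall>F\<in>AHMod g n D \<Gamma> k s. \<forall>G\<in>AHMod g n D \<Gamma> k s. \<forall>a b.
        sec_eq g (Aff D) (s + 1)
          (lower g (\<lambda>Z I. a * F Z I + b * G Z I))
          (\<lambda>Z I. a * lower g F Z I + b * lower g G Z I) \<and>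
        sec_eq g (Aff D) (s + 1)
          (raise g k (\<lambda>Z I. a * F Z I + b * G Z I))
          (\<lambda>Z I. a * raise g k F Z I + b * raise g k G Z I)) \<and>
    (\<forall>k s l t. \<forall>F\<in>AHMod g n D \<Gamma> k s. \<forall>G\<in>AHMod g n D \<Gamma> l t.
        sec_eq g (Aff D) (s + t + 1)
          (lower g (tensor s F G))
          (\<lambda>Z I. move_last s (tensor (s + 1) (lower g F) G) Z I + tensor s F (lower g G) Z I) \<and>
        sec_eq g (Aff D) (s + t + 1)
          (raise g (k + l) (tensor s F G))
          (\<lambda>Z I. move_last s (tensor (s + 1) (raise g k F) G) Z I + tensor s F (raise g l G) Z I)) \<and>
    (\<forall>k s. \<forall>F\<in>AHMod g n D \<Gamma> k s.
        sec_eq g (Aff D) (s + 2)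
          (\<lambda>Z I. lower g (raise g k F) Z I
                  - swap_slots (s + 1) (s + 2) (raise g (k - 1) (lower g F)) Z I)
          (\<lambda>Z I. of_int k / 2 * tensor s F (gmetric g) Z I
                  + 1 / 2 * (\<Sum>r = 1..s. swap_slots r (s + 1) (tensor s F (gmetric g)) Z I
                                           - swap_slots r (s + 2) (tensor s F (gmetric g)) Z I)))"
proof (intro conjI allI ballI impI)
  interpret quad_cone g "Aff D" by (rule quad_cone_Aff[OF assms(1,3)])
  have \<Gamma>: "\<Gamma> \<subseteq> carrier (Oplus g D)" using assms(4) by (rule subgroup.subset)
  fix k l s t F
  assume F: "F \<in> AHMod g n D \<Gamma> k s"
  show "lower g F \<in> AHMod g n D \<Gamma> (k - 1) (s + 1)" "raise g k F \<in> AHMod g n D \<Gamma> (k + 1) (s + 1)"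
    by (rule AHMod_lower_raise[OF assms(1-3) \<Gamma> F])+
  have rep: "difrep s F \<and> euler s F" if "F \<in> AHMod g n D \<Gamma> k s" for F k s
    using that smrep_difrep by (auto simp: AHMod_def is_section_iff)
  note F' = rep[OF F, THEN conjunct1] rep[OF F, THEN conjunct2]
  have "is_section g (Aff D) k s F" using F by (simp add: AHMod_def)
  from sec_eq_trans[OF commutator[OF this] sec_eq_pointwise[OF comm_rhs_tensor]]
  show "sec_eq g (Aff D) (s + 2)
      (\<lambda>Z I. lower g (raise g k F) Z I - swap_slots (s + 1) (s + 2) (raise g (k - 1) (lower g F)) Z I)
      (\<lambda>Z I. of_int k / 2 * tensor s F (gmetric g) Z I
        + 1 / 2 * (\<Sum>r = 1..s. swap_slots r (s + 1) (tensor s F (gmetric g)) Z I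
                                 - swap_slots r (s + 2) (tensor s F (gmetric g)) Z I))" .
  fix G
  show "sec_eq g (Aff D) (s + 1) (lower g F) (lower g G)"
    "sec_eq g (Aff D) (s + 1) (raise g k F) (raise g k G)"
    if "G \<in> AHMod g n D \<Gamma> k s" "sec_eq g (Aff D) s F G"
    using lower_sec_eq[OF F'(1) _ that(2)] raise_sec_eq[OF F'(1) _ that(2)] rep[OF that(1)] by blast+
  show "sec_eq g (Aff D) (s + 1) (lower g (\<lambda>Z I. a * F Z I + b * G Z I)) (\<lambda>Z I. a * lower g F Z I + b * lower g G Z I)"
    "sec_eq g (Aff D) (s + 1) (raise g k (\<lambda>Z I. a * F Z I + b * G Z I)) (\<lambda>Z I. a * raise g k F Z I + b * raise g k G Z I)"
    if "G \<in> AHMod g n D \<Gamma> k s" for a b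
    using rep[OF that] by (blast intro: lower_comb raise_comb F'(1))+
  show "sec_eq g (Aff D) (s + t + 1) (lower g (tensor s F G))
      (\<lambda>Z I. move_last s (tensor (s + 1) (lower g F) G) Z I + tensor s F (lower g G) Z I)"
    "sec_eq g (Aff D) (s + t + 1) (raise g (k + l) (tensor s F G))
      (\<lambda>Z I. move_last s (tensor (s + 1) (raise g k F) G) Z I + tensor s F (raise g l G) Z I)"
    if "G \<in> AHMod g n D \<Gamma> l t"
    using rep[OF that] by (blast intro: lower_tensor raise_tensor F')+
qed

end
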